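(* Work in NBG (von Neumann–Bernays–Gödel set theory with the Axiom of Global Choice), within a model consisting of the set universe $V$ together with all definable proper subclasses of $V$. Let $\Sigma=On^{<\omega}$ be the class of all finite sets of ordinals, and let $\mathcal P$ be the collection of all definable subclasses of $\Sigma$, coded by a definable class. Let $\mathcal F\subseteq\mathcal P$ be a non-principal definable ultrafilter, itself coded by a definable class, such that for each $\alpha\in On$ the definable class $\hat\alpha=\{s\in\Sigma:\alpha\in s\}$ is in $\mathcal F$. Let $$\mathbb{IIR}_0=\mathcal A_0(\mathbb Z\times\Sigma,\mathbb Z)/\!\sim_{\sigma\tau}$$ be the quotient constructed from $\mathcal F$ as described in the context. Then $\mathbb{IIR}_0$ is a class hyperreal field, and any definable hyperreal field ${}^*\mathbb R$ admits an elementary embedding into $\mathbb{IIR}_0$.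
   Context: Definability: NBG implies that there is a well-order $\leqslant_V$ on the class $V$ of all sets. A class $X\subseteq V$ is definable (also called $\Delta_0$-definable) if there is a first-order formula $\varphi(x)$ with set parameters in the language $\{\in,\leqslant_V\}$ such that for any set $a\in V$, $a\in X$ if and only if $\varphi(a)$ is true in $V$. Every set is definable. Coding: each definable subclass of $\Sigma$ is coded by the Gödel number of a first-order formula in the language $\{\in,\leqslant_V\}$ together with a set in $V$, a unique code for each definable class being determined by means of the well-order of $V$. In this way $\mathcal P$ is coded by a definable class. The ultrafilter $\mathcal F$ is formed using global choice, and it too is coded by a definable class. Hyperreal fields: let $\mathcal L'=\{+,\cdot,\leqslant,0,1\}\cup\{P_R\}$, with one $m$-ary relation symbol $P_R$ for each positive integer $m$ and each $R\subseteq\mathbb R^m$; $\mathbb R$ is an $\mathcal L'$-model with $P_R$ interpreted as $R$. An ordered field is a hyperreal field if it is a proper complete elementary extension of $\mathbb R$, i.e. a proper extension that can be expanded to an $\mathcal L'$-model which is an $\mathcal L'$-elementary extension of $\mathbb R$; hyperreal fields are viewed as such $\mathcal L'$-models. A class hyperreal field is a hyperreal field given as a class rather than required to be a set. A hyperreal field is definable if it is a definable class; it may be a set or a definable proper class. An elementary embedding is an embedding $e$ such that every first-order $\mathcal L'$-sentence $\varphi(r_1,\dots,r_m)$ with parameters from the first model is true there if and only if $\varphi(e(r_1),\dots,e(r_m))$ is true in the second model. Eudoxus reals: a function $f:\mathbb Z\to\mathbb Z$ is an almost homomorphism if $(p,q)\mapsto f(p+q)-f(p)-f(q)$ has bounded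 range. For almost homomorphisms $f,g$ write $f\sim_\sigma g$ if $f-g$ has bounded range. The classes $[f]_\sigma$ form a complete ordered field, identified with $\mathbb R$: addition is induced by pointwise addition, multiplication by composition, and $[f]_\sigma$ is positive iff $\sup_{m\in\mathbb N}f(m)=+\infty$. The construction: $\mathcal A_0(\mathbb Z\times\Sigma,\mathbb Z)$ is the collection of all definable class functions $F:\mathbb Z\times\Sigma\to\mathbb Z$ such that for each $s\in\Sigma$ the function $x\mapsto F(x,s)$ is an almost homomorphism. For $F,G$ in this collection, $F\sim_{\sigma\tau}G$ iff the definable class $\{s\in\Sigma: F(\cdot,s)-G(\cdot,s)\text{ has bounded range}\}$ is in $\mathcal F$. This is an equivalence relation, and $\mathbb{IIR}_0$ is the quotient. It is isomorphic to the definable ultrapower of $\mathbb R$ modulo $\mathcal F$ (definable functions $\Sigma\to\mathbb R$ modulo equality on a class in $\mathcal F$) via $F\mapsto(s\mapsto[F(\cdot,s)]_\sigma)$, and its operations, order and relations $P_R$ are those of this ultrapower.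
   Formalization: "Coded by a definable class" (for the ultrafilter and for IIR_0 as a class) is read formula by formula: for each fixed formula the set parameters of codes form a definable class; one definable class of all Gödel-number codes would define truth in V, contradicting Tarski. *)

theory Defs
  imports "HOL-Algebra.Ring"
begin

section \<open>The universe of sets and its definable classes\<close>

text \<open>The sets of the model are the elements of the type \<open>'v\<close>, with membership \<open>mem\<close> and the
  global well-order \<open>wo\<close>; neither need be standard.  Classes are HOL sets of type \<open>'v set\<close>, and a
  set \<open>x\<close> is identified with the class \<open>ext U x\<close> of its elements.\<close>

record 'v universe =
  mem :: "'v \<Rightarrow> 'v \<Rightarrow> bool"
  wo :: "'v \<Rightarrow> 'v \<Rightarrow> bool"

datatype fm = Mem nat nat | Leq nat nat | Eq nat nat | Neg fm | Conj fm fm | All fm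

text \<open>Variables are de Bruijn indices into an assignment.\<close>

primrec sat :: "'v universe \<Rightarrow> (nat \<Rightarrow> 'v) \<Rightarrow> fm \<Rightarrow> bool" where
  "sat U e (Mem i j) = mem U (e i) (e j)"
| "sat U e (Leq i j) = wo U (e i) (e j)"
| "sat U e (Eq i j) = (e i = e j)"
| "sat U e (Neg \<phi>) = (\<not> sat U e \<phi>)"
| "sat U e (Conj \<phi> \<psi>) = (sat U e \<phi> \<and> sat U e \<psi>)"
| "sat U e (All \<phi>) = (\<forall>x. sat U (case_nat x e) \<phi>)"

definition definable :: "'v universe \<Rightarrow> 'v set \<Rightarrow> bool" where
  "definable U X \<longleftrightarrow> (\<exists>\<phi> e. X = {x. sat U (case_nat x e) \<phi>})"

definition definable_rel :: "'v universe \<Rightarrow> nat \<Rightarrow> ('v list \<Rightarrow> bool) \<Rightarrow> bool" where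
  "definable_rel U k T \<longleftrightarrow> (\<exists>\<phi> e. \<forall>xs. length xs = k \<longrightarrow>
     T xs = sat U (\<lambda>i. if i < k then xs ! i else e (i - k)) \<phi>)"

text \<open>The class coded by a formula \<open>\<phi>\<close> and one set parameter \<open>a\<close>: variable 0 ranges over the class
  and every other free variable denotes \<open>a\<close>.  Finitely many parameters can be merged into one by
  pairing, so every definable class has a code.\<close>

definition coded_class :: "'v universe \<Rightarrow> fm \<Rightarrow> 'v \<Rightarrow> 'v set" where
  "coded_class U \<phi> a = {x. sat U (case_nat x (\<lambda>_. a)) \<phi>}"

text \<open>A relation between classes, and in particular a collection of classes (\<open>k = 1\<close>), is coded by a
  definable class if, for fixed formulas, the parameters for which it holds form a definable
  relation.  The quantification over formulas is external: a single definable class of pairs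
  (Goedel number, parameter) would yield a definition of truth in the model as soon as the
  collection separates the empty class from the full one.\<close>

definition coded_rel :: "'v universe \<Rightarrow> nat \<Rightarrow> ('v set list \<Rightarrow> bool) \<Rightarrow> bool" where
  "coded_rel U k T \<longleftrightarrow> (\<forall>\<phi>s. length \<phi>s = k \<longrightarrow>
     definable_rel U k (\<lambda>as. T (map2 (coded_class U) \<phi>s as)))"

definition coded :: "'v universe \<Rightarrow> 'v set set \<Rightarrow> bool" where
  "coded U S \<longleftrightarrow> coded_rel U 1 (\<lambda>Xs. Xs ! 0 \<in> S)"

definition ext :: "'v universe \<Rightarrow> 'v \<Rightarrow> 'v set" where
  "ext U x = {y. mem U y x}"

definition the_set :: "'v universe \<Rightarrow> 'v set \<Rightarrow> 'v" where
  "the_set U X = (THE x. ext U x = X)"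

definition empty_set :: "'v universe \<Rightarrow> 'v" where
  "empty_set U = the_set U {}"

definition succ_set :: "'v universe \<Rightarrow> 'v \<Rightarrow> 'v" where
  "succ_set U x = the_set U (insert x (ext U x))"

definition opair :: "'v universe \<Rightarrow> 'v \<Rightarrow> 'v \<Rightarrow> 'v" where
  "opair U x y = the_set U {the_set U {x}, the_set U {x, y}}"

definition class_prod :: "'v universe \<Rightarrow> 'v set \<Rightarrow> 'v set \<Rightarrow> 'v set" where
  "class_prod U A B = {opair U x y | x y. x \<in> A \<and> y \<in> B}"

text \<open>NBG with global choice for the model whose classes are exactly the definable ones.  Class
  comprehension holds by construction; the axioms listed are extensionality, pairing, union, power
  set, infinity, replacement (for possibly partial class functions, which yields separation),
  foundation, and that \<open>wo\<close> well-orders the class of all sets, which yields global choice (totality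
  and reflexivity follow from least elements of \<open>{x, y}\<close>).\<close>

definition NBG :: "'v universe \<Rightarrow> bool" where
  "NBG U \<longleftrightarrow>
     (\<forall>x y. ext U x = ext U y \<longrightarrow> x = y) \<and>
     (\<forall>x y. \<exists>z. ext U z = {x, y}) \<and>
     (\<forall>x. \<exists>z. ext U z = (\<Union>y \<in> ext U x. ext U y)) \<and>
     (\<forall>x. \<exists>z. ext U z = {y. ext U y \<subseteq> ext U x}) \<and>
     (\<exists>z. (\<exists>x \<in> ext U z. ext U x = {}) \<and>
          (\<forall>x \<in> ext U z. \<exists>y \<in> ext U z. ext U y = insert x (ext U x))) \<and>
     (\<forall>G. definable U G \<longrightarrow>
        (\<forall>u v w. opair U u v \<in> G \<longrightarrow> opair U u w \<in> G \<longrightarrow> v = w) \<longrightarrow>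
        (\<forall>x. \<exists>z. ext U z = {v. \<exists>u \<in> ext U x. opair U u v \<in> G})) \<and>
     (\<forall>X. definable U X \<longrightarrow> X \<noteq> {} \<longrightarrow> (\<exists>x \<in> X. ext U x \<inter> X = {})) \<and>
     (\<forall>x y. wo U x y \<longrightarrow> wo U y x \<longrightarrow> x = y) \<and>
     (\<forall>x y z. wo U x y \<longrightarrow> wo U y z \<longrightarrow> wo U x z) \<and>
     (\<forall>X. definable U X \<longrightarrow> X \<noteq> {} \<longrightarrow> (\<exists>x \<in> X. \<forall>y \<in> X. wo U x y))"

section \<open>Ordinals, integers and Eudoxus reals inside the model\<close>

definition transitive :: "'v universe \<Rightarrow> 'v \<Rightarrow> bool" where
  "transitive U x \<longleftrightarrow> (\<forall>y \<in> ext U x. ext U y \<subseteq> ext U x)"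

definition ordinals :: "'v universe \<Rightarrow> 'v set" where
  "ordinals U = {x. transitive U x \<and> (\<forall>y \<in> ext U x. transitive U y)}"

definition naturals :: "'v universe \<Rightarrow> 'v set" where
  "naturals U = {n \<in> ordinals U. \<forall>m \<in> insert n (ext U n).
     m = empty_set U \<or> (\<exists>k \<in> ordinals U. m = succ_set U k)}"

text \<open>The bijection has to be a set of the model.\<close>

definition equipollent :: "'v universe \<Rightarrow> 'v set \<Rightarrow> 'v set \<Rightarrow> bool" where
  "equipollent U A B \<longleftrightarrow> (\<exists>f.
     (\<forall>x \<in> A. \<exists>!y. y \<in> B \<and> opair U x y \<in> ext U f) \<and>
     (\<forall>y \<in> B. \<exists>!x. x \<in> A \<and> opair U x y \<in> ext U f))"

text \<open>\<open>Sigma_class U\<close> is the class of all finite sets of ordinals.\<close>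

definition Sigma_class :: "'v universe \<Rightarrow> 'v set" where
  "Sigma_class U = {s. ext U s \<subseteq> ordinals U \<and> (\<exists>n \<in> naturals U. equipollent U (ext U n) (ext U s))}"

text \<open>Addition of natural numbers as cardinality of a disjoint union.\<close>

definition nat_add :: "'v universe \<Rightarrow> 'v \<Rightarrow> 'v \<Rightarrow> 'v" where
  "nat_add U m n = (THE k. k \<in> naturals U \<and> equipollent U (ext U k)
     (class_prod U {empty_set U} (ext U m) \<union> class_prod U {succ_set U (empty_set U)} (ext U n)))"

text \<open>The integer \<open>m - n\<close> is represented by its reduced pair \<open>(m, n)\<close>, in which \<open>m\<close> or \<open>n\<close> is 0.\<close>

definition ints :: "'v universe \<Rightarrow> 'v set" where
  "ints U = {opair U m n | m n. m \<in> naturals U \<and> n \<in> naturals U \<and>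
     (m = empty_set U \<or> n = empty_set U)}"

definition int_of_nat :: "'v universe \<Rightarrow> 'v \<Rightarrow> 'v" where
  "int_of_nat U m = opair U m (empty_set U)"

definition int_add :: "'v universe \<Rightarrow> 'v \<Rightarrow> 'v \<Rightarrow> 'v" where
  "int_add U z w = (THE u. u \<in> ints U \<and> (\<exists>m n m' n' p q.
     z = opair U m n \<and> w = opair U m' n' \<and> u = opair U p q \<and>
     nat_add U (nat_add U m m') q = nat_add U (nat_add U n n') p))"

definition int_diff :: "'v universe \<Rightarrow> 'v \<Rightarrow> 'v \<Rightarrow> 'v" where
  "int_diff U z w = (THE u. u \<in> ints U \<and> int_add U u w = z)"

definition int_le :: "'v universe \<Rightarrow> 'v \<Rightarrow> 'v \<Rightarrow> bool" where
  "int_le U z w \<longleftrightarrow> (\<exists>m n m' n'. z = opair U m n \<and> w = opair U m' n' \<and>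
     ext U (nat_add U m n') \<subseteq> ext U (nat_add U m' n))"

definition bounded_range :: "'v universe \<Rightarrow> 'i set \<Rightarrow> ('i \<Rightarrow> 'v) \<Rightarrow> bool" where
  "bounded_range U I f \<longleftrightarrow>
     (\<exists>a \<in> ints U. \<exists>b \<in> ints U. \<forall>i \<in> I. int_le U a (f i) \<and> int_le U (f i) b)"

definition almost_hom :: "'v universe \<Rightarrow> ('v \<Rightarrow> 'v) \<Rightarrow> bool" where
  "almost_hom U f \<longleftrightarrow> (\<forall>p \<in> ints U. f p \<in> ints U) \<and>
     bounded_range U (ints U \<times> ints U)
       (\<lambda>(p, q). int_diff U (int_diff U (f (int_add U p q)) (f p)) (f q))"

definition sim_sigma :: "'v universe \<Rightarrow> ('v \<Rightarrow> 'v) \<Rightarrow> ('v \<Rightarrow> 'v) \<Rightarrow> bool" where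
  "sim_sigma U f g \<longleftrightarrow> bounded_range U (ints U) (\<lambda>p. int_diff U (f p) (g p))"

text \<open>Functions given by their graphs: a class of ordered pairs or, via \<open>ext\<close>, a set of them.\<close>

definition class_fun :: "'v universe \<Rightarrow> 'v set \<Rightarrow> 'v set \<Rightarrow> 'v set \<Rightarrow> bool" where
  "class_fun U A B G \<longleftrightarrow> G \<subseteq> class_prod U A B \<and> (\<forall>x \<in> A. \<exists>!y. opair U x y \<in> G)"

definition app :: "'v universe \<Rightarrow> 'v set \<Rightarrow> 'v \<Rightarrow> 'v" where
  "app U G x = (THE y. opair U x y \<in> G)"

definition almost_homs :: "'v universe \<Rightarrow> 'v set" where
  "almost_homs U = {f. class_fun U (ints U) (ints U) (ext U f) \<and> almost_hom U (app U (ext U f))}"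

definition eudoxus :: "'v universe \<Rightarrow> ('v \<Rightarrow> 'v) \<Rightarrow> 'v" where
  "eudoxus U f = the_set U {g \<in> almost_homs U. sim_sigma U f (app U (ext U g))}"

definition reals :: "'v universe \<Rightarrow> 'v set" where
  "reals U = {eudoxus U (app U (ext U f)) | f. f \<in> almost_homs U}"

definition real_add :: "'v universe \<Rightarrow> 'v \<Rightarrow> 'v \<Rightarrow> 'v" where
  "real_add U r t = (THE u. u \<in> reals U \<and> (\<exists>f \<in> ext U r. \<exists>g \<in> ext U t. \<exists>h \<in> ext U u.
     \<forall>p \<in> ints U. app U (ext U h) p = int_add U (app U (ext U f) p) (app U (ext U g) p)))"

definition real_mult :: "'v universe \<Rightarrow> 'v \<Rightarrow> 'v \<Rightarrow> 'v" where
  "real_mult U r t = (THE u. u \<in> reals U \<and> (\<exists>f \<in> ext U r. \<exists>g \<in> ext U t. \<exists>h \<in> ext U u.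
     \<forall>p \<in> ints U. app U (ext U h) p = app U (ext U f) (app U (ext U g) p)))"

definition real_zero :: "'v universe \<Rightarrow> 'v" where
  "real_zero U = eudoxus U (\<lambda>p. int_of_nat U (empty_set U))"

definition real_one :: "'v universe \<Rightarrow> 'v" where
  "real_one U = eudoxus U (\<lambda>p. p)"

definition real_pos :: "'v universe \<Rightarrow> 'v \<Rightarrow> bool" where
  "real_pos U r \<longleftrightarrow> r \<in> reals U \<and> (\<exists>f \<in> ext U r. \<forall>b \<in> ints U. \<exists>m \<in> naturals U.
     \<not> int_le U (app U (ext U f) (int_of_nat U m)) b)"

definition real_le :: "'v universe \<Rightarrow> 'v \<Rightarrow> 'v \<Rightarrow> bool" where
  "real_le U r t \<longleftrightarrow> r = t \<or> (\<exists>d. real_pos U d \<and> real_add U r d = t)"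

section \<open>The language of complete extensions\<close>

text \<open>Structures for the language with \<open>+\<close>, \<open>\<cdot>\<close>, \<open>\<le>\<close>, 0, 1 and relation symbols named by objects of
  type \<open>'r\<close>; the arity of a symbol occurrence is the length of its argument list, so that the
  symbol is really the pair of its name and that length.\<close>

record ('r, 'a) lstruct =
  carr :: "'a set"
  ladd :: "'a \<Rightarrow> 'a \<Rightarrow> 'a"
  lmul :: "'a \<Rightarrow> 'a \<Rightarrow> 'a"
  lle :: "'a \<Rightarrow> 'a \<Rightarrow> bool"
  lzero :: 'a
  lone :: 'a
  lrel :: "'r \<Rightarrow> 'a list \<Rightarrow> bool"

datatype lterm = LVar nat | LAdd lterm lterm | LMul lterm lterm | LZero | LOne

datatype 'r lfm = LEq lterm lterm | LLe lterm lterm | LRel 'r "lterm list"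
  | LNeg "'r lfm" | LConj "'r lfm" "'r lfm" | LAll "'r lfm"

primrec leval :: "('r, 'a) lstruct \<Rightarrow> (nat \<Rightarrow> 'a) \<Rightarrow> lterm \<Rightarrow> 'a" where
  "leval A e (LVar i) = e i"
| "leval A e (LAdd s t) = ladd A (leval A e s) (leval A e t)"
| "leval A e (LMul s t) = lmul A (leval A e s) (leval A e t)"
| "leval A e LZero = lzero A"
| "leval A e LOne = lone A"

primrec lsat :: "('r, 'a) lstruct \<Rightarrow> (nat \<Rightarrow> 'a) \<Rightarrow> 'r lfm \<Rightarrow> bool" where
  "lsat A e (LEq s t) = (leval A e s = leval A e t)"
| "lsat A e (LLe s t) = lle A (leval A e s) (leval A e t)"
| "lsat A e (LRel R ts) = lrel A R (map (leval A e) ts)"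
| "lsat A e (LNeg \<phi>) = (\<not> lsat A e \<phi>)"
| "lsat A e (LConj \<phi> \<psi>) = (lsat A e \<phi> \<and> lsat A e \<psi>)"
| "lsat A e (LAll \<phi>) = (\<forall>x \<in> carr A. lsat A (case_nat x e) \<phi>)"

fun tuple :: "'v universe \<Rightarrow> 'v list \<Rightarrow> 'v" where
  "tuple U [] = empty_set U"
| "tuple U [x] = x"
| "tuple U (x # y # ys) = opair U x (tuple U (y # ys))"

text \<open>The sets of the model that are \<open>m\<close>-ary relations on its reals.\<close>

definition real_rels :: "'v universe \<Rightarrow> nat \<Rightarrow> 'v set" where
  "real_rels U m = {R. ext U R \<subseteq> {tuple U xs | xs. length xs = m \<and> set xs \<subseteq> reals U}}"

primrec lformula :: "'v universe \<Rightarrow> 'v lfm \<Rightarrow> bool" where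
  "lformula U (LEq s t) = True"
| "lformula U (LLe s t) = True"
| "lformula U (LRel R ts) = (0 < length ts \<and> R \<in> real_rels U (length ts))"
| "lformula U (LNeg \<phi>) = lformula U \<phi>"
| "lformula U (LConj \<phi> \<psi>) = (lformula U \<phi> \<and> lformula U \<psi>)"
| "lformula U (LAll \<phi>) = lformula U \<phi>"

definition real_struct :: "'v universe \<Rightarrow> ('v, 'v) lstruct" where
  "real_struct U = \<lparr>carr = reals U, ladd = real_add U, lmul = real_mult U, lle = real_le U,
     lzero = real_zero U, lone = real_one U, lrel = (\<lambda>R xs. tuple U xs \<in> ext U R)\<rparr>"

text \<open>Equality is part of the language, so an elementary embedding is injective.\<close>

definition elementary_embedding ::
    "'v universe \<Rightarrow> ('v, 'a) lstruct \<Rightarrow> ('v, 'b) lstruct \<Rightarrow> ('a \<Rightarrow> 'b) \<Rightarrow> bool" where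
  "elementary_embedding U A B f \<longleftrightarrow> f ` carr A \<subseteq> carr B \<and>
     (\<forall>\<phi> e. lformula U \<phi> \<longrightarrow> range e \<subseteq> carr A \<longrightarrow> lsat A e \<phi> = lsat B (f \<circ> e) \<phi>)"

definition ordered_field :: "('r, 'a) lstruct \<Rightarrow> bool" where
  "ordered_field A \<longleftrightarrow>
     field \<lparr>carrier = carr A, monoid.mult = lmul A, one = lone A, zero = lzero A, add = ladd A\<rparr> \<and>
     (\<forall>x \<in> carr A. lle A x x) \<and>
     (\<forall>x \<in> carr A. \<forall>y \<in> carr A. lle A x y \<longrightarrow> lle A y x \<longrightarrow> x = y) \<and>
     (\<forall>x \<in> carr A. \<forall>y \<in> carr A. \<forall>z \<in> carr A. lle A x y \<longrightarrow> lle A y z \<longrightarrow> lle A x z) \<and>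
     (\<forall>x \<in> carr A. \<forall>y \<in> carr A. lle A x y \<or> lle A y x) \<and>
     (\<forall>x \<in> carr A. \<forall>y \<in> carr A. \<forall>z \<in> carr A. lle A x y \<longrightarrow> lle A (ladd A x z) (ladd A y z)) \<and>
     (\<forall>x \<in> carr A. \<forall>y \<in> carr A. lle A (lzero A) x \<longrightarrow> lle A (lzero A) y \<longrightarrow>
        lle A (lzero A) (lmul A x y))"

text \<open>Extensions are taken up to identification of the reals with their image.\<close>

definition hyperreal_field :: "'v universe \<Rightarrow> ('v, 'a) lstruct \<Rightarrow> bool" where
  "hyperreal_field U A \<longleftrightarrow> ordered_field A \<and>
     (\<exists>j. elementary_embedding U (real_struct U) A j \<and> j ` reals U \<noteq> carr A)"

definition definable_struct :: "'v universe \<Rightarrow> ('v, 'v) lstruct \<Rightarrow> bool" where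
  "definable_struct U A \<longleftrightarrow>
     (let def = (\<lambda>k T. definable_rel U k (\<lambda>xs. set xs \<subseteq> carr A \<and> T xs)) in
       definable U (carr A) \<and>
       def 3 (\<lambda>xs. ladd A (xs ! 0) (xs ! 1) = xs ! 2) \<and>
       def 3 (\<lambda>xs. lmul A (xs ! 0) (xs ! 1) = xs ! 2) \<and>
       def 2 (\<lambda>xs. lle A (xs ! 0) (xs ! 1)) \<and>
       (\<forall>m > 0. definable_rel U (Suc m) (\<lambda>xs. hd xs \<in> real_rels U m \<and>
          set (tl xs) \<subseteq> carr A \<and> lrel A (hd xs) (tl xs))))"

text \<open>A structure whose elements are equivalence classes of definable classes is given as a class
  through codes of representatives.\<close>

definition coded_struct :: "'v universe \<Rightarrow> ('v, 'v set set) lstruct \<Rightarrow> bool" where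
  "coded_struct U A \<longleftrightarrow>
     (let el = (\<lambda>Xs xs. set xs \<subseteq> carr A \<and> list_all2 (\<in>) Xs xs);
          cod = (\<lambda>k T. coded_rel U k (\<lambda>Xs. \<exists>xs. el Xs xs \<and> T xs)) in
       {} \<notin> carr A \<and> pairwise disjnt (carr A) \<and> (\<forall>X \<in> \<Union>(carr A). definable U X) \<and>
       cod 1 (\<lambda>xs. True) \<and>
       cod 2 (\<lambda>xs. xs ! 0 = xs ! 1) \<and>
       cod 3 (\<lambda>xs. ladd A (xs ! 0) (xs ! 1) = xs ! 2) \<and>
       cod 3 (\<lambda>xs. lmul A (xs ! 0) (xs ! 1) = xs ! 2) \<and>
       cod 2 (\<lambda>xs. lle A (xs ! 0) (xs ! 1)) \<and>
       cod 1 (\<lambda>xs. xs ! 0 = lzero A) \<and>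
       cod 1 (\<lambda>xs. xs ! 0 = lone A) \<and>
       (\<forall>m > 0. \<forall>\<phi>s. length \<phi>s = m \<longrightarrow>
          definable_rel U (Suc m) (\<lambda>as. hd as \<in> real_rels U m \<and>
            (\<exists>xs. el (map2 (coded_class U) \<phi>s (tl as)) xs \<and> lrel A (hd as) xs))))"

definition class_hyperreal_field :: "'v universe \<Rightarrow> ('v, 'v set set) lstruct \<Rightarrow> bool" where
  "class_hyperreal_field U A \<longleftrightarrow> hyperreal_field U A \<and> coded_struct U A"

definition definable_hyperreal_field :: "'v universe \<Rightarrow> ('v, 'v) lstruct \<Rightarrow> bool" where
  "definable_hyperreal_field U A \<longleftrightarrow> hyperreal_field U A \<and> definable_struct U A"

text \<open>A map into a structure of equivalence classes is a class of the model if representatives of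
  its values are the sections of a single definable class.\<close>

definition class_map :: "'v universe \<Rightarrow> 'v set \<Rightarrow> ('v \<Rightarrow> 'v set set) \<Rightarrow> bool" where
  "class_map U D f \<longleftrightarrow> (\<exists>G. definable U G \<and> (\<forall>x \<in> D. {w. opair U x w \<in> G} \<in> f x))"

section \<open>The definable ultrapower\<close>

definition definable_subclasses :: "'v universe \<Rightarrow> 'v set set" where
  "definable_subclasses U = {X. definable U X \<and> X \<subseteq> Sigma_class U}"

definition definable_ultrafilter :: "'v universe \<Rightarrow> 'v set set \<Rightarrow> bool" where
  "definable_ultrafilter U \<F> \<longleftrightarrow>
     \<F> \<subseteq> definable_subclasses U \<and>
     Sigma_class U \<in> \<F> \<and> {} \<notin> \<F> \<and>
     (\<forall>X \<in> \<F>. \<forall>Y \<in> \<F>. X \<inter> Y \<in> \<F>) \<and>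
     (\<forall>X \<in> \<F>. \<forall>Y \<in> definable_subclasses U. X \<subseteq> Y \<longrightarrow> Y \<in> \<F>) \<and>
     (\<forall>X \<in> definable_subclasses U. X \<in> \<F> \<or> Sigma_class U - X \<in> \<F>) \<and>
     coded U \<F>"

definition nonprincipal :: "'v universe \<Rightarrow> 'v set set \<Rightarrow> bool" where
  "nonprincipal U \<F> \<longleftrightarrow>
     \<not> (\<exists>s \<in> Sigma_class U. \<F> = {X \<in> definable_subclasses U. s \<in> X})"

definition hat :: "'v universe \<Rightarrow> 'v \<Rightarrow> 'v set" where
  "hat U \<alpha> = {s \<in> Sigma_class U. \<alpha> \<in> ext U s}"

definition A0 :: "'v universe \<Rightarrow> 'v set set" where
  "A0 U = {F. definable U F \<and> class_fun U (class_prod U (ints U) (Sigma_class U)) (ints U) F \<and>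
     (\<forall>s \<in> Sigma_class U. almost_hom U (\<lambda>p. app U F (opair U p s)))}"

definition sim_sigma_tau :: "'v universe \<Rightarrow> 'v set set \<Rightarrow> ('v set \<times> 'v set) set" where
  "sim_sigma_tau U \<F> = {(F, G). F \<in> A0 U \<and> G \<in> A0 U \<and>
     {s \<in> Sigma_class U. sim_sigma U (\<lambda>p. app U F (opair U p s)) (\<lambda>p. app U G (opair U p s))} \<in> \<F>}"

text \<open>\<open>val U F\<close> is the function from \<open>Sigma_class U\<close> to the reals that represents \<open>F\<close> in the
  definable ultrapower.\<close>

definition val :: "'v universe \<Rightarrow> 'v set \<Rightarrow> 'v \<Rightarrow> 'v" where
  "val U F s = eudoxus U (\<lambda>p. app U F (opair U p s))"

definition IIR0 :: "'v universe \<Rightarrow> 'v set set \<Rightarrow> ('v, 'v set set) lstruct" where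
  "IIR0 U \<F> = (let large = (\<lambda>Q. {s \<in> Sigma_class U. Q s} \<in> \<F>) in
    \<lparr>carr = A0 U // sim_sigma_tau U \<F>,
     ladd = (\<lambda>x y. {H \<in> A0 U. \<exists>F \<in> x. \<exists>G \<in> y.
       large (\<lambda>s. val U H s = real_add U (val U F s) (val U G s))}),
     lmul = (\<lambda>x y. {H \<in> A0 U. \<exists>F \<in> x. \<exists>G \<in> y.
       large (\<lambda>s. val U H s = real_mult U (val U F s) (val U G s))}),
     lle = (\<lambda>x y. \<exists>F \<in> x. \<exists>G \<in> y. large (\<lambda>s. real_le U (val U F s) (val U G s))),
     lzero = {H \<in> A0 U. large (\<lambda>s. val U H s = real_zero U)},
     lone = {H \<in> A0 U. large (\<lambda>s. val U H s = real_one U)},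
     lrel = (\<lambda>R xs. \<exists>Fs. list_all2 (\<in>) Fs xs \<and>
       large (\<lambda>s. tuple U (map (\<lambda>F. val U F s) Fs) \<in> ext U R))\<rparr>)"

end

theory Submission
  imports Defs
begin

text \<open>Everything rests on one device: since classes are definable with parameters, a map on the universe is
  usable inside the model as soon as it is definable, and \<open>wo\<close>-least choices keep it so.

  By global choice every set is enumerated by a pair of ordinals, uniformly, so a finite set \<open>s\<close> of ordinals
  determines a finite set \<open>apx s\<close>, and each set belongs to \<open>apx s\<close> for almost all \<open>s\<close>.  Los's theorem
  holds because least counterexamples are definable.  The least real outside \<open>apx s\<close> defines a
  nonstandard element, whence the ultrapower is a proper extension.

  To embed a definable hyperreal field \<open>A\<close>, one uses that internal functions \<open>pr1\<close>, \<open>pr2\<close> map the reals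
  onto the pairs of reals.  Finitely many elements of \<open>A\<close> are therefore the values of internal functions
  at a single element, so that the finitely many binary relations in \<open>apx s\<close> that hold between elements of
  \<open>A\<close> in \<open>apx s\<close> can be realised by reals.  The least such assignment defines the value at \<open>s\<close> of a
  representative of the image of each element, and binary relations are preserved by construction.
  A formula with several variables reduces to a binary relation, again by coding the variables.\<close>

section \<open>Definability with parameters\<close>

text \<open>The model may be nonstandard, so finiteness, induction and recursion must be its own:
  each induction runs over a definable predicate, and the finite sets \<open>apx s\<close> may be
  infinite from outside. The embedding, too, must be one definable class even if the hyperreal field
  is a proper class, which stands in the way of extending partial elementary maps by saturation and
  transfinite recursion. Fineness of the ultrafilter takes the place of saturation: the constraints
  are solved at each \<open>s\<close> separately, and each one is eventually imposed. The
  constraints at \<open>s\<close> must form a definable condition. For \<open>A\<close>,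
  definability is given for the relation symbols of each single arity, not for the satisfaction of
  all formulas at once. One arity therefore has to carry everything, and this is why reals are
  paired, by expansions to the base 7. That pairing and the field axioms require long computations
  with the integers of the model. Once these form a type, the ordered ring arithmetic of HOL applies
  to them.\<close>

text \<open>Each variable of the formula denotes a value of the environment (\<open>Inl\<close>) or a fixed parameter (\<open>Inr\<close>).
  The predicates on environments are kept shallow, so that definability is proved by the rules \<open>df\<close>,
  following the syntax of the HOL term.\<close>

definition dfn :: "'v universe \<Rightarrow> ((nat \<Rightarrow> 'v) \<Rightarrow> bool) \<Rightarrow> bool" where
  "dfn U P \<longleftrightarrow> (\<exists>\<phi> \<sigma>. \<forall>e. P e = sat U (\<lambda>i. case_sum e id (\<sigma> i)) \<phi>)"

text \<open>Definability of the graph, with the value in variable 0 and the environment shifted up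
  by one. A term is a function of the whole environment, so nested terms are handled by
  substitution.\<close>

definition dt :: "'v universe \<Rightarrow> ((nat \<Rightarrow> 'v) \<Rightarrow> 'v) \<Rightarrow> bool" where
  "dt U t \<longleftrightarrow> dfn U (\<lambda>e. t (\<lambda>i. e (Suc i)) = e 0)"

lemma dfnI: "(\<And>e. P e = sat U (\<lambda>i. case_sum e id (\<sigma> i)) \<phi>) \<Longrightarrow> dfn U P"
  unfolding dfn_def by (intro exI allI)

lemma dfnE:
  assumes "dfn U P"
  obtains \<phi> \<sigma> where "\<And>e. P e = sat U (\<lambda>i. case_sum e id (\<sigma> i)) \<phi>"
proof -
  obtain \<phi> \<sigma> where "\<forall>e. P e = sat U (\<lambda>i. case_sum e id (\<sigma> i)) \<phi>"
    using assms dfn_def[of U P] by (elim iffD1[THEN exE]) (assumption, elim exE)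
  then show thesis using that[of \<sigma> \<phi>] by auto
qed

primrec ren :: "(nat \<Rightarrow> nat) \<Rightarrow> fm \<Rightarrow> fm" where
  "ren r (Mem i j) = Mem (r i) (r j)"
| "ren r (Leq i j) = Leq (r i) (r j)"
| "ren r (Eq i j) = Eq (r i) (r j)"
| "ren r (Neg \<phi>) = Neg (ren r \<phi>)"
| "ren r (Conj \<phi> \<psi>) = Conj (ren r \<phi>) (ren r \<psi>)"
| "ren r (All \<phi>) = All (ren (case_nat 0 (\<lambda>i. Suc (r i))) \<phi>)"

lemma sat_ren: "sat U e (ren r \<phi>) = sat U (\<lambda>i. e (r i)) \<phi>"
proof (induction \<phi> arbitrary: e r)
  case (All \<phi>)
  have "(\<lambda>i. case_nat x e (case_nat 0 (\<lambda>i. Suc (r i)) i)) = case_nat x (\<lambda>i. e (r i))" for x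
    by (auto split: nat.split)
  then show ?case by (simp add: All)
qed auto

lemma dfn_cong: "(\<And>e. P e = Q e) \<Longrightarrow> dfn U Q \<Longrightarrow> dfn U P"
  by (simp add: dfn_def)

named_theorems df

lemma dfn_not [df]: "dfn U P \<Longrightarrow> dfn U (\<lambda>e. \<not> P e)"
  unfolding dfn_def by (metis sat.simps(4))

lemma dfn_conj [df]:
  assumes "dfn U P" "dfn U Q"
  shows "dfn U (\<lambda>e. P e \<and> Q e)"
proof -
  obtain \<phi> \<sigma> where 1: "\<And>e. P e = sat U (\<lambda>i. case_sum e id (\<sigma> i)) \<phi>"
    using assms(1) by (rule dfnE) (rule that)
  obtain \<psi> \<tau> where 2: "\<And>e. Q e = sat U (\<lambda>i. case_sum e id (\<tau> i)) \<psi>"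
    using assms(2) by (rule dfnE) (rule that)
  \<comment> \<open>Even positions serve the first formula and odd positions the second, so the two
    lists of parameters cannot collide.\<close>
  define \<rho> where "\<rho> i = (if even i then \<sigma> (i div 2) else \<tau> (i div 2))" for i
  have "(P e \<and> Q e) = sat U (\<lambda>i. case_sum e id (\<rho> i))
      (Conj (ren (\<lambda>i. 2 * i) \<phi>) (ren (\<lambda>i. 2 * i + 1) \<psi>))" for e
    by (simp add: sat_ren 1 2 \<rho>_def)
  then show ?thesis by (rule dfnI)
qed

lemma dfn_all [df]:
  assumes "dfn U (\<lambda>e. P (e 0) (\<lambda>i. e (Suc i)))"
  shows "dfn U (\<lambda>e. \<forall>x. P x e)"
proof -
  obtain \<phi> \<sigma> where 1: "\<And>e. P (e 0) (\<lambda>i. e (Suc i)) = sat U (\<lambda>i. case_sum e id (\<sigma> i)) \<phi>"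
    using assms by (rule dfnE) (rule that)
  \<comment> \<open>All positions assigned to the bound variable collapse to 0, the index bound by
    \<open>All\<close>; the others move up by one. Where \<open>r\<close> is 0, the entry of
    \<open>\<tau>\<close> is junk that is never read.\<close>
  define r where "r i = (if \<sigma> i = Inl 0 then 0 else Suc i)" for i
  define \<tau> where "\<tau> i = (case \<sigma> i of Inl j \<Rightarrow> Inl (j - 1) | Inr c \<Rightarrow> Inr c)" for i
  have "case_sum (case_nat x e) id (\<sigma> i) = case_nat x (\<lambda>i. case_sum e id (\<tau> i)) (r i)" for x e i
    by (auto simp: r_def \<tau>_def split: sum.split nat.split)
  then have "P x e = sat U (case_nat x (\<lambda>i. case_sum e id (\<tau> i))) (ren r \<phi>)" for x e
    using 1[of "case_nat x e"] by (simp add: sat_ren)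
  then show ?thesis by (intro dfnI[where \<phi> = "All (ren r \<phi>)" and \<sigma> = \<tau>]) simp
qed

lemma dfn_disj [df]: "dfn U P \<Longrightarrow> dfn U Q \<Longrightarrow> dfn U (\<lambda>e. P e \<or> Q e)"
  by (rule dfn_cong[of _ "\<lambda>e. \<not> (\<not> P e \<and> \<not> Q e)"]) (simp, intro df)

lemma dfn_imp [df]: "dfn U P \<Longrightarrow> dfn U Q \<Longrightarrow> dfn U (\<lambda>e. P e \<longrightarrow> Q e)"
  by (rule dfn_cong[of _ "\<lambda>e. \<not> (P e \<and> \<not> Q e)"]) (simp, intro df)

lemma dfn_iff [df]: "dfn U P \<Longrightarrow> dfn U Q \<Longrightarrow> dfn U (\<lambda>e. P e = Q e)"
  by (rule dfn_cong[of _ "\<lambda>e. (P e \<longrightarrow> Q e) \<and> (Q e \<longrightarrow> P e)"]) (blast, intro df)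

lemma dfn_ex [df]: "dfn U (\<lambda>e. P (e 0) (\<lambda>i. e (Suc i))) \<Longrightarrow> dfn U (\<lambda>e. \<exists>x. P x e)"
  by (rule dfn_cong[of _ "\<lambda>e. \<not> (\<forall>x. \<not> P x e)"]) (simp, intro df)

lemma dfn_const [df]: "dfn U (\<lambda>e. b)"
  by (rule dfnI[where \<sigma> = Inl and \<phi> = "if b then Eq 0 0 else Neg (Eq 0 0)"]) simp

text \<open>The substitution principle, by induction on the formula for arbitrary families of terms:
  a quantifier extends the family by its bound variable. An atom is unwound into an existential
  statement about the values of its two terms, so that only the graphs of terms occur.\<close>

lemma dfn_sat:
  assumes "\<And>i. dt U (t i)"
  shows "dfn U (\<lambda>e. sat U (\<lambda>i. t i e) \<phi>)"
proof -
  have atom: "dfn U (\<lambda>e. sat U (\<lambda>i. case_sum e id (\<sigma> i)) \<phi>)" for \<sigma> \<phi>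
    by (rule dfnI) (rule refl)
  have shift: "dt U (\<lambda>e. t (\<lambda>i. e (Suc i)))" if t: "dt U t" for t
  proof -
    obtain \<phi> \<sigma> where 1: "\<forall>e. (t (\<lambda>i. e (Suc i)) = e 0) = sat U (\<lambda>i. case_sum e id (\<sigma> i)) \<phi>"
      using t unfolding dt_def dfn_def by (elim exE)
    define \<tau> where "\<tau> i = (case \<sigma> i of Inl 0 \<Rightarrow> Inl 0 | Inl (Suc j) \<Rightarrow> Inl (Suc (Suc j)) | Inr c \<Rightarrow> Inr c)" for i
    have "case_sum e id (\<tau> i) = case_sum (case_nat (e 0) (\<lambda>i. e (Suc (Suc i)))) id (\<sigma> i)" for e i
      by (auto simp: \<tau>_def split: sum.split nat.split)
    then have "(t (\<lambda>i. e (Suc (Suc i))) = e 0) = sat U (\<lambda>i. case_sum e id (\<tau> i)) \<phi>" for e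
      using 1[rule_format, of "case_nat (e 0) (\<lambda>i. e (Suc (Suc i)))"] by simp
    then show ?thesis unfolding dt_def by (rule dfnI)
  qed
  have var: "dt U (\<lambda>e. e n)" for n
    using atom[of "\<lambda>i. Inl (if i = 0 then Suc n else 0)" "Eq 0 (Suc 0)"] by (simp add: dt_def)
  have bin: "dfn U (\<lambda>e. R (t e) (u e))"
    if t: "dt U t" and u: "dt U u" and R: "dfn U (\<lambda>e. R (e 0) (e (Suc 0)))" for R t u
  proof -
    have 1: "dfn U (\<lambda>e. \<exists>y. \<exists>x. x = t e \<and> (y = u e \<and> R x y))"
    proof (intro dfn_ex dfn_conj)
      show "dfn U (\<lambda>e. e 0 = t (\<lambda>i. e (Suc (Suc i))))"
        using shift[OF t] unfolding dt_def by (simp add: eq_commute)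
      have "dt U (\<lambda>e. e 0)" by (rule var)
      obtain \<phi> \<sigma> where 1: "\<forall>e. (u (\<lambda>i. e (Suc i)) = e 0) = sat U (\<lambda>i. case_sum e id (\<sigma> i)) \<phi>"
        using u unfolding dt_def dfn_def by (elim exE)
      define \<tau> where "\<tau> i = map_sum Suc id (\<sigma> i)" for i
      have "case_sum e id (\<tau> i) = case_sum (\<lambda>i. e (Suc i)) id (\<sigma> i)" for e i
        by (auto simp: \<tau>_def split: sum.split)
      then have "(e (Suc 0) = u (\<lambda>i. e (Suc (Suc i)))) = sat U (\<lambda>i. case_sum e id (\<tau> i)) \<phi>" for e
        using 1[rule_format, of "\<lambda>i. e (Suc i)"] by auto
      then show "dfn U (\<lambda>e. e (Suc 0) = u (\<lambda>i. e (Suc (Suc i))))" by (rule dfnI)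
      show "dfn U (\<lambda>e. R (e 0) (e (Suc 0)))" by (rule R)
    qed
    show ?thesis by (rule dfn_cong[OF _ 1]) blast
  qed
  show ?thesis using assms
  proof (induction \<phi> arbitrary: t)
    case (Mem i j)
    then show ?case
      using bin[of "t i" "t j" "mem U"] atom[of Inl "Mem 0 (Suc 0)"] by simp
  next
    case (Leq i j)
    then show ?case
      using bin[of "t i" "t j" "wo U"] atom[of Inl "Leq 0 (Suc 0)"] by simp
  next
    case (Eq i j)
    then show ?case
      using bin[of "t i" "t j" "(=)"] atom[of Inl "Eq 0 (Suc 0)"] by simp
  next
    case (All \<phi>)
    have "dt U (\<lambda>e. case_nat (e 0) (\<lambda>i. t i (\<lambda>i. e (Suc i))) i)" for i
      using var shift[OF All.prems] by (cases i) simp_all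
    then have "dfn U (\<lambda>e. sat U (\<lambda>i. case_nat (e 0) (\<lambda>i. t i (\<lambda>i. e (Suc i))) i) \<phi>)"
      by (rule All.IH)
    then show ?case by (simp add: dfn_all)
  qed (auto intro: df)
qed

lemma dt_var [df]: "dt U (\<lambda>e. e n)"
  unfolding dt_def
  by (rule dfnI[where \<sigma> = "\<lambda>i. Inl (if i = 0 then Suc n else 0)" and \<phi> = "Eq 0 (Suc 0)"]) simp

lemma dt_const [df]: "dt U (\<lambda>e. c)"
  unfolding dt_def
  by (rule dfnI[where \<sigma> = "\<lambda>i. if i = 0 then Inr c else Inl 0" and \<phi> = "Eq 0 (Suc 0)"]) simp

lemma dt_case_nat [df]:
  "dt U t \<Longrightarrow> (\<And>i. dt U (u i)) \<Longrightarrow> dt U (\<lambda>e. case_nat (t e) (\<lambda>i. u i e) n)"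
  by (cases n) simp_all

lemma dfn_subst:
  assumes "dfn U P" "\<And>i. dt U (t i)"
  shows "dfn U (\<lambda>e. P (\<lambda>i. t i e))"
proof -
  obtain \<phi> \<sigma> where 1: "\<And>e. P e = sat U (\<lambda>i. case_sum e id (\<sigma> i)) \<phi>"
    using assms(1) by (rule dfnE) (rule that)
  have "dt U (\<lambda>e. case_sum (\<lambda>i. t i e) id (\<sigma> i))" for i
    by (cases "\<sigma> i") (auto intro: df assms(2))
  then show ?thesis unfolding 1 by (rule dfn_sat)
qed

lemma dfn_subst1:
  "dfn U (\<lambda>e. P (e 0)) \<Longrightarrow> dt U t \<Longrightarrow> dfn U (\<lambda>e. P (t e))"
  using dfn_subst[of U "\<lambda>e. P (e 0)" "\<lambda>i. t"] by simp

lemma dfn_subst2: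
  "dfn U (\<lambda>e. P (e 0) (e 1)) \<Longrightarrow> dt U t \<Longrightarrow> dt U u \<Longrightarrow> dfn U (\<lambda>e. P (t e) (u e))"
  using dfn_subst[of U "\<lambda>e. P (e 0) (e 1)" "\<lambda>i. if i = 0 then t else u"] by simp

lemma dfn_subst3:
  "dfn U (\<lambda>e. P (e 0) (e 1) (e 2)) \<Longrightarrow> dt U t \<Longrightarrow> dt U u \<Longrightarrow> dt U v \<Longrightarrow> dfn U (\<lambda>e. P (t e) (u e) (v e))"
  using dfn_subst[of U "\<lambda>e. P (e 0) (e 1) (e 2)" "\<lambda>i. if i = 0 then t else if i = 1 then u else v"] by simp

lemma dt_subst:
  assumes "dt U f" "\<And>i. dt U (t i)"
  shows "dt U (\<lambda>e. f (\<lambda>i. t i e))"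
proof -
  have shift: "dt U (\<lambda>e. t i (\<lambda>j. e (Suc j)))" for i
    unfolding dt_def
    using dfn_subst[OF assms(2)[of i, unfolded dt_def], of "\<lambda>j e. e (if j = 0 then 0 else Suc j)"]
    by (simp add: dt_var)
  have "dt U (\<lambda>e. case_nat (e 0) (\<lambda>i. t i (\<lambda>i. e (Suc i))) i)" for i
    by (cases i) (auto intro: df shift)
  then have "dfn U (\<lambda>e. f (\<lambda>i. case_nat (e 0) (\<lambda>i. t i (\<lambda>i. e (Suc i))) (Suc i)) =
      case_nat (e 0) (\<lambda>i. t i (\<lambda>i. e (Suc i))) 0)"
    by (rule dfn_subst[OF assms(1)[unfolded dt_def]])
  then show ?thesis by (simp add: dt_def)
qed

lemma dt_subst1: "dt U (\<lambda>e. f (e 0)) \<Longrightarrow> dt U t \<Longrightarrow> dt U (\<lambda>e. f (t e))"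
  using dt_subst[of U "\<lambda>e. f (e 0)" "\<lambda>i. t"] by simp

lemma dt_subst2: "dt U (\<lambda>e. f (e 0) (e 1)) \<Longrightarrow> dt U t \<Longrightarrow> dt U u \<Longrightarrow> dt U (\<lambda>e. f (t e) (u e))"
  using dt_subst[of U "\<lambda>e. f (e 0) (e 1)" "\<lambda>i. if i = 0 then t else u"] by simp

lemma dt_graphI: "dfn U (\<lambda>e. f (e 1) = e 0) \<Longrightarrow> dt U (\<lambda>e. f (e 0))"
  by (simp add: dt_def)

lemma dt_graph2I: "dfn U (\<lambda>e. f (e 1) (e 2) = e 0) \<Longrightarrow> dt U (\<lambda>e. f (e 0) (e 1))"
  by (simp add: dt_def numeral_2_eq_2)

lemma dfn_eq [df]: "dt U t \<Longrightarrow> dt U u \<Longrightarrow> dfn U (\<lambda>e. t e = u e)"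
  by (rule dfn_subst2[where P = "(=)"])
     (use dfn_sat[of U "\<lambda>i e. e i" "Eq 0 1"] in \<open>simp_all add: df\<close>)

lemma dfn_mem [df]: "dt U t \<Longrightarrow> dt U u \<Longrightarrow> dfn U (\<lambda>e. mem U (t e) (u e))"
  by (rule dfn_subst2[where P = "mem U"])
     (use dfn_sat[of U "\<lambda>i e. e i" "Mem 0 1"] in \<open>simp_all add: df\<close>)

lemma dfn_wo [df]: "dt U t \<Longrightarrow> dt U u \<Longrightarrow> dfn U (\<lambda>e. wo U (t e) (u e))"
  by (rule dfn_subst2[where P = "wo U"])
     (use dfn_sat[of U "\<lambda>i e. e i" "Leq 0 1"] in \<open>simp_all add: df\<close>)

lemma dfn_ext [df]: "dt U t \<Longrightarrow> dt U u \<Longrightarrow> dfn U (\<lambda>e. t e \<in> ext U (u e))"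
  by (simp add: ext_def df)

lemma dfn_ex1 [df]:
  assumes "dfn U (\<lambda>e. P (e 0) (\<lambda>i. e (Suc i)))"
  shows "dfn U (\<lambda>e. \<exists>!x. P x e)"
proof -
  have "dfn U (\<lambda>e. \<exists>x. \<forall>y. P y e = (y = x))"
    using dfn_subst[OF assms, of "\<lambda>i e. case_nat (e 0) (\<lambda>i. e (Suc (Suc i))) i"]
    by (intro dfn_ex dfn_all dfn_iff) (simp_all add: df dfn_eq)
  then show ?thesis by (rule dfn_cong[rotated]) (auto simp: Ex1_def)
qed

lemma dfn_Collect [df]: "dfn U (\<lambda>e. P (t e) e) \<Longrightarrow> dfn U (\<lambda>e. t e \<in> {x. P x e})"
  by simp

lemma dfn_ball [df]:
  "dfn U (\<lambda>e. e 0 \<in> A (\<lambda>i. e (Suc i)) \<longrightarrow> P (e 0) (\<lambda>i. e (Suc i))) \<Longrightarrow> dfn U (\<lambda>e. \<forall>x \<in> A e. P x e)"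
  unfolding Ball_def by (rule dfn_all)

lemma dfn_bex [df]:
  "dfn U (\<lambda>e. e 0 \<in> A (\<lambda>i. e (Suc i)) \<and> P (e 0) (\<lambda>i. e (Suc i))) \<Longrightarrow> dfn U (\<lambda>e. \<exists>x \<in> A e. P x e)"
  unfolding Bex_def by (rule dfn_ex)

lemma dfn_subset [df]:
  "dfn U (\<lambda>e. e 0 \<in> A (\<lambda>i. e (Suc i)) \<longrightarrow> e 0 \<in> B (\<lambda>i. e (Suc i))) \<Longrightarrow> dfn U (\<lambda>e. A e \<subseteq> B e)"
  unfolding subset_iff by (rule dfn_all)

lemma dfn_seteq [df]:
  fixes A B :: "(nat \<Rightarrow> 'v) \<Rightarrow> 'v set"
  shows "dfn U (\<lambda>e. e 0 \<in> A (\<lambda>i. e (Suc i)) \<longleftrightarrow> e 0 \<in> B (\<lambda>i. e (Suc i))) \<Longrightarrow> dfn U (\<lambda>e. A e = B e)"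
  unfolding set_eq_iff by (rule dfn_all)

lemma dfn_insert [df]:
  "dfn U (\<lambda>e. t e = a e) \<Longrightarrow> dfn U (\<lambda>e. t e \<in> A e) \<Longrightarrow> dfn U (\<lambda>e. t e \<in> insert (a e) (A e))"
  unfolding insert_iff by (rule dfn_disj)

lemma dfn_empty [df]: "dfn U (\<lambda>e. t e \<in> {})"
  by (simp add: dfn_const)

lemma dfn_Un [df]: "dfn U (\<lambda>e. t e \<in> A e) \<Longrightarrow> dfn U (\<lambda>e. t e \<in> B e) \<Longrightarrow> dfn U (\<lambda>e. t e \<in> A e \<union> B e)"
  unfolding Un_iff by (rule dfn_disj)

lemma dt_if [df]:
  assumes "dfn U B" "dt U t" "dt U u"
  shows "dt U (\<lambda>e. if B e then t e else u e)"
proof -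
  have "dfn U (\<lambda>e. (B (\<lambda>i. e (Suc i)) \<longrightarrow> t (\<lambda>i. e (Suc i)) = e 0) \<and>
      (\<not> B (\<lambda>i. e (Suc i)) \<longrightarrow> u (\<lambda>i. e (Suc i)) = e 0))"
    using dfn_subst[OF assms(1), of "\<lambda>i e. e (Suc i)"] assms(2,3)[unfolded dt_def]
    by (intro dfn_conj dfn_imp dfn_not) (simp_all add: df)
  then show ?thesis unfolding dt_def by (rule dfn_cong[rotated]) auto
qed

text \<open>The passage from the shallow notion to \<open>definable\<close>: the fixed environment
  is absorbed into the parameters, so every member of a definable family is a definable
  class.\<close>

lemma dfn_imp_definable:
  assumes "dfn U (\<lambda>e. P (e 0) (\<lambda>i. e (Suc i)))"
  shows "definable U {x. P x e}"
proof -
  have "dfn U (\<lambda>f. P (f 0) e)"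
    using dfn_subst[OF assms, of "\<lambda>i f. case_nat (f 0) e i"] by (simp add: df)
  then obtain \<phi> \<sigma> where 1: "\<forall>f :: nat \<Rightarrow> _. P (f 0) e = sat U (\<lambda>i. case_sum f id (\<sigma> i)) \<phi>"
    unfolding dfn_def by (elim exE)
  define r where "r i = (if \<sigma> i = Inl 0 then 0 else Suc i)" for i
  define h where "h i = case_sum (\<lambda>_. undefined) id (\<sigma> i)" for i
  have "case_sum (case_nat x (\<lambda>_. undefined)) id (\<sigma> i) = case_nat x h (r i)" for x i
    by (auto simp: r_def h_def split: sum.split nat.split)
  then have "P x e = sat U (case_nat x h) (ren r \<phi>)" for x
    using 1[rule_format, of "case_nat x (\<lambda>_. undefined)"] by (simp add: sat_ren)
  then show ?thesis unfolding definable_def by blast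
qed

lemma definable_dfn:
  assumes "definable U X" "dt U t"
  shows "dfn U (\<lambda>e. t e \<in> X)"
proof -
  obtain \<phi> h where "X = {x. sat U (case_nat x h) \<phi>}" using assms unfolding definable_def by blast
  then show ?thesis
    using dfn_sat[of U "\<lambda>i e. case_nat (t e) h i" \<phi>] assms(2) by (simp add: df)
qed

lemma definable_iff: "definable U X \<longleftrightarrow> dfn U (\<lambda>e. e 0 \<in> X)"
  using dfn_imp_definable[of U "\<lambda>x _. x \<in> X"] definable_dfn[of U X] dt_var[of U 0] by auto

lemma definable_relI:
  assumes "dfn U (\<lambda>e. T (map e [0..<k]))"
  shows "definable_rel U k T"
proof -
  obtain \<phi> \<sigma> where 1: "\<And>e. T (map e [0..<k]) = sat U (\<lambda>i. case_sum e id (\<sigma> i)) \<phi>"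
    using assms by (rule dfnE) (rule that)
  \<comment> \<open>A variable of index at least \<open>k\<close> is not an entry of the list. Like
    a genuine parameter it is moved to position \<open>k + i\<close>, where it receives the value
    \<open>undefined\<close>.\<close>
  define r where "r i = (case \<sigma> i of Inl j \<Rightarrow> if j < k then j else k + i | Inr c \<Rightarrow> k + i)" for i
  define h where "h i = case_sum (\<lambda>_. undefined) id (\<sigma> i)" for i
  have "T xs = sat U (\<lambda>i. if i < k then xs ! i else h (i - k)) (ren r \<phi>)" if "length xs = k" for xs
  proof -
    let ?e = "\<lambda>i. if i < k then xs ! i else undefined"
    have "case_sum ?e id (\<sigma> i) = (\<lambda>i. if i < k then xs ! i else h (i - k)) (r i)" for i
      by (auto simp: r_def h_def split: sum.split)
    moreover have "map ?e [0..<k] = xs" using that by (auto intro: nth_equalityI)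
    ultimately show ?thesis using 1[of ?e] by (simp add: sat_ren)
  qed
  then show ?thesis unfolding definable_rel_def by blast
qed

lemma definable_relD:
  assumes "definable_rel U k T" "length ts = k" "\<And>t. t \<in> set ts \<Longrightarrow> dt U t"
  shows "dfn U (\<lambda>e. T (map (\<lambda>t. t e) ts))"
proof -
  obtain \<phi> h where 1: "\<And>xs. length xs = k \<Longrightarrow> T xs = sat U (\<lambda>i. if i < k then xs ! i else h (i - k)) \<phi>"
    using assms(1) unfolding definable_rel_def by blast
  have "dfn U (\<lambda>e. sat U (\<lambda>i. (if i < k then ts ! i else (\<lambda>_. h (i - k))) e) \<phi>)"
    using assms by (intro dfn_sat) (auto intro: df)
  moreover have "T (map (\<lambda>t. t e) ts) = sat U (\<lambda>i. (if i < k then ts ! i else (\<lambda>_. h (i - k))) e) \<phi>" for e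
  proof -
    have "(\<lambda>i. if i < k then map (\<lambda>t. t e) ts ! i else h (i - k)) = (\<lambda>i. (if i < k then ts ! i else (\<lambda>_. h (i - k))) e)"
      using assms(2) by auto
    then show ?thesis using 1[of "map (\<lambda>t. t e) ts"] assms(2) by simp
  qed
  ultimately show ?thesis by (rule dfn_cong[rotated])
qed

section \<open>Sets, least choices and ordered pairs in the model\<close>

definition isset :: "'v universe \<Rightarrow> 'v set \<Rightarrow> bool" where
  "isset U X \<longleftrightarrow> (\<exists>z. ext U z = X)"

text \<open>The junk value for an empty class makes \<open>wl\<close> total, hence definable without side conditions.\<close>

definition wl :: "'v universe \<Rightarrow> ('v \<Rightarrow> bool) \<Rightarrow> 'v" where
  "wl U P = (if \<exists>x. P x then THE x. P x \<and> (\<forall>y. P y \<longrightarrow> wo U x y) else empty_set U)"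

abbreviation (input) dfun :: "'v universe \<Rightarrow> ('v \<Rightarrow> 'v) \<Rightarrow> bool" where
  "dfun U f \<equiv> dt U (\<lambda>e. f (e 0))"

abbreviation (input) dprd :: "'v universe \<Rightarrow> ('v \<Rightarrow> bool) \<Rightarrow> bool" where
  "dprd U P \<equiv> dfn U (\<lambda>e. P (e 0))"

locale nbg =
  fixes U :: "'v universe"
  assumes NBG: "NBG U"
begin

lemma dprd_definable: "dprd U P \<Longrightarrow> definable U {x. P x}"
  using dfn_imp_definable[of U "\<lambda>x _. P x"] by simp

lemmas NBG_axioms = NBG[unfolded NBG_def]

lemma ext_eq_iff: "ext U x = ext U y \<longleftrightarrow> x = y"
  using NBG_axioms[THEN conjunct1] by blast

lemma isset_doubleton [simp]: "isset U {x, y}"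
  using NBG_axioms[THEN conjunct2, THEN conjunct1] unfolding isset_def by simp

lemma isset_Union_ext: "isset U (\<Union>y \<in> ext U x. ext U y)"
  using NBG_axioms[THEN conjunct2, THEN conjunct2, THEN conjunct1] unfolding isset_def by simp

lemma isset_Pow_ext: "isset U {y. ext U y \<subseteq> ext U x}"
  using NBG_axioms[THEN conjunct2, THEN conjunct2, THEN conjunct2, THEN conjunct1] unfolding isset_def by simp

lemmas NBG_axioms' = NBG_axioms[THEN conjunct2, THEN conjunct2, THEN conjunct2, THEN conjunct2]

lemma infinity:
  "\<exists>z. (\<exists>x \<in> ext U z. ext U x = {}) \<and> (\<forall>x \<in> ext U z. \<exists>y \<in> ext U z. ext U y = insert x (ext U x))"
  by (rule NBG_axioms'[THEN conjunct1])

lemma replacement: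
  "definable U G \<Longrightarrow> (\<And>u v w. opair U u v \<in> G \<Longrightarrow> opair U u w \<in> G \<Longrightarrow> v = w) \<Longrightarrow>
    isset U {v. \<exists>u \<in> ext U x. opair U u v \<in> G}"
  using NBG_axioms'[THEN conjunct2, THEN conjunct1] unfolding isset_def by simp

lemma foundation: "definable U X \<Longrightarrow> X \<noteq> {} \<Longrightarrow> \<exists>x \<in> X. ext U x \<inter> X = {}"
  using NBG_axioms'[THEN conjunct2, THEN conjunct2, THEN conjunct1] by simp

lemmas NBG_axioms'' = NBG_axioms'[THEN conjunct2, THEN conjunct2, THEN conjunct2]

lemma wo_antisym: "wo U x y \<Longrightarrow> wo U y x \<Longrightarrow> x = y"
  using NBG_axioms''[THEN conjunct1] by simp

lemma wo_least: "definable U X \<Longrightarrow> X \<noteq> {} \<Longrightarrow> \<exists>x \<in> X. \<forall>y \<in> X. wo U x y"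
  using NBG_axioms''[THEN conjunct2, THEN conjunct2] by simp

lemma the_set_ext [simp]: "the_set U (ext U x) = x"
  unfolding the_set_def ext_eq_iff by simp

lemma ext_the_set: "isset U X \<Longrightarrow> ext U (the_set U X) = X"
  unfolding isset_def by (elim exE) (metis the_set_ext)

lemma the_set_eq: "isset U X \<Longrightarrow> the_set U X = z \<longleftrightarrow> X = ext U z"
  using ext_the_set by force

lemma isset_ext [simp, intro]: "isset U (ext U x)"
  unfolding isset_def by blast

lemma isset_singleton [simp]: "isset U {x}"
  using isset_doubleton[of x x] by simp

lemma isset_Un [simp]:
  assumes "isset U A" "isset U B"
  shows "isset U (A \<union> B)"
proof -
  obtain a b where "ext U a = A" "ext U b = B" using assms unfolding isset_def by blast
  moreover obtain z where "ext U z = {a, b}" using isset_doubleton unfolding isset_def by blast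
  ultimately show ?thesis using isset_Union_ext[of z] by simp
qed

lemma isset_insert [simp]: "isset U A \<Longrightarrow> isset U (insert x A)"
  using isset_Un[of "{x}" A] by simp

definition sing :: "'v \<Rightarrow> 'v" where "sing x = the_set U {x}"
definition dbl :: "'v \<Rightarrow> 'v \<Rightarrow> 'v" where "dbl x y = the_set U {x, y}"

lemma opair_dbl: "opair U x y = dbl (sing x) (dbl x y)"
  unfolding opair_def sing_def dbl_def ..

lemma opair_inject [simp]: "opair U a b = opair U c d \<longleftrightarrow> a = c \<and> b = d"
proof
  assume "opair U a b = opair U c d"
  then have "{sing a, dbl a b} = {sing c, dbl c d}"
    unfolding opair_dbl by (metis dbl_def ext_the_set isset_doubleton)
  moreover have "sing x = sing y \<longleftrightarrow> x = y" "dbl x y = dbl u v \<longleftrightarrow> {x, y} = {u, v}"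
    "sing x = dbl u v \<longleftrightarrow> {x} = {u, v}" "dbl u v = sing x \<longleftrightarrow> {x} = {u, v}" for x y u v
    unfolding sing_def dbl_def
    by (metis ext_the_set isset_doubleton isset_singleton singleton_iff insert_absorb2 doubleton_eq_iff)+
  ultimately show "a = c \<and> b = d" by (auto simp: doubleton_eq_iff)
qed simp

lemma dt_sing: "dt U t \<Longrightarrow> dt U (\<lambda>e. sing (t e))"
  by (rule dt_subst1[where f = sing], rule dt_graphI) (unfold sing_def the_set_eq[OF isset_singleton], intro df)



lemmas df_sing [df] = dt_sing

lemma df_dbl [df]: "dt U t \<Longrightarrow> dt U u \<Longrightarrow> dt U (\<lambda>e. dbl (t e) (u e))"
  by (rule dt_subst2[where f = dbl], rule dt_graph2I) (unfold dbl_def the_set_eq[OF isset_doubleton], intro df)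

lemma df_opair [df]: "dt U t \<Longrightarrow> dt U u \<Longrightarrow> dt U (\<lambda>e. opair U (t e) (u e))"
  unfolding opair_dbl by (intro df)

text \<open>Foundation speaks of definable classes only, so this and every later induction principle
  carries a definability premise; membership of the model need not be well-founded from
  outside.\<close>

lemma ext_induct:
  assumes "dprd U P" "\<And>x. (\<And>y. y \<in> ext U x \<Longrightarrow> P y) \<Longrightarrow> P x"
  shows "P x"
proof (rule ccontr)
  assume "\<not> P x"
  have "dprd U (\<lambda>x. \<not> P x)" by (intro df assms(1))
  from foundation[OF dprd_definable[OF this]] \<open>\<not> P x\<close>
  obtain y where "\<not> P y" "ext U y \<inter> {x. \<not> P x} = {}" by auto
  moreover have "P y" by (rule assms(2)) (use \<open>ext U y \<inter> {x. \<not> P x} = {}\<close> in blast)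
  ultimately show False by simp
qed

lemma dfn_fix:
  assumes "dfn U (\<lambda>e. P (e 0) (\<lambda>i. e (Suc i)))"
  shows "dprd U (\<lambda>x. P x e)"
  using definable_dfn[OF dfn_imp_definable[where P = P and e = e, OF assms] dt_var[of U 0]] by simp

lemma isset_image:
  assumes "dfun U f" "isset U A"
  shows "isset U (f ` A)"
proof -
  obtain x where x: "ext U x = A" using assms(2) unfolding isset_def by blast
  let ?G = "{z. \<exists>u. z = opair U u (f u)}"
  have "dprd U (\<lambda>z. \<exists>u. z = opair U u (f u))"
    by (intro df dt_subst1[OF assms(1)])
  from replacement[OF dprd_definable[OF this]]
  have "isset U {v. \<exists>u \<in> ext U x. opair U u v \<in> ?G}" by auto
  moreover have "{v. \<exists>u \<in> ext U x. opair U u v \<in> ?G} = f ` A" using x by auto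
  ultimately show ?thesis by simp
qed

text \<open>Separation is replacement for the identity restricted to \<open>P\<close>, a partial
  class function.\<close>

lemma isset_sep:
  assumes "dprd U P" "isset U A"
  shows "isset U {y \<in> A. P y}"
proof -
  obtain x where x: "ext U x = A" using assms(2) unfolding isset_def by blast
  let ?G = "{z. \<exists>u. z = opair U u u \<and> P u}"
  have "dprd U (\<lambda>z. \<exists>u. z = opair U u u \<and> P u)"
    by (intro df dfn_subst1[OF assms(1)])
  from replacement[OF dprd_definable[OF this]]
  have "isset U {v. \<exists>u \<in> ext U x. opair U u v \<in> ?G}" by auto
  moreover have "{v. \<exists>u \<in> ext U x. opair U u v \<in> ?G} = {y \<in> A. P y}" using x by auto
  ultimately show ?thesis by simp
qed

lemma isset_subset: "dprd U (\<lambda>x. x \<in> B) \<Longrightarrow> B \<subseteq> A \<Longrightarrow> isset U A \<Longrightarrow> isset U B"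
  using isset_sep[of "\<lambda>x. x \<in> B" A] by (simp add: Collect_conj_eq Int_absorb2 Int_commute inf.absorb2)

lemma isset_dprd: "isset U A \<Longrightarrow> dprd U (\<lambda>x. x \<in> A)"
  unfolding isset_def by (auto intro: df)

lemma isset_empty [simp]: "isset U {}"
  using isset_sep[of "\<lambda>_. False" "ext U undefined"] by (simp add: dfn_const)

lemma isset_UN:
  assumes "dfun U f" "isset U A"
  shows "isset U (\<Union>x \<in> A. ext U (f x))"
proof -
  obtain z where "ext U z = f ` A" using isset_image[OF assms] unfolding isset_def by blast
  then show ?thesis using isset_Union_ext[of z] by simp
qed

lemma isset_Pow: "isset U A \<Longrightarrow> isset U {y. ext U y \<subseteq> A}"
  using isset_Pow_ext unfolding isset_def by metis

lemma wl_props: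
  assumes "dprd U P" "P x"
  shows "P (wl U P)" "P y \<Longrightarrow> wo U (wl U P) y"
proof -
  obtain z where z: "P z" "\<And>y. P y \<Longrightarrow> wo U z y"
    using wo_least[OF dprd_definable[OF assms(1)]] assms(2) by auto
  then have "wl U P = z"
    unfolding wl_def using wo_antisym by (auto intro!: the_equality)
  then show "P (wl U P)" "P y \<Longrightarrow> wo U (wl U P) y" using z by auto
qed

text \<open>There is no definability premise because a predicate with exactly one solution describes
  a singleton, which is definable with that solution as parameter.\<close>

lemma wl_eq:
  assumes "P x" "\<And>y. P y \<Longrightarrow> y = x"
  shows "wl U P = x"
proof -
  have "P = (\<lambda>y. y = x)" using assms by blast
  moreover have "dprd U (\<lambda>y. y = x)" by (intro df)
  ultimately show ?thesis using wl_props(1)[of P x] by simp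
qed

text \<open>Definable maps are closed under choice: the graph says that the value is a least
  solution, or that there is no solution and the value is the default.\<close>

lemma df_wl [df]:
  assumes "dfn U (\<lambda>e. P (e 0) (\<lambda>i. e (Suc i)))"
  shows "dt U (\<lambda>e. wl U (\<lambda>x. P x e))"
proof -
  have ch: "(wl U (\<lambda>x. P x e) = z) \<longleftrightarrow>
      P z e \<and> (\<forall>y. P y e \<longrightarrow> wo U z y) \<or> (\<not> (\<exists>x. P x e) \<and> z = empty_set U)" for e z
  proof (cases "\<exists>x. P x e")
    case True
    then show ?thesis
      using wl_props[OF dfn_fix[where P = P and e = e, OF assms]] wo_antisym by blast
  qed (auto simp: wl_def)
  have 1: "dfn U (\<lambda>e. P (e 0) (\<lambda>i. e (Suc (Suc i))))"
    using dfn_subst[OF assms, of "\<lambda>i e. e (if i = 0 then 0 else Suc i)"] by (simp add: df)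
  show ?thesis
    unfolding dt_def ch using assms 1 by (intro df) 
qed

lemma dfunD: "dfun U f \<Longrightarrow> dt U t \<Longrightarrow> dt U (\<lambda>e. f (t e))"
  by (rule dt_subst1)

lemma dprdD: "dprd U P \<Longrightarrow> dt U t \<Longrightarrow> dfn U (\<lambda>e. P (t e))"
  by (rule dfn_subst1)

lemma not_mem_self [simp]: "x \<notin> ext U x"
proof -
  have "dprd U (\<lambda>y. y \<in> {x})" by (intro df)
  from foundation[OF dprd_definable[OF this]] show ?thesis by auto
qed

lemma mem_asym: "x \<in> ext U y \<Longrightarrow> y \<notin> ext U x"
proof
  assume "x \<in> ext U y" "y \<in> ext U x"
  have "dprd U (\<lambda>z. z \<in> {x, y})" by (intro df)
  from foundation[OF dprd_definable[OF this]] \<open>x \<in> ext U y\<close> \<open>y \<in> ext U x\<close>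
  show False by auto
qed

lemma isset_class_prod:
  assumes "isset U A" "isset U B"
  shows "isset U (class_prod U A B)"
proof -
  obtain a where a: "ext U a = A" using assms(1) unfolding isset_def by blast
  obtain b where b: "ext U b = B" using assms(2) unfolding isset_def by blast
  have row: "isset U ((\<lambda>y. opair U x y) ` B)" for x
    using assms(2) by (intro isset_image df)
  \<comment> \<open>The rows are given by \<open>wl\<close> and not by \<open>the_set\<close>,
    because the union over \<open>A\<close> requires \<open>R\<close> to be a definable map.\<close>
  define R where "R x = wl U (\<lambda>z. ext U z = {w. \<exists>y \<in> ext U b. w = opair U x y})" for x
  have ext_R: "ext U (R x) = (\<lambda>y. opair U x y) ` B" for x
  proof -
    have *: "{w. \<exists>y \<in> ext U b. w = opair U x y} = (\<lambda>y. opair U x y) ` B" using b by auto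
    obtain z where "ext U z = (\<lambda>y. opair U x y) ` B" using row unfolding isset_def by blast
    then have "R x = z"
      unfolding R_def * by (intro wl_eq) (auto simp: ext_eq_iff[symmetric])
    then show ?thesis using \<open>ext U z = _\<close> by simp
  qed
  have "dfun U R" unfolding R_def by (intro df)
  from isset_UN[OF this assms(1)] have "isset U (\<Union>x \<in> A. (\<lambda>y. opair U x y) ` B)"
    by (simp add: ext_R)
  moreover have "(\<Union>x \<in> A. (\<lambda>y. opair U x y) ` B) = class_prod U A B"
    unfolding class_prod_def by auto
  ultimately show ?thesis by simp
qed

lemma df_class_prod [df]:
  assumes "dfn U (\<lambda>e. \<exists>x y. t e = opair U x y \<and> x \<in> A e \<and> y \<in> B e)"
  shows "dfn U (\<lambda>e. t e \<in> class_prod U (A e) (B e))"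
  unfolding class_prod_def mem_Collect_eq by (rule assms)

lemma opair_in_class_prod [simp]: "opair U x y \<in> class_prod U A B \<longleftrightarrow> x \<in> A \<and> y \<in> B"
  unfolding class_prod_def by auto

section \<open>Internal functions\<close>

text \<open>The total counterpart of \<open>app\<close>: with \<open>wl\<close> in place of a
  definite description the value is definable from both arguments. On arguments in the domain of a
  function the two agree, by \<open>app_eq_ap\<close>.\<close>

definition ap :: "'v \<Rightarrow> 'v \<Rightarrow> 'v" where
  "ap f x = wl U (\<lambda>y. opair U x y \<in> ext U f)"

lemma df_ap [df]: "dt U t \<Longrightarrow> dt U u \<Longrightarrow> dt U (\<lambda>e. ap (t e) (u e))"
  by (rule dt_subst2[where f = ap]) (unfold ap_def, intro df)

definition lam :: "'v set \<Rightarrow> ('v \<Rightarrow> 'v) \<Rightarrow> 'v" where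
  "lam A f = the_set U ((\<lambda>x. opair U x (f x)) ` A)"

lemma ext_lam:
  assumes "isset U A" "dfun U f"
  shows "ext U (lam A f) = (\<lambda>x. opair U x (f x)) ` A"
proof -
  have "dfun U (\<lambda>x. opair U x (f x))" by (intro df dfunD[OF assms(2)])
  from isset_image[OF this assms(1)] show ?thesis unfolding lam_def by (rule ext_the_set)
qed

lemma ap_lam: "isset U A \<Longrightarrow> dfun U f \<Longrightarrow> x \<in> A \<Longrightarrow> ap (lam A f) x = f x"
  unfolding ap_def by (rule wl_eq) (auto simp: ext_lam)

lemma class_fun_lam:
  "isset U A \<Longrightarrow> dfun U f \<Longrightarrow> f ` A \<subseteq> B \<Longrightarrow> class_fun U A B (ext U (lam A f))"
  unfolding class_fun_def class_prod_def by (auto simp: ext_lam)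

lemma app_eq_wl: "class_fun U A B G \<Longrightarrow> x \<in> A \<Longrightarrow> app U G x = wl U (\<lambda>y. opair U x y \<in> G)"
  unfolding class_fun_def app_def by (metis (no_types, lifting) the1_equality wl_eq)

lemma app_eq_ap: "class_fun U A B (ext U f) \<Longrightarrow> x \<in> A \<Longrightarrow> app U (ext U f) x = ap f x"
  unfolding ap_def by (rule app_eq_wl)

lemma class_fun_ap:
  assumes "class_fun U A B (ext U f)" "x \<in> A"
  shows "ap f x \<in> B" "opair U x y \<in> ext U f \<longleftrightarrow> y = ap f x"
proof -
  have "\<exists>!z. opair U x z \<in> ext U f"
    by (rule bspec[OF assms(1)[unfolded class_fun_def, THEN conjunct2] assms(2)])
  then obtain z where z: "opair U x z \<in> ext U f" "\<And>y. opair U x y \<in> ext U f \<Longrightarrow> y = z"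
    by (elim ex1E) blast
  from z have eq: "ap f x = z" unfolding ap_def by (rule wl_eq)
  show "opair U x y \<in> ext U f \<longleftrightarrow> y = ap f x" using z eq by blast
  have "opair U x z \<in> class_prod U A B"
    using z(1) assms(1)[unfolded class_fun_def, THEN conjunct1] by blast
  then show "ap f x \<in> B" unfolding eq by simp
qed

lemma class_fun_ext:
  assumes "class_fun U A B (ext U f)" "class_fun U A C (ext U g)" "\<And>x. x \<in> A \<Longrightarrow> ap f x = ap g x"
  shows "f = g"
proof -
  have "ext U f \<subseteq> ext U g"
    if fg: "class_fun U A B (ext U f)" "class_fun U A C (ext U g)" "\<And>x. x \<in> A \<Longrightarrow> ap f x = ap g x" for f g B C
  proof
    fix z assume "z \<in> ext U f"
    then obtain x y where "z = opair U x y" "x \<in> A"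
      using fg(1) unfolding class_fun_def class_prod_def by blast
    then show "z \<in> ext U g"
      using \<open>z \<in> ext U f\<close> class_fun_ap(2)[OF fg(1)] class_fun_ap(2)[OF fg(2)] fg(3) by simp
  qed
  from this[OF assms] this[OF assms(2,1) assms(3)[symmetric]] have "ext U f = ext U g" by simp
  then show ?thesis by (simp add: ext_eq_iff)
qed

lemma isset_funs:
  assumes "isset U A" "isset U B" "dprd U (\<lambda>x. x \<in> X)" "\<And>f. f \<in> X \<Longrightarrow> class_fun U A B (ext U f)"
  shows "isset U X"
proof (rule isset_subset[OF assms(3)])
  show "isset U {y. ext U y \<subseteq> class_prod U A B}"
    using assms by (intro isset_Pow isset_class_prod)
  show "X \<subseteq> {y. ext U y \<subseteq> class_prod U A B}" using assms(4) unfolding class_fun_def by blast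
qed

lemma df_class_fun [df]:
  assumes "dfn U (\<lambda>e. G e \<subseteq> class_prod U (A e) (B e))" "dfn U (\<lambda>e. \<forall>x \<in> A e. \<exists>!y. opair U x y \<in> G e)"
  shows "dfn U (\<lambda>e. class_fun U (A e) (B e) (G e))"
  unfolding class_fun_def using assms by (rule dfn_conj)

end

context nbg
begin

section \<open>Ordinals and natural numbers\<close>

lemma ext_empty_set [simp]: "ext U (empty_set U) = {}"
  unfolding empty_set_def by (simp add: ext_the_set)

lemma ext_eq_empty: "ext U x = {} \<longleftrightarrow> x = empty_set U"
  using ext_eq_iff[of x "empty_set U"] by simp

lemma ext_succ [simp]: "ext U (succ_set U x) = insert x (ext U x)"
  unfolding succ_set_def by (simp add: ext_the_set)

lemma succ_ne_empty [simp]: "succ_set U x \<noteq> empty_set U" "empty_set U \<noteq> succ_set U x"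
proof -
  have "ext U (succ_set U x) \<noteq> ext U (empty_set U)" unfolding ext_succ ext_empty_set by (rule insert_not_empty)
  then show "succ_set U x \<noteq> empty_set U" unfolding ext_eq_iff .
  then show "empty_set U \<noteq> succ_set U x" by (rule not_sym)
qed

lemma succ_inject [simp]: "succ_set U x = succ_set U y \<longleftrightarrow> x = y"
proof
  assume "succ_set U x = succ_set U y"
  from arg_cong[OF this, of "ext U"] have "insert x (ext U x) = insert y (ext U y)"
    unfolding ext_succ .
  then have "x = y \<or> x \<in> ext U y \<and> y \<in> ext U x" by auto
  then show "x = y" using mem_asym by blast
qed (rule arg_cong)

lemma df_succ [df]: "dt U t \<Longrightarrow> dt U (\<lambda>e. succ_set U (t e))"
  by (rule dt_subst1[where f = "succ_set U"], rule dt_graphI)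
     (unfold succ_set_def the_set_eq[OF isset_insert[OF isset_ext]], intro df)

lemma df_transitive [df]: "dt U t \<Longrightarrow> dfn U (\<lambda>e. transitive U (t e))"
  by (rule dfn_subst1[where P = "transitive U"]) (unfold transitive_def, intro df)

lemma df_ordinals [df]: "dt U t \<Longrightarrow> dfn U (\<lambda>e. t e \<in> ordinals U)"
  by (rule dfn_subst1[where P = "\<lambda>x. x \<in> ordinals U"]) (unfold ordinals_def, intro df)

lemma df_naturals [df]: "dt U t \<Longrightarrow> dfn U (\<lambda>e. t e \<in> naturals U)"
  by (rule dfn_subst1[where P = "\<lambda>x. x \<in> naturals U"]) (unfold naturals_def, intro df)

lemma On_trans: "a \<in> ordinals U \<Longrightarrow> b \<in> ext U a \<Longrightarrow> c \<in> ext U b \<Longrightarrow> c \<in> ext U a"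
  unfolding ordinals_def transitive_def by blast

lemma On_mem: "a \<in> ordinals U \<Longrightarrow> b \<in> ext U a \<Longrightarrow> b \<in> ordinals U"
  unfolding ordinals_def transitive_def by blast

lemma On_induct:
  assumes "dprd U P" "\<And>a. a \<in> ordinals U \<Longrightarrow> (\<And>b. b \<in> ext U a \<Longrightarrow> P b) \<Longrightarrow> P a" "a \<in> ordinals U"
  shows "P a"
proof -
  have "dprd U (\<lambda>a. a \<in> ordinals U \<longrightarrow> P a)" by (intro df dprdD[OF assms(1)])
  from ext_induct[OF this] show ?thesis using assms(2,3) On_mem by metis
qed

text \<open>Double induction. If \<open>a\<close> and \<open>b\<close> were incomparable although
  each is comparable with all elements of the other, transitivity would give the inclusions in both
  directions, and extensionality would make them equal.\<close>

lemma On_linear: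
  assumes "a \<in> ordinals U" "b \<in> ordinals U"
  shows "a \<in> ext U b \<or> a = b \<or> b \<in> ext U a"
proof -
  define C where "C a b \<longleftrightarrow> a \<in> ext U b \<or> a = b \<or> b \<in> ext U a" for a b
  have "\<forall>b \<in> ordinals U. C a b"
  proof (rule On_induct[OF _ _ assms(1)])
    show "dprd U (\<lambda>a. \<forall>b \<in> ordinals U. C a b)" unfolding C_def by (intro df)
    fix a assume a: "a \<in> ordinals U" and IH: "\<And>a'. a' \<in> ext U a \<Longrightarrow> \<forall>b \<in> ordinals U. C a' b"
    show "\<forall>b \<in> ordinals U. C a b"
    proof
      fix b assume "b \<in> ordinals U"
      then show "C a b"
      proof (rule On_induct[rotated -1])
        show "dprd U (\<lambda>b. C a b)" unfolding C_def by (intro df)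
        fix b assume b: "b \<in> ordinals U" and IH': "\<And>b'. b' \<in> ext U b \<Longrightarrow> C a b'"
        show "C a b"
        proof (rule ccontr)
          assume n: "\<not> C a b"
          have "x \<in> ext U b" if "x \<in> ext U a" for x
            using IH[OF that] b n On_trans[OF a that] that unfolding C_def by blast
          moreover have "x \<in> ext U a" if "x \<in> ext U b" for x
            using IH'[OF that] n On_trans[OF b that] that unfolding C_def by blast
          ultimately have "ext U a = ext U b" by blast
          then show False using n unfolding C_def ext_eq_iff by simp
        qed
      qed
    qed
  qed
  then show ?thesis using assms(2) unfolding C_def by blast
qed

lemma On_subset_iff:
  assumes "a \<in> ordinals U" "b \<in> ordinals U"
  shows "ext U a \<subseteq> ext U b \<longleftrightarrow> a = b \<or> a \<in> ext U b"
  using On_linear[OF assms] On_trans[OF assms(2), of a] not_mem_self[of b] by blast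

lemma zero_On [simp]: "empty_set U \<in> ordinals U"
  unfolding ordinals_def transitive_def by simp

lemma succ_On [simp]: "a \<in> ordinals U \<Longrightarrow> succ_set U a \<in> ordinals U"
  unfolding ordinals_def transitive_def by auto

lemma On_I: "transitive U x \<Longrightarrow> ext U x \<subseteq> ordinals U \<Longrightarrow> x \<in> ordinals U"
  unfolding ordinals_def by blast

text \<open>The paradox of Burali-Forti: the set of all ordinals would be an ordinal and hence an
  element of itself.\<close>

lemma not_isset_On: "\<not> isset U (ordinals U)"
proof
  assume "isset U (ordinals U)"
  then obtain z where z: "ext U z = ordinals U" unfolding isset_def by blast
  then have "z \<in> ordinals U" using On_mem unfolding transitive_def by (intro On_I) (auto simp: transitive_def)
  then show False using z not_mem_self by blast
qed

lemma On_sup: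
  assumes "isset U A" "A \<subseteq> ordinals U"
  obtains a where "a \<in> ordinals U" "\<And>b. b \<in> A \<Longrightarrow> b \<in> ext U a"
proof -
  obtain z where z: "ext U z = A" using assms(1) unfolding isset_def by blast
  obtain s where s: "ext U s = (\<Union>y \<in> ext U z. ext U y)" using isset_Union_ext unfolding isset_def by blast
  have "transitive U s" unfolding transitive_def s z using assms(2) On_trans by blast
  then have s_On: "s \<in> ordinals U" using assms(2) On_mem by (intro On_I) (auto simp: s z)
  have "b \<in> ext U (succ_set U s)" if "b \<in> A" for b
    using On_subset_iff[of b s] that s z s_On assms(2) by auto
  then show thesis using that[of "succ_set U s"] s_On by simp
qed

lemma N_On: "n \<in> naturals U \<Longrightarrow> n \<in> ordinals U"
  unfolding naturals_def by blast

lemma zero_N [simp]: "empty_set U \<in> naturals U"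
  unfolding naturals_def by simp

lemma succ_N [simp]: "n \<in> naturals U \<Longrightarrow> succ_set U n \<in> naturals U"
  unfolding naturals_def by auto

lemma N_mem: "n \<in> naturals U \<Longrightarrow> m \<in> ext U n \<Longrightarrow> m \<in> naturals U"
  using On_mem On_trans unfolding naturals_def by blast

lemma N_cases:
  assumes "n \<in> naturals U"
  obtains "n = empty_set U" | k where "k \<in> naturals U" "n = succ_set U k"
proof -
  have "n = empty_set U \<or> (\<exists>k \<in> ordinals U. n = succ_set U k)"
    using assms unfolding naturals_def by blast
  moreover have "k \<in> naturals U" if "n = succ_set U k" for k
    using N_mem[OF assms, of k] that by simp
  ultimately show thesis using that by blast
qed

text \<open>Induction over the natural numbers of the model, which may be nonstandard; a successor
  is reached from its predecessor by induction on membership.\<close>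

lemma N_induct:
  assumes "n \<in> naturals U" "dprd U P" "P (empty_set U)"
    "\<And>n. n \<in> naturals U \<Longrightarrow> P n \<Longrightarrow> P (succ_set U n)"
  shows "P n"
proof -
  have d: "dprd U (\<lambda>n. n \<in> naturals U \<longrightarrow> P n)" by (intro df dprdD[OF assms(2)])
  have "n \<in> naturals U \<longrightarrow> P n"
  proof (rule ext_induct[OF d], rule impI)
    fix x assume IH: "\<And>y. y \<in> ext U x \<Longrightarrow> y \<in> naturals U \<longrightarrow> P y" and "x \<in> naturals U"
    from this(2) show "P x"
    proof (cases rule: N_cases)
      case (2 k)
      then show ?thesis using assms(4) IH[of k] by simp
    qed (use assms(3) in simp)
  qed
  then show ?thesis using assms(1) by blast
qed

lemma isset_N: "isset U (naturals U)"
proof -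
  obtain z where z: "\<exists>x \<in> ext U z. ext U x = {}"
    "\<forall>x \<in> ext U z. \<exists>y \<in> ext U z. ext U y = insert x (ext U x)"
    using infinity by blast
  have "n \<in> ext U z" if "n \<in> naturals U" for n
  proof (rule N_induct[OF that])
    show "dprd U (\<lambda>n. n \<in> ext U z)" by (intro df)
    show "empty_set U \<in> ext U z" using z(1) ext_eq_empty by auto
    fix n assume "n \<in> ext U z"
    then obtain y where y: "y \<in> ext U z" "ext U y = insert n (ext U n)" using z(2) by blast
    then have "ext U y = ext U (succ_set U n)" by simp
    then show "succ_set U n \<in> ext U z" using y(1) unfolding ext_eq_iff by simp
  qed
  then have "naturals U \<subseteq> ext U z" by blast
  moreover have "dprd U (\<lambda>x. x \<in> naturals U)" by (intro df)
  ultimately show ?thesis using isset_subset isset_ext by blast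
qed

section \<open>Equipollence\<close>

text \<open>With \<open>eqpE\<close>, this exchanges bijections that are sets of the model for
  definable HOL functions, which are easier to compose and to modify. Replacement makes a set of the
  graph.\<close>

lemma eqpI:
  assumes "isset U A" "dfun U h" "bij_betw h A B"
  shows "equipollent U A B"
proof -
  have *: "opair U x y \<in> ext U (lam A h) \<longleftrightarrow> x \<in> A \<and> y = h x" for x y
    using ext_lam[OF assms(1,2)] by auto
  show ?thesis unfolding equipollent_def
    by (rule exI[of _ "lam A h"]) (use assms(3) in \<open>auto simp: * bij_betw_def inj_on_def\<close>)
qed

lemma eqpE:
  assumes "equipollent U A B" "dprd U (\<lambda>x. x \<in> B)"
  obtains h where "dfun U h" "bij_betw h A B"
proof -
  obtain f where f: "\<forall>x \<in> A. \<exists>!y. y \<in> B \<and> opair U x y \<in> ext U f"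
    "\<forall>y \<in> B. \<exists>!x. x \<in> A \<and> opair U x y \<in> ext U f"
    using assms(1) unfolding equipollent_def by (elim exE conjE)
  define h where "h x = wl U (\<lambda>y. y \<in> B \<and> opair U x y \<in> ext U f)" for x
  have h: "h x \<in> B \<and> opair U x (h x) \<in> ext U f" if xA: "x \<in> A" for x
  proof -
    obtain y where y: "y \<in> B \<and> opair U x y \<in> ext U f"
      and u: "\<And>z. z \<in> B \<and> opair U x z \<in> ext U f \<Longrightarrow> z = y"
      using bspec[OF f(1) xA] by (elim ex1E) blast
    have "h x = y" unfolding h_def by (rule wl_eq) (rule y, rule u)
    then show ?thesis using y by blast
  qed
  have "dfun U h" unfolding h_def by (intro df dprdD[OF assms(2)])
  moreover have "bij_betw h A B"
  proof (rule bij_betw_imageI)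
    show "inj_on h A"
    proof (rule inj_onI)
      fix x y assume "x \<in> A" "y \<in> A" "h x = h y"
      then show "x = y" using bspec[OF f(2), of "h x"] h[of x] h[of y] by auto
    qed
    show "h ` A = B"
    proof
      show "h ` A \<subseteq> B" using h by blast
      show "B \<subseteq> h ` A"
      proof
        fix y assume y: "y \<in> B"
        then obtain x where x: "x \<in> A" "opair U x y \<in> ext U f" using bspec[OF f(2) y] by blast
        then have "h x = y" using bspec[OF f(1) x(1)] h[OF x(1)] y by blast
        then show "y \<in> h ` A" using x(1) by blast
      qed
    qed
  qed
  ultimately show thesis by (rule that)
qed

lemma eqp_sym:
  assumes "equipollent U A B" "isset U A" "isset U B"
  shows "equipollent U B A"
proof -
  obtain h where h: "dfun U h" "bij_betw h A B" using eqpE[OF assms(1) isset_dprd[OF assms(3)]] .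
  define g where "g y = wl U (\<lambda>x. x \<in> A \<and> h x = y)" for y
  have g: "g (h x) = x" if "x \<in> A" for x
    unfolding g_def by (rule wl_eq) (use that h(2) in \<open>auto simp: bij_betw_def inj_on_def\<close>)
  have "dfun U g" unfolding g_def by (intro df dprdD[OF isset_dprd[OF assms(2)]] dfunD[OF h(1)])
  moreover have "bij_betw g B A"
    using h(2) g by (intro bij_betw_byWitness[where f' = h]) (auto simp: bij_betw_def)
  ultimately show ?thesis by (rule eqpI[OF assms(3)])
qed

lemma eqp_trans:
  assumes "equipollent U A B" "equipollent U B C" "isset U A" "isset U B" "isset U C"
  shows "equipollent U A C"
proof -
  obtain h where h: "dfun U h" "bij_betw h A B" using eqpE[OF assms(1) isset_dprd[OF assms(4)]] .
  obtain g where g: "dfun U g" "bij_betw g B C" using eqpE[OF assms(2) isset_dprd[OF assms(5)]] .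
  have "dfun U (\<lambda>x. g (h x))" by (intro dfunD[OF g(1)] h(1))
  moreover have "bij_betw (\<lambda>x. g (h x)) A C" using bij_betw_trans[OF h(2) g(2)] by (simp add: comp_def)
  ultimately show ?thesis by (rule eqpI[OF assms(3)])
qed

lemma df_equipollent [df]:
  assumes "dfn U (\<lambda>e. \<exists>f.
     (\<forall>x \<in> A e. \<exists>!y. y \<in> B e \<and> opair U x y \<in> ext U f) \<and>
     (\<forall>y \<in> B e. \<exists>!x. x \<in> A e \<and> opair U x y \<in> ext U f))"
  shows "dfn U (\<lambda>e. equipollent U (A e) (B e))"
  unfolding equipollent_def by (rule assms)

lemma pigeonhole:
  assumes "n \<in> naturals U" "m \<in> naturals U" "equipollent U (ext U n) (ext U m)"
  shows "n = m"
proof -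
  have "\<forall>m \<in> naturals U. equipollent U (ext U n) (ext U m) \<longrightarrow> n = m"
  proof (rule N_induct[OF assms(1)])
    show "dprd U (\<lambda>n. \<forall>m \<in> naturals U. equipollent U (ext U n) (ext U m) \<longrightarrow> n = m)"
      by (intro df)
    show "\<forall>m \<in> naturals U. equipollent U (ext U (empty_set U)) (ext U m) \<longrightarrow> empty_set U = m"
      unfolding equipollent_def using ext_eq_empty by fastforce
    fix k assume k: "k \<in> naturals U" and IH: "\<forall>m \<in> naturals U. equipollent U (ext U k) (ext U m) \<longrightarrow> k = m"
    show "\<forall>m \<in> naturals U. equipollent U (ext U (succ_set U k)) (ext U m) \<longrightarrow> succ_set U k = m"
    proof (intro ballI impI)
      fix m assume m: "m \<in> naturals U" and "equipollent U (ext U (succ_set U k)) (ext U m)"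
      then obtain h where h: "dfun U h" "bij_betw h (insert k (ext U k)) (ext U m)"
        using eqpE[OF _ isset_dprd[OF isset_ext]] ext_succ by metis
      from m show "succ_set U k = m"
      proof (cases rule: N_cases)
        case 1
        then show ?thesis using h(2) by (simp add: bij_betw_def)
      next
        case (2 l)
        \<comment> \<open>To remove \<open>k\<close> from the domain and \<open>l\<close> from the
          range, the argument that was sent to \<open>l\<close> is redirected to \<open>h k\<close>,
          the value that becomes free.\<close>
        define g where "g x = (if h x = l then h k else h x)" for x
        have inj: "inj_on h (insert k (ext U k))" and im: "h ` insert k (ext U k) = insert l (ext U l)"
          using h(2) 2 by (auto simp: bij_betw_def)
        have dg: "dfun U g" unfolding g_def by (intro df dfunD[OF h(1)])
        have "bij_betw g (ext U k) (ext U l)"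
        proof (rule bij_betw_imageI)
          have "h x \<noteq> h k" if "x \<in> ext U k" for x
            using inj that not_mem_self[of k] unfolding inj_on_def by blast
          then show "inj_on g (ext U k)" using inj unfolding inj_on_def g_def by auto
          show "g ` ext U k = ext U l"
          proof
            show "g ` ext U k \<subseteq> ext U l"
            proof (rule image_subsetI)
              fix x assume x: "x \<in> ext U k"
              have "h x \<in> insert l (ext U l)" "h k \<in> insert l (ext U l)" using im x by blast+
              then show "g x \<in> ext U l"
                using \<open>\<And>x. x \<in> ext U k \<Longrightarrow> h x \<noteq> h k\<close>[OF x] unfolding g_def by auto
            qed
            show "ext U l \<subseteq> g ` ext U k"
            proof
              fix y assume y: "y \<in> ext U l"
              then have "y \<in> h ` insert k (ext U k)" "l \<in> h ` insert k (ext U k)" unfolding im by simp_all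
              then obtain x x0 where x: "x \<in> insert k (ext U k)" "h x = y"
                and x0: "x0 \<in> insert k (ext U k)" "h x0 = l" by (elim imageE) simp
              have "y \<noteq> l" using y by auto
              show "y \<in> g ` ext U k"
              proof (cases "x = k")
                case True
                then have "x0 \<in> ext U k" "g x0 = y" using x x0 \<open>y \<noteq> l\<close> by (auto simp: g_def)
                then show ?thesis by blast
              next
                case False
                then have "x \<in> ext U k" "g x = y" using x \<open>y \<noteq> l\<close> by (auto simp: g_def)
                then show ?thesis by blast
              qed
            qed
          qed
        qed
        from eqpI[OF isset_ext dg this] show ?thesis using IH 2 by simp
      qed
    qed
  qed
  then show ?thesis using assms by blast
qed

section \<open>Addition of natural numbers\<close>

definition dsum :: "'v \<Rightarrow> 'v \<Rightarrow> 'v set" where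
  "dsum m n = class_prod U {empty_set U} (ext U m) \<union> class_prod U {succ_set U (empty_set U)} (ext U n)"

text \<open>The counterpart of \<open>nat_add\<close> built with \<open>wl\<close>, hence definable
  for all arguments. The laws of arithmetic are proved for it by internal induction, and
  \<open>nat_add_eq\<close> connects the two.\<close>

definition nadd :: "'v \<Rightarrow> 'v \<Rightarrow> 'v" (infixl "\<uplus>" 65) where
  "m \<uplus> n = wl U (\<lambda>k. k \<in> naturals U \<and> equipollent U (ext U k) (dsum m n))"

lemma df_nadd [df]: "dt U t \<Longrightarrow> dt U u \<Longrightarrow> dt U (\<lambda>e. t e \<uplus> u e)"
  by (rule dt_subst2[where f = nadd]) (unfold nadd_def dsum_def, intro df)

lemma isset_dsum [simp]: "isset U (dsum m n)"
  unfolding dsum_def by (intro isset_Un isset_class_prod) simp_all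

lemma nadd_eqI:
  assumes "k \<in> naturals U" "equipollent U (ext U k) (dsum m n)"
  shows "m \<uplus> n = k" "nat_add U m n = k"
proof -
  have u: "l = k" if "l \<in> naturals U \<and> equipollent U (ext U l) (dsum m n)" for l
  proof -
    have "equipollent U (ext U l) (ext U k)"
      using that assms eqp_trans eqp_sym isset_dsum isset_ext by metis
    then show ?thesis using pigeonhole that assms(1) by blast
  qed
  show "m \<uplus> n = k" unfolding nadd_def by (rule wl_eq) (use assms u in blast)+
  show "nat_add U m n = k"
    unfolding nat_add_def dsum_def[symmetric] by (rule the_equality) (use assms u in blast)+
qed

lemma eqp_dsum_zero: "equipollent U (ext U m) (dsum m (empty_set U))"
proof (rule eqpI)
  show "dfun U (\<lambda>x. opair U (empty_set U) x)" by (intro df)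
  show "bij_betw (\<lambda>x. opair U (empty_set U) x) (ext U m) (dsum m (empty_set U))"
    unfolding dsum_def class_prod_def bij_betw_def inj_on_def by auto
qed simp

lemma eqp_dsum_succ:
  assumes "equipollent U (ext U k) (dsum m n)"
  shows "equipollent U (ext U (succ_set U k)) (dsum m (succ_set U n))"
proof -
  obtain h where h: "dfun U h" "bij_betw h (ext U k) (dsum m n)"
    using eqpE[OF assms isset_dprd[OF isset_dsum]] .
  let ?c = "opair U (succ_set U (empty_set U)) n"
  have c: "?c \<notin> dsum m n" "dsum m (succ_set U n) = insert ?c (dsum m n)"
    unfolding dsum_def by (auto simp: class_prod_def)
  have "dfun U (\<lambda>x. if x = k then ?c else h x)" by (intro df dfunD[OF h(1)])
  moreover have "bij_betw (\<lambda>x. if x = k then ?c else h x) (ext U (succ_set U k)) (dsum m (succ_set U n))"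
  proof -
    have "bij_betw (\<lambda>x. if x = k then ?c else h x) (ext U k) (dsum m n)"
      by (rule bij_betw_cong[THEN iffD1, OF _ h(2)]) auto
    then show ?thesis using c notIn_Un_bij_betw[of k "ext U k" "\<lambda>x. if x = k then ?c else h x" "dsum m n"]
      by simp
  qed
  ultimately show ?thesis by (rule eqpI[OF isset_ext])
qed

lemma ex_nadd:
  assumes "m \<in> naturals U" "n \<in> naturals U"
  shows "\<exists>k. k \<in> naturals U \<and> equipollent U (ext U k) (dsum m n)"
proof (rule N_induct[OF assms(2)])
  show "dprd U (\<lambda>n. \<exists>k. k \<in> naturals U \<and> equipollent U (ext U k) (dsum m n))"
    unfolding dsum_def by (intro df)
qed (use eqp_dsum_zero eqp_dsum_succ assms(1) succ_N in blast)+

lemma nadd_N [simp]: "m \<in> naturals U \<Longrightarrow> n \<in> naturals U \<Longrightarrow> m \<uplus> n \<in> naturals U"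
  using ex_nadd nadd_eqI(1) by metis

lemma eqp_nadd: "m \<in> naturals U \<Longrightarrow> n \<in> naturals U \<Longrightarrow> equipollent U (ext U (m \<uplus> n)) (dsum m n)"
  using ex_nadd nadd_eqI(1) by metis

lemma nat_add_eq: "m \<in> naturals U \<Longrightarrow> n \<in> naturals U \<Longrightarrow> nat_add U m n = m \<uplus> n"
  using eqp_nadd nadd_eqI(2) nadd_N by metis

lemma nadd_0 [simp]: "m \<in> naturals U \<Longrightarrow> m \<uplus> empty_set U = m"
  using nadd_eqI(1) eqp_dsum_zero by blast

lemma nadd_S [simp]:
  "m \<in> naturals U \<Longrightarrow> n \<in> naturals U \<Longrightarrow> m \<uplus> succ_set U n = succ_set U (m \<uplus> n)"
  using nadd_eqI(1) eqp_dsum_succ[OF eqp_nadd] by simp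

lemma nadd_0_left [simp]:
  assumes "n \<in> naturals U" shows "empty_set U \<uplus> n = n"
  by (rule N_induct[OF assms]) (intro df, simp_all)

lemma nadd_S_left [simp]:
  assumes "m \<in> naturals U" "n \<in> naturals U" shows "succ_set U m \<uplus> n = succ_set U (m \<uplus> n)"
  by (rule N_induct[OF assms(2)]) (intro df, simp_all add: assms)

lemma nadd_commute:
  assumes "m \<in> naturals U" "n \<in> naturals U" shows "m \<uplus> n = n \<uplus> m"
  by (rule N_induct[OF assms(2)]) (intro df, simp_all add: assms)

lemma nadd_assoc:
  assumes "m \<in> naturals U" "n \<in> naturals U" "k \<in> naturals U" shows "(m \<uplus> n) \<uplus> k = m \<uplus> (n \<uplus> k)"
  by (rule N_induct[OF assms(3)]) (intro df, simp_all add: assms)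

lemma nadd_left_commute:
  assumes "m \<in> naturals U" "n \<in> naturals U" "k \<in> naturals U" shows "m \<uplus> (n \<uplus> k) = n \<uplus> (m \<uplus> k)"
  using assms nadd_assoc nadd_commute by metis

lemmas nadd_ac = nadd_assoc nadd_commute nadd_left_commute

lemma nadd_cancel [simp]:
  assumes "m \<in> naturals U" "n \<in> naturals U" "k \<in> naturals U"
  shows "m \<uplus> k = n \<uplus> k \<longleftrightarrow> m = n"
  by (rule N_induct[OF assms(3)]) (intro df, simp_all add: assms)

lemma nadd_cancel_left [simp]:
  assumes "m \<in> naturals U" "n \<in> naturals U" "k \<in> naturals U"
  shows "k \<uplus> m = k \<uplus> n \<longleftrightarrow> m = n"
  using nadd_cancel[OF assms] nadd_commute assms by metis

lemma nadd_eq_0 [simp]: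
  assumes "m \<in> naturals U" "n \<in> naturals U"
  shows "m \<uplus> n = empty_set U \<longleftrightarrow> m = empty_set U \<and> n = empty_set U"
  using assms(2) by (rule N_cases) (use assms(1) in auto)

lemma nle_iff:
  assumes "m \<in> naturals U" "n \<in> naturals U"
  shows "ext U m \<subseteq> ext U n \<longleftrightarrow> (\<exists>k \<in> naturals U. n = m \<uplus> k)"
proof
  assume "ext U m \<subseteq> ext U n"
  then show "\<exists>k \<in> naturals U. n = m \<uplus> k"
  proof (rule N_induct[OF assms(2), THEN mp, rotated -1])
    show "dprd U (\<lambda>n. ext U m \<subseteq> ext U n \<longrightarrow> (\<exists>k \<in> naturals U. n = m \<uplus> k))" by (intro df)
    show "ext U m \<subseteq> ext U (empty_set U) \<longrightarrow> (\<exists>k \<in> naturals U. empty_set U = m \<uplus> k)"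
      using ext_eq_empty[of m] by (auto intro!: bexI[of _ "empty_set U"])
    fix n assume n: "n \<in> naturals U" and IH: "ext U m \<subseteq> ext U n \<longrightarrow> (\<exists>k \<in> naturals U. n = m \<uplus> k)"
    show "ext U m \<subseteq> ext U (succ_set U n) \<longrightarrow> (\<exists>k \<in> naturals U. succ_set U n = m \<uplus> k)"
    proof
      assume "ext U m \<subseteq> ext U (succ_set U n)"
      then have "m = succ_set U n \<or> ext U m \<subseteq> ext U n"
        using On_subset_iff[of m "succ_set U n"] On_subset_iff[of m n] assms(1) n N_On by auto
      then show "\<exists>k \<in> naturals U. succ_set U n = m \<uplus> k"
      proof
        assume "m = succ_set U n"
        then have "succ_set U n = m \<uplus> empty_set U" using n by simp
        then show ?thesis using zero_N by blast
      next
        assume "ext U m \<subseteq> ext U n"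
        then obtain k where "k \<in> naturals U" "n = m \<uplus> k" using IH by blast
        then show ?thesis using nadd_S[OF assms(1)] succ_N by metis
      qed
    qed
  qed
next
  assume "\<exists>k \<in> naturals U. n = m \<uplus> k"
  then obtain k where k: "k \<in> naturals U" "n = m \<uplus> k" by blast
  have "ext U m \<subseteq> ext U (m \<uplus> k)"
    by (rule N_induct[OF k(1)]) (intro df, auto simp: assms)
  then show "ext U m \<subseteq> ext U n" using k by simp
qed

lemma nle_linear:
  assumes "m \<in> naturals U" "n \<in> naturals U"
  shows "ext U m \<subseteq> ext U n \<or> ext U n \<subseteq> ext U m"
  using On_linear[of m n] On_subset_iff[of m n] On_subset_iff[of n m] assms N_On by blast

lemma nle_cancel:
  assumes "m \<in> naturals U" "n \<in> naturals U" "k \<in> naturals U"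
  shows "ext U (m \<uplus> k) \<subseteq> ext U (n \<uplus> k) \<longleftrightarrow> ext U m \<subseteq> ext U n"
proof -
  have "n \<uplus> k = (m \<uplus> k) \<uplus> j \<longleftrightarrow> n = m \<uplus> j" if "j \<in> naturals U" for j
  proof -
    have "(m \<uplus> k) \<uplus> j = (m \<uplus> j) \<uplus> k" using assms that by (simp add: nadd_ac)
    then show ?thesis using assms that by simp
  qed
  then show ?thesis using assms by (auto simp: nle_iff)
qed

section \<open>Integers\<close>

lemma df_ints [df]: "dt U t \<Longrightarrow> dfn U (\<lambda>e. t e \<in> ints U)"
  by (rule dfn_subst1[where P = "\<lambda>x. x \<in> ints U"]) (unfold ints_def, intro df)

text \<open>The reduced pair that stands for \<open>m - n\<close>, for arbitrary \<open>m\<close>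
  and \<open>n\<close>. Calculations use \<open>zi\<close>, whose equality is cross addition by
  \<open>zi_eq\<close>, so that reducedness need not be tracked.\<close>

definition zi :: "'v \<Rightarrow> 'v \<Rightarrow> 'v" where
  "zi m n = wl U (\<lambda>u. u \<in> ints U \<and> (\<exists>p q. u = opair U p q \<and> m \<uplus> q = n \<uplus> p))"

text \<open>Adding the two cross equations and cancelling leaves
  \<open>q \<uplus> p' = p \<uplus> q'\<close>, which for reduced pairs forces equality.\<close>

lemma zi_unique:
  assumes "m \<in> naturals U" "n \<in> naturals U" "p \<in> naturals U" "q \<in> naturals U" "p' \<in> naturals U" "q' \<in> naturals U"
    and "p = empty_set U \<or> q = empty_set U" "p' = empty_set U \<or> q' = empty_set U"
    and "m \<uplus> q = n \<uplus> p" "m \<uplus> q' = n \<uplus> p'"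
  shows "p = p' \<and> q = q'"
proof -
  have "(m \<uplus> n) \<uplus> (q \<uplus> p') = (m \<uplus> q) \<uplus> (n \<uplus> p')" using assms(1-6) by (simp add: nadd_ac)
  also have "\<dots> = (n \<uplus> p) \<uplus> (m \<uplus> q')" using assms(9,10) by simp
  also have "\<dots> = (m \<uplus> n) \<uplus> (p \<uplus> q')" using assms(1-6) by (simp add: nadd_ac)
  finally have eq: "q \<uplus> p' = p \<uplus> q'" using assms(1-6) by simp
  from assms(7,8) show ?thesis
    using eq eq[symmetric] assms(3-6) by (elim disjE) simp_all
qed

lemma ex_zi:
  assumes "m \<in> naturals U" "n \<in> naturals U"
  obtains p q where "p \<in> naturals U" "q \<in> naturals U" "p = empty_set U \<or> q = empty_set U" "m \<uplus> q = n \<uplus> p"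
proof -
  consider "ext U m \<subseteq> ext U n" | "ext U n \<subseteq> ext U m" using nle_linear[OF assms] by blast
  then show thesis
  proof cases
    case 1
    then obtain k where "k \<in> naturals U" "n = m \<uplus> k" using nle_iff assms by blast
    then show thesis using that[of "empty_set U" k] assms by simp
  next
    case 2
    then obtain k where "k \<in> naturals U" "m = n \<uplus> k" using nle_iff assms by blast
    then show thesis using that[of k "empty_set U"] assms by simp
  qed
qed

lemma opair_ints: "opair U p q \<in> ints U \<longleftrightarrow>
    p \<in> naturals U \<and> q \<in> naturals U \<and> (p = empty_set U \<or> q = empty_set U)"
  unfolding ints_def by auto

lemma zi_props:
  assumes "m \<in> naturals U" "n \<in> naturals U"
  obtains p q where "zi m n = opair U p q" "opair U p q \<in> ints U" "p \<in> naturals U" "q \<in> naturals U"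
    "p = empty_set U \<or> q = empty_set U" "m \<uplus> q = n \<uplus> p"
    "\<forall>p' q'. opair U p' q' \<in> ints U \<longrightarrow> m \<uplus> q' = n \<uplus> p' \<longrightarrow> p' = p \<and> q' = q"
proof -
  obtain p q where pq: "p \<in> naturals U" "q \<in> naturals U" "p = empty_set U \<or> q = empty_set U" "m \<uplus> q = n \<uplus> p"
    using ex_zi[OF assms] .
  have u: "\<forall>p' q'. opair U p' q' \<in> ints U \<longrightarrow> m \<uplus> q' = n \<uplus> p' \<longrightarrow> p' = p \<and> q' = q"
    using zi_unique[OF assms _ _ pq(1,2) _ pq(3) _ pq(4)] unfolding opair_ints by blast
  have "zi m n = opair U p q"
    unfolding zi_def
  proof (rule wl_eq)
    show "opair U p q \<in> ints U \<and> (\<exists>p' q'. opair U p q = opair U p' q' \<and> m \<uplus> q' = n \<uplus> p')"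
      using pq by (auto simp: opair_ints)
    fix y assume "y \<in> ints U \<and> (\<exists>p' q'. y = opair U p' q' \<and> m \<uplus> q' = n \<uplus> p')"
    then obtain p' q' where "y = opair U p' q'" "opair U p' q' \<in> ints U" "m \<uplus> q' = n \<uplus> p'" by auto
    then show "y = opair U p q" using u[rule_format, of p' q'] by simp
  qed
  moreover have "opair U p q \<in> ints U" using pq by (simp add: opair_ints)
  ultimately show thesis using pq u by (rule that)
qed

lemma zi_props':
  assumes "m \<in> naturals U" "n \<in> naturals U"
  obtains p q where "zi m n = opair U p q" "opair U p q \<in> ints U" "p \<in> naturals U" "q \<in> naturals U" "m \<uplus> q = n \<uplus> p"
  by (rule zi_props[OF assms]) (rule that)

lemma zi_in [simp]: "m \<in> naturals U \<Longrightarrow> n \<in> naturals U \<Longrightarrow> zi m n \<in> ints U"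
  by (rule zi_props'[of m n]) simp_all

lemma zi_opair:
  assumes "opair U m n \<in> ints U"
  shows "zi m n = opair U m n"
proof -
  have mn: "m \<in> naturals U" "n \<in> naturals U" using assms unfolding opair_ints by auto
  obtain p q where pq: "zi m n = opair U p q" "opair U p q \<in> ints U" "p \<in> naturals U" "q \<in> naturals U"
    "p = empty_set U \<or> q = empty_set U" "m \<uplus> q = n \<uplus> p"
    "\<forall>p' q'. opair U p' q' \<in> ints U \<longrightarrow> m \<uplus> q' = n \<uplus> p' \<longrightarrow> p' = p \<and> q' = q"
    using zi_props[OF mn] .
  from pq(7)[rule_format, OF assms nadd_commute[OF mn]] show ?thesis unfolding pq(1) by simp
qed

lemma ints_opairE:
  assumes "z \<in> ints U"
  obtains m n where "z = opair U m n" "m \<in> naturals U" "n \<in> naturals U" "m = empty_set U \<or> n = empty_set U" "z = zi m n"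
proof -
  obtain m n where z: "z = opair U m n" "m \<in> naturals U" "n \<in> naturals U" "m = empty_set U \<or> n = empty_set U"
    using assms unfolding ints_def by blast
  moreover have "z = zi m n" unfolding z(1) by (rule zi_opair[symmetric]) (use assms z(1) in simp)
  ultimately show thesis by (rule that)
qed

lemma ints_cases:
  assumes "z \<in> ints U"
  obtains m n where "m \<in> naturals U" "n \<in> naturals U" "z = zi m n"
  using assms by (rule ints_opairE) (rule that)

lemma zi_eq:
  assumes "m \<in> naturals U" "n \<in> naturals U" "m' \<in> naturals U" "n' \<in> naturals U"
  shows "zi m n = zi m' n' \<longleftrightarrow> m \<uplus> n' = m' \<uplus> n"
proof -
  obtain p q where pq: "zi m n = opair U p q" "opair U p q \<in> ints U" "p \<in> naturals U" "q \<in> naturals U"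
    "p = empty_set U \<or> q = empty_set U" "m \<uplus> q = n \<uplus> p"
    "\<forall>p' q'. opair U p' q' \<in> ints U \<longrightarrow> m \<uplus> q' = n \<uplus> p' \<longrightarrow> p' = p \<and> q' = q"
    using zi_props[OF assms(1,2)] .
  obtain p' q' where p'q': "zi m' n' = opair U p' q'"  "opair U p' q' \<in> ints U" "p' \<in> naturals U" "q' \<in> naturals U"
    "p' = empty_set U \<or> q' = empty_set U" "m' \<uplus> q' = n' \<uplus> p'"
    "\<forall>p q. opair U p q \<in> ints U \<longrightarrow> m' \<uplus> q = n' \<uplus> p \<longrightarrow> p = p' \<and> q = q'"
    using zi_props[OF assms(3,4)] .
  show ?thesis
  proof
    assume "zi m n = zi m' n'"
    then have eq: "p' = p" "q' = q" using pq(1) p'q'(1) by simp_all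
    have "(m \<uplus> n') \<uplus> (p \<uplus> q) = (m \<uplus> q) \<uplus> (n' \<uplus> p)" using assms pq(3,4) by (simp add: nadd_ac)
    also have "\<dots> = (n \<uplus> p) \<uplus> (m' \<uplus> q)" using pq(6) p'q'(6) eq by simp
    also have "\<dots> = (m' \<uplus> n) \<uplus> (p \<uplus> q)" using assms pq(3,4) by (simp add: nadd_ac)
    finally show "m \<uplus> n' = m' \<uplus> n" using assms pq(3,4) by simp
  next
    assume eq: "m \<uplus> n' = m' \<uplus> n"
    have "(m' \<uplus> q) \<uplus> (m \<uplus> n) = (m \<uplus> q) \<uplus> (m' \<uplus> n)" using assms pq(3,4) by (simp add: nadd_ac)
    also have "\<dots> = (n \<uplus> p) \<uplus> (m \<uplus> n')" using eq pq(6) by simp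
    also have "\<dots> = (n' \<uplus> p) \<uplus> (m \<uplus> n)" using assms pq(3,4) by (simp add: nadd_ac)
    finally have "m' \<uplus> q = n' \<uplus> p" using assms pq(3,4) by simp
    then have "p = p' \<and> q = q'" by (rule p'q'(7)[rule_format, OF pq(2)])
    then show "zi m n = zi m' n'" unfolding pq(1) p'q'(1) by simp
  qed
qed

definition iadd :: "'v \<Rightarrow> 'v \<Rightarrow> 'v" where
  "iadd z w = wl U (\<lambda>u. \<exists>m n m' n'. m \<in> naturals U \<and> n \<in> naturals U \<and> m' \<in> naturals U \<and> n' \<in> naturals U \<and>
     z = zi m n \<and> w = zi m' n' \<and> u = zi (m \<uplus> m') (n \<uplus> n'))"

lemma df_zi [df]: "dt U t \<Longrightarrow> dt U u \<Longrightarrow> dt U (\<lambda>e. zi (t e) (u e))"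
  by (rule dt_subst2[where f = zi]) (unfold zi_def, intro df)

lemma df_iadd [df]: "dt U t \<Longrightarrow> dt U u \<Longrightarrow> dt U (\<lambda>e. iadd (t e) (u e))"
  by (rule dt_subst2[where f = iadd]) (unfold iadd_def, intro df)

lemma zi_cong:
  assumes "m \<in> naturals U" "n \<in> naturals U" "m' \<in> naturals U" "n' \<in> naturals U"
    "a \<in> naturals U" "b \<in> naturals U" "a' \<in> naturals U" "b' \<in> naturals U"
    "zi m n = zi a b" "zi m' n' = zi a' b'"
  shows "zi (m \<uplus> m') (n \<uplus> n') = zi (a \<uplus> a') (b \<uplus> b')"
proof -
  have e: "m \<uplus> b = a \<uplus> n" "m' \<uplus> b' = a' \<uplus> n'" using assms zi_eq by blast+
  have "(m \<uplus> m') \<uplus> (b \<uplus> b') = (m \<uplus> b) \<uplus> (m' \<uplus> b')" using assms(1-8) by (simp add: nadd_ac)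
  also have "\<dots> = (a \<uplus> n) \<uplus> (a' \<uplus> n')" using e by simp
  also have "\<dots> = (a \<uplus> a') \<uplus> (n \<uplus> n')" using assms(1-8) by (simp add: nadd_ac)
  finally show ?thesis using assms(1-8) by (simp add: zi_eq)
qed

lemma iadd_zi [simp]:
  assumes "m \<in> naturals U" "n \<in> naturals U" "m' \<in> naturals U" "n' \<in> naturals U"
  shows "iadd (zi m n) (zi m' n') = zi (m \<uplus> m') (n \<uplus> n')"
  unfolding iadd_def
proof (rule wl_eq)
  show "\<exists>a b a' b'. a \<in> naturals U \<and> b \<in> naturals U \<and> a' \<in> naturals U \<and> b' \<in> naturals U \<and>
     zi m n = zi a b \<and> zi m' n' = zi a' b' \<and> zi (m \<uplus> m') (n \<uplus> n') = zi (a \<uplus> a') (b \<uplus> b')"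
    by (intro exI conjI, (rule assms)+, (rule refl)+)
  fix y assume "\<exists>a b a' b'. a \<in> naturals U \<and> b \<in> naturals U \<and> a' \<in> naturals U \<and> b' \<in> naturals U \<and>
     zi m n = zi a b \<and> zi m' n' = zi a' b' \<and> y = zi (a \<uplus> a') (b \<uplus> b')"
  then show "y = zi (m \<uplus> m') (n \<uplus> n')"
    by (elim exE conjE) (simp only:, rule zi_cong[symmetric], (rule assms | assumption)+)
qed

lemma iadd_in [simp]: "z \<in> ints U \<Longrightarrow> w \<in> ints U \<Longrightarrow> iadd z w \<in> ints U"
  by (elim ints_cases) simp

lemma int_add_eq:
  assumes "z \<in> ints U" "w \<in> ints U"
  shows "int_add U z w = iadd z w"
proof -
  obtain m n where z: "z = opair U m n" "m \<in> naturals U" "n \<in> naturals U" "m = empty_set U \<or> n = empty_set U" "z = zi m n"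
    using assms(1) by (rule ints_opairE)
  obtain m' n' where w: "w = opair U m' n'" "m' \<in> naturals U" "n' \<in> naturals U" "m' = empty_set U \<or> n' = empty_set U" "w = zi m' n'"
    using assms(2) by (rule ints_opairE)
  have eq: "iadd z w = zi (m \<uplus> m') (n \<uplus> n')" unfolding z(5) w(5) using z(2,3) w(2,3) by (rule iadd_zi)
  have mm: "m \<uplus> m' \<in> naturals U" "n \<uplus> n' \<in> naturals U" using z(2,3) w(2,3) by simp_all
  obtain p q where pq: "zi (m \<uplus> m') (n \<uplus> n') = opair U p q" "opair U p q \<in> ints U" "p \<in> naturals U" "q \<in> naturals U"
    "p = empty_set U \<or> q = empty_set U"
    "(m \<uplus> m') \<uplus> q = (n \<uplus> n') \<uplus> p"
    "\<forall>p' q'. opair U p' q' \<in> ints U \<longrightarrow> (m \<uplus> m') \<uplus> q' = (n \<uplus> n') \<uplus> p' \<longrightarrow> p' = p \<and> q' = q"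
    using zi_props[OF mm] .
  show ?thesis unfolding int_add_def eq pq(1)
  proof (rule the_equality)
    show "opair U p q \<in> ints U \<and> (\<exists>m n m' n' r s. z = opair U m n \<and> w = opair U m' n' \<and> opair U p q = opair U r s \<and>
        nat_add U (nat_add U m m') s = nat_add U (nat_add U n n') r)"
      by (intro conjI exI, rule pq(2), rule z(1), rule w(1), rule refl)
         (simp add: nat_add_eq z(2,3) w(2,3) mm pq(3,4,6))
    fix u assume "u \<in> ints U \<and> (\<exists>m n m' n' p q. z = opair U m n \<and> w = opair U m' n' \<and> u = opair U p q \<and>
        nat_add U (nat_add U m m') q = nat_add U (nat_add U n n') p)"
    then obtain p' q' where "opair U p' q' \<in> ints U" "u = opair U p' q'" 
      "nat_add U (nat_add U m m') q' = nat_add U (nat_add U n n') p'"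
      using z(1) w(1) by auto
    moreover from this(1) have "p' \<in> naturals U" "q' \<in> naturals U" by (simp_all add: opair_ints)
    ultimately show "u = opair U p q" using pq(7)[rule_format, of p' q'] z(2,3) w(2,3) mm by (simp add: nat_add_eq)
  qed
qed

lemma int_le_zi:
  assumes "m \<in> naturals U" "n \<in> naturals U" "m' \<in> naturals U" "n' \<in> naturals U"
  shows "int_le U (zi m n) (zi m' n') \<longleftrightarrow> ext U (m \<uplus> n') \<subseteq> ext U (m' \<uplus> n)"
proof -
  obtain p q where pq: "zi m n = opair U p q" "opair U p q \<in> ints U" "p \<in> naturals U" "q \<in> naturals U" "m \<uplus> q = n \<uplus> p"
    using zi_props'[OF assms(1,2)] .
  obtain p' q' where p'q': "zi m' n' = opair U p' q'" "opair U p' q' \<in> ints U" "p' \<in> naturals U" "q' \<in> naturals U" "m' \<uplus> q' = n' \<uplus> p'"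
    using zi_props'[OF assms(3,4)] .
  have "int_le U (zi m n) (zi m' n') \<longleftrightarrow> ext U (p \<uplus> q') \<subseteq> ext U (p' \<uplus> q)"
    unfolding int_le_def pq(1) p'q'(1) using pq(3,4) p'q'(3,4) by (auto simp: nat_add_eq)
  also have "\<dots> \<longleftrightarrow> ext U ((p \<uplus> q') \<uplus> (n \<uplus> n')) \<subseteq> ext U ((p' \<uplus> q) \<uplus> (n \<uplus> n'))"
    using nle_cancel assms pq(3,4) p'q'(3,4) by simp
  also have "(p \<uplus> q') \<uplus> (n \<uplus> n') = (n \<uplus> p) \<uplus> (q' \<uplus> n')" using assms pq(3,4) p'q'(3,4) by (simp add: nadd_ac)
  also have "\<dots> = (m \<uplus> n') \<uplus> (q \<uplus> q')" using assms pq(3,4) p'q'(3,4) by (simp add: pq(5)[symmetric]) (simp add: nadd_ac)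
  also have "(p' \<uplus> q) \<uplus> (n \<uplus> n') = (n' \<uplus> p') \<uplus> (q \<uplus> n)" using assms pq(3,4) p'q'(3,4) by (simp add: nadd_ac)
  also have "\<dots> = (m' \<uplus> n) \<uplus> (q \<uplus> q')" using assms pq(3,4) p'q'(3,4) by (simp add: p'q'(5)[symmetric]) (simp add: nadd_ac)
  finally show ?thesis using nle_cancel assms pq(3,4) p'q'(3,4) by simp
qed

lemma iadd_commute: "z \<in> ints U \<Longrightarrow> w \<in> ints U \<Longrightarrow> iadd z w = iadd w z"
  by (elim ints_cases) (simp add: nadd_commute)

lemma iadd_assoc: "z \<in> ints U \<Longrightarrow> w \<in> ints U \<Longrightarrow> v \<in> ints U \<Longrightarrow> iadd (iadd z w) v = iadd z (iadd w v)"
  by (elim ints_cases) (simp add: nadd_assoc)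

abbreviation "izero \<equiv> int_of_nat U (empty_set U)"
abbreviation "ione \<equiv> int_of_nat U (succ_set U (empty_set U))"

lemma int_of_nat_zi: "m \<in> naturals U \<Longrightarrow> int_of_nat U m = zi m (empty_set U)"
  unfolding int_of_nat_def by (simp add: zi_opair opair_ints)

lemma int_of_nat_in [simp]: "m \<in> naturals U \<Longrightarrow> int_of_nat U m \<in> ints U"
  by (simp add: int_of_nat_zi)

lemma iadd_0: "z \<in> ints U \<Longrightarrow> iadd izero z = z"
  by (elim ints_cases) (simp add: int_of_nat_zi)

definition ineg :: "'v \<Rightarrow> 'v" where "ineg z = wl U (\<lambda>w. w \<in> ints U \<and> iadd w z = izero)"

lemma df_ineg [df]: "dt U t \<Longrightarrow> dt U (\<lambda>e. ineg (t e))"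
  by (rule dt_subst1[where f = ineg]) (unfold ineg_def, intro df)

lemma ineg: "z \<in> ints U \<Longrightarrow> ineg z \<in> ints U \<and> iadd (ineg z) z = izero"
proof (elim ints_cases)
  fix m n assume mn: "m \<in> naturals U" "n \<in> naturals U" "z = zi m n"
  then have 1: "zi n m \<in> ints U \<and> iadd (zi n m) z = izero"
    by (simp add: int_of_nat_zi zi_eq nadd_commute)
  have "dprd U (\<lambda>w. w \<in> ints U \<and> iadd w z = izero)" by (intro df)
  from wl_props(1)[of "\<lambda>w. w \<in> ints U \<and> iadd w z = izero", OF this 1] show ?thesis unfolding ineg_def .
qed

lemma int_diff_eq:
  assumes "z \<in> ints U" "w \<in> ints U"
  shows "int_diff U z w = iadd z (ineg w)"
  unfolding int_diff_def
proof (rule the_equality)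
  have "iadd (iadd z (ineg w)) w = z"
    using assms ineg[OF assms(2)] iadd_assoc iadd_0 iadd_commute int_of_nat_in zero_N by metis
  then show "iadd z (ineg w) \<in> ints U \<and> int_add U (iadd z (ineg w)) w = z"
    using assms ineg int_add_eq by simp
  fix u assume "u \<in> ints U \<and> int_add U u w = z"
  then have "u \<in> ints U" "iadd u w = z" using int_add_eq assms by auto
  then show "u = iadd z (ineg w)"
    using assms ineg[OF assms(2)] iadd_assoc iadd_0 iadd_commute int_of_nat_in zero_N by metis
qed

definition ile :: "'v \<Rightarrow> 'v \<Rightarrow> bool" where
  "ile z w \<longleftrightarrow> (\<exists>m n m' n'. m \<in> naturals U \<and> n \<in> naturals U \<and> m' \<in> naturals U \<and> n' \<in> naturals U \<and>
     z = zi m n \<and> w = zi m' n' \<and> ext U (m \<uplus> n') \<subseteq> ext U (m' \<uplus> n))"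

lemma df_ile [df]: "dt U t \<Longrightarrow> dt U u \<Longrightarrow> dfn U (\<lambda>e. ile (t e) (u e))"
  by (rule dfn_subst2[where P = ile]) (unfold ile_def, intro df)

lemma int_le_eq: "z \<in> ints U \<Longrightarrow> w \<in> ints U \<Longrightarrow> int_le U z w \<longleftrightarrow> ile z w"
  unfolding ile_def by (metis int_le_zi ints_cases)

lemma ile_zi:
  assumes "m \<in> naturals U" "n \<in> naturals U" "m' \<in> naturals U" "n' \<in> naturals U"
  shows "ile (zi m n) (zi m' n') \<longleftrightarrow> ext U (m \<uplus> n') \<subseteq> ext U (m' \<uplus> n)"
  using int_le_eq int_le_zi assms by simp

lemma ile_linear: "z \<in> ints U \<Longrightarrow> w \<in> ints U \<Longrightarrow> ile z w \<or> ile w z"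
  by (elim ints_cases) (simp add: ile_zi nle_linear)

lemma ext_antisym: "ext U x \<subseteq> ext U y \<Longrightarrow> ext U y \<subseteq> ext U x \<Longrightarrow> x = y"
  using ext_eq_iff by blast

lemma ile_antisym: "z \<in> ints U \<Longrightarrow> w \<in> ints U \<Longrightarrow> ile z w \<Longrightarrow> ile w z \<Longrightarrow> z = w"
  by (elim ints_cases) (simp add: ile_zi zi_eq ext_antisym)

lemma ile_add:
  assumes "z \<in> ints U" "w \<in> ints U" "v \<in> ints U" "ile z w"
  shows "ile (iadd v z) (iadd v w)"
proof -
  obtain m n m' n' a b where *: "m \<in> naturals U" "n \<in> naturals U" "m' \<in> naturals U" "n' \<in> naturals U"
    "a \<in> naturals U" "b \<in> naturals U" "z = zi m n" "w = zi m' n'" "v = zi a b"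
    using assms(1-3) by (elim ints_cases) (rule that)
  have "(a \<uplus> m) \<uplus> (b \<uplus> n') = (m \<uplus> n') \<uplus> (a \<uplus> b)" "(a \<uplus> m') \<uplus> (b \<uplus> n) = (m' \<uplus> n) \<uplus> (a \<uplus> b)"
    using * by (simp_all add: nadd_ac)
  then show ?thesis using assms(4) * nle_cancel[of "m \<uplus> n'" "m' \<uplus> n" "a \<uplus> b"] by (simp add: ile_zi)
qed

lemma ile_trans:
  assumes "z \<in> ints U" "w \<in> ints U" "v \<in> ints U" "ile z w" "ile w v"
  shows "ile z v"
proof -
  obtain m n m' n' a b where *: "m \<in> naturals U" "n \<in> naturals U" "m' \<in> naturals U" "n' \<in> naturals U"
    "a \<in> naturals U" "b \<in> naturals U" "z = zi m n" "w = zi m' n'" "v = zi a b"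
    using assms(1-3) by (elim ints_cases) (rule that)
  have "ext U ((m \<uplus> n') \<uplus> b) \<subseteq> ext U ((m' \<uplus> n) \<uplus> b)"
    using assms(4) * nle_cancel by (simp add: ile_zi)
  moreover have "(m' \<uplus> n) \<uplus> b = (m' \<uplus> b) \<uplus> n" using * by (simp add: nadd_ac)
  moreover have "ext U ((m' \<uplus> b) \<uplus> n) \<subseteq> ext U ((a \<uplus> n') \<uplus> n)"
    using assms(5) * nle_cancel by (simp add: ile_zi)
  moreover have "(m \<uplus> n') \<uplus> b = (m \<uplus> b) \<uplus> n'" "(a \<uplus> n') \<uplus> n = (a \<uplus> n) \<uplus> n'" using * by (simp_all add: nadd_ac)
  ultimately have "ext U ((m \<uplus> b) \<uplus> n') \<subseteq> ext U ((a \<uplus> n) \<uplus> n')" by simp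
  then show ?thesis using * nle_cancel by (simp add: ile_zi)
qed

lemma ione_ne_izero: "ione \<noteq> izero"
  by (simp add: int_of_nat_def)

lemma ile_discrete:
  assumes "z \<in> ints U"
  shows "ile ione z \<or> ile z izero"
proof -
  obtain m n where *: "m \<in> naturals U" "n \<in> naturals U" "z = zi m n" using assms ints_cases by blast
  have On: "m \<in> ordinals U" "n \<in> ordinals U" using * N_On by blast+
  have "insert n (ext U n) \<subseteq> ext U m \<or> ext U m \<subseteq> ext U n"
    using On_linear[OF On] On_subset_iff[OF On] On_subset_iff[OF On(2,1)] by blast
  then show ?thesis using * by (simp add: ile_zi int_of_nat_zi)
qed

lemma ile_0_1: "ile izero ione"
  by (simp add: ile_zi int_of_nat_zi)

lemma ile_0_iff: "z \<in> ints U \<Longrightarrow> ile izero z \<longleftrightarrow> (\<exists>m \<in> naturals U. z = int_of_nat U m)"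
proof (elim ints_cases)
  fix m n assume *: "m \<in> naturals U" "n \<in> naturals U" "z = zi m n"
  have "ile izero z \<longleftrightarrow> ext U n \<subseteq> ext U m" using * by (simp add: ile_zi int_of_nat_zi)
  also have "\<dots> \<longleftrightarrow> (\<exists>k \<in> naturals U. m = n \<uplus> k)" using * nle_iff by blast
  also have "\<dots> \<longleftrightarrow> (\<exists>k \<in> naturals U. z = int_of_nat U k)"
    using * by (auto simp: int_of_nat_zi zi_eq nadd_commute)
  finally show ?thesis .
qed

text \<open>Premise \<open>D\<close> carries the property downwards and so to the negative integers.
  A reduced pair has a zero component, which leaves two ordinary inductions on natural
  numbers.\<close>

lemma ints_induct:
  assumes "z \<in> ints U" "dprd U P" "P izero"
    and S: "\<And>z. z \<in> ints U \<Longrightarrow> P z \<Longrightarrow> P (iadd z ione)"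
    and D: "\<And>z. z \<in> ints U \<Longrightarrow> P (iadd z ione) \<Longrightarrow> P z"
  shows "P z"
proof -
  obtain m n where z: "z = opair U m n" "m \<in> naturals U" "n \<in> naturals U" "m = empty_set U \<or> n = empty_set U" "z = zi m n"
    using assms(1) by (rule ints_opairE)
  have "P (zi k (empty_set U))" if "k \<in> naturals U" for k
  proof (rule N_induct[OF that])
    show "dprd U (\<lambda>k. P (zi k (empty_set U)))" by (intro dprdD[OF assms(2)] df)
    show "P (zi (empty_set U) (empty_set U))" using assms(3) by (simp add: int_of_nat_zi)
    show "P (zi (succ_set U k) (empty_set U))" if "k \<in> naturals U" "P (zi k (empty_set U))" for k
      using S[of "zi k (empty_set U)"] that by (simp add: int_of_nat_zi)
  qed
  moreover have "P (zi (empty_set U) k)" if "k \<in> naturals U" for k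
  proof (rule N_induct[OF that])
    show "dprd U (\<lambda>k. P (zi (empty_set U) k))" by (intro dprdD[OF assms(2)] df)
    show "P (zi (empty_set U) (empty_set U))" using assms(3) by (simp add: int_of_nat_zi)
    fix k assume k: "k \<in> naturals U" "P (zi (empty_set U) k)"
    have "iadd (zi (empty_set U) (succ_set U k)) ione = zi (empty_set U) k"
      using k(1) by (simp add: int_of_nat_zi zi_eq)
    then show "P (zi (empty_set U) (succ_set U k))" using D[of "zi (empty_set U) (succ_set U k)"] k by simp
  qed
  ultimately show ?thesis using z(2-5) by auto
qed

lemma isset_ints: "isset U (ints U)"
proof (rule isset_subset)
  show "isset U (class_prod U (naturals U) (naturals U))" by (intro isset_class_prod isset_N)
  show "dprd U (\<lambda>x. x \<in> ints U)" by (intro df)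
qed (auto simp: ints_def)

end

text \<open>The reals are mapped onto the pairs of reals by two functions that are sets of the
  model. Membership in graphs is used in place of application, so that the statement speaks about
  \<open>U\<close> alone.\<close>

definition real_pairing :: "'v universe \<Rightarrow> bool" where
  "real_pairing U \<longleftrightarrow> (\<exists>p q. class_fun U (reals U) (reals U) (ext U p) \<and> class_fun U (reals U) (reals U) (ext U q) \<and>
     (\<forall>x \<in> reals U. \<forall>y \<in> reals U. \<exists>z \<in> reals U. opair U z x \<in> ext U p \<and> opair U z y \<in> ext U q))"

text \<open>The interface of the reals for all that follows, stated for \<open>U\<close> alone
  because it will be proved for one chosen model only. The clause with \<open>A\<close>,
  \<open>M\<close> and \<open>L\<close> turns the operations and the order, given by definite
  descriptions and integer arithmetic, into sets of the model and thereby into definable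
  relations.\<close>

definition real_facts :: "'v universe \<Rightarrow> bool" where
  "real_facts U \<longleftrightarrow> ordered_field (real_struct U) \<and> real_pairing U \<and> isset U (reals U) \<and>
     (\<forall>x \<in> reals U. ext U x \<subseteq> almost_homs U) \<and>
     (\<forall>f \<in> almost_homs U. \<forall>g \<in> almost_homs U.
        (eudoxus U (app U (ext U f)) = eudoxus U (app U (ext U g)) \<longleftrightarrow> sim_sigma U (app U (ext U f)) (app U (ext U g))) \<and>
        (g \<in> ext U (eudoxus U (app U (ext U f))) \<longleftrightarrow> sim_sigma U (app U (ext U f)) (app U (ext U g)))) \<and>
     (\<exists>A M L. \<forall>r \<in> reals U. \<forall>t \<in> reals U. (opair U r t \<in> ext U L \<longleftrightarrow> real_le U r t) \<and>
        (\<forall>u \<in> reals U. (opair U r (opair U t u) \<in> ext U A \<longleftrightarrow> real_add U r t = u) \<and>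
          (opair U r (opair U t u) \<in> ext U M \<longleftrightarrow> real_mult U r t = u))) \<and>
     (\<forall>r \<in> reals U. \<exists>t \<in> reals U. \<not> real_le U t r)"

text \<open>HOL has no types depending on terms, so the integers of an arbitrary model cannot be made a type.
  Those of one particular model can: it is chosen as a counterexample to the facts about the reals
  of the model that are to be shown, if there is one.  The integers of HOL serve as a substitute
  if the choice fails to be a model.\<close>

definition cex :: "'v universe" where
  "cex = (SOME U. NBG U \<and> \<not> real_facts U)"

typedef 'v zint = "{x :: 'v + int. if NBG (cex :: 'v universe) then x \<in> Inl ` ints (cex :: 'v universe) else x \<in> range Inr}"
proof (cases "NBG (cex :: 'v universe)")
  case True
  then interpret nbg "cex :: 'v universe" by unfold_locales
  have "Inl izero \<in> Inl ` ints (cex :: 'v universe)" by simp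
  then show ?thesis using True by (intro exI[of _ "Inl izero"]) simp
qed auto

definition rep :: "'v zint \<Rightarrow> 'v" where "rep z = projl (Rep_zint z)"
definition repi :: "'v zint \<Rightarrow> int" where "repi z = projr (Rep_zint z)"
definition zl :: "'v \<Rightarrow> 'v zint" where "zl a = Abs_zint (Inl a)"
definition zr :: "int \<Rightarrow> 'v zint" where "zr i = Abs_zint (Inr i)"

lemma zint_NBG:
  fixes z w :: "'v zint"
  assumes "NBG (cex :: 'v universe)"
  shows "rep z \<in> ints (cex :: 'v universe)" "z = w \<longleftrightarrow> rep z = rep w"
    "a \<in> ints (cex :: 'v universe) \<Longrightarrow> rep (zl a :: 'v zint) = a"
proof -
  have *: "Rep_zint z \<in> Inl ` ints (cex :: 'v universe)" for z :: "'v zint"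
    using Rep_zint[of z] assms by simp
  show "rep z \<in> ints (cex :: 'v universe)" using *[of z] by (auto simp: rep_def)
  show "z = w \<longleftrightarrow> rep z = rep w"
    using *[of z] *[of w] Rep_zint_inject[of z w] by (auto simp: rep_def)
  show "a \<in> ints (cex :: 'v universe) \<Longrightarrow> rep (zl a :: 'v zint) = a"
    unfolding rep_def zl_def by (subst Abs_zint_inverse) (use assms in auto)
qed

lemma zint_not_NBG:
  fixes z w :: "'v zint"
  assumes "\<not> NBG (cex :: 'v universe)"
  shows "z = w \<longleftrightarrow> repi z = repi w" "repi (zr i :: 'v zint) = i"
proof -
  have *: "Rep_zint z \<in> range Inr" for z :: "'v zint"
    using Rep_zint[of z] assms by simp
  show "z = w \<longleftrightarrow> repi z = repi w"
    using *[of z] *[of w] Rep_zint_inject[of z w] by (auto simp: repi_def)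
  show "repi (zr i :: 'v zint) = i"
    unfolding repi_def zr_def by (subst Abs_zint_inverse) (use assms in auto)
qed

instantiation zint :: (type) "{linordered_ab_group_add, one}"
begin

definition "(0 :: 'a zint) = (if NBG (cex :: 'a universe) then zl (int_of_nat cex (empty_set cex)) else zr 0)"
definition "(1 :: 'a zint) = (if NBG (cex :: 'a universe) then zl (int_of_nat cex (succ_set cex (empty_set cex))) else zr 1)"
definition "(x :: 'a zint) + y = (if NBG (cex :: 'a universe) then zl (nbg.iadd cex (rep x) (rep y)) else zr (repi x + repi y))"
definition "- (x :: 'a zint) = (if NBG (cex :: 'a universe) then zl (nbg.ineg cex (rep x)) else zr (- repi x))"
definition "(x :: 'a zint) - y = x + (- y)"
definition "(x :: 'a zint) \<le> y \<longleftrightarrow> (if NBG (cex :: 'a universe) then nbg.ile cex (rep x) (rep y) else repi x \<le> repi y)"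
definition "(x :: 'a zint) < y \<longleftrightarrow> x \<le> y \<and> \<not> y \<le> x"

lemma zint_rep:
  fixes x y :: "'a zint"
  assumes "NBG (cex :: 'a universe)"
  shows "rep (0 :: 'a zint) = int_of_nat cex (empty_set cex)"
    "rep (1 :: 'a zint) = int_of_nat cex (succ_set cex (empty_set cex))"
    "rep (x + y) = nbg.iadd cex (rep x) (rep y)" "rep (- x) = nbg.ineg cex (rep x)"
    "x \<le> y \<longleftrightarrow> nbg.ile cex (rep x) (rep y)"
proof -
  interpret nbg "cex :: 'a universe" by unfold_locales (rule assms)
  note [simp] = zint_NBG[OF assms] assms
  show "rep (0 :: 'a zint) = int_of_nat cex (empty_set cex)" 
    "rep (1 :: 'a zint) = int_of_nat cex (succ_set cex (empty_set cex))"
    "rep (x + y) = nbg.iadd cex (rep x) (rep y)" "rep (- x) = nbg.ineg cex (rep x)"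
    "x \<le> y \<longleftrightarrow> nbg.ile cex (rep x) (rep y)"
    by (simp_all add: zero_zint_def one_zint_def plus_zint_def uminus_zint_def less_eq_zint_def ineg)
qed

lemma zint_repi:
  fixes x y :: "'a zint"
  assumes "\<not> NBG (cex :: 'a universe)"
  shows "repi (0 :: 'a zint) = 0" "repi (1 :: 'a zint) = 1"
    "repi (x + y) = repi x + repi y" "repi (- x) = - repi x" "x \<le> y \<longleftrightarrow> repi x \<le> repi y"
  using assms zint_not_NBG(2)[OF assms]
  by (simp_all add: zero_zint_def one_zint_def plus_zint_def uminus_zint_def less_eq_zint_def)

lemma zint_axioms:
  fixes x y z :: "'a zint"
  shows "x + y + z = x + (y + z)" "x + y = y + x" "0 + x = x" "- x + x = 0" "x \<le> x" "x \<le> y \<or> y \<le> x"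
    "x \<le> y \<Longrightarrow> z + x \<le> z + y" "x \<le> y \<Longrightarrow> y \<le> z \<Longrightarrow> x \<le> z" "x \<le> y \<Longrightarrow> y \<le> x \<Longrightarrow> x = y"
proof -
  have E: "x + y + z = x + (y + z) \<and> x + y = y + x \<and> 0 + x = x \<and> - x + x = 0"
  proof (cases "NBG (cex :: 'a universe)")
    case True
    interpret nbg "cex :: 'a universe" by unfold_locales (rule True)
    note [simp] = zint_NBG(1)[OF True] zint_rep[OF True]
    show ?thesis unfolding zint_NBG(2)[OF True]
      using iadd_commute[of "rep x" "rep y"] iadd_assoc[of "rep x" "rep y" "rep z"] iadd_0[of "rep x"] ineg[of "rep x"]
      by simp
  qed (auto simp: zint_not_NBG(1) zint_repi)
  have L: "x \<le> x \<and> (x \<le> y \<longrightarrow> y \<le> z \<longrightarrow> x \<le> z) \<and> (x \<le> y \<longrightarrow> y \<le> x \<longrightarrow> x = y) \<and>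
    (x \<le> y \<longrightarrow> z + x \<le> z + y) \<and> (x \<le> y \<or> y \<le> x)"
  proof (cases "NBG (cex :: 'a universe)")
    case True
    interpret nbg "cex :: 'a universe" by unfold_locales (rule True)
    note [simp] = zint_NBG(1)[OF True] zint_rep[OF True]
    show ?thesis unfolding zint_NBG(2)[OF True]
      using ile_linear[of "rep x" "rep x"] ile_antisym[of "rep x" "rep y"] ile_trans[of "rep x" "rep y" "rep z"]
        ile_linear[of "rep x" "rep y"] ile_add[of "rep x" "rep y" "rep z"] by simp
  qed (auto simp: zint_not_NBG(1) zint_repi)
  show "x + y + z = x + (y + z)" "x + y = y + x" "0 + x = x" "- x + x = 0" using E by fast+
  show "x \<le> x" "x \<le> y \<or> y \<le> x" "x \<le> y \<Longrightarrow> z + x \<le> z + y" "x \<le> y \<Longrightarrow> y \<le> z \<Longrightarrow> x \<le> z"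
    "x \<le> y \<Longrightarrow> y \<le> x \<Longrightarrow> x = y"
    using L by iprover+
qed

instance
  by standard (assumption | rule minus_zint_def less_zint_def zint_axioms)+

end

section \<open>The integers of the chosen model as an ordered ring\<close>

locale nbg0 = nbg U for U :: "'v universe" +
  assumes U_cex: "U = cex"
begin

lemmas zint_U = zint_NBG[OF NBG[unfolded U_cex], folded U_cex] zint_rep[OF NBG[unfolded U_cex], folded U_cex]

text \<open>An inverse of \<open>rep\<close>, made total by the value 0 outside the integers. A
  quantifier over the type of integers thus becomes an unrestricted quantifier over the universe,
  and definability of a predicate on integers is expressed through \<open>ab\<close>.\<close>

definition ab :: "'v \<Rightarrow> 'v zint" where "ab x = (if x \<in> ints U then zl x else 0)"

lemma rep_in [simp]: "rep (z :: 'v zint) \<in> ints U" by (rule zint_U)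
lemma rep_eq: "z = w \<longleftrightarrow> rep z = rep (w :: 'v zint)" by (rule zint_U)
lemma ab_rep [simp]: "ab (rep z) = z" unfolding ab_def rep_eq by (simp add: zint_U)
lemma rep_ab [simp]: "x \<in> ints U \<Longrightarrow> rep (ab x) = x" unfolding ab_def by (simp add: zint_U)
lemma rep_0 [simp]: "rep (0 :: 'v zint) = izero" by (rule zint_U)
lemma rep_1 [simp]: "rep (1 :: 'v zint) = ione" by (rule zint_U)
lemma rep_add: "rep (x + y) = iadd (rep x) (rep (y :: 'v zint))" by (rule zint_U)
lemma rep_neg: "rep (- x) = ineg (rep (x :: 'v zint))" by (rule zint_U)
lemma le_rep: "x \<le> y \<longleftrightarrow> ile (rep x) (rep (y :: 'v zint))" by (rule zint_U)

lemma int_add_rep: "int_add U (rep x) (rep y) = rep (x + y)" by (simp add: int_add_eq rep_add)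
lemma int_diff_rep: "int_diff U (rep x) (rep y) = rep (x - y)"
  unfolding minus_zint_def rep_add rep_neg by (rule int_diff_eq) simp_all
lemma int_le_rep: "int_le U (rep x) (rep y) \<longleftrightarrow> x \<le> y" by (simp add: int_le_eq le_rep)

lemma ints_repE:
  assumes "x \<in> ints U"
  obtains z where "x = rep z"
  using rep_ab[OF assms] that by metis

abbreviation (input) zdt :: "((nat \<Rightarrow> 'v) \<Rightarrow> 'v zint) \<Rightarrow> bool" where "zdt t \<equiv> dt U (\<lambda>e. rep (t e))"

lemma zdt_add [df]: "zdt t \<Longrightarrow> zdt u \<Longrightarrow> zdt (\<lambda>e. t e + u e)" unfolding rep_add by (intro df)
lemma zdt_neg [df]: "zdt t \<Longrightarrow> zdt (\<lambda>e. - t e)" unfolding rep_neg by (intro df)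
lemma zdt_diff [df]: "zdt t \<Longrightarrow> zdt u \<Longrightarrow> zdt (\<lambda>e. t e - u e)" unfolding minus_zint_def by (intro df)
lemma zdt_ab [df]: "dt U t \<Longrightarrow> zdt (\<lambda>e. ab (t e))"
proof -
  have "rep (ab x) = (if x \<in> ints U then x else izero)" for x
    by (simp, simp add: ab_def)
  then show "dt U t \<Longrightarrow> zdt (\<lambda>e. ab (t e))" by (simp only:) (intro df)
qed
lemma zdt_if [df]: "dfn U B \<Longrightarrow> zdt t \<Longrightarrow> zdt u \<Longrightarrow> zdt (\<lambda>e. if B e then t e else u e)"
  unfolding if_distrib[of rep] by (intro df)
lemma zdfn_eq [df]: "zdt t \<Longrightarrow> zdt u \<Longrightarrow> dfn U (\<lambda>e. t e = u e)" unfolding rep_eq by (intro df)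
lemma zdfn_le [df]: "zdt t \<Longrightarrow> zdt u \<Longrightarrow> dfn U (\<lambda>e. t e \<le> u e)" unfolding le_rep by (intro df)
lemma zdfn_less [df]: "zdt t \<Longrightarrow> zdt u \<Longrightarrow> dfn U (\<lambda>e. t e < u e)" unfolding less_zint_def by (intro df)

lemma zdfn_all [df]:
  assumes "dfn U (\<lambda>e. P (ab (e 0)) (\<lambda>i. e (Suc i)))"
  shows "dfn U (\<lambda>e. \<forall>z :: 'v zint. P z e)"
proof -
  have "(\<forall>z :: 'v zint. P z e) = (\<forall>x. P (ab x) e)" for e by (metis ab_rep)
  then show ?thesis using dfn_all[OF assms] by simp
qed

lemma zdfn_ex [df]:
  assumes "dfn U (\<lambda>e. P (ab (e 0)) (\<lambda>i. e (Suc i)))"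
  shows "dfn U (\<lambda>e. \<exists>z :: 'v zint. P z e)"
proof -
  have "(\<exists>z :: 'v zint. P z e) = (\<exists>x. P (ab x) e)" for e by (metis ab_rep)
  then show ?thesis using dfn_ex[OF assms] by simp
qed

abbreviation (input) zprd :: "('v zint \<Rightarrow> bool) \<Rightarrow> bool" where "zprd P \<equiv> dfn U (\<lambda>e. P (ab (e 0)))"

lemma zprdD: "zprd P \<Longrightarrow> zdt t \<Longrightarrow> dfn U (\<lambda>e. P (t e))"
  using dfn_subst1[of U "\<lambda>x. P (ab x)" "\<lambda>e. rep (t e)"] by simp

lemma zint_induct:
  assumes "zprd P" "P 0" "\<And>z. P z \<Longrightarrow> P (z + 1)" "\<And>z. P (z + 1) \<Longrightarrow> P z"
  shows "P z"
proof -
  have "P (ab (rep z))"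
  proof (rule ints_induct[OF rep_in assms(1)])
    show "P (ab izero)" using assms(2) ab_rep[of 0] by simp
    fix x assume x: "x \<in> ints U"
    have eq: "ab (iadd x ione) = ab x + 1" unfolding rep_eq using x by (simp add: rep_add)
    show "P (ab x) \<Longrightarrow> P (ab (iadd x ione))" unfolding eq by (rule assms(3))
    show "P (ab (iadd x ione)) \<Longrightarrow> P (ab x)" unfolding eq by (rule assms(4))
  qed
  then show ?thesis by simp
qed

lemma one_neq_zero: "(1 :: 'v zint) \<noteq> 0" unfolding rep_eq using ione_ne_izero by simp

lemma zint_discrete: "(z :: 'v zint) < 1 \<longleftrightarrow> z \<le> 0"
proof -
  have "(0 :: 'v zint) \<le> 1" unfolding le_rep using ile_0_1 by simp
  then have "(0 :: 'v zint) < 1" using one_neq_zero by (simp add: order.strict_iff_order)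
  moreover have "1 \<le> z \<or> z \<le> 0" unfolding le_rep using ile_discrete by simp
  ultimately show ?thesis by (metis not_le order.strict_trans1)
qed

lemma zint_less_iff: "(z :: 'v zint) < w \<longleftrightarrow> z + 1 \<le> w"
  using zint_discrete[of "1 + z - w"] by (simp add: algebra_simps)

lemma zint_nonneg_induct:
  assumes "0 \<le> z" "zprd P" "P 0" "\<And>z. 0 \<le> z \<Longrightarrow> P z \<Longrightarrow> P (z + 1)"
  shows "P z"
proof -
  \<comment> \<open>The two-sided induction also has a downward step. For this bounded form that
    step is trivial, and at negative \<open>z\<close> the claim is empty.\<close>
  have "\<forall>w. 0 \<le> w \<longrightarrow> w \<le> z \<longrightarrow> P w"
  proof (rule zint_induct)
    show "zprd (\<lambda>z. \<forall>w. 0 \<le> w \<longrightarrow> w \<le> z \<longrightarrow> P w)" by (intro df zprdD[OF assms(2)])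
    show "\<forall>w. 0 \<le> w \<longrightarrow> w \<le> 0 \<longrightarrow> P w" using assms(3) by (auto dest: antisym)
    fix z :: "'v zint"
    have 01: "(0 :: 'v zint) \<le> 1" using zint_discrete[of 0] by simp
    { assume IH: "\<forall>w. 0 \<le> w \<longrightarrow> w \<le> z \<longrightarrow> P w"
      show "\<forall>w. 0 \<le> w \<longrightarrow> w \<le> z + 1 \<longrightarrow> P w"
      proof (intro allI impI)
        fix w assume w: "0 \<le> w" "w \<le> z + 1"
        show "P w"
        proof (cases "w \<le> z")
          case False
          then have wz: "w = z + 1" using w(2) zint_less_iff[of z w] by auto
          show ?thesis
          proof (cases "0 \<le> z")
            case True
            then show ?thesis using IH assms(4)[of z] wz by simp
          next
            case False
            then have "z + 1 \<le> 0" using zint_less_iff[of z 0] by auto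
            then show ?thesis using wz w(1) assms(3) by auto
          qed
        qed (use IH w in blast)
      qed }
    { assume "\<forall>w. 0 \<le> w \<longrightarrow> w \<le> z + 1 \<longrightarrow> P w"
      moreover have "w \<le> z \<Longrightarrow> w \<le> z + 1" for w using 01 by (simp add: add_increasing2)
      ultimately show "\<forall>w. 0 \<le> w \<longrightarrow> w \<le> z \<longrightarrow> P w" by blast }
  qed
  then show ?thesis using assms(1) by blast
qed

definition zap :: "'v \<Rightarrow> 'v zint \<Rightarrow> 'v zint" where "zap g z = ab (ap g (rep z))"

lemma zdt_zap [df]: "dt U g \<Longrightarrow> zdt t \<Longrightarrow> zdt (\<lambda>e. zap (g e) (t e))"
  unfolding zap_def by (intro df)

abbreviation (input) zfn :: "('v zint \<Rightarrow> 'v zint) \<Rightarrow> bool" where "zfn h \<equiv> zdt (\<lambda>e. h (ab (e 0)))"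

lemma zfnD: "zfn h \<Longrightarrow> zdt t \<Longrightarrow> zdt (\<lambda>e. h (t e))"
  using dt_subst1[of U "\<lambda>x. rep (h (ab x))" "\<lambda>e. rep (t e)"] by simp

lemma zfn_zap: "zfn (zap g)" by (intro df)

definition zlam :: "('v zint \<Rightarrow> 'v zint) \<Rightarrow> 'v" where "zlam h = lam (ints U) (\<lambda>x. rep (h (ab x)))"

lemma zlam:
  assumes "zfn h"
  shows "class_fun U (ints U) (ints U) (ext U (zlam h))" "ap (zlam h) (rep z) = rep (h z)" "zap (zlam h) = h"
proof -
  show "class_fun U (ints U) (ints U) (ext U (zlam h))"
    unfolding zlam_def by (rule class_fun_lam[OF isset_ints assms]) auto
  show *: "ap (zlam h) (rep z) = rep (h z)" for z
    unfolding zlam_def by (simp add: ap_lam[OF isset_ints assms])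
  show "zap (zlam h) = h" unfolding zap_def * by simp
qed

definition zadditive :: "'v \<Rightarrow> bool" where
  "zadditive g \<longleftrightarrow> (\<forall>x y. zap g (x + y) = zap g x + zap g y)"

lemma df_zadditive [df]: "dt U t \<Longrightarrow> dfn U (\<lambda>e. zadditive (t e))"
  by (rule dfn_subst1[where P = zadditive]) (unfold zadditive_def, intro df)

lemma zadditiveI: "zfn h \<Longrightarrow> (\<And>x y. h (x + y) = h x + h y) \<Longrightarrow> zadditive (zlam h)"
  unfolding zadditive_def by (simp add: zlam)

lemma zadditive_unique:
  assumes "zadditive g" "zadditive h" "zap g 1 = zap h 1"
  shows "zap g z = zap h z"
proof (rule zint_induct[where P = "\<lambda>z. zap g z = zap h z"])
  show "zprd (\<lambda>z. zap g z = zap h z)" by (intro df)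
  have "zap g (0 + 0) = zap g 0 + zap g 0" "zap h (0 + 0) = zap h 0 + zap h 0"
    using assms(1,2) unfolding zadditive_def by blast+
  then show "zap g 0 = zap h 0" by simp
qed (use assms in \<open>simp_all add: zadditive_def\<close>)

lemma ex_zadditive: "\<exists>g. zadditive g \<and> zap g 1 = z"
proof (rule zint_induct)
  show "zprd (\<lambda>z. \<exists>g. zadditive g \<and> zap g 1 = z)" by (intro df)
  have "zfn (\<lambda>x. 0)" by (intro df)
  then have "zadditive (zlam (\<lambda>x. 0)) \<and> zap (zlam (\<lambda>x. 0)) 1 = 0" using zadditiveI by (simp add: zlam)
  then show "\<exists>g. zadditive g \<and> zap g 1 = 0" by blast
  fix z
  { assume "\<exists>g. zadditive g \<and> zap g 1 = z"
    then obtain g where g: "zadditive g" "zap g 1 = z" by blast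
    have f: "zfn (\<lambda>x. zap g x + x)" by (intro df)
    have "zadditive (zlam (\<lambda>x. zap g x + x))"
      by (rule zadditiveI[OF f]) (use g in \<open>simp add: zadditive_def algebra_simps\<close>)
    moreover have "zap (zlam (\<lambda>x. zap g x + x)) 1 = z + 1" using g by (simp add: zlam[OF f])
    ultimately show "\<exists>g. zadditive g \<and> zap g 1 = z + 1" by blast }
  { assume "\<exists>g. zadditive g \<and> zap g 1 = z + 1"
    then obtain g where g: "zadditive g" "zap g 1 = z + 1" by blast
    have f: "zfn (\<lambda>x. zap g x - x)" by (intro df)
    have "zadditive (zlam (\<lambda>x. zap g x - x))"
      by (rule zadditiveI[OF f]) (use g in \<open>simp add: zadditive_def algebra_simps\<close>)
    moreover have "zap (zlam (\<lambda>x. zap g x - x)) 1 = z" using g by (simp add: zlam[OF f])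
    ultimately show "\<exists>g. zadditive g \<and> zap g 1 = z" by blast }
qed

text \<open>Multiplication by \<open>z\<close> is the additive internal function with value
  \<open>z\<close> at 1. Such a function is unique and exists by induction on \<open>z\<close>, so
  multiplication is obtained before any recursion theorem.\<close>

definition zmul :: "'v zint \<Rightarrow> 'v zint \<Rightarrow> 'v zint" where
  "zmul z w = ab (wl U (\<lambda>v. \<exists>g. zadditive g \<and> zap g 1 = z \<and> v = rep (zap g w)))"

lemma zdt_zmul: "zdt t \<Longrightarrow> zdt u \<Longrightarrow> zdt (\<lambda>e. zmul (t e) (u e))"
proof -
  have "dt U (\<lambda>e. rep (zmul (ab (e 0)) (ab (e 1))))" unfolding zmul_def by (intro df)
  from dt_subst2[where f = "\<lambda>x y. rep (zmul (ab x) (ab y))", OF this]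
  show "zdt t \<Longrightarrow> zdt u \<Longrightarrow> zdt (\<lambda>e. zmul (t e) (u e))" by fastforce
qed

lemma zmul_zap:
  assumes "zadditive g"
  shows "zmul (zap g 1) w = zap g w"
proof -
  have "wl U (\<lambda>v. \<exists>h. zadditive h \<and> zap h 1 = zap g 1 \<and> v = rep (zap h w)) = rep (zap g w)"
  proof (rule wl_eq)
    show "\<exists>h. zadditive h \<and> zap h 1 = zap g 1 \<and> rep (zap g w) = rep (zap h w)" using assms by blast
    show "v = rep (zap g w)" if "\<exists>h. zadditive h \<and> zap h 1 = zap g 1 \<and> v = rep (zap h w)" for v
      using that zadditive_unique[OF _ assms] by metis
  qed
  then show ?thesis unfolding zmul_def by simp
qed

text \<open>The source of the ring laws: a definable additive map is multiplication by its value at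
  1, so a law follows once both sides are additive in one variable and agree at 1.\<close>

lemma zmul_zfn:
  assumes "zfn h" "\<And>x y. h (x + y) = h x + h y"
  shows "zmul (h 1) w = h w"
  using zmul_zap[OF zadditiveI[OF assms]] by (simp add: zlam(3)[OF assms(1)])

lemma zmul_ring:
  "zmul a 1 = a" "zmul 1 a = a" "zmul a (b + c) = zmul a b + zmul a c" "zmul (a + b) c = zmul a c + zmul b c"
  "zmul a b = zmul b a" "zmul (zmul a b) c = zmul a (zmul b c)"
proof -
  have r1: "zmul a 1 = a" for a
  proof -
    obtain g where "zadditive g" "zap g 1 = a" using ex_zadditive by blast
    then show ?thesis using zmul_zap[of g 1] by simp
  qed
  have "zfn (\<lambda>x. x)" by (intro df)
  from zmul_zfn[OF this] have l1: "zmul 1 a = a" for a by simp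
  have dl: "zmul a (b + c) = zmul a b + zmul a c" for a b c
  proof -
    obtain g where "zadditive g" "zap g 1 = a" using ex_zadditive by blast
    then show ?thesis using zmul_zap[of g] by (simp add: zadditive_def)
  qed
  have dr: "zmul (a + b) c = zmul a c + zmul b c" for a b c
  proof -
    have "zfn (\<lambda>x. zmul a x + zmul b x)" by (intro df zdt_zmul)
    from zmul_zfn[OF this, of c] show ?thesis by (simp add: dl r1 algebra_simps)
  qed
  show "zmul a 1 = a" "zmul 1 a = a" "zmul a (b + c) = zmul a b + zmul a c" "zmul (a + b) c = zmul a c + zmul b c"
    by (rule r1 l1 dl dr)+
  show "zmul a b = zmul b a"
  proof -
    have "zfn (\<lambda>x. zmul x a)" by (intro df zdt_zmul)
    from zmul_zfn[OF this, of b] show ?thesis by (simp add: dr l1)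
  qed
  show "zmul (zmul a b) c = zmul a (zmul b c)"
  proof -
    have "zfn (\<lambda>x. zmul a (zmul b x))" by (intro df zdt_zmul)
    from zmul_zfn[OF this, of c] show ?thesis by (simp add: dl r1)
  qed
qed

lemma zmul_pos:
  assumes "0 < z" "0 < w"
  shows "0 < zmul z w"
proof -
  have 0: "zmul z 0 = 0" using zmul_ring(3)[of z 0 0] by simp
  have "0 < zmul z (v + 1)" if "0 \<le> v" for v
  proof (rule zint_nonneg_induct[OF that])
    show "zprd (\<lambda>v. 0 < zmul z (v + 1))" by (intro df zdt_zmul)
    show "0 < zmul z (0 + 1)" using assms(1) by (simp add: zmul_ring)
    show "0 < zmul z (v + 1 + 1)" if "0 < zmul z (v + 1)" for v
      using that assms(1) by (simp add: zmul_ring(3)[of _ "_ + 1"] zmul_ring(1) add_pos_pos)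
  qed
  from this[of "w - 1"] show ?thesis using assms(2) zint_less_iff[of 0 w] by simp
qed

end

instantiation zint :: (type) linordered_idom
begin

definition "(x :: 'a zint) * y = (if NBG (cex :: 'a universe) then nbg0.zmul cex x y else zr (repi x * repi y))"
definition "\<bar>x :: 'a zint\<bar> = (if x < 0 then - x else x)"
definition "sgn (x :: 'a zint) = (if x = 0 then 0 else if 0 < x then 1 else - 1)"

lemma zint_mult_axioms:
  fixes x y z :: "'a zint"
  shows "x * y * z = x * (y * z)" "x * y = y * x" "1 * x = x" "(x + y) * z = x * z + y * z" "(0 :: 'a zint) \<noteq> 1"
    "x < y \<Longrightarrow> 0 < z \<Longrightarrow> z * x < z * y"
proof -
  have "x * y * z = x * (y * z) \<and> x * y = y * x \<and> 1 * x = x \<and> (x + y) * z = x * z + y * z \<and> (0 :: 'a zint) \<noteq> 1 \<and>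
     (x < y \<longrightarrow> 0 < z \<longrightarrow> z * x < z * y)"
  proof (cases "NBG (cex :: 'a universe)")
    case True
    interpret nbg0 "cex :: 'a universe" by unfold_locales (rule True, rule refl)
    have "zmul z x < zmul z y" if "x < y" "0 < z"
      using zmul_pos[of z "y - x"] zmul_ring(3)[of z "y - x" x] that by simp
    then show ?thesis
      using one_neq_zero zmul_ring(2)[of x] zmul_ring(4)[of x y z] zmul_ring(5)[of x y] zmul_ring(6)[of x y z]
      by (simp add: times_zint_def True)
  next
    case False
    note [simp] = zint_repi[OF False] zint_not_NBG(2)[OF False]
    have "repi x < repi y \<longleftrightarrow> x < y" for x y :: "'a zint" by (auto simp: less_zint_def)
    then have le: "x < y \<longleftrightarrow> repi x < repi y" for x y :: "'a zint" by simp
    show ?thesis unfolding zint_not_NBG(1)[OF False] le by (auto simp: times_zint_def False algebra_simps)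
  qed
  then show "x * y * z = x * (y * z)" "x * y = y * x" "1 * x = x" "(x + y) * z = x * z + y * z" "(0 :: 'a zint) \<noteq> 1"
     "x < y \<Longrightarrow> 0 < z \<Longrightarrow> z * x < z * y" by blast+
qed

instance
proof
  fix x y z :: "'a zint"
  show 0: "0 * x = 0" using zint_mult_axioms(4)[of 0 0 x] by simp
  show "x * 0 = 0" unfolding zint_mult_axioms(2)[of x] by (rule 0)
qed (assumption | rule zint_mult_axioms abs_zint_def sgn_zint_def)+

end

context nbg0
begin

lemma zdt_mult [df]: "zdt t \<Longrightarrow> zdt u \<Longrightarrow> zdt (\<lambda>e. t e * u e)"
  unfolding times_zint_def using NBG by (simp add: zdt_zmul U_cex[symmetric])

lemma zdt_abs [df]: "zdt t \<Longrightarrow> zdt (\<lambda>e. \<bar>t e\<bar>)"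
  unfolding abs_zint_def by (intro df)

end

context nbg0
begin

section \<open>Almost homomorphisms\<close>

lemma zint_add1_le: "(z :: 'v zint) < w \<Longrightarrow> z + 1 \<le> w"
  by (simp add: zint_less_iff)

lemma zint_strong_induct:
  assumes "0 \<le> z" "zprd P" "\<And>z. 0 \<le> z \<Longrightarrow> (\<And>w. 0 \<le> w \<Longrightarrow> w < z \<Longrightarrow> P w) \<Longrightarrow> P z"
  shows "P z"
proof -
  have "\<forall>w. 0 \<le> w \<longrightarrow> w < z \<longrightarrow> P w"
  proof (rule zint_nonneg_induct[OF assms(1)])
    show "zprd (\<lambda>z. \<forall>w. 0 \<le> w \<longrightarrow> w < z \<longrightarrow> P w)" by (intro df zprdD[OF assms(2)])
    fix z :: "'v zint" assume IH: "\<forall>w. 0 \<le> w \<longrightarrow> w < z \<longrightarrow> P w"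
    show "\<forall>w. 0 \<le> w \<longrightarrow> w < z + 1 \<longrightarrow> P w"
    proof (intro allI impI)
      fix w assume w: "0 \<le> w" "w < z + 1"
      then have "w \<le> z" using zint_add1_le by fastforce
      show "P w"
        by (rule assms(3)[OF w(1)]) (use IH \<open>w \<le> z\<close> in auto)
    qed
  qed auto
  then show ?thesis using assms(1,3) by blast
qed

text \<open>The global well-order need not agree with the order of the integers. Therefore
  \<open>wl\<close> is applied to a predicate that already singles out the minimum.\<close>

definition zleast :: "('v zint \<Rightarrow> bool) \<Rightarrow> 'v zint" where
  "zleast P = ab (wl U (\<lambda>x. P (ab x) \<and> (\<forall>m. P m \<longrightarrow> ab x \<le> m)))"

lemma zdt_zleast [df]:
  assumes "dfn U (\<lambda>e. P (ab (e 0)) (\<lambda>i. e (Suc i)))"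
  shows "zdt (\<lambda>e. zleast (\<lambda>z. P z e))"
proof -
  have "dfn U (\<lambda>e. P (ab (e 0)) (\<lambda>i. e (Suc (Suc i))))"
    using dfn_subst[OF assms, of "\<lambda>i e. e (if i = 0 then 0 else Suc i)"] by (simp add: df)
  then show ?thesis unfolding zleast_def by (intro df assms)
qed

lemma zleast:
  assumes "zprd P" "\<And>n. P n \<Longrightarrow> 0 \<le> n" "P n"
  shows "P (zleast P)" "P m \<Longrightarrow> zleast P \<le> m"
proof -
  have "P n \<longrightarrow> (\<exists>k. P k \<and> (\<forall>m. P m \<longrightarrow> k \<le> m))"
  proof (rule zint_strong_induct[OF assms(2)[OF assms(3)]])
    show "zprd (\<lambda>n. P n \<longrightarrow> (\<exists>k. P k \<and> (\<forall>m. P m \<longrightarrow> k \<le> m)))" by (intro df zprdD[OF assms(1)])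
    fix n assume IH: "\<And>w. 0 \<le> w \<Longrightarrow> w < n \<Longrightarrow> P w \<longrightarrow> (\<exists>k. P k \<and> (\<forall>m. P m \<longrightarrow> k \<le> m))"
    show "P n \<longrightarrow> (\<exists>k. P k \<and> (\<forall>m. P m \<longrightarrow> k \<le> m))"
    proof
      assume "P n"
      show "\<exists>k. P k \<and> (\<forall>m. P m \<longrightarrow> k \<le> m)"
      proof (cases "\<exists>m. P m \<and> m < n")
        case True
        then show ?thesis using IH assms(2) by blast
      next
        case False
        then show ?thesis using \<open>P n\<close> by (auto simp: not_less)
      qed
    qed
  qed
  then obtain k where k: "P k \<and> (\<forall>m. P m \<longrightarrow> k \<le> m)" using assms(3) by blast
  have "dprd U (\<lambda>x. P (ab x) \<and> (\<forall>m. P m \<longrightarrow> ab x \<le> m))" by (intro df zprdD[OF assms(1)])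
  from wl_props(1)[OF this, of "rep k"] k
  have "P (zleast P) \<and> (\<forall>m. P m \<longrightarrow> zleast P \<le> m)" unfolding zleast_def by simp
  then show "P (zleast P)" "P m \<Longrightarrow> zleast P \<le> m" by blast+
qed

text \<open>Definability belongs to the notion because a HOL function on the type of integers may
  satisfy the bound without being a function of the model.\<close>

definition AH :: "('v zint \<Rightarrow> 'v zint) \<Rightarrow> bool" where
  "AH f \<longleftrightarrow> zfn f \<and> (\<exists>C. \<forall>p q. \<bar>f (p + q) - f p - f q\<bar> \<le> C)"

definition sim :: "('v zint \<Rightarrow> 'v zint) \<Rightarrow> ('v zint \<Rightarrow> 'v zint) \<Rightarrow> bool" where
  "sim f g \<longleftrightarrow> (\<exists>C. \<forall>p. \<bar>f p - g p\<bar> \<le> C)"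

definition pos :: "('v zint \<Rightarrow> 'v zint) \<Rightarrow> bool" where
  "pos f \<longleftrightarrow> (\<forall>b. \<exists>m\<ge>0. b < f m)"

lemma AH_zfn: "AH f \<Longrightarrow> zfn f" unfolding AH_def by blast

lemma AHE:
  assumes "AH f"
  obtains C where "0 \<le> C" "\<And>p q. \<bar>f (p + q) - f p - f q\<bar> \<le> C" "\<And>p. \<bar>f p + f (- p)\<bar> \<le> C"
proof -
  obtain C where C: "\<And>p q. \<bar>f (p + q) - f p - f q\<bar> \<le> C" using assms unfolding AH_def by blast
  have 0: "0 \<le> C" using C[of 0 0] by linarith
  have "\<bar>f (p + q) - f p - f q\<bar> \<le> C + \<bar>f 0\<bar>" for p q using C[of p q] abs_ge_zero[of "f 0"] by linarith
  moreover have "\<bar>f p + f (- p)\<bar> \<le> C + \<bar>f 0\<bar>" for p using C[of p "- p"] abs_triangle_ineq4[of "f 0" "f 0 - f p - f (- p)"] by simp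
  moreover have "0 \<le> C + \<bar>f 0\<bar>" using 0 by simp
  ultimately show thesis using that by blast
qed

lemma simI: "(\<And>p. \<bar>f p - g p\<bar> \<le> C) \<Longrightarrow> sim f g" unfolding sim_def by blast
lemma simE: assumes "sim f g" obtains C where "0 \<le> C" "\<And>p. \<bar>f p - g p\<bar> \<le> C"
proof -
  obtain C where C: "\<And>p. \<bar>f p - g p\<bar> \<le> C" using assms unfolding sim_def by blast
  have "0 \<le> C" using C[of 0] by linarith
  then show thesis using C that by blast
qed

lemma sim_refl [simp]: "sim f f" by (rule simI[of _ _ 0]) simp
lemma sim_sym: "sim f g \<Longrightarrow> sim g f" unfolding sim_def by (metis abs_minus_commute)
lemma sim_trans: assumes "sim f g" "sim g h" shows "sim f h"
proof -
  obtain C where C: "\<And>p. \<bar>f p - g p\<bar> \<le> C" using assms(1) by (rule simE) (rule that)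
  obtain D where D: "\<And>p. \<bar>g p - h p\<bar> \<le> D" using assms(2) by (rule simE) (rule that)
  show ?thesis
  proof (rule simI)
    show "\<bar>f p - h p\<bar> \<le> C + D" for p using C[of p] D[of p] by linarith
  qed
qed

text \<open>A unit step changes \<open>f\<close> by at most \<open>\<bar>f 1\<bar> + C\<close>;
  negative arguments are covered by the bound on \<open>f p + f (- p)\<close>.\<close>

lemma AH_linear:
  assumes "AH f"
  obtains A B where "0 \<le> A" "0 \<le> B" "\<And>p. \<bar>f p\<bar> \<le> A * \<bar>p\<bar> + B"
proof -
  obtain C where C: "0 \<le> C" "\<And>p q. \<bar>f (p + q) - f p - f q\<bar> \<le> C" "\<And>p. \<bar>f p + f (- p)\<bar> \<le> C"
    using assms by (rule AHE) (rule that) 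
  let ?A = "\<bar>f 1\<bar> + C" and ?B = "\<bar>f 0\<bar> + C"
  have nn: "\<bar>f p\<bar> \<le> ?A * p + \<bar>f 0\<bar>" if "0 \<le> p" for p
  proof (rule zint_nonneg_induct[OF that])
    show "zprd (\<lambda>p. \<bar>f p\<bar> \<le> ?A * p + \<bar>f 0\<bar>)" by (intro df zfnD[OF AH_zfn[OF assms]])
    fix p assume "\<bar>f p\<bar> \<le> ?A * p + \<bar>f 0\<bar>"
    then have "\<bar>f (p + 1)\<bar> \<le> ?A * p + \<bar>f 0\<bar> + \<bar>f 1\<bar> + C" using C(2)[of p 1] by linarith
    then show "\<bar>f (p + 1)\<bar> \<le> ?A * (p + 1) + \<bar>f 0\<bar>" by (simp add: algebra_simps)
  qed simp
  have "\<bar>f p\<bar> \<le> ?A * \<bar>p\<bar> + ?B" for p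
  proof (cases "0 \<le> p")
    case True
    then show ?thesis using nn[of p] C(1) by simp
  next
    case False
    then have "\<bar>f (- p)\<bar> \<le> ?A * \<bar>p\<bar> + \<bar>f 0\<bar>" using nn[of "- p"] by (simp add: abs_if)
    then show ?thesis using C(3)[of p] by linarith
  qed
  then show thesis using that[of ?A ?B] C(1) by simp
qed

lemma AH_bounded:
  assumes "AH f"
  obtains M where "0 \<le> M" "\<And>d. \<bar>d\<bar> \<le> D \<Longrightarrow> \<bar>f d\<bar> \<le> M"
proof -
  obtain A B where AB: "0 \<le> A" "0 \<le> B" "\<And>p. \<bar>f p\<bar> \<le> A * \<bar>p\<bar> + B" using assms by (rule AH_linear) (rule that)
  have "\<bar>f d\<bar> \<le> A * \<bar>D\<bar> + B" if "\<bar>d\<bar> \<le> D" for d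
  proof -
    have "A * \<bar>d\<bar> \<le> A * \<bar>D\<bar>" using AB(1) that by (intro mult_left_mono) auto
    then show ?thesis using AB(3)[of d] by linarith
  qed
  moreover have "0 \<le> A * \<bar>D\<bar> + B" using AB by simp
  ultimately show thesis using that by blast
qed

lemma AHI: "zfn f \<Longrightarrow> (\<And>p q. \<bar>f (p + q) - f p - f q\<bar> \<le> C) \<Longrightarrow> AH f" unfolding AH_def by blast

lemma AH_add: assumes "AH f" "AH g" shows "AH (\<lambda>p. f p + g p)"
proof -
  obtain C where C: "\<And>p q. \<bar>f (p + q) - f p - f q\<bar> \<le> C" using assms(1) by (rule AHE) (rule that)
  obtain D where D: "\<And>p q. \<bar>g (p + q) - g p - g q\<bar> \<le> D" using assms(2) by (rule AHE) (rule that)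
  show ?thesis
  proof (rule AHI)
    show "zfn (\<lambda>p. f p + g p)" by (intro df zfnD[OF AH_zfn[OF assms(1)]] zfnD[OF AH_zfn[OF assms(2)]])
    show "\<bar>f (p + q) + g (p + q) - (f p + g p) - (f q + g q)\<bar> \<le> C + D" for p q
      using C[of p q] D[of p q] by linarith
  qed
qed

lemma AH_minus: assumes "AH f" shows "AH (\<lambda>p. - f p)"
proof -
  obtain C where C: "\<And>p q. \<bar>f (p + q) - f p - f q\<bar> \<le> C" using assms by (rule AHE) (rule that)
  show ?thesis
  proof (rule AHI)
    show "zfn (\<lambda>p. - f p)" by (intro df zfnD[OF AH_zfn[OF assms]])
    show "\<bar>- f (p + q) - (- f p) - (- f q)\<bar> \<le> C" for p q
      using C[of p q] by linarith
  qed
qed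

lemma AH_zero: "AH (\<lambda>p. 0)" by (rule AHI[of _ 0]) (intro df, simp)
lemma AH_id: "AH (\<lambda>p. p)" by (rule AHI[of _ 0]) (intro df, simp)

text \<open>Up to the defect, \<open>f a - f b\<close> is \<open>f (a - b)\<close>, and
  \<open>f\<close> is bounded where its argument is bounded. This is what makes composition
  compatible with bounded errors.\<close>

lemma AH_near:
  assumes "AH f"
  obtains M where "0 \<le> M" "\<And>a b. \<bar>a - b\<bar> \<le> D \<Longrightarrow> \<bar>f a - f b\<bar> \<le> M"
proof -
  obtain C where C: "0 \<le> C" "\<And>p q. \<bar>f (p + q) - f p - f q\<bar> \<le> C" using assms by (rule AHE) (rule that)
  obtain M where M: "0 \<le> M" "\<And>d. \<bar>d\<bar> \<le> D \<Longrightarrow> \<bar>f d\<bar> \<le> M" using assms by (rule AH_bounded) (rule that)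
  have "\<bar>f a - f b\<bar> \<le> M + C" if "\<bar>a - b\<bar> \<le> D" for a b
  proof -
    have "\<bar>f a - f b - f (a - b)\<bar> \<le> C" using C(2)[of b "a - b"] by simp
    then show ?thesis using M(2)[OF that] by linarith
  qed
  then show thesis using that[of "M + C"] C(1) M(1) by simp
qed

lemma AH_comp: assumes "AH f" "AH g" shows "AH (\<lambda>p. f (g p))"
proof -
  obtain C where C: "\<And>p q. \<bar>f (p + q) - f p - f q\<bar> \<le> C" using assms(1) by (rule AHE) (rule that)
  obtain D where D: "\<And>p q. \<bar>g (p + q) - g p - g q\<bar> \<le> D" using assms(2) by (rule AHE) (rule that)
  obtain M where M: "\<And>a b. \<bar>a - b\<bar> \<le> D \<Longrightarrow> \<bar>f a - f b\<bar> \<le> M" using assms(1) by (rule AH_near) (rule that)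
  show ?thesis
  proof (rule AHI)
    show "zfn (\<lambda>p. f (g p))" by (intro df zfnD[OF AH_zfn[OF assms(1)]] zfnD[OF AH_zfn[OF assms(2)]])
    fix p q
    have "\<bar>g (p + q) - (g p + g q)\<bar> \<le> D" using D[of p q] by (simp add: algebra_simps)
    from M[OF this] C[of "g p" "g q"]
    show "\<bar>f (g (p + q)) - f (g p) - f (g q)\<bar> \<le> M + C" by linarith
  qed
qed

lemma sim_comp:
  assumes "AH f" "sim f f'" "sim g g'"
  shows "sim (\<lambda>p. f (g p)) (\<lambda>p. f' (g' p))"
proof -
  obtain C where C: "\<And>p. \<bar>f p - f' p\<bar> \<le> C" using assms(2) by (rule simE) (rule that)
  obtain D where D: "\<And>p. \<bar>g p - g' p\<bar> \<le> D" using assms(3) by (rule simE) (rule that)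
  obtain M where M: "\<And>a b. \<bar>a - b\<bar> \<le> D \<Longrightarrow> \<bar>f a - f b\<bar> \<le> M" using assms(1) by (rule AH_near) (rule that)
  show ?thesis
  proof (rule simI)
    show "\<bar>f (g p) - f' (g' p)\<bar> \<le> M + C" for p using M[OF D[of p]] C[of "g' p"] by linarith
  qed
qed

lemma sim_add:
  assumes "sim f f'" "sim g g'"
  shows "sim (\<lambda>p. f p + g p) (\<lambda>p. f' p + g' p)"
proof -
  obtain C where C: "\<And>p. \<bar>f p - f' p\<bar> \<le> C" using assms(1) by (rule simE) (rule that)
  obtain D where D: "\<And>p. \<bar>g p - g' p\<bar> \<le> D" using assms(2) by (rule simE) (rule that)
  show ?thesis
  proof (rule simI)
    show "\<bar>f p + g p - (f' p + g' p)\<bar> \<le> C + D" for p using C[of p] D[of p] by linarith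
  qed
qed

text \<open>Each step of the induction on \<open>n\<close> adds one defect. The error is therefore
  linear in \<open>n\<close> and uniform in \<open>p\<close>, so that in \<open>sim_comm\<close>
  also values of almost homomorphisms may be substituted for \<open>p\<close>.\<close>

lemma AH_mult:
  assumes "AH f"
  obtains C E where "0 \<le> C" "0 \<le> E" "\<And>n p. \<bar>f (n * p) - n * f p\<bar> \<le> C * \<bar>n\<bar> + E"
proof -
  obtain C where C: "0 \<le> C" "\<And>p q. \<bar>f (p + q) - f p - f q\<bar> \<le> C" "\<And>p. \<bar>f p + f (- p)\<bar> \<le> C"
    using assms by (rule AHE) (rule that)
  have nn: "\<bar>f (n * p) - n * f p\<bar> \<le> C * n + \<bar>f 0\<bar>" if "0 \<le> n" for n p
  proof (rule zint_nonneg_induct[OF that])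
    show "zprd (\<lambda>n. \<bar>f (n * p) - n * f p\<bar> \<le> C * n + \<bar>f 0\<bar>)" by (intro df zfnD[OF AH_zfn[OF assms]])
    fix n assume "\<bar>f (n * p) - n * f p\<bar> \<le> C * n + \<bar>f 0\<bar>"
    then have "\<bar>f (n * p + p) - n * f p - f p\<bar> \<le> C * n + \<bar>f 0\<bar> + C" using C(2)[of "n * p" p] by linarith
    then show "\<bar>f ((n + 1) * p) - (n + 1) * f p\<bar> \<le> C * (n + 1) + \<bar>f 0\<bar>" by (simp add: algebra_simps)
  qed simp
  have "\<bar>f (n * p) - n * f p\<bar> \<le> C * \<bar>n\<bar> + (\<bar>f 0\<bar> + C)" for n p
  proof (cases "0 \<le> n")
    case True
    then show ?thesis using nn[of n p] C(1) by simp
  next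
    case False
    then have "\<bar>f (- (n * p)) + n * f p\<bar> \<le> C * \<bar>n\<bar> + \<bar>f 0\<bar>" using nn[of "- n" p] by simp
    moreover have "\<bar>f (n * p) + f (- (n * p))\<bar> \<le> C" using C(3) .
    ultimately show ?thesis by linarith
  qed
  then show thesis using that[of C "\<bar>f 0\<bar> + C"] C(1) by simp
qed

text \<open>Both \<open>p * f (g p)\<close> and \<open>g p * f p\<close> differ from
  \<open>f (p * g p)\<close> by linear errors, and the same holds with \<open>f\<close> and
  \<open>g\<close> exchanged. Hence \<open>p\<close> times the difference of the two compositions
  grows at most linearly, and dividing by \<open>p\<close> leaves a constant.\<close>

lemma sim_comm:
  assumes "AH f" "AH g"
  shows "sim (\<lambda>p. f (g p)) (\<lambda>p. g (f p))"
proof -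
  obtain C E where C: "0 \<le> C" "0 \<le> E" "\<And>n p. \<bar>f (n * p) - n * f p\<bar> \<le> C * \<bar>n\<bar> + E" using assms(1) by (rule AH_mult) (rule that)
  obtain C' E' where C': "0 \<le> C'" "0 \<le> E'" "\<And>n p. \<bar>g (n * p) - n * g p\<bar> \<le> C' * \<bar>n\<bar> + E'" using assms(2) by (rule AH_mult) (rule that)
  obtain A B where A: "0 \<le> A" "0 \<le> B" "\<And>p. \<bar>f p\<bar> \<le> A * \<bar>p\<bar> + B" using assms(1) by (rule AH_linear) (rule that)
  obtain A' B' where A': "0 \<le> A'" "0 \<le> B'" "\<And>p. \<bar>g p\<bar> \<le> A' * \<bar>p\<bar> + B'" using assms(2) by (rule AH_linear) (rule that)
  let ?K = "C + C * A' + C' + C' * A" and ?L = "C * B' + C' * B + 2 * E + 2 * E'"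
  have K: "0 \<le> ?K" "0 \<le> ?L" using C C' A A' by simp_all
  have *: "\<bar>p\<bar> * \<bar>f (g p) - g (f p)\<bar> \<le> ?K * \<bar>p\<bar> + ?L" for p
  proof -
    have 1: "\<bar>f (p * g p) - p * f (g p)\<bar> \<le> C * \<bar>p\<bar> + E" "\<bar>f (p * g p) - g p * f p\<bar> \<le> C * \<bar>g p\<bar> + E"
      using C(3)[of p "g p"] C(3)[of "g p" p] by (simp_all add: mult.commute)
    have 2: "\<bar>g (p * f p) - p * g (f p)\<bar> \<le> C' * \<bar>p\<bar> + E'" "\<bar>g (p * f p) - f p * g p\<bar> \<le> C' * \<bar>f p\<bar> + E'"
      using C'(3)[of p "f p"] C'(3)[of "f p" p] by (simp_all add: mult.commute)
    have 3: "C * \<bar>g p\<bar> \<le> C * (A' * \<bar>p\<bar> + B')" using A'(3) C(1) by (rule mult_left_mono)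
    have 4: "C' * \<bar>f p\<bar> \<le> C' * (A * \<bar>p\<bar> + B)" using A(3) C'(1) by (rule mult_left_mono)
    have "\<bar>p * f (g p) - p * g (f p)\<bar> \<le> C * \<bar>p\<bar> + C * \<bar>g p\<bar> + C' * \<bar>p\<bar> + C' * \<bar>f p\<bar> + 2 * E + 2 * E'"
      using 1 2 mult.commute[of "g p" "f p"] by linarith
    also have "\<dots> \<le> ?K * \<bar>p\<bar> + ?L" using 3 4 by (simp add: algebra_simps)
    finally show ?thesis by (simp add: abs_mult[symmetric] right_diff_distrib)
  qed
  show ?thesis
  proof (rule simI)
    fix p
    show "\<bar>f (g p) - g (f p)\<bar> \<le> ?K + ?L + \<bar>f (g 0) - g (f 0)\<bar>"
    proof (cases "p = 0")
      case True
      then show ?thesis using K by simp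
    next
      case False
      then have p: "1 \<le> \<bar>p\<bar>" using zint_less_iff[of 0 "\<bar>p\<bar>"] by simp
      \<comment> \<open>Since \<open>p\<close> is a nonzero integer, the constant term
        \<open>?L\<close> is absorbed into a multiple of \<open>\<bar>p\<bar>\<close>, which is then
        cancelled.\<close>
      have "?L * 1 \<le> ?L * \<bar>p\<bar>" using p K(2) by (rule mult_left_mono)
      then have "\<bar>p\<bar> * \<bar>f (g p) - g (f p)\<bar> \<le> \<bar>p\<bar> * (?K + ?L)"
        using *[of p] by (simp add: algebra_simps)
      then have "\<bar>f (g p) - g (f p)\<bar> \<le> ?K + ?L" using p False by (subst (asm) mult_le_cancel_left_pos) auto
      then show ?thesis by (simp add: add_increasing2)
    qed
  qed
qed

section \<open>Positivity\<close>

text \<open>Positivity merely says that \<open>f\<close> is unbounded on the right. Once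
  \<open>f N\<close> exceeds the defect \<open>C\<close>, a step by \<open>N\<close> does not
  decrease \<open>f\<close>; so on nonnegative arguments \<open>f\<close> stays above
  \<open>- D\<close>, where \<open>D\<close> bounds it on the first \<open>N\<close> arguments.
  Starting from a point with value beyond \<open>b + C + D\<close>, it stays above
  \<open>b\<close>.\<close>

lemma pos_eventually:
  assumes "AH f" "pos f"
  obtains M where "0 \<le> M" "\<And>m. M \<le> m \<Longrightarrow> b \<le> f m"
proof -
  obtain C where C: "0 \<le> C" "\<And>p q. \<bar>f (p + q) - f p - f q\<bar> \<le> C" using assms(1) by (rule AHE) (rule that)
  obtain N where N: "0 \<le> N" "C < f N" using assms(2) unfolding pos_def by blast
  have "N \<noteq> 0"
  proof
    assume "N = 0"
    then show False using N C(2)[of 0 0] by simp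
  qed
  obtain D where D: "0 \<le> D" "\<And>d. \<bar>d\<bar> \<le> N \<Longrightarrow> \<bar>f d\<bar> \<le> D" using assms(1) by (rule AH_bounded) (rule that)
  have low: "- D \<le> f m" if "0 \<le> m" for m
  proof (rule zint_strong_induct[OF that])
    show "zprd (\<lambda>m. - D \<le> f m)" by (intro df zfnD[OF AH_zfn[OF assms(1)]])
    fix m :: "'v zint" assume m: "0 \<le> m" "\<And>w. 0 \<le> w \<Longrightarrow> w < m \<Longrightarrow> - D \<le> f w"
    show "- D \<le> f m"
    proof (cases "m \<le> N")
      case True
      then have "\<bar>m\<bar> \<le> N" using m(1) by simp
      from D(2)[OF this] show ?thesis by linarith
    next
      case False
      then have "- D \<le> f (m - N)" using m(2)[of "m - N"] N(1) \<open>N \<noteq> 0\<close> by simp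
      then show ?thesis using C(2)[of "m - N" N, unfolded diff_add_cancel] N(2) by linarith
    qed
  qed
  obtain M where M: "0 \<le> M" "b + C + D < f M" using assms(2) unfolding pos_def by blast
  have "b \<le> f m" if "M \<le> m" for m
  proof -
    have "0 \<le> m - M" using that by simp
    from low[OF this] show ?thesis using C(2)[of "m - M" M, unfolded diff_add_cancel] M(2) by linarith
  qed
  then show thesis using that M(1) by blast
qed

lemma pos_sim:
  assumes "pos f" "sim f g"
  shows "pos g"
proof -
  obtain C where C: "\<And>p. \<bar>f p - g p\<bar> \<le> C" using assms(2) by (rule simE) (rule that)
  show ?thesis unfolding pos_def
  proof
    fix b
    obtain m where "0 \<le> m" "b + C < f m" using assms(1) unfolding pos_def by blast
    moreover from this have "b < g m" using C[of m] by linarith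
    ultimately show "\<exists>m\<ge>0. b < g m" by blast
  qed
qed

lemma pos_not_sim_zero: "pos f \<Longrightarrow> \<not> sim f (\<lambda>p. 0)"
  unfolding pos_def sim_def by (metis abs_ge_self diff_zero leD le_less_trans order.trans)

text \<open>If neither sign is unbounded, \<open>f\<close> is bounded on the nonnegative integers,
  and the bound on \<open>f p + f (- p)\<close> extends this to all integers.\<close>

lemma pos_trichotomy:
  assumes "AH f"
  shows "sim f (\<lambda>p. 0) \<or> pos f \<or> pos (\<lambda>p. - f p)"
proof (rule ccontr)
  assume n: "\<not> ?thesis"
  then obtain a b where ab: "\<And>m. 0 \<le> m \<Longrightarrow> f m \<le> a" "\<And>m. 0 \<le> m \<Longrightarrow> - f m \<le> b"
    unfolding pos_def by (auto simp: not_less)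
  obtain C where C: "0 \<le> C" "\<And>p. \<bar>f p + f (- p)\<bar> \<le> C" using assms(1) by (rule AHE) (rule that)
  have "\<bar>f p - 0\<bar> \<le> \<bar>a\<bar> + \<bar>b\<bar> + C" for p
  proof (cases "0 \<le> p")
    case True
    then show ?thesis using ab[of p] C(1) by linarith
  next
    case False
    then have "0 \<le> - p" by simp
    from ab[OF this] show ?thesis using C(2)[of p] by linarith
  qed
  then have "sim f (\<lambda>p. 0)" by (rule simI)
  then show False using n by blast
qed

lemma pos_add:
  assumes "AH f" "AH g" "pos f" "pos g"
  shows "pos (\<lambda>p. f p + g p)"
  unfolding pos_def
proof
  fix b
  obtain M where M: "0 \<le> M" "\<And>m. M \<le> m \<Longrightarrow> b + 1 \<le> f m" using assms(1,3) by (rule pos_eventually) (rule that)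
  obtain N where N: "0 \<le> N" "\<And>m. N \<le> m \<Longrightarrow> 0 \<le> g m" using assms(2,4) by (rule pos_eventually) (rule that)
  have "b + 1 \<le> f (M + N) + g (M + N)" using M(2)[of "M + N"] N(2)[of "M + N"] M(1) N(1) by simp
  then have "b < f (M + N) + g (M + N)" by (meson less_add_one less_le_trans)
  moreover have "0 \<le> M + N" using M(1) N(1) by simp
  ultimately show "\<exists>m\<ge>0. b < f m + g m" by blast
qed

lemma pos_comp:
  assumes "AH f" "AH g" "pos f" "pos g"
  shows "pos (\<lambda>p. f (g p))"
  unfolding pos_def
proof
  fix b
  obtain M where M: "0 \<le> M" "\<And>m. M \<le> m \<Longrightarrow> b + 1 \<le> f m" using assms(1,3) by (rule pos_eventually) (rule that)
  obtain m where m: "0 \<le> m" "M < g m" using assms(4) unfolding pos_def by blast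
  have "b + 1 \<le> f (g m)" using M(2)[of "g m"] m by simp
  then have "b < f (g m)" by (meson less_add_one less_le_trans)
  then show "\<exists>m\<ge>0. b < f (g m)" using m(1) by blast
qed

text \<open>Dividing by the slope of \<open>f\<close> and rounding gives \<open>g\<close>, with
  \<open>f (g p)\<close> close to \<open>p\<close>. For the defect \<open>d\<close> of
  \<open>g\<close> at two arguments, both \<open>f d\<close> and \<open>f (- d)\<close> are then
  bounded; as \<open>f\<close> is eventually large, neither \<open>d\<close> nor \<open>- d\<close>
  can be large.\<close>

lemma pos_inverse:
  assumes "AH f" "pos f"
  obtains g where "AH g" "sim (\<lambda>p. f (g p)) (\<lambda>p. p)"
proof -
  obtain C where C: "0 \<le> C" "\<And>p q. \<bar>f (p + q) - f p - f q\<bar> \<le> C" "\<And>p. \<bar>f p + f (- p)\<bar> \<le> C"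
    using assms(1) by (rule AHE) (rule that)
  define h where "h p = zleast (\<lambda>n. 0 \<le> n \<and> p \<le> f n)" for p
  define g where "g p = (if 0 \<le> p then h p else - h (- p))" for p
  have zf: "zfn f" using assms(1) by (rule AH_zfn)
  have "zfn h" unfolding h_def by (intro df zfnD[OF zf])
  then have zg: "zfn g" unfolding g_def by (intro df zfnD[OF \<open>zfn h\<close>])
  have h: "0 \<le> h p" "p \<le> f (h p)" "\<And>m. 0 \<le> m \<Longrightarrow> p \<le> f m \<Longrightarrow> h p \<le> m" for p
  proof -
    have z: "zprd (\<lambda>n. 0 \<le> n \<and> p \<le> f n)" by (intro df zfnD[OF zf])
    obtain n where n: "0 \<le> n \<and> p \<le> f n" using assms(2) unfolding pos_def by (meson less_imp_le)
    from zleast[of "\<lambda>n. 0 \<le> n \<and> p \<le> f n", OF z _ n]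
    show "0 \<le> h p" "p \<le> f (h p)" "\<And>m. 0 \<le> m \<Longrightarrow> p \<le> f m \<Longrightarrow> h p \<le> m" unfolding h_def by blast+
  qed
  \<comment> \<open>Minimality gives \<open>f (h p - 1) < p\<close>, and the last step raises
    \<open>f\<close> by at most \<open>\<bar>f 1\<bar> + C\<close>; the term
    \<open>\<bar>f 0\<bar>\<close> is for the case \<open>h p = 0\<close>.\<close>
  let ?K = "\<bar>f 0\<bar> + \<bar>f 1\<bar> + C"
  have hK: "\<bar>f (h p) - p\<bar> \<le> ?K" if "0 \<le> p" for p
  proof (cases "h p = 0")
    case True
    then have "p \<le> f 0" using h(2)[of p] by simp
    then show ?thesis using True that C(1) abs_ge_zero[of "f 1"] by (simp only: True)
  next
    case False
    then have "0 \<le> h p - 1" using h(1)[of p] zint_less_iff[of 0 "h p"] by simp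
    then have "f (h p - 1) < p" using h(3)[of "h p - 1" p] by (force simp: not_le[symmetric])
    then show ?thesis using C(2)[of "h p - 1" 1, unfolded diff_add_cancel] h(2)[of p] abs_ge_zero[of "f 0"] by linarith
  qed
  let ?L = "?K + C"
  have gL: "\<bar>f (g p) - p\<bar> \<le> ?L" for p
  proof (cases "0 \<le> p")
    case True
    then show ?thesis using hK[of p] C(1) by (simp add: g_def)
  next
    case False
    then have "\<bar>f (h (- p)) - (- p)\<bar> \<le> ?K" using hK[of "- p"] by simp
    moreover have "g p = - h (- p)" using False by (simp add: g_def)
    ultimately show ?thesis using C(3)[of "h (- p)"] by (simp only:)
  qed
  define L where "L = ?L"
  have L: "\<bar>f (g p) - p\<bar> \<le> L" for p using gL unfolding L_def .
  \<comment> \<open>Three errors \<open>L\<close> come from the three values of \<open>g\<close> and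
    two defects \<open>C\<close> from splitting a sum of three terms; a third \<open>C\<close> pays
    for passing to \<open>- d\<close>, and 1 makes the inequality strict.\<close>
  obtain M where M: "0 \<le> M" "\<And>m. M \<le> m \<Longrightarrow> 3 * L + 3 * C + 1 \<le> f m" using assms by (rule pos_eventually) (rule that)
  have "\<bar>g (p + q) - g p - g q\<bar> \<le> M" for p q
  proof -
    let ?d = "g (p + q) - g p - g q"
    have "\<bar>f (?d + g q) - f ?d - f (g q)\<bar> \<le> C" "\<bar>f (?d + g q + g p) - f (?d + g q) - f (g p)\<bar> \<le> C"
      using C(2) by blast+
    moreover have "?d + g q + g p = g (p + q)" by simp
    ultimately have "\<bar>f ?d\<bar> \<le> 3 * L + 2 * C" using L[of p] L[of q] L[of "p + q"] by (simp only:)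
    moreover have "\<bar>f ?d + f (- ?d)\<bar> \<le> C" using C(3) .
    ultimately have "f ?d < 3 * L + 3 * C + 1" "f (- ?d) < 3 * L + 3 * C + 1"
      using C(1) zero_less_one[where 'a = "'v zint"] by linarith+
    then have "\<not> M \<le> ?d" "\<not> M \<le> - ?d" using M(2)[of ?d] M(2)[of "- ?d"] by (auto simp: not_le[symmetric])
    then show ?thesis by linarith
  qed
  then have "AH g" by (rule AHI[OF zg])
  moreover have "sim (\<lambda>p. f (g p)) (\<lambda>p. p)" using L by (rule simI)
  ultimately show thesis by (rule that)
qed

end

context nbg0
begin

section \<open>The Eudoxus reals of the model\<close>

text \<open>The translation from ranges between two integers of the model to bounds on absolute
  values in the type. Through it \<open>almost_hom\<close> and \<open>sim_sigma\<close> become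
  statements about HOL functions on integers.\<close>

lemma bounded_rep:
  assumes "\<And>i. i \<in> I \<Longrightarrow> F i = rep (\<phi> i)"
  shows "bounded_range U I F \<longleftrightarrow> (\<exists>C. \<forall>i \<in> I. \<bar>\<phi> i\<bar> \<le> C)"
proof
  assume "bounded_range U I F"
  then obtain x y where xy: "x \<in> ints U" "y \<in> ints U" and b: "\<forall>i \<in> I. int_le U x (F i) \<and> int_le U (F i) y"
    unfolding bounded_range_def by blast
  obtain a where a: "x = rep a" using xy(1) by (rule ints_repE)
  obtain c where c: "y = rep c" using xy(2) by (rule ints_repE)
  have "\<bar>\<phi> i\<bar> \<le> \<bar>a\<bar> + \<bar>c\<bar>" if "i \<in> I" for i
  proof -
    have "a \<le> \<phi> i" "\<phi> i \<le> c" using bspec[OF b that] assms[OF that] by (simp_all add: a c int_le_rep)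
    then show ?thesis by linarith
  qed
  then show "\<exists>C. \<forall>i \<in> I. \<bar>\<phi> i\<bar> \<le> C" by blast
next
  assume "\<exists>C. \<forall>i \<in> I. \<bar>\<phi> i\<bar> \<le> C"
  then obtain C where C: "\<forall>i \<in> I. \<bar>\<phi> i\<bar> \<le> C" by blast
  have "int_le U (rep (- C)) (F i) \<and> int_le U (F i) (rep C)" if "i \<in> I" for i
    using bspec[OF C that] assms[OF that] by (simp add: int_le_rep abs_le_iff minus_le_iff)
  then show "bounded_range U I F" unfolding bounded_range_def using rep_in by blast
qed

lemma almost_hom_rep:
  assumes "\<And>p. F (rep p) = rep (f p)"
  shows "almost_hom U F \<longleftrightarrow> (\<exists>C. \<forall>p q. \<bar>f (p + q) - f p - f q\<bar> \<le> C)"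
proof -
  have F: "F x = rep (f (ab x))" if "x \<in> ints U" for x using assms[of "ab x"] that by simp
  let ?\<phi> = "\<lambda>(x, y). f (ab x + ab y) - f (ab x) - f (ab y)"
  have "bounded_range U (ints U \<times> ints U) (\<lambda>(p, q). int_diff U (int_diff U (F (int_add U p q)) (F p)) (F q)) \<longleftrightarrow>
      (\<exists>C. \<forall>i \<in> ints U \<times> ints U. \<bar>?\<phi> i\<bar> \<le> C)"
  proof (rule bounded_rep)
    fix i assume "i \<in> ints U \<times> ints U"
    then obtain x y where i: "i = (x, y)" "x \<in> ints U" "y \<in> ints U" by blast
    obtain p where p: "x = rep p" using i(2) by (rule ints_repE)
    obtain q where q: "y = rep q" using i(3) by (rule ints_repE)
    show "(case i of (p, q) \<Rightarrow> int_diff U (int_diff U (F (int_add U p q)) (F p)) (F q)) = rep (?\<phi> i)"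
      unfolding i(1) p q by (simp add: int_add_rep int_diff_rep assms)
  qed
  also have "\<dots> \<longleftrightarrow> (\<exists>C. \<forall>p q. \<bar>f (p + q) - f p - f q\<bar> \<le> C)"
  proof
    assume "\<exists>C. \<forall>i \<in> ints U \<times> ints U. \<bar>?\<phi> i\<bar> \<le> C"
    then obtain C where C: "\<forall>i \<in> ints U \<times> ints U. \<bar>?\<phi> i\<bar> \<le> C" by blast
    have "\<bar>f (p + q) - f p - f q\<bar> \<le> C" for p q
      using bspec[OF C, of "(rep p, rep q)"] by simp
    then show "\<exists>C. \<forall>p q. \<bar>f (p + q) - f p - f q\<bar> \<le> C" by blast
  qed auto
  finally show ?thesis unfolding almost_hom_def using F by simp
qed

lemma sim_sigma_rep:
  assumes "\<And>p. F (rep p) = rep (f p)" "\<And>p. G (rep p) = rep (g p)"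
  shows "sim_sigma U F G \<longleftrightarrow> sim f g"
proof -
  have "sim_sigma U F G \<longleftrightarrow> (\<exists>C. \<forall>x \<in> ints U. \<bar>f (ab x) - g (ab x)\<bar> \<le> C)"
    unfolding sim_sigma_def
  proof (rule bounded_rep)
    fix x assume "x \<in> ints U"
    then obtain p where p: "x = rep p" by (rule ints_repE)
    show "int_diff U (F x) (G x) = rep (f (ab x) - g (ab x))"
      unfolding p by (simp add: int_diff_rep assms)
  qed
  also have "\<dots> \<longleftrightarrow> sim f g" unfolding sim_def by (metis ab_rep rep_in)
  finally show ?thesis .
qed

lemma app_rep:
  assumes "class_fun U (ints U) (ints U) (ext U g)"
  shows "app U (ext U g) (rep p) = rep (zap g p)"
  using app_eq_ap[OF assms rep_in] class_fun_ap(1)[OF assms rep_in] by (simp add: zap_def)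

lemma almost_homs_iff: "g \<in> almost_homs U \<longleftrightarrow>
    class_fun U (ints U) (ints U) (ext U g) \<and> (\<exists>C. \<forall>p q. \<bar>zap g (p + q) - zap g p - zap g q\<bar> \<le> C)"
  unfolding almost_homs_def using almost_hom_rep[where F = "app U (ext U g)" and f = "zap g", OF app_rep] by auto

lemma df_almost_homs [df]: "dt U t \<Longrightarrow> dfn U (\<lambda>e. t e \<in> almost_homs U)"
  by (rule dfn_subst1[where P = "\<lambda>g. g \<in> almost_homs U"]) (unfold almost_homs_iff, intro df)

lemma almost_homs_AH: "g \<in> almost_homs U \<Longrightarrow> AH (zap g)"
  unfolding almost_homs_iff AH_def using zfn_zap by blast

lemma zlam_almost_homs: "AH f \<Longrightarrow> zlam f \<in> almost_homs U"
  unfolding almost_homs_iff AH_def by (auto simp: zlam)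

lemma isset_almost_homs: "isset U (almost_homs U)"
proof (rule isset_funs[OF isset_ints isset_ints])
  show "dprd U (\<lambda>x. x \<in> almost_homs U)" by (intro df)
qed (simp add: almost_homs_iff)

definition rl :: "('v zint \<Rightarrow> 'v zint) \<Rightarrow> 'v" where
  "rl f = eudoxus U (\<lambda>x. rep (f (ab x)))"

lemma eudoxus_rep:
  assumes "\<And>p. F (rep p) = rep (f p)"
  shows "eudoxus U F = the_set U {g \<in> almost_homs U. sim f (zap g)}"
proof -
  have "sim_sigma U F (app U (ext U g)) \<longleftrightarrow> sim f (zap g)" if "g \<in> almost_homs U" for g
    by (rule sim_sigma_rep[where F = F and f = f and G = "app U (ext U g)" and g = "zap g", OF assms app_rep]) (use that almost_homs_iff in blast)
  then have "{g \<in> almost_homs U. sim_sigma U F (app U (ext U g))} = {g \<in> almost_homs U. sim f (zap g)}" by blast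
  then show ?thesis unfolding eudoxus_def by simp
qed

lemma eudoxus_rl: "(\<And>p. F (rep p) = rep (f p)) \<Longrightarrow> eudoxus U F = rl f"
  unfolding rl_def by (subst eudoxus_rep, assumption, subst eudoxus_rep[where f = f]) simp_all

lemma ext_rl:
  assumes "zfn f"
  shows "ext U (rl f) = {g \<in> almost_homs U. sim f (zap g)}"
proof -
  have "dprd U (\<lambda>g. sim f (zap g))" unfolding sim_def by (intro df zfnD[OF assms])
  from isset_sep[OF this isset_almost_homs] show ?thesis
    unfolding rl_def by (subst eudoxus_rep[where f = f]) (simp_all add: ext_the_set)
qed

lemma rl_mem: "AH f \<Longrightarrow> g \<in> ext U (rl f) \<longleftrightarrow> g \<in> almost_homs U \<and> sim f (zap g)"
  by (simp add: ext_rl AH_zfn)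

lemma zlam_rl: "AH f \<Longrightarrow> zlam f \<in> ext U (rl f)"
  by (simp add: rl_mem zlam_almost_homs zlam(3)[OF AH_zfn])

lemma rl_eq:
  assumes "AH f" "AH g"
  shows "rl f = rl g \<longleftrightarrow> sim f g"
proof
  assume "rl f = rl g"
  then have "zlam g \<in> ext U (rl f)" using zlam_rl assms by simp
  then show "sim f g" using assms by (simp add: rl_mem zlam(3)[OF AH_zfn])
next
  assume "sim f g"
  then have "sim f h \<longleftrightarrow> sim g h" for h using sim_trans sim_sym by blast
  then have "ext U (rl f) = ext U (rl g)" using assms by (auto simp: rl_mem)
  then show "rl f = rl g" by (simp add: ext_eq_iff)
qed

lemma reals_rl: "reals U = {rl f | f. AH f}"
proof -
  have "eudoxus U (app U (ext U f)) = rl (zap f)" if "f \<in> almost_homs U" for f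
    by (rule eudoxus_rl[where F = "app U (ext U f)" and f = "zap f", OF app_rep]) (use that almost_homs_iff in blast)
  moreover have "rl f = rl (zap (zlam f))" if "AH f" for f using zlam(3)[OF AH_zfn[OF that]] by simp
  ultimately show ?thesis
    unfolding reals_def using almost_homs_AH zlam_almost_homs by (auto; metis)
qed

lemma rl_reals [simp]: "AH f \<Longrightarrow> rl f \<in> reals U"
  unfolding reals_rl by blast

lemma realsE:
  assumes "x \<in> reals U"
  obtains f where "AH f" "x = rl f"
  using assms unfolding reals_rl by blast

lemma real_add_rl:
  assumes "AH f" "AH g"
  shows "real_add U (rl f) (rl g) = rl (\<lambda>p. f p + g p)"
  unfolding real_add_def
proof (rule the_equality)
  have h: "AH (\<lambda>p. f p + g p)" using assms by (rule AH_add)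
  have cf: "class_fun U (ints U) (ints U) (ext U (zlam f))" if "AH f" for f
    using zlam_almost_homs[OF that] almost_homs_iff by blast
  have "\<forall>p \<in> ints U. app U (ext U (zlam (\<lambda>p. f p + g p))) p = int_add U (app U (ext U (zlam f)) p) (app U (ext U (zlam g)) p)"
  proof
    fix p assume "p \<in> ints U"
    then obtain q where q: "p = rep q" by (rule ints_repE)
    show "app U (ext U (zlam (\<lambda>p. f p + g p))) p = int_add U (app U (ext U (zlam f)) p) (app U (ext U (zlam g)) p)"
      unfolding q app_rep[OF cf[OF h]] app_rep[OF cf[OF assms(1)]] app_rep[OF cf[OF assms(2)]]
        zlam(3)[OF AH_zfn[OF h]] zlam(3)[OF AH_zfn[OF assms(1)]] zlam(3)[OF AH_zfn[OF assms(2)]] int_add_rep ..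
  qed
  then show "rl (\<lambda>p. f p + g p) \<in> reals U \<and> (\<exists>f' \<in> ext U (rl f). \<exists>g' \<in> ext U (rl g). \<exists>h \<in> ext U (rl (\<lambda>p. f p + g p)).
     \<forall>p \<in> ints U. app U (ext U h) p = int_add U (app U (ext U f') p) (app U (ext U g') p))"
    using zlam_rl[OF h] zlam_rl[OF assms(1)] zlam_rl[OF assms(2)] rl_reals[OF h] by blast
  fix u assume u: "u \<in> reals U \<and> (\<exists>f \<in> ext U (rl f). \<exists>g \<in> ext U (rl g). \<exists>h \<in> ext U u.
     \<forall>p \<in> ints U. app U (ext U h) p = int_add U (app U (ext U f) p) (app U (ext U g) p))"
  then obtain k where k: "AH k" "u = rl k" using realsE by blast
  obtain f' g' k' where *: "f' \<in> ext U (rl f)" "g' \<in> ext U (rl g)" "k' \<in> ext U (rl k)"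
     "\<forall>p \<in> ints U. app U (ext U k') p = int_add U (app U (ext U f') p) (app U (ext U g') p)" using u k(2) by blast
  have s: "sim f (zap f')" "sim g (zap g')" "sim k (zap k')" and
    c: "class_fun U (ints U) (ints U) (ext U f')" "class_fun U (ints U) (ints U) (ext U g')" "class_fun U (ints U) (ints U) (ext U k')"
    using *(1-3) assms k(1) by (auto simp: rl_mem almost_homs_iff)
  have "zap k' q = zap f' q + zap g' q" for q
    using bspec[OF *(4) rep_in, of q] unfolding app_rep[OF c(1)] app_rep[OF c(2)] app_rep[OF c(3)] int_add_rep rep_eq .
  then have "zap k' = (\<lambda>q. zap f' q + zap g' q)" by blast
  then have "sim k (\<lambda>p. f p + g p)" using s(3) sim_sym[OF sim_add[OF s(1,2)]] sim_trans by simp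
  then show "u = rl (\<lambda>p. f p + g p)" using rl_eq[OF k(1) h] k(2) by simp
qed

lemma real_mult_rl:
  assumes "AH f" "AH g"
  shows "real_mult U (rl f) (rl g) = rl (\<lambda>p. f (g p))"
  unfolding real_mult_def
proof (rule the_equality)
  have h: "AH (\<lambda>p. f (g p))" using assms by (rule AH_comp)
  have cf: "class_fun U (ints U) (ints U) (ext U (zlam f))" if "AH f" for f
    using zlam_almost_homs[OF that] almost_homs_iff by blast
  have "\<forall>p \<in> ints U. app U (ext U (zlam (\<lambda>p. f (g p)))) p = app U (ext U (zlam f)) (app U (ext U (zlam g)) p)"
  proof
    fix p assume "p \<in> ints U"
    then obtain q where q: "p = rep q" by (rule ints_repE)
    show "app U (ext U (zlam (\<lambda>p. f (g p)))) p = app U (ext U (zlam f)) (app U (ext U (zlam g)) p)"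
      unfolding q app_rep[OF cf[OF h]] app_rep[OF cf[OF assms(1)]] app_rep[OF cf[OF assms(2)]]
        zlam(3)[OF AH_zfn[OF h]] zlam(3)[OF AH_zfn[OF assms(1)]] zlam(3)[OF AH_zfn[OF assms(2)]] ..
  qed
  then show "rl (\<lambda>p. f (g p)) \<in> reals U \<and> (\<exists>f' \<in> ext U (rl f). \<exists>g' \<in> ext U (rl g). \<exists>h \<in> ext U (rl (\<lambda>p. f (g p))).
     \<forall>p \<in> ints U. app U (ext U h) p = app U (ext U f') (app U (ext U g') p))"
    using zlam_rl[OF h] zlam_rl[OF assms(1)] zlam_rl[OF assms(2)] rl_reals[OF h] by blast
  fix u assume u: "u \<in> reals U \<and> (\<exists>f \<in> ext U (rl f). \<exists>g \<in> ext U (rl g). \<exists>h \<in> ext U u.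
     \<forall>p \<in> ints U. app U (ext U h) p = app U (ext U f) (app U (ext U g) p))"
  then obtain k where k: "AH k" "u = rl k" using realsE by blast
  obtain f' g' k' where *: "f' \<in> ext U (rl f)" "g' \<in> ext U (rl g)" "k' \<in> ext U (rl k)"
     "\<forall>p \<in> ints U. app U (ext U k') p = app U (ext U f') (app U (ext U g') p)" using u k(2) by blast
  have s: "sim f (zap f')" "sim g (zap g')" "sim k (zap k')" and
    c: "class_fun U (ints U) (ints U) (ext U f')" "class_fun U (ints U) (ints U) (ext U g')" "class_fun U (ints U) (ints U) (ext U k')"
    using *(1-3) assms k(1) by (auto simp: rl_mem almost_homs_iff)
  have "zap k' q = zap f' (zap g' q)" for q
    using bspec[OF *(4) rep_in, of q] unfolding app_rep[OF c(1)] app_rep[OF c(2)] app_rep[OF c(3)] rep_eq .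
  then have "zap k' = (\<lambda>q. zap f' (zap g' q))" by blast
  then have "sim k (\<lambda>p. f (g p))" using s(3) sim_sym[OF sim_comp[OF assms(1) s(1,2)]] sim_trans by simp
  then show "u = rl (\<lambda>p. f (g p))" using rl_eq[OF k(1) h] k(2) by simp
qed

lemma real_zero_rl: "real_zero U = rl (\<lambda>p. 0)"
  unfolding real_zero_def by (rule eudoxus_rl) simp

lemma real_one_rl: "real_one U = rl (\<lambda>p. p)"
  unfolding real_one_def by (rule eudoxus_rl) simp

lemma int_of_nat_rep: "(\<exists>m \<in> naturals U. P (int_of_nat U m)) \<longleftrightarrow> (\<exists>z\<ge>0. P (rep z))"
proof
  assume "\<exists>m \<in> naturals U. P (int_of_nat U m)"
  then obtain m where m: "m \<in> naturals U" "P (int_of_nat U m)" by blast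
  then have "rep (ab (int_of_nat U m)) = int_of_nat U m" by simp
  moreover from this have "0 \<le> ab (int_of_nat U m)" unfolding le_rep using m(1) ile_0_iff by auto
  ultimately show "\<exists>z\<ge>0. P (rep z)" using m(2) by metis
next
  assume "\<exists>z\<ge>0. P (rep z)"
  then obtain z where "0 \<le> z" "P (rep z)" by blast
  then show "\<exists>m \<in> naturals U. P (int_of_nat U m)" unfolding le_rep rep_0 using ile_0_iff[of "rep z"] by auto
qed

lemma real_pos_rl:
  assumes "AH f"
  shows "real_pos U (rl f) \<longleftrightarrow> pos f"
proof -
  have eq: "(\<forall>b \<in> ints U. \<exists>m \<in> naturals U. \<not> int_le U (app U (ext U g) (int_of_nat U m)) b) \<longleftrightarrow> pos (zap g)"
    if "g \<in> almost_homs U" for g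
  proof -
    have c: "class_fun U (ints U) (ints U) (ext U g)" using that almost_homs_iff by blast
    have "(\<forall>b \<in> ints U. \<exists>m \<in> naturals U. \<not> int_le U (app U (ext U g) (int_of_nat U m)) b) \<longleftrightarrow>
      (\<forall>b. \<exists>m \<in> naturals U. \<not> int_le U (app U (ext U g) (int_of_nat U m)) (rep b))"
      using ints_repE rep_in by metis
    also have "\<dots> \<longleftrightarrow> (\<forall>b. \<exists>m\<ge>0. \<not> int_le U (app U (ext U g) (rep m)) (rep b))"
      by (subst int_of_nat_rep) (rule refl)
    also have "\<dots> \<longleftrightarrow> pos (zap g)" unfolding app_rep[OF c] int_le_rep pos_def not_le ..
    finally show ?thesis .
  qed
  show ?thesis
  proof
    assume "real_pos U (rl f)"
    then obtain g where "g \<in> ext U (rl f)" "pos (zap g)"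
      unfolding real_pos_def using eq assms rl_mem by blast
    then show "pos f" using pos_sim sim_sym rl_mem[OF assms] by blast
  next
    assume "pos f"
    then have "pos (zap (zlam f))" using zlam(3)[OF AH_zfn[OF assms]] by simp
    then show "real_pos U (rl f)"
      unfolding real_pos_def using eq[OF zlam_almost_homs[OF assms]] zlam_rl[OF assms] rl_reals[OF assms] by blast
  qed
qed

lemma AH_diff: "AH f \<Longrightarrow> AH g \<Longrightarrow> AH (\<lambda>p. f p - g p)"
  using AH_add[of f "\<lambda>p. - g p"] AH_minus[of g] by simp

lemma real_le_rl:
  assumes "AH f" "AH g"
  shows "real_le U (rl f) (rl g) \<longleftrightarrow> sim f g \<or> pos (\<lambda>p. g p - f p)"
proof -
  have "(\<exists>d. real_pos U d \<and> real_add U (rl f) d = rl g) \<longleftrightarrow> pos (\<lambda>p. g p - f p)"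
  proof
    assume "\<exists>d. real_pos U d \<and> real_add U (rl f) d = rl g"
    then obtain d where d: "real_pos U d" "real_add U (rl f) d = rl g" by blast
    then obtain k where k: "AH k" "d = rl k" using realsE unfolding real_pos_def by blast
    then have "pos k" using d(1) real_pos_rl by blast
    have "sim (\<lambda>p. f p + k p) g" using d(2) k assms real_add_rl rl_eq AH_add by simp
    then obtain C where "\<And>p. \<bar>f p + k p - g p\<bar> \<le> C" by (rule simE) (rule that)
    then have "sim k (\<lambda>p. g p - f p)" by (intro simI[of _ _ C]) (simp add: algebra_simps)
    then show "pos (\<lambda>p. g p - f p)" using \<open>pos k\<close> pos_sim by blast
  next
    assume p: "pos (\<lambda>p. g p - f p)"
    have a: "AH (\<lambda>p. g p - f p)" using assms AH_diff by blast
    have "real_add U (rl f) (rl (\<lambda>p. g p - f p)) = rl g" using real_add_rl[OF assms(1) a] by simp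
    then show "\<exists>d. real_pos U d \<and> real_add U (rl f) d = rl g" using real_pos_rl[OF a] p by blast
  qed
  then show ?thesis unfolding real_le_def rl_eq[OF assms] by blast
qed

lemma sim_diff_zero: "sim (\<lambda>p. g p - f p) (\<lambda>p. 0) \<longleftrightarrow> sim f g"
  unfolding sim_def by (simp add: abs_minus_commute)

lemma ordered_field_reals: "ordered_field (real_struct U)"
proof -
  let ?R = "\<lparr>carrier = carr (real_struct U), monoid.mult = lmul (real_struct U), one = lone (real_struct U),
    zero = lzero (real_struct U), add = ladd (real_struct U)\<rparr>"
  note [simp] = real_struct_def AH_add AH_comp AH_zero AH_id AH_minus AH_diff real_zero_rl real_one_rl real_add_rl real_mult_rl
  have "abelian_group ?R"
  proof (rule abelian_groupI)
    fix x assume "x \<in> carrier ?R"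
    then obtain f where f: "AH f" "x = rl f" by (auto elim: realsE)
    then have "rl (\<lambda>p. - f p) \<oplus>\<^bsub>?R\<^esub> x = \<zero>\<^bsub>?R\<^esub>" by simp
    then show "\<exists>y \<in> carrier ?R. y \<oplus>\<^bsub>?R\<^esub> x = \<zero>\<^bsub>?R\<^esub>" using f by (intro bexI[of _ "rl (\<lambda>p. - f p)"]) simp_all
  qed (auto elim!: realsE simp: ac_simps)
  moreover have comm: "real_mult U (rl f) (rl g) = real_mult U (rl g) (rl f)" if "AH f" "AH g" for f g
    using that sim_comm[OF that] by (simp add: rl_eq)
  have "comm_monoid ?R"
    by (rule comm_monoidI) (auto elim!: realsE simp: comm simp del: real_mult_rl, auto)
  moreover have "(x \<oplus>\<^bsub>?R\<^esub> y) \<otimes>\<^bsub>?R\<^esub> z = x \<otimes>\<^bsub>?R\<^esub> z \<oplus>\<^bsub>?R\<^esub> y \<otimes>\<^bsub>?R\<^esub> z"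
    if "x \<in> carrier ?R" "y \<in> carrier ?R" "z \<in> carrier ?R" for x y z
    using that by (auto elim!: realsE)
  ultimately have "cring ?R" by (rule cringI)
  then interpret R: cring ?R .
  have pos1: "pos (\<lambda>p. p)" unfolding pos_def
    by (metis abs_ge_self abs_ge_zero add_nonneg_nonneg le_less_trans less_add_one zero_le_one)
  have "field ?R"
  proof (rule R.cring_fieldI2)
    show "\<zero>\<^bsub>?R\<^esub> \<noteq> \<one>\<^bsub>?R\<^esub>" using pos_not_sim_zero[OF pos1] sim_sym by (auto simp: rl_eq)
    fix a assume "a \<in> carrier ?R" "a \<noteq> \<zero>\<^bsub>?R\<^esub>"
    then obtain f where f: "AH f" "a = rl f" "\<not> sim f (\<lambda>p. 0)" by (auto elim!: realsE simp: rl_eq)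
    then consider "pos f" | "pos (\<lambda>p. - f p)" using pos_trichotomy by blast
    then obtain g where g: "AH g" "sim (\<lambda>p. f (g p)) (\<lambda>p. p)"
    proof cases
      case 1
      show thesis using pos_inverse[OF f(1) 1] that by blast
    next
      case 2
      \<comment> \<open>From an inverse \<open>g\<close> of the negative of \<open>f\<close> one
        gets the inverse \<open>- g\<close> of \<open>f\<close>, because \<open>f\<close> is odd up
        to a bounded error.\<close>
      obtain g where g: "AH g" "sim (\<lambda>p. - f (g p)) (\<lambda>p. p)" using pos_inverse[OF AH_minus[OF f(1)] 2] by blast
      obtain C where C: "\<And>p. \<bar>f p + f (- p)\<bar> \<le> C" using f(1) by (rule AHE) (rule that)
      obtain D where D: "\<And>p. \<bar>- f (g p) - p\<bar> \<le> D" using g(2) by (rule simE) (rule that)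
      have "\<bar>f (- g p) - p\<bar> \<le> C + D" for p using C[of "g p"] D[of p] by linarith
      then have "sim (\<lambda>p. f (- g p)) (\<lambda>p. p)" by (rule simI)
      then show thesis using that[of "\<lambda>p. - g p"] AH_minus[OF g(1)] by simp
    qed
    then have "a \<otimes>\<^bsub>?R\<^esub> rl g = \<one>\<^bsub>?R\<^esub>" using f by (simp add: rl_eq)
    then show "\<exists>b \<in> carrier ?R. a \<otimes>\<^bsub>?R\<^esub> b = \<one>\<^bsub>?R\<^esub>" using g(1) by (intro bexI[of _ "rl g"]) simp_all
  qed
  moreover have "\<forall>x \<in> reals U. real_le U x x" unfolding real_le_def by blast
  moreover have "\<forall>x \<in> reals U. \<forall>y \<in> reals U. real_le U x y \<longrightarrow> real_le U y x \<longrightarrow> x = y"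
  proof (intro ballI impI)
    fix x y assume "x \<in> reals U" "y \<in> reals U" and le: "real_le U x y" "real_le U y x"
    then obtain f g where f: "AH f" "x = rl f" and g: "AH g" "y = rl g" by (auto elim!: realsE)
    have "\<not> (pos (\<lambda>p. g p - f p) \<and> pos (\<lambda>p. f p - g p))"
      using pos_add[OF AH_diff[OF g(1) f(1)] AH_diff[OF f(1) g(1)]] unfolding pos_def by auto
    then show "x = y" using le sim_sym f g by (auto simp: real_le_rl rl_eq)
  qed
  moreover have "\<forall>x \<in> reals U. \<forall>y \<in> reals U. \<forall>z \<in> reals U. real_le U x y \<longrightarrow> real_le U y z \<longrightarrow> real_le U x z"
  proof (intro ballI impI)
    fix x y z assume "x \<in> reals U" "y \<in> reals U" "z \<in> reals U" and le: "real_le U x y" "real_le U y z"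
    then obtain f g h where f: "AH f" "x = rl f" and g: "AH g" "y = rl g" and h: "AH h" "z = rl h" by (auto elim!: realsE)
    show "real_le U x z"
    proof (cases "x = y \<or> y = z")
      case False
      then have "pos (\<lambda>p. g p - f p)" "pos (\<lambda>p. h p - g p)" using le f g h by (auto simp: real_le_rl rl_eq)
      from pos_add[OF AH_diff[OF g(1) f(1)] AH_diff[OF h(1) g(1)] this]
      show ?thesis using f h by (simp add: real_le_rl)
    qed (use le in auto)
  qed
  moreover have "\<forall>x \<in> reals U. \<forall>y \<in> reals U. real_le U x y \<or> real_le U y x"
  proof (intro ballI)
    fix x y assume "x \<in> reals U" "y \<in> reals U"
    then obtain f g where f: "AH f" "x = rl f" and g: "AH g" "y = rl g" by (auto elim!: realsE)
    show "real_le U x y \<or> real_le U y x"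
      using pos_trichotomy[OF AH_diff[OF g(1) f(1)]] f g sim_sym by (auto simp: real_le_rl sim_diff_zero)
  qed
  moreover have "\<forall>x \<in> reals U. \<forall>y \<in> reals U. \<forall>z \<in> reals U. real_le U x y \<longrightarrow> real_le U (real_add U x z) (real_add U y z)"
  proof (intro ballI impI)
    fix x y z assume "x \<in> reals U" "y \<in> reals U" "z \<in> reals U" and le: "real_le U x y"
    then obtain f g h where f: "AH f" "x = rl f" and g: "AH g" "y = rl g" and h: "AH h" "z = rl h" by (auto elim!: realsE)
    show "real_le U (real_add U x z) (real_add U y z)"
      using le f g h sim_add[of f g h h] by (auto simp: real_le_rl)
  qed
  moreover have "\<forall>x \<in> reals U. \<forall>y \<in> reals U. real_le U (real_zero U) x \<longrightarrow> real_le U (real_zero U) y \<longrightarrow>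
      real_le U (real_zero U) (real_mult U x y)"
  proof (intro ballI impI)
    fix x y assume "x \<in> reals U" "y \<in> reals U" and le: "real_le U (real_zero U) x" "real_le U (real_zero U) y"
    then obtain f g where f: "AH f" "x = rl f" and g: "AH g" "y = rl g" by (auto elim!: realsE)
    have le': "sim (\<lambda>p. 0) f \<or> pos f" "sim (\<lambda>p. 0) g \<or> pos g" using le f g by (auto simp: real_le_rl)
    have "sim (\<lambda>p. f (g p)) (\<lambda>p. 0)" if "sim f (\<lambda>p. 0)"
      using sim_comp[OF f(1) that sim_refl] by simp
    moreover have "sim (\<lambda>p. f (g p)) (\<lambda>p. 0)" if "sim g (\<lambda>p. 0)"
    proof -
      have "sim (\<lambda>p. f (g p)) (\<lambda>p. f 0)" using sim_comp[OF f(1) sim_refl that] .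
      moreover have "sim (\<lambda>p. f 0) (\<lambda>p. 0)" by (rule simI[of _ _ "\<bar>f 0\<bar>"]) simp
      ultimately show ?thesis by (rule sim_trans)
    qed
    ultimately have "sim (\<lambda>p. 0) (\<lambda>p. f (g p)) \<or> pos (\<lambda>p. f (g p))"
      using le' pos_comp[OF f(1) g(1)] sim_sym by blast
    then show "real_le U (real_zero U) (real_mult U x y)" using f g by (simp add: real_le_rl)
  qed
  ultimately have *: "field ?R" "\<forall>x \<in> reals U. real_le U x x"
      "\<forall>x \<in> reals U. \<forall>y \<in> reals U. real_le U x y \<longrightarrow> real_le U y x \<longrightarrow> x = y"
      "\<forall>x \<in> reals U. \<forall>y \<in> reals U. \<forall>z \<in> reals U. real_le U x y \<longrightarrow> real_le U y z \<longrightarrow> real_le U x z"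
      "\<forall>x \<in> reals U. \<forall>y \<in> reals U. real_le U x y \<or> real_le U y x"
      "\<forall>x \<in> reals U. \<forall>y \<in> reals U. \<forall>z \<in> reals U. real_le U x y \<longrightarrow> real_le U (real_add U x z) (real_add U y z)"
      "\<forall>x \<in> reals U. \<forall>y \<in> reals U. real_le U (real_zero U) x \<longrightarrow> real_le U (real_zero U) y \<longrightarrow>
        real_le U (real_zero U) (real_mult U x y)"
    by -
  have rs: "carr (real_struct U) = reals U" "lle (real_struct U) = real_le U" "lmul (real_struct U) = real_mult U"
    "ladd (real_struct U) = real_add U" "lone (real_struct U) = real_one U" "lzero (real_struct U) = real_zero U"
    unfolding real_struct_def by (simp_all del: real_zero_rl real_one_rl)
  show ?thesis unfolding ordered_field_def rs
    by (intro conjI) (rule *[unfolded rs])+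
qed

section \<open>Pairs of reals\<close>

text \<open>Recursion along the nonnegative integers of the model. Internal functions satisfying the
  equations up to \<open>n\<close> exist by internal induction and agree where they overlap;
  \<open>F\<close> reads off their common value, and its definability makes it internal.\<close>

lemma zint_recursion:
  assumes "dt U (\<lambda>e. rep (h (ab (e 0)) (ab (e 1))))"
  obtains N where "zap N 0 = a" "\<And>n. 0 \<le> n \<Longrightarrow> zap N (n + 1) = h n (zap N n)"
proof -
  define good where "good n g \<longleftrightarrow> zap g 0 = a \<and> (\<forall>m. 0 \<le> m \<longrightarrow> m < n \<longrightarrow> zap g (m + 1) = h m (zap g m))" for n g
  have zh: "zdt t \<Longrightarrow> zdt u \<Longrightarrow> zdt (\<lambda>e. h (t e) (u e))" for t u
    using dt_subst2[where f = "\<lambda>x y. rep (h (ab x) (ab y))" and t = "\<lambda>e. rep (t e)" and u = "\<lambda>e. rep (u e)", OF assms] by simp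
  have dg: "zdt t \<Longrightarrow> dt U u \<Longrightarrow> dfn U (\<lambda>e. good (t e) (u e))" for t u
  proof -
    have "dfn U (\<lambda>e. good (ab (e 0)) (e 1))" unfolding good_def by (intro df zh)
    from dfn_subst2[where P = "\<lambda>x y. good (ab x) y" and t = "\<lambda>e. rep (t e)", OF this]
    show "zdt t \<Longrightarrow> dt U u \<Longrightarrow> dfn U (\<lambda>e. good (t e) (u e))" by simp
  qed
  have ex: "\<exists>g. good n g" if "0 \<le> n" for n
  proof (rule zint_nonneg_induct[where P = "\<lambda>n. \<exists>g. good n g", OF that])
    show "zprd (\<lambda>n. \<exists>g. good n g)" by (intro df dg)
    have "zfn (\<lambda>_. a)" by (intro df)
    then have "good 0 (zlam (\<lambda>_. a))" unfolding good_def by (simp add: zlam(3) leD)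
    then show "\<exists>g. good 0 g" by blast
    fix n :: "'v zint" assume n: "0 \<le> n" and "\<exists>g. good n g"
    then obtain g where g: "good n g" by blast
    let ?g = "\<lambda>x. if x = n + 1 then h n (zap g n) else zap g x"
    have "zfn ?g" by (intro df)
    then have "zap (zlam ?g) = ?g" by (rule zlam)
    moreover have "n + 1 \<noteq> 0" using n by (metis add_nonneg_pos less_irrefl zero_less_one)
    moreover have "m < n \<or> m = n" if "m < n + 1" for m
      using zint_add1_le[OF that] by auto
    ultimately have "good (n + 1) (zlam ?g)"
      using g unfolding good_def by auto
    then show "\<exists>g. good (n + 1) g" by blast
  qed
  have uniq: "zap g n = zap g' n" if g: "good n g" and g': "good n g'" and n: "0 \<le> n" for n g g'
  proof -
    have "0 \<le> n \<longrightarrow> (\<forall>g g'. good n g \<longrightarrow> good n g' \<longrightarrow> zap g n = zap g' n)"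
      using n
    proof (rule zint_nonneg_induct[where P = "\<lambda>n. 0 \<le> n \<longrightarrow> (\<forall>g g'. good n g \<longrightarrow> good n g' \<longrightarrow> zap g n = zap g' n)"])
      show "zprd (\<lambda>n. 0 \<le> n \<longrightarrow> (\<forall>g g'. good n g \<longrightarrow> good n g' \<longrightarrow> zap g n = zap g' n))" by (intro df dg)
      fix n :: "'v zint" assume "0 \<le> n" and IH: "0 \<le> n \<longrightarrow> (\<forall>g g'. good n g \<longrightarrow> good n g' \<longrightarrow> zap g n = zap g' n)"
      show "0 \<le> n + 1 \<longrightarrow> (\<forall>g g'. good (n + 1) g \<longrightarrow> good (n + 1) g' \<longrightarrow> zap g (n + 1) = zap g' (n + 1))"
      proof (intro impI allI)
        fix g g' assume g: "good (n + 1) g" and g': "good (n + 1) g'"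
        have "good n g" "good n g'" using g g' unfolding good_def by (auto intro: less_trans[OF _ less_add_one])
        then have "zap g n = zap g' n" using IH \<open>0 \<le> n\<close> by blast
        then show "zap g (n + 1) = zap g' (n + 1)" using g g' \<open>0 \<le> n\<close> unfolding good_def by simp
      qed
    qed (simp add: good_def)
    then show ?thesis using g g' n by blast
  qed
  define F where "F n = ab (wl U (\<lambda>y. \<exists>g. good n g \<and> y = rep (zap g n)))" for n
  have F: "F n = zap g n" if g: "good n g" and n: "0 \<le> n" for n g
  proof -
    have "wl U (\<lambda>y. \<exists>g. good n g \<and> y = rep (zap g n)) = rep (zap g n)"
    proof (rule wl_eq)
      show "\<exists>g'. good n g' \<and> rep (zap g n) = rep (zap g' n)" using g by blast
      fix y assume "\<exists>g. good n g \<and> y = rep (zap g n)"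
      then obtain g' where "good n g'" "y = rep (zap g' n)" by blast
      then show "y = rep (zap g n)" using uniq[OF g _ n] by simp
    qed
    then show ?thesis unfolding F_def by simp
  qed
  have zF: "zfn F" unfolding F_def by (intro df dg)
  show thesis
  proof (rule that[of "zlam F"])
    obtain g where "good 0 g" using ex[of 0] by auto
    then show "zap (zlam F) 0 = a" unfolding zlam(3)[OF zF] using F[of 0 g] by (simp add: good_def)
    fix n :: "'v zint" assume n: "0 \<le> n"
    then have n1: "0 \<le> n + 1" by simp
    obtain g where g: "good (n + 1) g" using ex[OF n1] by blast
    then have g': "good n g" unfolding good_def by (auto intro: less_trans[OF _ less_add_one])
    show "zap (zlam F) (n + 1) = h n (zap (zlam F) n)"
      unfolding zlam(3)[OF zF] F[OF g n1] F[OF g' n] using g n unfolding good_def by simp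
  qed
qed

text \<open>Nonnegative integers go to even numbers and negative integers to odd ones.\<close>

definition enc :: "'v zint \<Rightarrow> 'v zint" where "enc a = (if 0 \<le> a then 2 * a else - 2 * a - 1)"
text \<open>An injection of the pairs of integers into the nonnegative integers. With
  \<open>s\<close> the sum of the two codes, the number lies from the square of \<open>s\<close> up
  to below the next square, so \<open>s\<close> can be recovered from it, and then both
  codes.\<close>

definition kap :: "'v zint \<Rightarrow> 'v zint \<Rightarrow> 'v zint" where
  "kap a b = (enc a + enc b) * (enc a + enc b) + enc a"

lemma zint_neg_le: "\<not> 0 \<le> (a :: 'v zint) \<Longrightarrow> a \<le> - 1"
  using zint_add1_le[of a 0] by simp

lemma enc_nonneg: "0 \<le> enc a"
  unfolding enc_def using zint_neg_le[of a] by (auto; linarith)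

lemma zint_odd: "2 * (a :: 'v zint) \<noteq> - 1" "2 * (a :: 'v zint) \<noteq> 1"
proof -
  have "a \<le> - 1 \<or> 0 \<le> a" "a \<le> 0 \<or> 1 \<le> a" using zint_neg_le[of a] zint_discrete[of a] by auto
  then show "2 * a \<noteq> - 1" "2 * a \<noteq> 1" by linarith+
qed

lemma enc_inj: "enc a = enc b \<Longrightarrow> a = b"
proof -
  assume eq: "enc a = enc b"
  have "2 * (a + b) \<noteq> - 1" by (rule zint_odd)
  then have "2 * a + 2 * b \<noteq> - 1" by (simp add: distrib_left)
  then show "a = b" using eq unfolding enc_def by (auto split: if_splits simp: algebra_simps)
qed

lemma kap_nonneg: "0 \<le> kap a b"
  unfolding kap_def using enc_nonneg by simp

lemma kap_inj:
  assumes "kap a b = kap c d"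
  shows "a = c \<and> b = d"
proof -
  have less: "s * s + x < t * t + y" if "s + 1 \<le> t" "0 \<le> x" "x \<le> s" "0 \<le> y" for s t x y :: "'v zint"
  proof -
    have "(s + 1) * (s + 1) \<le> t * t" using that by (intro mult_mono) auto
    then show ?thesis using that by (simp add: algebra_simps)
  qed
  let ?s = "enc a + enc b" and ?t = "enc c + enc d"
  have "?s = ?t"
  proof (rule ccontr)
    assume "?s \<noteq> ?t"
    then have "?s + 1 \<le> ?t \<or> ?t + 1 \<le> ?s" using zint_add1_le by (metis linorder_neqE)
    then show False
      using less[of ?s ?t "enc a" "enc c"] less[of ?t ?s "enc c" "enc a"] assms enc_nonneg unfolding kap_def by auto
  qed
  then have "enc a = enc c" "enc b = enc d" using assms unfolding kap_def by auto
  then show ?thesis using enc_inj by blast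
qed

lemma zdt_kap [df]: "zdt t \<Longrightarrow> zdt u \<Longrightarrow> zdt (\<lambda>e. kap (t e) (u e))"
proof -
  have "dt U (\<lambda>e. rep (kap (ab (e 0)) (ab (e 1))))" unfolding kap_def enc_def by (intro df)
  from dt_subst2[where f = "\<lambda>x y. rep (kap (ab x) (ab y))" and t = "\<lambda>e. rep (t e)" and u = "\<lambda>e. rep (u e)", OF this]
  show "zdt t \<Longrightarrow> zdt u \<Longrightarrow> zdt (\<lambda>e. kap (t e) (u e))" by simp
qed

text \<open>A canonical representative of a real; through it the real is determined by the graph of
  a single function, a set of pairs of integers.\<close>

definition crep :: "'v \<Rightarrow> 'v" where "crep x = wl U (\<lambda>f. f \<in> ext U x)"

lemma df_crep [df]: "dt U t \<Longrightarrow> dt U (\<lambda>e. crep (t e))"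
  by (rule dt_subst1[where f = crep]) (unfold crep_def, intro df)

lemma crep: assumes "x \<in> reals U" shows "rl (zap (crep x)) = x"
proof -
  obtain f where f: "AH f" "x = rl f" using assms by (rule realsE)
  have "dprd U (\<lambda>f. f \<in> ext U x)" by (intro df)
  from wl_props(1)[OF this] zlam_rl[OF f(1)] have "crep x \<in> ext U (rl f)" unfolding crep_def f(2) by blast
  then have "crep x \<in> almost_homs U" "sim f (zap (crep x))" using rl_mem[OF f(1)] by auto
  then show ?thesis using rl_eq[OF almost_homs_AH f(1)] sim_sym f(2) by blast
qed

definition graphd :: "'v \<Rightarrow> 'v zint \<Rightarrow> bool" where
  "graphd f n \<longleftrightarrow> (\<exists>a. n = kap a (zap f a))"

text \<open>The digit at position \<open>n\<close> tells which of the graphs of the representatives of \<open>x\<close> and \<open>y\<close>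
  contain the pair with number \<open>n\<close>.  To the base 7, digits below 4 determine the real.\<close>

definition digit :: "'v \<Rightarrow> 'v \<Rightarrow> 'v zint \<Rightarrow> 'v zint" where
  "digit x y n = (if graphd (crep x) n then 1 else 0) + (if graphd (crep y) n then 2 else 0)"

lemma df_graphd [df]: "dt U t \<Longrightarrow> zdt u \<Longrightarrow> dfn U (\<lambda>e. graphd (t e) (u e))"
proof -
  have "dfn U (\<lambda>e. graphd (e 0) (ab (e 1)))" unfolding graphd_def by (intro df)
  from dfn_subst2[where P = "\<lambda>x y. graphd x (ab y)" and t = t and u = "\<lambda>e. rep (u e)", OF this]
  show "dt U t \<Longrightarrow> zdt u \<Longrightarrow> dfn U (\<lambda>e. graphd (t e) (u e))" by simp
qed

lemma digit_bounds: "0 \<le> digit x y n" "digit x y n \<le> 3"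
  unfolding digit_def by auto

lemma digit_inj:
  assumes "digit x y n = digit x' y' n"
  shows "graphd (crep x) n = graphd (crep x') n \<and> graphd (crep y) n = graphd (crep y') n"
  using assms unfolding digit_def by (auto split: if_splits)

text \<open>In the reals, \<open>z\<close> is the sum of the terms
  \<open>digit x y n / 7^(n+1)\<close>. Here \<open>B n\<close> is \<open>7^n\<close> and
  \<open>N n\<close> is the integer written by the first \<open>n\<close> digits; an almost
  homomorphism for \<open>z\<close> sends \<open>7^n\<close> to that integer up to a bounded error.
  The recursions are stated through existentially quantified internal functions, which keeps the
  relation definable.\<close>

definition pcode :: "'v \<Rightarrow> 'v \<Rightarrow> 'v \<Rightarrow> bool" where
  "pcode z x y \<longleftrightarrow> (\<exists>N B. zap N 0 = 0 \<and> (\<forall>n. 0 \<le> n \<longrightarrow> zap N (n + 1) = 7 * zap N n + digit x y n) \<and>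
     zap B 0 = 1 \<and> (\<forall>n. 0 \<le> n \<longrightarrow> zap B (n + 1) = 7 * zap B n) \<and>
     (\<exists>f \<in> ext U z. \<exists>C. \<forall>n. 0 \<le> n \<longrightarrow> \<bar>zap f (zap B n) - zap N n\<bar> \<le> C))"

lemma df_pcode [df]: "dt U t \<Longrightarrow> dt U u \<Longrightarrow> dt U v \<Longrightarrow> dfn U (\<lambda>e. pcode (t e) (u e) (v e))"
  by (rule dfn_subst3[where P = pcode]) (unfold pcode_def digit_def, intro df)

text \<open>The difference \<open>D\<close> of the two truncated expansions is bounded, since both
  approximate the same real. A first nonzero digit difference would make \<open>D\<close> nonzero,
  after which it would grow without bound; so all digits agree, and they contain the graphs of the
  representatives.\<close>

lemma pcode_unique:
  assumes z: "z \<in> reals U" and x: "x \<in> reals U" "x' \<in> reals U" "y \<in> reals U" "y' \<in> reals U"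
    and c: "pcode z x y" "pcode z x' y'"
  shows "x = x' \<and> y = y'"
proof -
  obtain k where k: "AH k" "z = rl k" using z by (rule realsE)
  obtain N B f C where 1: "zap N 0 = 0" "\<forall>n. 0 \<le> n \<longrightarrow> zap N (n + 1) = 7 * zap N n + digit x y n"
     "zap B 0 = 1" "\<forall>n. 0 \<le> n \<longrightarrow> zap B (n + 1) = 7 * zap B n" "f \<in> ext U z"
     "\<forall>n. 0 \<le> n \<longrightarrow> \<bar>zap f (zap B n) - zap N n\<bar> \<le> C"
    using c(1) unfolding pcode_def by blast
  obtain N' B' f' C' where 2: "zap N' 0 = 0" "\<forall>n. 0 \<le> n \<longrightarrow> zap N' (n + 1) = 7 * zap N' n + digit x' y' n"
     "zap B' 0 = 1" "\<forall>n. 0 \<le> n \<longrightarrow> zap B' (n + 1) = 7 * zap B' n" "f' \<in> ext U z"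
     "\<forall>n. 0 \<le> n \<longrightarrow> \<bar>zap f' (zap B' n) - zap N' n\<bar> \<le> C'"
    using c(2) unfolding pcode_def by blast
  have BB: "zap B n = zap B' n" if "0 \<le> n" for n
    by (rule zint_nonneg_induct[where P = "\<lambda>n. zap B n = zap B' n", OF that]) (intro df, use 1 2 in auto)
  have "sim (zap f) (zap f')" using 1(5) 2(5) sim_trans[OF sim_sym] unfolding k(2) rl_mem[OF k(1)] by blast
  then obtain K where K: "\<And>p. \<bar>zap f p - zap f' p\<bar> \<le> K" by (rule simE) (rule that)
  define D where "D n = zap N n - zap N' n" for n
  define d where "d n = digit x y n - digit x' y' n" for n
  have zD: "zfn D" unfolding D_def by (intro df)
  have Dbound: "\<bar>D n\<bar> \<le> C + C' + K" if n: "0 \<le> n" for n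
    using 1(6)[rule_format, OF n] 2(6)[rule_format, OF n] K[of "zap B n"] BB[OF n] unfolding D_def by (simp only:)
  have Dstep: "D (n + 1) = 7 * D n + d n" if "0 \<le> n" for n
    using 1(2)[rule_format, OF that] 2(2)[rule_format, OF that] unfolding D_def d_def by (simp add: algebra_simps)
  have d3: "\<bar>d n\<bar> \<le> 3" for n
    using digit_bounds[of x y n] digit_bounds[of x' y' n] unfolding d_def by linarith
  \<comment> \<open>With digit differences of size at most 3 and \<open>x = \<bar>D n\<bar>\<close>,
    this is \<open>7 * x - 3 \<ge> x + 1\<close> for \<open>x \<ge> 1\<close>.\<close>
  have step: "\<bar>D n\<bar> + 1 \<le> \<bar>D (n + 1)\<bar>" if "0 \<le> n" "1 \<le> \<bar>D n\<bar>" for n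
    unfolding Dstep[OF that(1)] using d3[of n] that(2) by linarith
  have d0: "d n = 0" if n: "0 \<le> n" for n
  proof (rule ccontr)
    assume "d n \<noteq> 0"
    have "D (n + 1) \<noteq> 0"
    proof
      assume "D (n + 1) = 0"
      then have "7 * D n + d n = 0" using Dstep[OF n] by simp
      moreover from this have "D n \<noteq> 0" using \<open>d n \<noteq> 0\<close> by auto
      then have "1 \<le> \<bar>D n\<bar>" using zint_add1_le[of 0 "\<bar>D n\<bar>"] by simp
      ultimately show False using d3[of n] by linarith
    qed
    then have one: "1 \<le> \<bar>D (n + 1)\<bar>" using zint_add1_le[of 0 "\<bar>D (n + 1)\<bar>"] by simp
    have grow: "m + 1 \<le> \<bar>D (n + 1 + m)\<bar>" if m: "0 \<le> m" for m
    proof (rule zint_nonneg_induct[where P = "\<lambda>m. m + 1 \<le> \<bar>D (n + 1 + m)\<bar>", OF m])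
      show "zprd (\<lambda>m. m + 1 \<le> \<bar>D (n + 1 + m)\<bar>)" by (intro df zfnD[OF zD])
      show "0 + 1 \<le> \<bar>D (n + 1 + 0)\<bar>" using one by simp
      fix m :: "'v zint" assume m: "0 \<le> m" "m + 1 \<le> \<bar>D (n + 1 + m)\<bar>"
      have "\<bar>D (n + 1 + m)\<bar> + 1 \<le> \<bar>D (n + 1 + m + 1)\<bar>" by (rule step) (use n m in auto)
      then show "m + 1 + 1 \<le> \<bar>D (n + 1 + (m + 1))\<bar>" using m(2) by (simp only: add.assoc)
    qed
    have "0 \<le> C + C' + K" using Dbound[OF n] by linarith
    from grow[OF this] have "C + C' + K + 1 \<le> C + C' + K"
      using Dbound[of "n + 1 + (C + C' + K)"] n \<open>0 \<le> C + C' + K\<close> by simp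
    then show False by simp
  qed
  have "graphd (crep x) n = graphd (crep x') n \<and> graphd (crep y) n = graphd (crep y') n" if "0 \<le> n" for n
    by (rule digit_inj) (use d0[OF that] in \<open>simp add: d_def\<close>)
  then have g: "graphd (crep x) (kap a b) = graphd (crep x') (kap a b) \<and> graphd (crep y) (kap a b) = graphd (crep y') (kap a b)" for a b
    using kap_nonneg by blast
  have gk: "graphd f (kap a b) \<longleftrightarrow> zap f a = b" for f a b
    unfolding graphd_def using kap_inj by metis
  have "zap (crep x) = zap (crep x')" "zap (crep y) = zap (crep y')" using g unfolding gk by auto
  then show ?thesis using crep x by metis
qed

text \<open>For each combination of signs, moving the negative terms to the other side turns the
  defect into one at nonnegative arguments.\<close>

lemma AH_odd:
  assumes "zfn f" and f: "\<And>p q. 0 \<le> p \<Longrightarrow> 0 \<le> q \<Longrightarrow> \<bar>f (p + q) - f p - f q\<bar> \<le> 1"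
  shows "AH (\<lambda>p. if 0 \<le> p then f p else - f (- p))" (is "AH ?F")
proof (rule AHI)
  show "zfn ?F" by (intro df zfnD[OF assms(1)])
  fix p q :: "'v zint"
  have e: "p + q + - q = p" "p + q + - p = q" "- (p + q) + p = - q" "- (p + q) + q = - p" "- (p + q) = - p + - q" by simp_all
  consider "0 \<le> p" "0 \<le> q" | "0 \<le> p" "\<not> 0 \<le> q" "0 \<le> p + q" | "\<not> 0 \<le> p" "0 \<le> q" "0 \<le> p + q"
    | "0 \<le> p" "\<not> 0 \<le> q" "\<not> 0 \<le> p + q" | "\<not> 0 \<le> p" "0 \<le> q" "\<not> 0 \<le> p + q"
    | "\<not> 0 \<le> p" "\<not> 0 \<le> q" by blast
  then show "\<bar>?F (p + q) - ?F p - ?F q\<bar> \<le> 1"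
  proof cases
    case 1
    then show ?thesis using f[of p q] by simp
  next
    case 2
    then have "\<bar>f p - f (p + q) - f (- q)\<bar> \<le> 1" using f[of "p + q" "- q"] unfolding e by simp
    moreover have "?F (p + q) = f (p + q)" "?F p = f p" "?F q = - f (- q)" using 2 by simp_all
    ultimately show ?thesis by linarith
  next
    case 3
    then have "\<bar>f q - f (p + q) - f (- p)\<bar> \<le> 1" using f[of "p + q" "- p"] unfolding e by simp
    moreover have "?F (p + q) = f (p + q)" "?F p = - f (- p)" "?F q = f q" using 3 by simp_all
    ultimately show ?thesis by linarith
  next
    case 4
    then have "\<bar>f (- q) - f (- (p + q)) - f p\<bar> \<le> 1" using f[of "- (p + q)" p] unfolding e(3) by simp
    moreover have "?F (p + q) = - f (- (p + q))" "?F p = f p" "?F q = - f (- q)" using 4 by simp_all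
    ultimately show ?thesis by linarith
  next
    case 5
    then have "\<bar>f (- p) - f (- (p + q)) - f q\<bar> \<le> 1" using f[of "- (p + q)" q] unfolding e(4) by simp
    moreover have "?F (p + q) = - f (- (p + q))" "?F p = - f (- p)" "?F q = f q" using 5 by simp_all
    ultimately show ?thesis by linarith
  next
    case 6
    then have "\<bar>f (- (p + q)) - f (- p) - f (- q)\<bar> \<le> 1" using f[of "- p" "- q"] unfolding e(5) by simp
    moreover have "?F (p + q) = - f (- (p + q))" using 6 by (simp add: not_le add_neg_neg)
    moreover have "?F p = - f (- p)" "?F q = - f (- q)" using 6 by simp_all
    ultimately show ?thesis by linarith
  qed
qed

text \<open>The code is the supremum of the fractions \<open>v n / b n\<close>. By
  \<open>mono\<close> they increase, and by \<open>upper\<close> they stay below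
  \<open>(v n + 1) / b n\<close>. An almost homomorphism for the supremum sends \<open>p\<close> to
  the largest \<open>q\<close> whose quotient by \<open>p\<close> is at most one of the fractions;
  at \<open>p = b n\<close> the two estimates confine this \<open>q\<close> to distance 1 from
  \<open>v n\<close>.\<close>

lemma ex_pcode: "\<exists>z \<in> reals U. pcode z x y"
proof -
  let ?d = "digit x y"
  have "dt U (\<lambda>e. rep (7 * ab (e 1) + digit x y (ab (e 0))))" unfolding digit_def by (intro df)
  then obtain N where N: "zap N 0 = 0" "\<And>n. 0 \<le> n \<Longrightarrow> zap N (n + 1) = 7 * zap N n + ?d n"
    using zint_recursion[of "\<lambda>n v. 7 * v + ?d n" 0] by blast
  have "dt U (\<lambda>e. rep (7 * ab (e 1)))" by (intro df)
  then obtain B where B: "zap B 0 = 1" "\<And>n. 0 \<le> n \<Longrightarrow> zap B (n + 1) = 7 * zap B n"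
    using zint_recursion[of "\<lambda>n v. 7 * v" 1] by blast
  define b where "b = zap B"
  define v where "v = zap N"
  have zb: "zfn b" and zv: "zfn v" unfolding b_def v_def by (rule zfn_zap)+
  have b0: "b 0 = 1" and bS: "\<And>n. 0 \<le> n \<Longrightarrow> b (n + 1) = 7 * b n" using B by (auto simp: b_def)
  have v0: "v 0 = 0" and vS: "\<And>n. 0 \<le> n \<Longrightarrow> v (n + 1) = 7 * v n + ?d n" using N by (auto simp: v_def)
  have bpos: "1 \<le> b n" if "0 \<le> n" for n
  proof (rule zint_nonneg_induct[where P = "\<lambda>n. 1 \<le> b n", OF that])
    show "zprd (\<lambda>n. 1 \<le> b n)" by (intro df zfnD[OF zb])
  qed (auto simp: b0 bS)
  have vnn: "0 \<le> v n" if "0 \<le> n" for n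
  proof (rule zint_nonneg_induct[where P = "\<lambda>n. 0 \<le> v n", OF that])
    show "zprd (\<lambda>n. 0 \<le> v n)" by (intro df zfnD[OF zv])
  qed (auto simp: v0 vS digit_bounds)
  have mono: "v n * b (n + m) \<le> v (n + m) * b n" if n: "0 \<le> n" and m: "0 \<le> m" for n m
  proof (rule zint_nonneg_induct[where P = "\<lambda>m. v n * b (n + m) \<le> v (n + m) * b n", OF m])
    show "zprd (\<lambda>m. v n * b (n + m) \<le> v (n + m) * b n)" by (intro df zfnD[OF zb] zfnD[OF zv])
    fix m :: "'v zint" assume m: "0 \<le> m" and IH: "v n * b (n + m) \<le> v (n + m) * b n"
    have "0 \<le> n + m" using n m by simp
    then have "b (n + (m + 1)) = 7 * b (n + m)" "v (n + (m + 1)) = 7 * v (n + m) + ?d (n + m)"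
      using bS[of "n + m"] vS[of "n + m"] by (simp_all add: add.assoc)
    moreover have "0 \<le> ?d (n + m) * b n" using digit_bounds bpos[OF n] by simp
    ultimately show "v n * b (n + (m + 1)) \<le> v (n + (m + 1)) * b n" using IH by (simp add: algebra_simps)
  qed simp
  have upper: "v (n + m) * b n + b n \<le> (v n + 1) * b (n + m)" if n: "0 \<le> n" and m: "0 \<le> m" for n m
  proof (rule zint_nonneg_induct[where P = "\<lambda>m. v (n + m) * b n + b n \<le> (v n + 1) * b (n + m)", OF m])
    show "zprd (\<lambda>m. v (n + m) * b n + b n \<le> (v n + 1) * b (n + m))" by (intro df zfnD[OF zb] zfnD[OF zv])
    fix m :: "'v zint" assume m: "0 \<le> m" and IH: "v (n + m) * b n + b n \<le> (v n + 1) * b (n + m)"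
    have "0 \<le> n + m" using n m by simp
    then have "b (n + (m + 1)) = 7 * b (n + m)" "v (n + (m + 1)) = 7 * v (n + m) + ?d (n + m)"
      using bS[of "n + m"] vS[of "n + m"] by (simp_all add: add.assoc)
    moreover have "?d (n + m) * b n \<le> 3 * b n" using digit_bounds bpos[OF n] by (intro mult_right_mono) auto
    moreover have "0 \<le> b n" using bpos[OF n] by simp
    ultimately show "v (n + (m + 1)) * b n + b n \<le> (v n + 1) * b (n + (m + 1))" using IH by (simp add: algebra_simps)
  qed (simp add: algebra_simps)
  have up: "v n * b k \<le> (v k + 1) * b n" if nk: "0 \<le> n" "0 \<le> k" for n k
  proof (cases "n \<le> k")
    case True
    then have "v n * b k \<le> v k * b n" using mono[of n "k - n"] nk by simp
    moreover have "0 \<le> b n" using bpos[OF nk(1)] by simp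
    ultimately show ?thesis by (simp add: algebra_simps)
  next
    case False
    then have "v n * b k + b k \<le> (v k + 1) * b n" using upper[of k "n - k"] nk by simp
    moreover have "0 \<le> b k" using bpos[OF nk(2)] by simp
    ultimately show ?thesis by simp
  qed
  have vb: "v n \<le> b n" if n: "0 \<le> n" for n
    using up[of n 0] n by (simp add: b0 v0)
  define S where "S p q \<longleftrightarrow> (\<exists>n\<ge>0. q * b n \<le> p * v n)" for p q
  have dS: "zdt t \<Longrightarrow> zdt u \<Longrightarrow> dfn U (\<lambda>e. S (t e) (u e))" for t u
  proof -
    have "dfn U (\<lambda>e. S (ab (e 0)) (ab (e 1)))" unfolding S_def by (intro df zfnD[OF zb] zfnD[OF zv])
    from dfn_subst2[where P = "\<lambda>x y. S (ab x) (ab y)" and t = "\<lambda>e. rep (t e)" and u = "\<lambda>e. rep (u e)", OF this]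
    show "zdt t \<Longrightarrow> zdt u \<Longrightarrow> dfn U (\<lambda>e. S (t e) (u e))" by simp
  qed
  \<comment> \<open>The largest \<open>q\<close> with \<open>S p q\<close> is sought, while
    \<open>zleast\<close> yields minima. As \<open>v n \<le> b n\<close> puts every such
    \<open>q\<close> below \<open>p\<close>, one minimises the distance \<open>r\<close> of
    \<open>q\<close> from \<open>p\<close>.\<close>
  define f where "f p = p - zleast (\<lambda>r. 0 \<le> r \<and> S p (p - r))" for p
  have zf: "zfn f" unfolding f_def by (intro df dS)
  have Sle: "q \<le> p" if Spq: "S p q" and p: "0 \<le> p" for p q
  proof -
    obtain n where n: "0 \<le> n" "q * b n \<le> p * v n" using Spq unfolding S_def by blast
    have "p * v n \<le> p * b n" using vb[OF n(1)] p by (rule mult_left_mono)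
    then have "q * b n \<le> p * b n" using n(2) by simp
    then show ?thesis using bpos[OF n(1)] by simp
  qed
  have f: "S p (f p)" "\<And>q. S p q \<Longrightarrow> q \<le> f p" if p: "0 \<le> p" for p
  proof -
    have z: "zprd (\<lambda>r. 0 \<le> r \<and> S p (p - r))" by (intro df dS)
    have "S p 0" unfolding S_def using p by (intro exI[of _ 0]) (simp add: v0)
    then have ne: "0 \<le> p \<and> S p (p - p)" using p by simp
    note zl = zleast[of "\<lambda>r. 0 \<le> r \<and> S p (p - r)", OF z _ ne]
    show "S p (f p)" using zl(1) unfolding f_def by blast
    show "q \<le> f p" if "S p q" for q
    proof -
      have "0 \<le> p - q \<and> S p (p - (p - q))" using Sle[OF that p] that by simp
      then have "zleast (\<lambda>r. 0 \<le> r \<and> S p (p - r)) \<le> p - q" using zl(2) by blast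
      then show ?thesis unfolding f_def by simp
    qed
  qed
  have lift: "q * b m \<le> p * v m" if "q * b n \<le> p * v n" "0 \<le> n" "n \<le> m" "0 \<le> p" for p q n m
  proof -
    have bn: "0 < b n" and bm: "0 \<le> b m" using bpos[of n] bpos[of m] that by simp_all
    have "q * b n * b m \<le> p * v n * b m" using that(1) bm by (rule mult_right_mono)
    also have "\<dots> \<le> p * v m * b n" using mult_left_mono[OF mono[of n "m - n"] that(4)] that by (simp add: mult.assoc)
    finally have "(q * b m) * b n \<le> (p * v m) * b n" by (simp add: ac_simps)
    then show ?thesis using bn by simp
  qed
  \<comment> \<open>Taking the largest integer below a multiple of a real is additive up to 1:
    \<open>lift\<close> brings two witnesses of \<open>S\<close> to a common index, and maximality
    at \<open>p\<close> and \<open>q\<close> bounds the value at \<open>p + q\<close>.\<close>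
  have fadd: "\<bar>f (p + q) - f p - f q\<bar> \<le> 1" if p: "0 \<le> p" and q: "0 \<le> q" for p q
  proof -
    have pq: "0 \<le> p + q" using p q by simp
    obtain n where n: "0 \<le> n" "f p * b n \<le> p * v n" using f(1)[OF p] unfolding S_def by blast
    obtain m where m: "0 \<le> m" "f q * b m \<le> q * v m" using f(1)[OF q] unfolding S_def by blast
    obtain k where k: "0 \<le> k" "f (p + q) * b k \<le> (p + q) * v k" using f(1)[OF pq] unfolding S_def by blast
    have "f p * b (n + m) \<le> p * v (n + m)" "f q * b (n + m) \<le> q * v (n + m)"
      using lift[OF n(2,1) _ p, of "n + m"] lift[OF m(2,1) _ q, of "n + m"] n(1) m(1) by simp_all
    then have "(f p + f q) * b (n + m) \<le> (p + q) * v (n + m)" by (simp add: distrib_right add_mono)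
    then have "S (p + q) (f p + f q)" unfolding S_def using n(1) m(1) by (intro exI[of _ "n + m"]) simp
    then have 1: "f p + f q \<le> f (p + q)" by (rule f(2)[OF pq])
    have "\<not> S p (f p + 1)" "\<not> S q (f q + 1)" using f(2)[OF p, of "f p + 1"] f(2)[OF q, of "f q + 1"] by auto
    then have "\<not> (f p + 1) * b k \<le> p * v k" "\<not> (f q + 1) * b k \<le> q * v k" unfolding S_def using k(1) by blast+
    then have "p * v k < (f p + 1) * b k" "q * v k < (f q + 1) * b k" by (simp_all only: not_le)
    then have "f (p + q) * b k < (f p + 1 + (f q + 1)) * b k"
      using k(2) unfolding distrib_right by linarith
    then have "f (p + q) < f p + 1 + (f q + 1)" using bpos[OF k(1)] by simp
    then have "f (p + q) + 1 \<le> f p + 1 + (f q + 1)" by (rule zint_add1_le)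
    then show ?thesis using 1 by (simp add: abs_le_iff algebra_simps)
  qed
  define F where "F p = (if 0 \<le> p then f p else - f (- p))" for p
  have AF: "AH F" unfolding F_def using zf fadd by (rule AH_odd)
  have close: "\<bar>F (b n) - v n\<bar> \<le> 1" if n: "0 \<le> n" for n
  proof -
    have bn: "0 \<le> b n" using bpos[OF n] by simp
    have "S (b n) (v n)" unfolding S_def using n by (intro exI[of _ n]) (simp add: mult.commute)
    then have 1: "v n \<le> f (b n)" by (rule f(2)[OF bn])
    obtain k where k: "0 \<le> k" "f (b n) * b k \<le> b n * v k" using f(1)[OF bn] unfolding S_def by blast
    have "f (b n) * b k \<le> (v n + 1) * b k" using k(2) up[OF k(1) n] by (simp add: mult.commute)
    then have "f (b n) \<le> v n + 1" using bpos[OF k(1)] by simp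
    then show ?thesis using 1 bn by (simp add: F_def abs_le_iff algebra_simps)
  qed
  have c: "\<forall>n. 0 \<le> n \<longrightarrow> \<bar>zap (zlam F) (zap B n) - zap N n\<bar> \<le> 1"
    using close unfolding zlam(3)[OF AH_zfn[OF AF]] b_def v_def by blast
  have "pcode (rl F) x y" unfolding pcode_def
  proof (rule exI[of _ N], rule exI[of _ B], intro conjI)
    show "\<exists>f \<in> ext U (rl F). \<exists>C. \<forall>n. 0 \<le> n \<longrightarrow> \<bar>zap f (zap B n) - zap N n\<bar> \<le> C"
      using c zlam_rl[OF AF] by blast
  qed (use N B in blast)+
  then show ?thesis using rl_reals[OF AF] by blast
qed

lemma isset_reals0: "isset U (reals U)"
proof -
  have "dprd U (\<lambda>x. \<exists>f \<in> almost_homs U. ext U x = {g \<in> almost_homs U. \<exists>C. \<forall>p. \<bar>zap f p - zap g p\<bar> \<le> C})"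
    by (intro df)
  moreover have "x \<in> reals U \<longleftrightarrow> (\<exists>f \<in> almost_homs U. ext U x = {g \<in> almost_homs U. \<exists>C. \<forall>p. \<bar>zap f p - zap g p\<bar> \<le> C})" for x
  proof -
    have "x \<in> reals U \<longleftrightarrow> (\<exists>f \<in> almost_homs U. x = rl (zap f))"
    proof
      assume "x \<in> reals U"
      then obtain f where f: "AH f" "x = rl f" by (rule realsE)
      then show "\<exists>f \<in> almost_homs U. x = rl (zap f)"
        using zlam_almost_homs[OF f(1)] zlam(3)[OF AH_zfn[OF f(1)]] by (intro bexI[of _ "zlam f"]) simp_all
    qed (use almost_homs_AH rl_reals in blast)
    also have "\<dots> \<longleftrightarrow> (\<exists>f \<in> almost_homs U. ext U x = {g \<in> almost_homs U. sim (zap f) (zap g)})"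
      using ext_rl[OF zfn_zap] ext_eq_iff by (metis (no_types, lifting))
    finally show ?thesis unfolding sim_def .
  qed
  ultimately have d: "dprd U (\<lambda>x. x \<in> reals U)" by simp
  have "reals U \<subseteq> {y. ext U y \<subseteq> almost_homs U}"
    unfolding reals_rl using rl_mem by blast
  then show ?thesis using isset_subset[OF d] isset_Pow[OF isset_almost_homs] by blast
qed

lemma real_pairing0: "real_pairing U"
proof -
  note d = dprdD[OF isset_dprd[OF isset_reals0]]
  define L where "L z x \<longleftrightarrow> x \<in> reals U \<and> (\<exists>y. y \<in> reals U \<and> pcode z x y)" for z x
  define R where "R z y \<longleftrightarrow> y \<in> reals U \<and> (\<exists>x. x \<in> reals U \<and> pcode z x y)" for z y
  \<comment> \<open>Reals that code no pair are sent to 0, which makes both components total on the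
    reals.\<close>
  define p where "p z = (if \<exists>x. L z x then wl U (L z) else real_zero U)" for z
  define q where "q z = (if \<exists>y. R z y then wl U (R z) else real_zero U)" for z
  have dL: "dprd U (L z)" and dR: "dprd U (R z)" for z unfolding L_def R_def by (intro df d)+
  have dp: "dfun U p" and dq: "dfun U q" unfolding p_def q_def L_def R_def by (intro df d)+
  have "real_zero U \<in> reals U" unfolding real_zero_rl by (rule rl_reals[OF AH_zero])
  moreover have "L z (wl U (L z))" if "\<exists>x. L z x" for z
    using that by (elim exE) (rule wl_props(1)[OF dL])
  then have "wl U (L z) \<in> reals U" if "\<exists>x. L z x" for z
    by (rule conjunct1[OF iffD1[OF L_def]]) (rule that)
  moreover have "R z (wl U (R z))" if "\<exists>x. R z x" for z
    using that by (elim exE) (rule wl_props(1)[OF dR])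
  then have "wl U (R z) \<in> reals U" if "\<exists>x. R z x" for z
    by (rule conjunct1[OF iffD1[OF R_def]]) (rule that)
  ultimately have pr: "p z \<in> reals U" and qr: "q z \<in> reals U" for z
    unfolding p_def q_def by simp_all
  have fp: "class_fun U (reals U) (reals U) (ext U (lam (reals U) p))" "class_fun U (reals U) (reals U) (ext U (lam (reals U) q))"
    using class_fun_lam[OF isset_reals0 dp] class_fun_lam[OF isset_reals0 dq] pr qr by blast+
  moreover have "\<forall>x \<in> reals U. \<forall>y \<in> reals U. \<exists>z \<in> reals U.
      opair U z x \<in> ext U (lam (reals U) p) \<and> opair U z y \<in> ext U (lam (reals U) q)"
  proof (intro ballI)
    fix x y assume x: "x \<in> reals U" and y: "y \<in> reals U"
    obtain z where z: "z \<in> reals U" "pcode z x y" using ex_pcode by blast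
    have "wl U (L z) = x"
    proof (rule wl_eq)
      show "L z x" using x y z unfolding L_def by blast
      show "x' = x" if Lx: "L z x'" for x'
      proof -
        obtain y' where "x' \<in> reals U" "y' \<in> reals U" "pcode z x' y'" using Lx unfolding L_def by blast
        then show ?thesis using pcode_unique[OF z(1) _ x _ y _ z(2)] by blast
      qed
    qed
    moreover have "wl U (R z) = y"
    proof (rule wl_eq)
      show "R z y" using x y z unfolding R_def by blast
      show "y' = y" if Ry: "R z y'" for y'
      proof -
        obtain x' where "x' \<in> reals U" "y' \<in> reals U" "pcode z x' y'" using Ry unfolding R_def by blast
        then show ?thesis using pcode_unique[OF z(1) _ x _ y _ z(2)] by blast
      qed
    qed
    moreover have "\<exists>x. L z x" "\<exists>y. R z y" using x y z unfolding L_def R_def by blast+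
    ultimately have "p z = x" "q z = y" unfolding p_def q_def by simp_all
    then show "\<exists>z \<in> reals U. opair U z x \<in> ext U (lam (reals U) p) \<and> opair U z y \<in> ext U (lam (reals U) q)"
      using z(1) unfolding ext_lam[OF isset_reals0 dp] ext_lam[OF isset_reals0 dq] by blast
  qed
  ultimately show ?thesis unfolding real_pairing_def by blast
qed

lemma zap_zlam: "AH f \<Longrightarrow> zap (zlam f) = f"
  by (rule zlam(3)) (rule AH_zfn)

text \<open>A form of the graph without definite descriptions, in terms of representatives and
  \<open>zap\<close>; in this form it is visibly definable.\<close>

lemma real_add_iff:
  assumes "r \<in> reals U" "t \<in> reals U" "u \<in> reals U"
  shows "real_add U r t = u \<longleftrightarrow> (\<exists>f \<in> ext U r. \<exists>g \<in> ext U t. \<exists>h \<in> ext U u. \<forall>p. zap h p = zap f p + zap g p)"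
proof -
  obtain f where f: "AH f" "r = rl f" using assms(1) by (rule realsE)
  obtain g where g: "AH g" "t = rl g" using assms(2) by (rule realsE)
  obtain h where h: "AH h" "u = rl h" using assms(3) by (rule realsE)
  have fg: "AH (\<lambda>p. f p + g p)" using f(1) g(1) by (rule AH_add)
  show ?thesis
  proof
    assume "real_add U r t = u"
    then have "u = rl (\<lambda>p. f p + g p)" using real_add_rl f g by simp
    then show "\<exists>f \<in> ext U r. \<exists>g \<in> ext U t. \<exists>h \<in> ext U u. \<forall>p. zap h p = zap f p + zap g p"
      by (simp only: f(2) g(2), intro rev_bexI[OF zlam_rl[OF f(1)]], intro rev_bexI[OF zlam_rl[OF g(1)]],
          intro rev_bexI[OF zlam_rl[OF fg]]) (simp add: zap_zlam f(1) g(1) fg)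
  next
    assume "\<exists>f \<in> ext U r. \<exists>g \<in> ext U t. \<exists>h \<in> ext U u. \<forall>p. zap h p = zap f p + zap g p"
    then obtain f' g' h' where *: "sim f (zap f')" "sim g (zap g')" "sim h (zap h')" "zap h' = (\<lambda>p. zap f' p + zap g' p)"
      using f g h rl_mem by blast
    have "sim (\<lambda>p. f p + g p) h" using sim_add[OF *(1,2)] sim_sym[OF *(3)] sim_trans unfolding *(4) by blast
    then show "real_add U r t = u" using f g h fg by (simp add: real_add_rl rl_eq)
  qed
qed

lemma real_mult_iff:
  assumes "r \<in> reals U" "t \<in> reals U" "u \<in> reals U"
  shows "real_mult U r t = u \<longleftrightarrow> (\<exists>f \<in> ext U r. \<exists>g \<in> ext U t. \<exists>h \<in> ext U u. \<forall>p. zap h p = zap f (zap g p))"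
proof -
  obtain f where f: "AH f" "r = rl f" using assms(1) by (rule realsE)
  obtain g where g: "AH g" "t = rl g" using assms(2) by (rule realsE)
  obtain h where h: "AH h" "u = rl h" using assms(3) by (rule realsE)
  have fg: "AH (\<lambda>p. f (g p))" using f(1) g(1) by (rule AH_comp)
  show ?thesis
  proof
    assume "real_mult U r t = u"
    then have "u = rl (\<lambda>p. f (g p))" using real_mult_rl f g by simp
    then show "\<exists>f \<in> ext U r. \<exists>g \<in> ext U t. \<exists>h \<in> ext U u. \<forall>p. zap h p = zap f (zap g p)"
      by (simp only: f(2) g(2), intro rev_bexI[OF zlam_rl[OF f(1)]], intro rev_bexI[OF zlam_rl[OF g(1)]],
          intro rev_bexI[OF zlam_rl[OF fg]]) (simp add: zap_zlam f(1) g(1) fg)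
  next
    assume "\<exists>f \<in> ext U r. \<exists>g \<in> ext U t. \<exists>h \<in> ext U u. \<forall>p. zap h p = zap f (zap g p)"
    then obtain f' g' h' where *: "sim f (zap f')" "sim g (zap g')" "sim h (zap h')" "zap h' = (\<lambda>p. zap f' (zap g' p))"
      using f g h rl_mem by blast
    have "sim (\<lambda>p. f (g p)) h" using sim_comp[OF f(1) *(1,2)] sim_sym[OF *(3)] sim_trans unfolding *(4) by blast
    then show "real_mult U r t = u" using f g h fg by (simp add: real_mult_rl rl_eq)
  qed
qed

lemma real_le_iff:
  assumes "r \<in> reals U" "t \<in> reals U"
  shows "real_le U r t \<longleftrightarrow> (\<exists>f \<in> ext U r. \<exists>g \<in> ext U t. sim (zap f) (zap g) \<or> pos (\<lambda>p. zap g p - zap f p))"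
proof -
  obtain f where f: "AH f" "r = rl f" using assms(1) by (rule realsE)
  obtain g where g: "AH g" "t = rl g" using assms(2) by (rule realsE)
  have "real_le U r t \<longleftrightarrow> sim (zap f') (zap g') \<or> pos (\<lambda>p. zap g' p - zap f' p)"
    if "f' \<in> ext U r" "g' \<in> ext U t" for f' g'
  proof -
    have *: "f' \<in> almost_homs U" "g' \<in> almost_homs U" "sim f (zap f')" "sim g (zap g')" using that f g rl_mem by auto
    have "rl f = rl (zap f')" "rl g = rl (zap g')" using * rl_eq f(1) g(1) almost_homs_AH by blast+
    then show ?thesis unfolding f(2) g(2) using real_le_rl[OF almost_homs_AH almost_homs_AH] * by simp
  qed
  then show ?thesis using zlam_rl[OF f(1)] zlam_rl[OF g(1)] f(2) g(2) by blast
qed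

text \<open>As sets of the model, the graphs can later serve as parameters of formulas in every
  model, where the type of integers is not at hand.\<close>

lemma real_graphs:
  "\<exists>A M L. \<forall>r \<in> reals U. \<forall>t \<in> reals U. (opair U r t \<in> ext U L \<longleftrightarrow> real_le U r t) \<and>
        (\<forall>u \<in> reals U. (opair U r (opair U t u) \<in> ext U A \<longleftrightarrow> real_add U r t = u) \<and>
          (opair U r (opair U t u) \<in> ext U M \<longleftrightarrow> real_mult U r t = u))"
proof -
  note d = dprdD[OF isset_dprd[OF isset_reals0]]
  let ?R = "reals U"
  have s: "isset U (class_prod U ?R ?R)" "isset U (class_prod U ?R (class_prod U ?R ?R))"
    by (intro isset_class_prod isset_reals0)+
  have "dprd U (\<lambda>w. \<exists>r t u. w = opair U r (opair U t u) \<and> (\<exists>f \<in> ext U r. \<exists>g \<in> ext U t. \<exists>h \<in> ext U u. \<forall>p. zap h p = zap f p + zap g p))"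
    by (intro df)
  from isset_sep[OF this s(2)] obtain A where A: "ext U A = {w \<in> class_prod U ?R (class_prod U ?R ?R).
      \<exists>r t u. w = opair U r (opair U t u) \<and> (\<exists>f \<in> ext U r. \<exists>g \<in> ext U t. \<exists>h \<in> ext U u. \<forall>p. zap h p = zap f p + zap g p)}"
    unfolding isset_def by blast
  have "dprd U (\<lambda>w. \<exists>r t u. w = opair U r (opair U t u) \<and> (\<exists>f \<in> ext U r. \<exists>g \<in> ext U t. \<exists>h \<in> ext U u. \<forall>p. zap h p = zap f (zap g p)))"
    by (intro df)
  from isset_sep[OF this s(2)] obtain M where M: "ext U M = {w \<in> class_prod U ?R (class_prod U ?R ?R).
      \<exists>r t u. w = opair U r (opair U t u) \<and> (\<exists>f \<in> ext U r. \<exists>g \<in> ext U t. \<exists>h \<in> ext U u. \<forall>p. zap h p = zap f (zap g p))}"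
    unfolding isset_def by blast
  have "dprd U (\<lambda>w. \<exists>r t. w = opair U r t \<and> (\<exists>f \<in> ext U r. \<exists>g \<in> ext U t. sim (zap f) (zap g) \<or> pos (\<lambda>p. zap g p - zap f p)))"
    unfolding sim_def pos_def by (intro df)
  from isset_sep[OF this s(1)] obtain L where L: "ext U L = {w \<in> class_prod U ?R ?R.
      \<exists>r t. w = opair U r t \<and> (\<exists>f \<in> ext U r. \<exists>g \<in> ext U t. sim (zap f) (zap g) \<or> pos (\<lambda>p. zap g p - zap f p))}"
    unfolding isset_def by blast
  show ?thesis
    by (rule exI[of _ A], rule exI[of _ M], rule exI[of _ L]) (simp add: A M L real_add_iff real_mult_iff real_le_iff)
qed

lemma real_no_max:
  assumes "r \<in> reals U"
  shows "\<exists>t \<in> reals U. \<not> real_le U t r"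
proof -
  obtain f where f: "AH f" "r = rl f" using assms by (rule realsE)
  have g: "AH (\<lambda>p. f p + p)" using AH_add[OF f(1) AH_id] .
  have pos1: "pos (\<lambda>p :: 'v zint. p)" unfolding pos_def
    by (metis abs_ge_self abs_ge_zero add_nonneg_nonneg le_less_trans less_add_one zero_le_one)
  have "\<not> sim (\<lambda>p. f p + p) f"
  proof
    assume "sim (\<lambda>p. f p + p) f"
    then obtain C where "\<And>p. \<bar>f p + p - f p\<bar> \<le> C" by (rule simE) (rule that)
    then have "sim (\<lambda>p :: 'v zint. p) (\<lambda>p. 0)" by (intro simI[of _ _ C]) simp
    then show False using pos_not_sim_zero[OF pos1] by blast
  qed
  moreover have "\<not> pos (\<lambda>p. f p - (f p + p))" unfolding pos_def by (auto simp: not_less intro!: exI[of _ 0])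
  ultimately have "\<not> real_le U (rl (\<lambda>p. f p + p)) r" unfolding f(2) real_le_rl[OF g f(1)] by blast
  then show ?thesis using rl_reals[OF g] by blast
qed

lemma real_facts_cex: "real_facts U"
proof -
  have c: "class_fun U (ints U) (ints U) (ext U f)" if "f \<in> almost_homs U" for f
    using that almost_homs_iff by blast
  have e: "eudoxus U (app U (ext U f)) = rl (zap f)" if "f \<in> almost_homs U" for f
    by (rule eudoxus_rl[where F = "app U (ext U f)" and f = "zap f", OF app_rep[OF c[OF that]]])
  have "sim_sigma U (app U (ext U f)) (app U (ext U g)) \<longleftrightarrow> sim (zap f) (zap g)"
    if "f \<in> almost_homs U" "g \<in> almost_homs U" for f g
    by (rule sim_sigma_rep) (rule app_rep[OF c[OF that(1)]], rule app_rep[OF c[OF that(2)]])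
  then have "(eudoxus U (app U (ext U f)) = eudoxus U (app U (ext U g)) \<longleftrightarrow> sim_sigma U (app U (ext U f)) (app U (ext U g))) \<and>
      (g \<in> ext U (eudoxus U (app U (ext U f))) \<longleftrightarrow> sim_sigma U (app U (ext U f)) (app U (ext U g)))"
    if "f \<in> almost_homs U" "g \<in> almost_homs U" for f g
    using rl_eq rl_mem almost_homs_AH that by (simp add: e)
  moreover have "ext U x \<subseteq> almost_homs U" if "x \<in> reals U" for x
    using that realsE rl_mem by blast
  ultimately show ?thesis
    unfolding real_facts_def using ordered_field_reals real_pairing0 isset_reals0 real_graphs real_no_max
    by (intro conjI) blast+
qed

end

text \<open>If some model failed, the chosen \<open>cex\<close> would be a failing model of NBG, but
  there the facts have been proved.\<close>

lemma NBG_real_facts: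
  fixes U :: "'v universe"
  assumes "NBG U"
  shows "real_facts U"
proof (rule ccontr)
  assume "\<not> ?thesis"
  then have "\<exists>U :: 'v universe. NBG U \<and> \<not> real_facts U" using assms by blast
  from someI_ex[OF this] have c: "NBG (cex :: 'v universe)" "\<not> real_facts (cex :: 'v universe)"
    unfolding cex_def[symmetric] by blast+
  interpret nbg0 "cex :: 'v universe" by unfold_locales (use c in auto)
  show False using c(2) real_facts_cex by blast
qed

context nbg
begin

section \<open>Enumerating the universe by pairs of ordinals\<close>

definition img :: "'v \<Rightarrow> 'v \<Rightarrow> 'v" where
  "img g b = wl U (\<lambda>z. ext U z = {y. \<exists>c \<in> ext U b. y = ap g c})"

lemma df_img [df]: "dt U t \<Longrightarrow> dt U u \<Longrightarrow> dt U (\<lambda>e. img (t e) (u e))"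
  by (rule dt_subst2[where f = img]) (unfold img_def, intro df)

lemma wl_set:
  assumes "isset U X"
  shows "ext U (wl U (\<lambda>z. ext U z = X)) = X"
proof -
  obtain z where z: "ext U z = X" using assms unfolding isset_def by blast
  have "wl U (\<lambda>z. ext U z = X) = z"
  proof (rule wl_eq)
    show "ext U z = X" by (rule z)
    show "y = z" if "ext U y = X" for y using z that ext_eq_iff by blast
  qed
  then show ?thesis using z by simp
qed

lemma ext_img: "ext U (img g b) = ap g ` ext U b"
proof -
  have "{y. \<exists>c \<in> ext U b. y = ap g c} = ap g ` ext U b" by blast
  moreover have "isset U (ap g ` ext U b)" by (rule isset_image) (intro df, rule isset_ext)
  ultimately show ?thesis unfolding img_def using wl_set by simp
qed

lemma img_cong: "(\<And>c. c \<in> ext U b \<Longrightarrow> ap g c = ap h c) \<Longrightarrow> img g b = img h b"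
  using ext_img[of g b] ext_img[of h b] ext_eq_iff by (metis image_cong)

text \<open>The step function sees only the set of earlier values, which is enough for the
  cumulative hierarchy and for exhausting a set. The parameter \<open>p\<close> is carried along so
  that the result is definable in \<open>p\<close> and the ordinal together.\<close>

lemma ordinal_recursion:
  assumes "dt U (\<lambda>e. H (e 0) (e 1))"
  obtains G where "dt U (\<lambda>e. G (e 0) (e 1))"
    "\<And>p a. a \<in> ordinals U \<Longrightarrow> G p a = H p (the_set U (G p ` ext U a))"
proof -
  have dH: "dt U t \<Longrightarrow> dt U u \<Longrightarrow> dt U (\<lambda>e. H (t e) (u e))" for t u using assms by (rule dt_subst2)
  define good where "good p a g \<longleftrightarrow> (\<forall>b \<in> ext U a. ap g b = H p (img g b))" for p a g
  have dg: "dfn U (\<lambda>e. good (t e) (u e) (v e))" if "dt U t" "dt U u" "dt U v" for t u v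
  proof (rule dfn_subst3[where P = good, OF _ that])
    show "dfn U (\<lambda>e. good (e 0) (e 1) (e 2))" unfolding good_def by (intro df dH)
  qed
  define G where "G p b = wl U (\<lambda>y. \<exists>g. good p (succ_set U b) g \<and> y = ap g b)" for p b
  have dG: "dt U (\<lambda>e. G (e 0) (e 1))" unfolding G_def by (intro df dg)
  have mono: "good p b g" if "good p a g" "ext U b \<subseteq> ext U a" for p a b g
    using that unfolding good_def by blast
  have uniq: "ap g b = ap h b"
    if g: "good p a g" and h: "good p a h" and b: "b \<in> ext U a" and a: "a \<in> ordinals U" for p a b g h
  proof -
    have "b \<in> ext U a \<longrightarrow> ap g b = ap h b"
    proof (rule On_induct[OF _ _ On_mem[OF a b], where P = "\<lambda>b. b \<in> ext U a \<longrightarrow> ap g b = ap h b"])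
      show "dprd U (\<lambda>b. b \<in> ext U a \<longrightarrow> ap g b = ap h b)" by (intro df)
      fix c assume IH: "\<And>b. b \<in> ext U c \<Longrightarrow> b \<in> ext U a \<longrightarrow> ap g b = ap h b"
      show "c \<in> ext U a \<longrightarrow> ap g c = ap h c"
      proof
        assume c: "c \<in> ext U a"
        have "img g c = img h c" by (rule img_cong) (use IH On_trans[OF a c] in blast)
        then show "ap g c = ap h c" using g h c unfolding good_def by simp
      qed
    qed
    then show ?thesis using b by blast
  qed
  have step: "\<exists>h. good p (succ_set U a) h" if g: "good p a g" and a: "a \<in> ordinals U" for p a g
  proof -
    define f where "f x = (if x = a then H p (img g a) else ap g x)" for x
    have dff: "dfun U f" unfolding f_def by (intro df dH)
    let ?h = "lam (insert a (ext U a)) f"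
    have h: "ap ?h x = f x" if "x \<in> insert a (ext U a)" for x
      by (rule ap_lam[OF _ dff that]) simp
    have "img ?h b = img g b" if b: "b = a \<or> b \<in> ext U a" for b
    proof (rule img_cong)
      fix c assume "c \<in> ext U b"
      then have "c \<in> ext U a" using b On_trans[OF a] by blast
      moreover from this have "c \<noteq> a" using not_mem_self[of a] by blast
      ultimately show "ap ?h c = ap g c" using h[of c] by (simp add: f_def)
    qed
    then have "good p (succ_set U a) ?h"
      using g h unfolding good_def by (auto simp: f_def)
    then show ?thesis by blast
  qed
  have G: "G p b = ap g b" if g: "good p (succ_set U b) g" and b: "b \<in> ordinals U" for p b g
    unfolding G_def
  proof (rule wl_eq)
    show "\<exists>h. good p (succ_set U b) h \<and> ap g b = ap h b" using g by blast
    fix y assume "\<exists>h. good p (succ_set U b) h \<and> y = ap h b"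
    then obtain h where "good p (succ_set U b) h" "y = ap h b" by blast
    then show "y = ap g b" using uniq[OF _ g _ succ_On[OF b]] by simp
  qed
  have ex: "\<exists>g. good p a g" if a: "a \<in> ordinals U" for p a
  proof (rule On_induct[OF _ _ a, where P = "\<lambda>a. \<exists>g. good p a g"])
    show "dprd U (\<lambda>a. \<exists>g. good p a g)" by (intro df dg)
    fix a assume a: "a \<in> ordinals U" and IH: "\<And>b. b \<in> ext U a \<Longrightarrow> \<exists>g. good p b g"
    have dGp: "dfun U (G p)" using dt_subst2[where f = G, OF dG dt_const dt_var] .
    have ap: "ap (lam (ext U a) (G p)) b = G p b" if "b \<in> ext U a" for b
      by (rule ap_lam[OF isset_ext dGp that])
    have "good p a (lam (ext U a) (G p))" unfolding good_def
    proof
      fix b assume b: "b \<in> ext U a"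
      then have bO: "b \<in> ordinals U" using On_mem[OF a] by blast
      obtain g where "good p b g" using IH[OF b] by blast
      then obtain h where h: "good p (succ_set U b) h" using step bO by blast
      have "img (lam (ext U a) (G p)) b = img h b"
      proof (rule img_cong)
        fix c assume c: "c \<in> ext U b"
        then have cO: "c \<in> ordinals U" and ca: "c \<in> ext U a" using On_mem[OF bO] On_trans[OF a b] by blast+
        have "ext U (succ_set U c) \<subseteq> ext U (succ_set U b)" using c On_trans[OF bO c] by auto
        then have "G p c = ap h c" using G[OF mono[OF h] cO] by blast
        then show "ap (lam (ext U a) (G p)) c = ap h c" using ap[OF ca] by simp
      qed
      then show "ap (lam (ext U a) (G p)) b = H p (img (lam (ext U a) (G p)) b)"
        using ap[OF b] G[OF h bO] h unfolding good_def by simp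
    qed
    then show "\<exists>g. good p a g" by blast
  qed
  have "G p a = H p (the_set U (G p ` ext U a))" if a: "a \<in> ordinals U" for p a
  proof -
    obtain g where g: "good p (succ_set U a) g" using ex[OF succ_On[OF a]] by blast
    have "ap g c = G p c" if c: "c \<in> ext U a" for c
    proof -
      have "ext U (succ_set U c) \<subseteq> ext U (succ_set U a)" using c On_trans[OF a c] by auto
      then show ?thesis using G[OF mono[OF g] On_mem[OF a c]] by simp
    qed
    then have "ext U (img g a) = G p ` ext U a" unfolding ext_img by simp
    then have "img g a = the_set U (G p ` ext U a)" by (metis the_set_ext)
    then show ?thesis using G[OF g a] g unfolding good_def by simp
  qed
  with dG show thesis by (rule that)
qed

text \<open>The von Neumann hierarchy in the form that a stage consists of all subsets of earlier
  stages. By induction on membership a set appears one step above a bound on the stages of its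
  elements; such a bound exists by replacement.\<close>

lemma hierarchy:
  obtains V where "dfun U V" "\<And>x. \<exists>a \<in> ordinals U. x \<in> ext U (V a)"
proof -
  define pw where "pw w = wl U (\<lambda>z. ext U z = {y. ext U y \<subseteq> ext U w})" for w
  have pw: "ext U (pw w) = {y. ext U y \<subseteq> ext U w}" for w unfolding pw_def by (rule wl_set[OF isset_Pow_ext])
  have dpw: "dfun U pw" unfolding pw_def by (intro df)
  define H :: "'v \<Rightarrow> 'v \<Rightarrow> 'v" where "H p X = wl U (\<lambda>z. ext U z = {y. \<exists>w \<in> ext U X. ext U y \<subseteq> ext U w})" for p X
  have dH: "dt U (\<lambda>e. H (e 0) (e 1))" unfolding H_def by (intro df)
  have H: "ext U (H p X) = {y. \<exists>w \<in> ext U X. ext U y \<subseteq> ext U w}" for p X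
  proof -
    have "isset U (\<Union>w \<in> ext U X. ext U (pw w))" by (rule isset_UN[OF dpw isset_ext])
    moreover have "(\<Union>w \<in> ext U X. ext U (pw w)) = {y. \<exists>w \<in> ext U X. ext U y \<subseteq> ext U w}" by (auto simp: pw)
    ultimately show ?thesis unfolding H_def using wl_set by simp
  qed
  obtain G where G: "dt U (\<lambda>e. G (e 0) (e 1))" "\<And>p a. a \<in> ordinals U \<Longrightarrow> G p a = H p (the_set U (G p ` ext U a))"
    by (rule ordinal_recursion[OF dH]) (rule that)
  define V where "V = G (empty_set U)"
  have dV: "dfun U V" unfolding V_def using dt_subst2[where f = G, OF G(1) dt_const dt_var] .
  have V: "ext U (V a) = {y. \<exists>b \<in> ext U a. ext U y \<subseteq> ext U (V b)}" if a: "a \<in> ordinals U" for a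
  proof -
    have "ext U (the_set U (V ` ext U a)) = V ` ext U a" by (rule ext_the_set[OF isset_image[OF dV isset_ext]])
    then show ?thesis using G(2)[OF a, of "empty_set U"] unfolding V_def[symmetric] by (simp add: H)
  qed
  have mono: "ext U (V b) \<subseteq> ext U (V a)" if "a \<in> ordinals U" "b \<in> ext U a" for a b
    using V[OF that(1)] V[OF On_mem[OF that]] On_trans[OF that] by auto
  have "\<exists>a \<in> ordinals U. x \<in> ext U (V a)" for x
  proof (rule ext_induct[where P = "\<lambda>x. \<exists>a \<in> ordinals U. x \<in> ext U (V a)"])
    show "dprd U (\<lambda>x. \<exists>a \<in> ordinals U. x \<in> ext U (V a))" by (intro df dfunD[OF dV])
    fix x assume IH: "\<And>y. y \<in> ext U x \<Longrightarrow> \<exists>a \<in> ordinals U. y \<in> ext U (V a)"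
    define r where "r y = wl U (\<lambda>a. a \<in> ordinals U \<and> y \<in> ext U (V a))" for y
    have dr: "dfun U r" unfolding r_def by (intro df dfunD[OF dV])
    have r: "r y \<in> ordinals U \<and> y \<in> ext U (V (r y))" if y: "y \<in> ext U x" for y
    proof -
      obtain a where a: "a \<in> ordinals U \<and> y \<in> ext U (V a)" using IH[OF y] by blast
      have "dprd U (\<lambda>a. a \<in> ordinals U \<and> y \<in> ext U (V a))" by (intro df dfunD[OF dV])
      from wl_props(1)[OF this a] show ?thesis unfolding r_def .
    qed
    obtain a where a: "a \<in> ordinals U" "\<And>b. b \<in> r ` ext U x \<Longrightarrow> b \<in> ext U a"
      using On_sup[OF isset_image[OF dr isset_ext], of x] r by blast
    have "ext U x \<subseteq> ext U (V a)"
    proof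
      fix y assume y: "y \<in> ext U x"
      have "r y \<in> ext U a" using a(2) y by blast
      then show "y \<in> ext U (V a)" using mono[OF a(1)] r[OF y] by blast
    qed
    then have "x \<in> ext U (V (succ_set U a))" using V[OF succ_On[OF a(1)]] by auto
    then show "\<exists>a \<in> ordinals U. x \<in> ext U (V a)" using succ_On[OF a(1)] by blast
  qed
  with dV show thesis by (rule that)
qed

text \<open>At each ordinal the least element not yet listed is taken. If some element were never
  listed, no stage would run out, and the ordinals would be injected into the set
  \<open>x\<close>.\<close>

lemma enumeration:
  obtains G where "dt U (\<lambda>e. G (e 0) (e 1))" "\<And>x y. y \<in> ext U x \<Longrightarrow> \<exists>a \<in> ordinals U. G x a = y"
proof -
  define H where "H x X = wl U (\<lambda>y. y \<in> ext U x \<and> y \<notin> ext U X)" for x X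
  have dH: "dt U (\<lambda>e. H (e 0) (e 1))" unfolding H_def by (intro df)
  obtain G where G: "dt U (\<lambda>e. G (e 0) (e 1))" "\<And>p a. a \<in> ordinals U \<Longrightarrow> G p a = H p (the_set U (G p ` ext U a))"
    by (rule ordinal_recursion[OF dH]) (rule that)
  have "\<exists>a \<in> ordinals U. G x a = y" if y: "y \<in> ext U x" for x y
  proof (rule ccontr)
    assume n: "\<not> (\<exists>a \<in> ordinals U. G x a = y)"
    have dG: "dfun U (G x)" using dt_subst2[where f = G, OF G(1) dt_const dt_var] .
    have *: "G x a \<in> ext U x \<and> G x a \<notin> G x ` ext U a" if a: "a \<in> ordinals U" for a
    proof -
      have X: "ext U (the_set U (G x ` ext U a)) = G x ` ext U a" by (rule ext_the_set[OF isset_image[OF dG isset_ext]])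
      have "y \<in> ext U x \<and> y \<notin> ext U (the_set U (G x ` ext U a))" unfolding X using y n On_mem[OF a] by blast
      moreover have "dprd U (\<lambda>y. y \<in> ext U x \<and> y \<notin> ext U (the_set U (G x ` ext U a)))" by (intro df)
      ultimately have "H x (the_set U (G x ` ext U a)) \<in> ext U x \<and> H x (the_set U (G x ` ext U a)) \<notin> ext U (the_set U (G x ` ext U a))"
        unfolding H_def by (rule wl_props(1)[rotated])
      then show ?thesis unfolding G(2)[OF a, symmetric] X .
    qed
    have inj: "a = b" if "a \<in> ordinals U" "b \<in> ordinals U" "G x a = G x b" for a b
      using On_linear[OF that(1,2)] *[OF that(1)] *[OF that(2)] that(3) by (metis imageI)
    \<comment> \<open>An inverse of the enumeration: it would map the set \<open>x\<close> onto a
      class containing all ordinals, which would then be a set.\<close>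
    define f where "f y = wl U (\<lambda>a. a \<in> ordinals U \<and> G x a = y)" for y
    have dff: "dfun U f" unfolding f_def by (intro df dfunD[OF dG])
    have f: "f (G x a) = a" if "a \<in> ordinals U" for a
      unfolding f_def by (rule wl_eq) (use that inj in blast)+
    have "ordinals U \<subseteq> f ` ext U x" using f * by (metis imageI subsetI)
    moreover have "dprd U (\<lambda>x. x \<in> ordinals U)" by (intro df)
    ultimately have "isset U (ordinals U)" using isset_subset isset_image[OF dff isset_ext] by blast
    then show False using not_isset_On by blast
  qed
  with G(1) show thesis by (rule that)
qed

text \<open>Initial segments of \<open>wo\<close> may be proper classes, so the well-order does not
  itself list the universe along the ordinals. The first ordinal selects a stage of the hierarchy
  and the second a position in the enumeration of that stage.\<close>

lemma pair_enumeration: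
  obtains T where "dt U (\<lambda>e. T (e 0) (e 1))" "\<And>y. \<exists>a \<in> ordinals U. \<exists>b \<in> ordinals U. T a b = y"
proof -
  obtain V where V: "dfun U V" "\<And>x. \<exists>a \<in> ordinals U. x \<in> ext U (V a)" by (rule hierarchy) (rule that)
  obtain G where G: "dt U (\<lambda>e. G (e 0) (e 1))" "\<And>x y. y \<in> ext U x \<Longrightarrow> \<exists>a \<in> ordinals U. G x a = y"
    by (rule enumeration) (rule that)
  have "dt U (\<lambda>e. V (e 0))" by (rule V(1))
  then have "dt U (\<lambda>e. G (V (e 0)) (e 1))" by (rule dt_subst2[OF G(1)]) (rule dt_var)
  moreover have "\<exists>a \<in> ordinals U. \<exists>b \<in> ordinals U. G (V a) b = y" for y using V(2)[of y] G(2) by blast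
  ultimately show thesis using that[of "\<lambda>a. G (V a)"] by blast
qed

section \<open>Finite sets\<close>

definition fin :: "'v \<Rightarrow> bool" where
  "fin x \<longleftrightarrow> (\<exists>n \<in> naturals U. equipollent U (ext U n) (ext U x))"

lemma Sigma_iff: "s \<in> Sigma_class U \<longleftrightarrow> ext U s \<subseteq> ordinals U \<and> fin s"
  unfolding Sigma_class_def fin_def by blast

lemma df_Sigma [df]: "dt U t \<Longrightarrow> dfn U (\<lambda>e. t e \<in> Sigma_class U)"
  by (rule dfn_subst1[where P = "\<lambda>s. s \<in> Sigma_class U"]) (unfold Sigma_class_def, intro df)

definition adj :: "'v \<Rightarrow> 'v \<Rightarrow> 'v" where "adj x a = the_set U (insert a (ext U x))"

lemma ext_adj [simp]: "ext U (adj x a) = insert a (ext U x)"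
  unfolding adj_def by (simp add: ext_the_set)

text \<open>Finiteness is that of the model, so induction over standard finite sets would not reach
  all cases. The proof is an internal induction on the number of elements, splitting off the last
  value of an enumerating bijection.\<close>

lemma fin_induct:
  assumes "fin x" "dprd U P" "P (empty_set U)" "\<And>x a. P x \<Longrightarrow> P (adj x a)"
  shows "P x"
proof -
  obtain n where n: "n \<in> naturals U" "equipollent U (ext U n) (ext U x)" using assms(1) unfolding fin_def by blast
  have "\<forall>x. equipollent U (ext U n) (ext U x) \<longrightarrow> P x"
  proof (rule N_induct[OF n(1), where P = "\<lambda>n. \<forall>x. equipollent U (ext U n) (ext U x) \<longrightarrow> P x"])
    show "dprd U (\<lambda>n. \<forall>x. equipollent U (ext U n) (ext U x) \<longrightarrow> P x)" by (intro df dprdD[OF assms(2)])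
    show "\<forall>x. equipollent U (ext U (empty_set U)) (ext U x) \<longrightarrow> P x"
    proof (intro allI impI)
      fix x assume "equipollent U (ext U (empty_set U)) (ext U x)"
      then have "ext U x = {}" unfolding equipollent_def by auto
      then show "P x" using assms(3) unfolding ext_eq_empty by simp
    qed
    fix k assume IH: "\<forall>x. equipollent U (ext U k) (ext U x) \<longrightarrow> P x"
    show "\<forall>x. equipollent U (ext U (succ_set U k)) (ext U x) \<longrightarrow> P x"
    proof (intro allI impI)
      fix x assume "equipollent U (ext U (succ_set U k)) (ext U x)"
      then obtain h where h: "dfun U h" "bij_betw h (insert k (ext U k)) (ext U x)"
        using eqpE[OF _ isset_dprd[OF isset_ext]] ext_succ by metis
      have b: "bij_betw h (ext U k) (ext U x - {h k})"
      proof (rule bij_betw_imageI)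
        have inj: "inj_on h (insert k (ext U k))" and im: "h ` insert k (ext U k) = ext U x"
          using h(2) by (simp_all add: bij_betw_def)
        show "inj_on h (ext U k)" using inj by simp
        show "h ` ext U k = ext U x - {h k}"
          unfolding im[symmetric] using inj not_mem_self[of k] by (auto simp: inj_on_def)
      qed
      have "isset U {y \<in> ext U x. y \<noteq> h k}" by (rule isset_sep) (intro df, rule isset_ext)
      then obtain z where z: "ext U z = ext U x - {h k}" unfolding isset_def by auto
      have "P z" using IH eqpI[OF isset_ext h(1) b] unfolding z[symmetric] by blast
      moreover have "ext U (adj z (h k)) = ext U x" using z h(2) by (auto simp: bij_betw_def)
      ultimately show "P x" using assms(4)[of z "h k"] unfolding ext_eq_iff by simp
    qed
  qed
  then show ?thesis using n(2) by blast
qed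

text \<open>The image of a finite set is adjoined one element at a time. This is the inner induction
  when the finite table of values in \<open>finite_approximation\<close> is built row by
  row.\<close>

lemma fin_image_adj:
  assumes "fin t" "dfun U f" "dprd U P" "\<And>x a. P x \<Longrightarrow> P (adj x a)" "P x"
  shows "P (the_set U (ext U x \<union> f ` ext U t))"
proof -
  have "\<forall>y. ext U y = ext U x \<union> {w. \<exists>a \<in> ext U t. w = f a} \<longrightarrow> P y"
  proof (rule fin_induct[OF assms(1), where P = "\<lambda>t. \<forall>y. ext U y = ext U x \<union> {w. \<exists>a \<in> ext U t. w = f a} \<longrightarrow> P y"])
    show "dprd U (\<lambda>t. \<forall>y. ext U y = ext U x \<union> {w. \<exists>a \<in> ext U t. w = f a} \<longrightarrow> P y)"
      by (intro df dfunD[OF assms(2)] dprdD[OF assms(3)])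
    show "\<forall>y. ext U y = ext U x \<union> {w. \<exists>a \<in> ext U (empty_set U). w = f a} \<longrightarrow> P y"
      using assms(5) by (auto simp: ext_eq_iff)
    fix t a assume IH: "\<forall>y. ext U y = ext U x \<union> {w. \<exists>a \<in> ext U t. w = f a} \<longrightarrow> P y"
    show "\<forall>y. ext U y = ext U x \<union> {w. \<exists>a \<in> ext U (adj t a). w = f a} \<longrightarrow> P y"
    proof (intro allI impI)
      fix y assume y: "ext U y = ext U x \<union> {w. \<exists>b \<in> ext U (adj t a). w = f b}"
      have "{w. \<exists>a \<in> ext U t. w = f a} = f ` ext U t" by blast
      then have "isset U (ext U x \<union> {w. \<exists>a \<in> ext U t. w = f a})"
        using isset_Un[OF isset_ext isset_image[OF assms(2) isset_ext]] by simp
      then obtain z where z: "ext U z = ext U x \<union> {w. \<exists>a \<in> ext U t. w = f a}" unfolding isset_def by blast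
      then have "P z" using IH by blast
      moreover have "ext U (adj z (f a)) = ext U y" unfolding y using z by auto
      ultimately show "P y" using assms(4)[of z "f a"] unfolding ext_eq_iff by simp
    qed
  qed
  moreover have "ext U (the_set U (ext U x \<union> f ` ext U t)) = ext U x \<union> f ` ext U t"
    by (rule ext_the_set[OF isset_Un[OF isset_ext isset_image[OF assms(2) isset_ext]]])
  moreover have "{w. \<exists>a \<in> ext U t. w = f a} = f ` ext U t" by blast
  ultimately show ?thesis by simp
qed

text \<open>Every set is enumerated by a pair of ordinals, so that a finite set of ordinals determines a
  finite set of arbitrary sets.\<close>

lemma finite_approximation:
  obtains E where "dfun U E"
    "\<And>x. \<exists>a \<in> ordinals U. \<exists>b \<in> ordinals U. \<forall>s. a \<in> ext U s \<longrightarrow> b \<in> ext U s \<longrightarrow> x \<in> ext U (E s)"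
    "\<And>P s. dprd U P \<Longrightarrow> P (empty_set U) \<Longrightarrow> (\<And>x a. P x \<Longrightarrow> P (adj x a)) \<Longrightarrow> s \<in> Sigma_class U \<Longrightarrow> P (E s)"
proof -
  obtain T where T: "dt U (\<lambda>e. T (e 0) (e 1))" "\<And>y. \<exists>a \<in> ordinals U. \<exists>b \<in> ordinals U. T a b = y"
    by (rule pair_enumeration) (rule that)
  have dT: "dt U t \<Longrightarrow> dt U u \<Longrightarrow> dt U (\<lambda>e. T (t e) (u e))" for t u using T(1) by (rule dt_subst2)
  have dTa: "dfun U (T a)" for a by (intro dT df)
  define row where "row a t = wl U (\<lambda>z. ext U z = {y. \<exists>b \<in> ext U t. y = T a b})" for a t
  have row: "ext U (row a t) = T a ` ext U t" for a t
  proof -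
    have "{y. \<exists>b \<in> ext U t. y = T a b} = T a ` ext U t" by blast
    then show ?thesis unfolding row_def using wl_set isset_image[OF dTa isset_ext] by simp
  qed
  \<comment> \<open>Rows and columns have separate index sets, although both will be
    \<open>s\<close>: the induction runs over the rows while the columns stay fixed.\<close>
  define E2 where "E2 s t = wl U (\<lambda>z. ext U z = {y. \<exists>a \<in> ext U s. \<exists>b \<in> ext U t. y = T a b})" for s t
  have E2: "ext U (E2 s t) = {T a b | a b. a \<in> ext U s \<and> b \<in> ext U t}" for s t
  proof -
    have "dfun U (\<lambda>a. row a t)" unfolding row_def by (intro df dT)
    from isset_UN[OF this isset_ext, of s] have "isset U (\<Union>a \<in> ext U s. T a ` ext U t)" unfolding row .
    moreover have "(\<Union>a \<in> ext U s. T a ` ext U t) = {y. \<exists>a \<in> ext U s. \<exists>b \<in> ext U t. y = T a b}" by blast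
    ultimately have "ext U (E2 s t) = {y. \<exists>a \<in> ext U s. \<exists>b \<in> ext U t. y = T a b}" unfolding E2_def using wl_set by simp
    then show ?thesis by blast
  qed
  have dE2: "dt U u \<Longrightarrow> dt U v \<Longrightarrow> dt U (\<lambda>e. E2 (u e) (v e))" for u v
    by (rule dt_subst2[where f = E2]) (unfold E2_def, intro df dT)
  have P: "P (E2 s s)" if P: "dprd U P" "P (empty_set U)" "\<And>x a. P x \<Longrightarrow> P (adj x a)" and s: "s \<in> Sigma_class U" for P s
  proof -
    have fs: "fin s" using s Sigma_iff by blast
    show "P (E2 s s)"
    proof (rule fin_induct[OF fs, where P = "\<lambda>t. P (E2 t s)"])
      show "dprd U (\<lambda>t. P (E2 t s))" by (intro dprdD[OF P(1)] dE2 df)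
      have "ext U (E2 (empty_set U) s) = {}" by (simp add: E2)
      then show "P (E2 (empty_set U) s)" using P(2) unfolding ext_eq_empty by simp
      fix t a assume "P (E2 t s)"
      from fin_image_adj[OF fs dTa P(1,3) this] have *: "P (the_set U (ext U (E2 t s) \<union> T a ` ext U s))" .
      have "ext U (E2 (adj t a) s) = ext U (E2 t s) \<union> T a ` ext U s" unfolding E2 by auto
      then have "E2 (adj t a) s = the_set U (ext U (E2 t s) \<union> T a ` ext U s)" by (metis the_set_ext)
      then show "P (E2 (adj t a) s)" using * by simp
    qed
  qed
  show thesis
  proof (rule that[of "\<lambda>s. E2 s s"])
    show "dfun U (\<lambda>s. E2 s s)" by (intro dE2 df)
    fix x
    obtain a b where "a \<in> ordinals U" "b \<in> ordinals U" "T a b = x" using T(2) by blast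
    then show "\<exists>a \<in> ordinals U. \<exists>b \<in> ordinals U. \<forall>s. a \<in> ext U s \<longrightarrow> b \<in> ext U s \<longrightarrow> x \<in> ext U (E2 s s)"
      unfolding E2 by blast
  qed (rule P)
qed

end

section \<open>Merging parameters\<close>

text \<open>In contrast to \<open>dfn\<close>, no parameters are allowed.\<close>

definition fml :: "'v universe \<Rightarrow> ((nat \<Rightarrow> 'v) \<Rightarrow> bool) \<Rightarrow> bool" where
  "fml U P \<longleftrightarrow> (\<exists>\<phi>. \<forall>e. P e = sat U e \<phi>)"

lemma fmlI: "(\<And>e. P e = sat U e \<phi>) \<Longrightarrow> fml U P"
  unfolding fml_def by blast

lemma fml_cong: "(\<And>e. P e = Q e) \<Longrightarrow> fml U Q \<Longrightarrow> fml U P"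
  by (simp add: fml_def)

lemma fml_atoms: "fml U (\<lambda>e. mem U (e i) (e j))" "fml U (\<lambda>e. e i = e j)"
  by (rule fmlI[where \<phi> = "Mem i j"], simp) (rule fmlI[where \<phi> = "Eq i j"], simp)

lemma fml_not: "fml U P \<Longrightarrow> fml U (\<lambda>e. \<not> P e)"
  unfolding fml_def by (metis sat.simps(4))

lemma fml_conj: "fml U P \<Longrightarrow> fml U Q \<Longrightarrow> fml U (\<lambda>e. P e \<and> Q e)"
  unfolding fml_def by (metis sat.simps(5))

lemma fml_disj: "fml U P \<Longrightarrow> fml U Q \<Longrightarrow> fml U (\<lambda>e. P e \<or> Q e)"
  by (rule fml_cong[of _ "\<lambda>e. \<not> (\<not> P e \<and> \<not> Q e)"]) (simp, intro fml_not fml_conj)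

lemma fml_iff: "fml U P \<Longrightarrow> fml U Q \<Longrightarrow> fml U (\<lambda>e. P e = Q e)"
  by (rule fml_cong[of _ "\<lambda>e. (P e \<and> Q e) \<or> (\<not> P e \<and> \<not> Q e)"]) (blast, intro fml_not fml_conj fml_disj)

lemma fml_all:
  assumes "fml U (\<lambda>e. P (e 0) (\<lambda>i. e (Suc i)))"
  shows "fml U (\<lambda>e. \<forall>x. P x e)"
proof -
  obtain \<phi> where \<phi>: "\<forall>e. P (e 0) (\<lambda>i. e (Suc i)) = sat U e \<phi>" using assms unfolding fml_def by (elim exE)
  have "P x e = sat U (case_nat x e) \<phi>" for x e using \<phi>[rule_format, of "case_nat x e"] by simp
  then show ?thesis by (intro fmlI[where \<phi> = "All \<phi>"]) simp
qed

lemma fml_ex: "fml U (\<lambda>e. P (e 0) (\<lambda>i. e (Suc i))) \<Longrightarrow> fml U (\<lambda>e. \<exists>x. P x e)"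
  by (rule fml_cong[of _ "\<lambda>e. \<not> (\<forall>x. \<not> P x e)"]) (simp, intro fml_not fml_all)

lemma fml_ren: "fml U P \<Longrightarrow> fml U (\<lambda>e. P (\<lambda>i. e (r i)))"
  unfolding fml_def by (metis sat_ren)

lemma sat_dependence: "\<exists>n. \<forall>e e'. (\<forall>i<n. e i = e' i) \<longrightarrow> sat U e \<phi> = sat U e' \<phi>"
proof (induction \<phi>)
  case (Mem i j)
  show ?case by (rule exI[of _ "Suc (max i j)"]) auto
next
  case (Leq i j)
  show ?case by (rule exI[of _ "Suc (max i j)"]) auto
next
  case (Eq i j)
  show ?case by (rule exI[of _ "Suc (max i j)"]) auto
next
  case (Neg \<phi>)
  then show ?case by auto
next
  case (Conj \<phi> \<psi>)
  then obtain n m where n: "\<forall>e e'. (\<forall>i<n. e i = e' i) \<longrightarrow> sat U e \<phi> = sat U e' \<phi>"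
    and m: "\<forall>e e'. (\<forall>i<m. e i = e' i) \<longrightarrow> sat U e \<psi> = sat U e' \<psi>" by (elim exE)
  have "sat U e (Conj \<phi> \<psi>) = sat U e' (Conj \<phi> \<psi>)" if "\<forall>i<max n m. e i = e' i" for e e'
    using n[rule_format, of e e'] m[rule_format, of e e'] that by simp
  then show ?case by blast
next
  case (All \<phi>)
  then obtain n where n: "\<forall>e e'. (\<forall>i<n. e i = e' i) \<longrightarrow> sat U e \<phi> = sat U e' \<phi>" by (elim exE)
  have "sat U e (All \<phi>) = sat U e' (All \<phi>)" if "\<forall>i<n. e i = e' i" for e e'
  proof -
    have "\<forall>i<n. case_nat x e i = case_nat x e' i" for x using that by (auto split: nat.split)
    then have "sat U (case_nat x e) \<phi> = sat U (case_nat x e') \<phi>" for x using n by blast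
    then show ?thesis by simp
  qed
  then show ?case by blast
qed

context nbg
begin

text \<open>Pairing spelled out in membership and equality, since \<open>fml\<close> admits neither
  parameters nor defined terms.\<close>

lemma opair_graph: "z = opair U x y \<longleftrightarrow> (\<exists>u v. (\<forall>w. mem U w z = (w = u \<or> w = v)) \<and>
    (\<forall>w. mem U w u = (w = x)) \<and> (\<forall>w. mem U w v = (w = x \<or> w = y)))"
proof -
  have e: "(\<forall>w. mem U w z = (w = u \<or> w = v)) \<longleftrightarrow> ext U z = {u, v}" for z u v
    unfolding ext_def by blast
  have e1: "(\<forall>w. mem U w z = (w = u)) \<longleftrightarrow> ext U z = {u}" for z u
    unfolding ext_def by blast
  have "ext U z = {x, y} \<longleftrightarrow> z = dbl x y" "ext U z = {x} \<longleftrightarrow> z = sing x" for z x y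
    unfolding dbl_def sing_def using the_set_eq by (metis isset_doubleton, metis isset_singleton)
  then show ?thesis unfolding e e1 opair_dbl by simp
qed

lemma fml_opair: "fml U (\<lambda>e. e i = opair U (e j) (e k))"
  unfolding opair_graph by (intro fml_ex fml_conj fml_all fml_iff fml_disj fml_atoms)

text \<open>Variable 0 ranges over the class and the remaining \<open>n + 1\<close> relevant
  variables are parameters; the first two of these are merged into an ordered pair until one is
  left. The merged parameter depends definably on the original ones, which is what families of
  classes require.\<close>

lemma param_code:
  assumes "fml U P" "\<And>e e'. (\<forall>i<n + 2. e i = e' i) \<Longrightarrow> P e = P e'"
  shows "\<exists>\<psi> t. dt U t \<and> (\<forall>e x. P (case_nat x e) = sat U (case_nat x (\<lambda>_. t e)) \<psi>)"
  using assms
proof (induction n arbitrary: P)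
  case 0
  obtain \<psi> where \<psi>: "\<And>e. P e = sat U e \<psi>" using 0(1) unfolding fml_def by blast
  have "P (case_nat x e) = P (case_nat x (\<lambda>_. e 0))" for x e
    by (rule 0(2)) (auto simp: less_Suc_eq numeral_2_eq_2)
  then show ?case by (intro exI[of _ \<psi>] exI[of _ "\<lambda>e. e 0"]) (simp add: \<psi> df)
next
  case (Suc n)
  \<comment> \<open>\<open>P1\<close> reads variable 1 as a pair and unpacks it into the first two
    parameters, so it depends on one variable fewer.\<close>
  define P1 where "P1 e \<longleftrightarrow> (\<exists>u v. e (Suc 0) = opair U u v \<and>
    P (case_nat (e 0) (case_nat u (case_nat v (\<lambda>i. e (Suc (Suc i)))))))" for e
  have "fml U P1" unfolding P1_def
  proof (intro fml_ex fml_conj fml_opair)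
    let ?r = "case_nat (Suc (Suc 0)) (case_nat (Suc 0) (case_nat 0 (\<lambda>i. Suc (Suc (Suc (Suc i))))))"
    have "case_nat (e (Suc (Suc 0))) (case_nat (e (Suc 0)) (case_nat (e 0) (\<lambda>i. e (Suc (Suc (Suc (Suc i))))))) = (\<lambda>i. e (?r i))"
      for e :: "nat \<Rightarrow> 'v" by (auto split: nat.split)
    then show "fml U (\<lambda>e. P (case_nat (e (Suc (Suc 0))) (case_nat (e (Suc 0)) (case_nat (e 0) (\<lambda>i. e (Suc (Suc (Suc (Suc i)))))))))"
      using fml_ren[OF Suc.prems(1), of ?r] by simp
  qed
  moreover have "P1 e = P1 e'" if e: "\<forall>i<n + 2. e i = e' i" for e e'
  proof -
    have "P (case_nat (e 0) (case_nat u (case_nat v (\<lambda>i. e (Suc (Suc i)))))) =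
        P (case_nat (e' 0) (case_nat u (case_nat v (\<lambda>i. e' (Suc (Suc i))))))" for u v
      by (rule Suc.prems(2)) (use e in \<open>auto split: nat.split\<close>)
    then show ?thesis unfolding P1_def using e by simp
  qed
  ultimately have "\<exists>\<psi> t. dt U t \<and> (\<forall>e x. P1 (case_nat x e) = sat U (case_nat x (\<lambda>_. t e)) \<psi>)" by (rule Suc.IH)
  then obtain \<psi> t where t: "dt U t" "\<And>e x. P1 (case_nat x e) = sat U (case_nat x (\<lambda>_. t e)) \<psi>" by blast
  let ?m = "\<lambda>e. case_nat (opair U (e 0) (e (Suc 0))) (\<lambda>i. e (Suc (Suc i)))"
  have "P (case_nat x e) = P1 (case_nat x (?m e))" for x e
  proof -
    have "case_nat x e = case_nat x (case_nat (e 0) (case_nat (e (Suc 0)) (\<lambda>i. e (Suc (Suc i)))))"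
      by (auto split: nat.split)
    then show ?thesis unfolding P1_def by simp
  qed
  moreover have "dt U (\<lambda>e. t (?m e))" by (rule dt_subst[OF t(1)]) (intro df)
  ultimately show ?case using t(2) by (intro exI[of _ \<psi>] exI[of _ "\<lambda>e. t (?m e)"]) simp
qed

text \<open>A definable family of classes is coded by one fixed formula and a parameter definable
  from the environment. In this shape a hypothesis such as \<open>coded U \<F>\<close>, whose
  quantifier over formulas is external, applies to families.\<close>

lemma dfn_code:
  assumes "dfn U (\<lambda>e. Q (e 0) (\<lambda>i. e (Suc i)))"
  shows "\<exists>\<psi> t. dt U t \<and> (\<forall>e. coded_class U \<psi> (t e) = {x. Q x e})"
proof -
  obtain \<phi> \<sigma> where 1: "\<forall>e :: nat \<Rightarrow> 'v. Q (e 0) (\<lambda>i. e (Suc i)) = sat U (\<lambda>i. case_sum e id (\<sigma> i)) \<phi>"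
    using assms unfolding dfn_def by (elim exE)
  define r where "r i = (if \<sigma> i = Inl 0 then 0 else Suc i)" for i
  define \<gamma> where "\<gamma> i e = (case \<sigma> i of Inl j \<Rightarrow> e (j - 1) | Inr c \<Rightarrow> c)" for i and e :: "nat \<Rightarrow> 'v"
  have \<gamma>: "dt U (\<gamma> i)" for i unfolding \<gamma>_def by (cases "\<sigma> i") (simp_all add: df)
  have "case_nat x (\<lambda>i. \<gamma> i e) (r i) = case_sum (case_nat x e) id (\<sigma> i)" for x e i
    by (auto simp: r_def \<gamma>_def split: sum.split nat.split)
  then have Q: "Q x e = sat U (case_nat x (\<lambda>i. \<gamma> i e)) (ren r \<phi>)" for x e
    using 1[rule_format, of "case_nat x e"] by (simp add: sat_ren)
  obtain n where n: "\<forall>e e'. (\<forall>i<n. e i = e' i) \<longrightarrow> sat U e (ren r \<phi>) = sat U e' (ren r \<phi>)"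
    using sat_dependence by blast
  have "\<exists>\<psi> t. dt U t \<and> (\<forall>e x. sat U (case_nat x e) (ren r \<phi>) = sat U (case_nat x (\<lambda>_. t e)) \<psi>)"
  proof (rule param_code)
    show "fml U (\<lambda>e. sat U e (ren r \<phi>))" by (rule fmlI) (rule refl)
    show "sat U e (ren r \<phi>) = sat U e' (ren r \<phi>)" if "\<forall>i<n + 2. e i = e' i" for e e'
      using n that by simp
  qed
  then obtain \<psi> t where t: "dt U t" "\<And>e x. sat U (case_nat x e) (ren r \<phi>) = sat U (case_nat x (\<lambda>_. t e)) \<psi>" by blast
  have "dt U (\<lambda>e. t (\<lambda>i. \<gamma> i e))" by (rule dt_subst[OF t(1) \<gamma>])
  moreover have "coded_class U \<psi> (t (\<lambda>i. \<gamma> i e)) = {x. Q x e}" for e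
    unfolding coded_class_def Q t(2) ..
  ultimately show ?thesis by (intro exI[of _ \<psi>] exI[of _ "\<lambda>e. t (\<lambda>i. \<gamma> i e)"]) simp
qed

lemma df_coded_class: "dt U t \<Longrightarrow> dt U u \<Longrightarrow> dfn U (\<lambda>e. t e \<in> coded_class U \<phi> (u e))"
  unfolding coded_class_def using dfn_sat[of U "\<lambda>i e. case_nat (t e) (\<lambda>_. u e) i" \<phi>] by (simp add: df)

section \<open>Representatives of reals\<close>

lemmas RF = NBG_real_facts[OF NBG, unfolded real_facts_def]

lemmas RF_sub = RF[THEN conjunct2, THEN conjunct2, THEN conjunct2, THEN conjunct1]
lemmas RF_graphs = RF[THEN conjunct2, THEN conjunct2, THEN conjunct2, THEN conjunct2, THEN conjunct2, THEN conjunct1]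
lemmas RF_eud = RF[THEN conjunct2, THEN conjunct2, THEN conjunct2, THEN conjunct2, THEN conjunct1]

lemma ordered_field_reals: "ordered_field (real_struct U)" by (rule RF[THEN conjunct1])
lemma real_pairing: "real_pairing U" by (rule RF[THEN conjunct2, THEN conjunct1])
lemma isset_reals: "isset U (reals U)" by (rule RF[THEN conjunct2, THEN conjunct2, THEN conjunct1])
lemma real_no_max: "r \<in> reals U \<Longrightarrow> \<exists>t \<in> reals U. \<not> real_le U t r"
  by (rule bspec[OF RF[THEN conjunct2, THEN conjunct2, THEN conjunct2, THEN conjunct2, THEN conjunct2, THEN conjunct2]])

lemma df_reals [df]: "dt U t \<Longrightarrow> dfn U (\<lambda>e. t e \<in> reals U)"
  by (rule dprdD[OF isset_dprd[OF isset_reals]])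

definition eud :: "'v \<Rightarrow> 'v" where "eud f = eudoxus U (app U (ext U f))"

lemma reals_eud: "reals U = eud ` almost_homs U"
  unfolding reals_def eud_def by blast

lemma eud_real: "f \<in> almost_homs U \<Longrightarrow> eud f \<in> reals U"
  unfolding reals_eud by (rule imageI)

lemma real_eudE:
  assumes "x \<in> reals U"
  obtains f where "f \<in> almost_homs U" "x = eud f"
  using assms unfolding reals_eud by (elim imageE) (rule that)

lemma eud_mem: "f \<in> almost_homs U \<Longrightarrow> g \<in> almost_homs U \<Longrightarrow> g \<in> ext U (eud f) \<longleftrightarrow> eud g = eud f"
  unfolding eud_def using bspec[OF bspec[OF RF_eud], of f g] by auto

lemma mem_real: "x \<in> reals U \<Longrightarrow> f \<in> ext U x \<longleftrightarrow> f \<in> almost_homs U \<and> eud f = x"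
proof -
  assume x: "x \<in> reals U"
  then have "x \<in> eud ` almost_homs U" unfolding reals_eud .
  then obtain g where g: "x = eud g" "g \<in> almost_homs U" by (rule imageE)
  have "ext U x \<subseteq> almost_homs U" by (rule bspec[OF RF_sub x])
  then show ?thesis unfolding g(1) using eud_mem[OF g(2), of f] by auto
qed

lemma almost_homs_iff: "f \<in> almost_homs U \<longleftrightarrow> (\<exists>x \<in> reals U. f \<in> ext U x)"
  using mem_real[of _ f] mem_real[OF eud_real, of f f] eud_real[of f] by blast

lemma df_almost_homs [df]: "dt U t \<Longrightarrow> dfn U (\<lambda>e. t e \<in> almost_homs U)"
  by (rule dfn_subst1[where P = "\<lambda>f. f \<in> almost_homs U"]) (unfold almost_homs_iff, intro df)

definition rp :: "'v \<Rightarrow> 'v" where "rp x = wl U (\<lambda>f. f \<in> ext U x)"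

lemma df_rp [df]: "dt U t \<Longrightarrow> dt U (\<lambda>e. rp (t e))"
  by (rule dt_subst1[where f = rp]) (unfold rp_def, intro df)

lemma rp: assumes "x \<in> reals U" shows "rp x \<in> almost_homs U" "eud (rp x) = x"
proof -
  obtain f where "f \<in> almost_homs U" "x = eud f" using assms by (rule real_eudE)
  then have "f \<in> ext U x" using mem_real[OF assms] by simp
  moreover have "dprd U (\<lambda>f. f \<in> ext U x)" by (intro df)
  ultimately have "rp x \<in> ext U x" unfolding rp_def by (rule wl_props(1)[rotated])
  then show "rp x \<in> almost_homs U" "eud (rp x) = x" using mem_real[OF assms] by auto
qed

lemma int_add_in: "p \<in> ints U \<Longrightarrow> q \<in> ints U \<Longrightarrow> int_add U p q \<in> ints U"
  by (simp add: int_add_eq)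

lemma almost_hom_cong: "(\<And>p. p \<in> ints U \<Longrightarrow> f p = g p) \<Longrightarrow> almost_hom U f = almost_hom U g"
  unfolding almost_hom_def bounded_range_def using int_add_in by (simp cong: ball_cong_simp)

lemma sim_sigma_cong: "(\<And>p. p \<in> ints U \<Longrightarrow> f p = g p) \<Longrightarrow> sim_sigma U f h = sim_sigma U g h"
  "(\<And>p. p \<in> ints U \<Longrightarrow> f p = g p) \<Longrightarrow> sim_sigma U h f = sim_sigma U h g"
  unfolding sim_sigma_def bounded_range_def by (simp_all cong: ball_cong_simp)

lemma eudoxus_cong: "(\<And>p. p \<in> ints U \<Longrightarrow> f p = g p) \<Longrightarrow> eudoxus U f = eudoxus U g"
  unfolding eudoxus_def using sim_sigma_cong(1)[of f g] by simp

text \<open>The section of \<open>G\<close> at \<open>s\<close> as a set of the model, written with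
  \<open>wl\<close> so that it is definable also when \<open>G\<close> varies in a definable
  family.\<close>

definition slice :: "'v set \<Rightarrow> 'v \<Rightarrow> 'v" where
  "slice G s = wl U (\<lambda>f. ext U f = {w. \<exists>p \<in> ints U. w = opair U p (wl U (\<lambda>y. opair U (opair U p s) y \<in> G))})"

text \<open>The definable substitute for \<open>val\<close>; they agree on \<open>A0 U\<close> over
  \<open>Sigma_class U\<close> by \<open>val_vl\<close>.\<close>

definition vl :: "'v set \<Rightarrow> 'v \<Rightarrow> 'v" where
  "vl G s = wl U (\<lambda>x. x \<in> reals U \<and> slice G s \<in> ext U x)"

lemma slice_lam:
  assumes "definable U G"
  shows "slice G s = lam (ints U) (\<lambda>p. wl U (\<lambda>y. opair U (opair U p s) y \<in> G))"
proof -
  have d: "dfun U (\<lambda>p. wl U (\<lambda>y. opair U (opair U p s) y \<in> G))" by (intro df definable_dfn[OF assms])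
  let ?X = "(\<lambda>p. opair U p (wl U (\<lambda>y. opair U (opair U p s) y \<in> G))) ` ints U"
  have "{w. \<exists>p \<in> ints U. w = opair U p (wl U (\<lambda>y. opair U (opair U p s) y \<in> G))} = ?X" by blast
  moreover have "isset U ?X" by (rule isset_image[OF _ isset_ints]) (intro df definable_dfn[OF assms])
  ultimately have "ext U (slice G s) = ?X" unfolding slice_def using wl_set by simp
  then have "ext U (slice G s) = ext U (lam (ints U) (\<lambda>p. wl U (\<lambda>y. opair U (opair U p s) y \<in> G)))"
    using ext_lam[OF isset_ints d] by simp
  then show ?thesis unfolding ext_eq_iff .
qed

lemma slice_props:
  assumes "definable U G" "class_fun U (class_prod U (ints U) (Sigma_class U)) (ints U) G" "s \<in> Sigma_class U"
  shows "class_fun U (ints U) (ints U) (ext U (slice G s))"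
    "p \<in> ints U \<Longrightarrow> app U (ext U (slice G s)) p = app U G (opair U p s)"
proof -
  let ?f = "\<lambda>p. wl U (\<lambda>y. opair U (opair U p s) y \<in> G)"
  have d: "dfun U ?f" by (intro df definable_dfn[OF assms(1)])
  have f: "?f p = app U G (opair U p s)" if "p \<in> ints U" for p
    using app_eq_wl[OF assms(2), of "opair U p s"] that assms(3) by simp
  have "app U G (opair U p s) \<in> ints U" if p: "p \<in> ints U" for p
  proof -
    have "\<exists>!y. opair U (opair U p s) y \<in> G"
      using assms(2)[unfolded class_fun_def, THEN conjunct2] p assms(3) by simp
    then have "opair U (opair U p s) (app U G (opair U p s)) \<in> G" unfolding app_def by (rule theI')
    then show ?thesis using assms(2) unfolding class_fun_def by auto
  qed
  then have "?f ` ints U \<subseteq> ints U" using f by auto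
  from class_fun_lam[OF isset_ints d this]
  show cf: "class_fun U (ints U) (ints U) (ext U (slice G s))" unfolding slice_lam[OF assms(1)] .
  show "app U (ext U (slice G s)) p = app U G (opair U p s)" if p: "p \<in> ints U" for p
    using app_eq_ap[OF cf p] f[OF p] ap_lam[OF isset_ints d p] unfolding slice_lam[OF assms(1)] by simp
qed

lemma A0_iff: "G \<in> A0 U \<longleftrightarrow> definable U G \<and> class_fun U (class_prod U (ints U) (Sigma_class U)) (ints U) G \<and>
    (\<forall>s \<in> Sigma_class U. slice G s \<in> almost_homs U)"
proof -
  have "almost_hom U (\<lambda>p. app U G (opair U p s)) \<longleftrightarrow> slice G s \<in> almost_homs U"
    if G: "definable U G" "class_fun U (class_prod U (ints U) (Sigma_class U)) (ints U) G" and s: "s \<in> Sigma_class U" for s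
  proof -
    have "almost_hom U (\<lambda>p. app U G (opair U p s)) = almost_hom U (app U (ext U (slice G s)))"
      by (rule almost_hom_cong) (simp add: slice_props(2)[OF G s])
    then show ?thesis unfolding almost_homs_def using slice_props(1)[OF G s] by simp
  qed
  then show ?thesis unfolding A0_def by blast
qed

lemma val_eud:
  assumes "G \<in> A0 U" "s \<in> Sigma_class U"
  shows "val U G s = eud (slice G s)"
  unfolding val_def eud_def by (rule eudoxus_cong) (use assms slice_props(2) A0_iff in simp)

lemma val_reals: "G \<in> A0 U \<Longrightarrow> s \<in> Sigma_class U \<Longrightarrow> val U G s \<in> reals U"
  using val_eud A0_iff eud_real by simp

lemma val_vl:
  assumes "G \<in> A0 U" "s \<in> Sigma_class U"
  shows "val U G s = vl G s"
proof -
  have a: "slice G s \<in> almost_homs U" using assms A0_iff by blast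
  have "vl G s = eud (slice G s)" unfolding vl_def
  proof (rule wl_eq)
    show "eud (slice G s) \<in> reals U \<and> slice G s \<in> ext U (eud (slice G s))"
      using eud_real[OF a] eud_mem[OF a a] by simp
    show "y = eud (slice G s)" if "y \<in> reals U \<and> slice G s \<in> ext U y" for y
      using that mem_real[of y "slice G s"] by auto
  qed
  then show ?thesis using val_eud[OF assms] by simp
qed

lemma sim_sigma_val:
  assumes "F \<in> A0 U" "G \<in> A0 U" "s \<in> Sigma_class U"
  shows "sim_sigma U (\<lambda>p. app U F (opair U p s)) (\<lambda>p. app U G (opair U p s)) \<longleftrightarrow> val U F s = val U G s"
proof -
  have a: "slice F s \<in> almost_homs U" "slice G s \<in> almost_homs U" using assms A0_iff by blast+
  have "sim_sigma U (\<lambda>p. app U F (opair U p s)) (\<lambda>p. app U G (opair U p s)) \<longleftrightarrow>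
      sim_sigma U (app U (ext U (slice F s))) (\<lambda>p. app U G (opair U p s))"
    by (rule sim_sigma_cong(1)) (use assms slice_props(2) A0_iff in simp)
  also have "\<dots> \<longleftrightarrow> sim_sigma U (app U (ext U (slice F s))) (app U (ext U (slice G s)))"
    by (rule sim_sigma_cong(2)) (use assms slice_props(2) A0_iff in simp)
  also have "\<dots> \<longleftrightarrow> val U F s = val U G s"
    unfolding val_eud[OF assms(1,3)] val_eud[OF assms(2,3)] eud_def using bspec[OF bspec[OF RF_eud a(1)] a(2)] by blast
  finally show ?thesis .
qed

text \<open>The class itself may depend on a parameter, in a definable way; this is the situation of
  classes given by codes.\<close>

lemma df_slice:
  assumes "dfn U (\<lambda>e. e 0 \<in> \<Phi> (e 1))" "dt U t" "dt U u"
  shows "dt U (\<lambda>e. slice (\<Phi> (t e)) (u e))"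
proof -
  note d = dfn_subst2[where P = "\<lambda>x y. x \<in> \<Phi> y", OF assms(1)]
  show ?thesis
    by (rule dt_subst2[where f = "\<lambda>x y. slice (\<Phi> x) y", OF _ assms(2,3)]) (unfold slice_def, intro df d)
qed

lemma df_vl:
  assumes "dfn U (\<lambda>e. e 0 \<in> \<Phi> (e 1))" "dt U t" "dt U u"
  shows "dt U (\<lambda>e. vl (\<Phi> (t e)) (u e))"
  by (rule dt_subst2[where f = "\<lambda>x y. vl (\<Phi> x) y", OF _ assms(2,3)])
     (unfold vl_def, intro df df_slice[where \<Phi> = \<Phi>] assms(1))

lemma df_vl1: "definable U G \<Longrightarrow> dt U t \<Longrightarrow> dt U (\<lambda>e. vl G (t e))"
  by (rule df_vl[where \<Phi> = "\<lambda>_. G" and t = "\<lambda>e. e 0"]) (unfold definable_iff, assumption, rule dt_var)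

lemma df_A0:
  assumes "dfn U (\<lambda>e. e 0 \<in> \<Phi> (e 1))" "dt U t"
  shows "dfn U (\<lambda>e. \<Phi> (t e) \<in> A0 U)"
proof (rule dfn_subst1[where P = "\<lambda>x. \<Phi> x \<in> A0 U", OF _ assms(2)])
  note d = dfn_subst2[where P = "\<lambda>x y. x \<in> \<Phi> y", OF assms(1)]
  \<comment> \<open>The conjunct of \<open>A0_iff\<close> on definability is not a condition inside
    the model. It holds for every member of the family and is simplified away.\<close>
  have "definable U (\<Phi> a)" for a
    unfolding definable_iff by (intro d df)
  then show "dprd U (\<lambda>x. \<Phi> x \<in> A0 U)"
    unfolding A0_iff by (simp only: simp_thms) (intro df d df_slice[where \<Phi> = \<Phi>] assms(1))
qed

text \<open>The converse of taking values: a definable map from \<open>Sigma_class U\<close> to the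
  reals is lifted to an element of \<open>A0 U\<close> by choosing the least representative of each
  real. This is why every element of the definable ultrapower of the reals comes from
  \<open>A0 U\<close>.\<close>

definition mk :: "('v \<Rightarrow> 'v) \<Rightarrow> 'v set" where
  "mk h = {w. \<exists>p \<in> ints U. \<exists>s \<in> Sigma_class U. w = opair U (opair U p s) (ap (rp (h s)) p)}"

lemma mk:
  assumes "dfun U h" "\<And>s. s \<in> Sigma_class U \<Longrightarrow> h s \<in> reals U"
  shows "mk h \<in> A0 U" "s \<in> Sigma_class U \<Longrightarrow> val U (mk h) s = h s"
proof -
  have m: "opair U (opair U p s) y \<in> mk h \<longleftrightarrow> p \<in> ints U \<and> s \<in> Sigma_class U \<and> y = ap (rp (h s)) p" for p s y
    unfolding mk_def by auto
  have d: "definable U (mk h)" unfolding definable_iff mk_def by (intro df dfunD[OF assms(1)])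
  have rcf: "class_fun U (ints U) (ints U) (ext U (rp (h s)))" if "s \<in> Sigma_class U" for s
    using rp(1)[OF assms(2)[OF that]] unfolding almost_homs_def by blast
  have cf: "class_fun U (class_prod U (ints U) (Sigma_class U)) (ints U) (mk h)"
    unfolding class_fun_def
  proof
    show "mk h \<subseteq> class_prod U (class_prod U (ints U) (Sigma_class U)) (ints U)"
      unfolding mk_def using class_fun_ap(1)[OF rcf] by auto
    show "\<forall>x \<in> class_prod U (ints U) (Sigma_class U). \<exists>!y. opair U x y \<in> mk h"
    proof
      fix x assume "x \<in> class_prod U (ints U) (Sigma_class U)"
      then obtain p s where "x = opair U p s" "p \<in> ints U" "s \<in> Sigma_class U" unfolding class_prod_def by blast
      then show "\<exists>!y. opair U x y \<in> mk h" by (simp add: m)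
    qed
  qed
  have sl: "slice (mk h) s = rp (h s)" if s: "s \<in> Sigma_class U" for s
  proof (rule class_fun_ext[OF slice_props(1)[OF d cf s] rcf[OF s]])
    fix p assume p: "p \<in> ints U"
    have "dfun U (\<lambda>p. wl U (\<lambda>y. opair U (opair U p s) y \<in> mk h))" by (intro df definable_dfn[OF d])
    then have "ap (slice (mk h) s) p = wl U (\<lambda>y. opair U (opair U p s) y \<in> mk h)"
      unfolding slice_lam[OF d] by (rule ap_lam[OF isset_ints _ p])
    also have "\<dots> = ap (rp (h s)) p" by (rule wl_eq) (use p s m in blast)+
    finally show "ap (slice (mk h) s) p = ap (rp (h s)) p" .
  qed
  show A: "mk h \<in> A0 U" unfolding A0_iff using d cf sl rp(1) assms(2) by simp
  show "s \<in> Sigma_class U \<Longrightarrow> val U (mk h) s = h s"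
    using val_eud[OF A] sl rp(2) assms(2) by simp
qed

section \<open>The definable copy of the real field\<close>

lemma real_closed:
  "real_zero U \<in> reals U" "real_one U \<in> reals U"
  "r \<in> reals U \<Longrightarrow> t \<in> reals U \<Longrightarrow> real_add U r t \<in> reals U"
  "r \<in> reals U \<Longrightarrow> t \<in> reals U \<Longrightarrow> real_mult U r t \<in> reals U"
proof -
  let ?R = "\<lparr>carrier = reals U, monoid.mult = real_mult U, one = real_one U, zero = real_zero U, add = real_add U\<rparr>"
  have "field ?R" using ordered_field_reals unfolding ordered_field_def real_struct_def by simp
  then interpret R: field ?R .
  show "real_zero U \<in> reals U" "real_one U \<in> reals U" using R.zero_closed R.one_closed by simp_all
  show "r \<in> reals U \<Longrightarrow> t \<in> reals U \<Longrightarrow> real_add U r t \<in> reals U"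
    "r \<in> reals U \<Longrightarrow> t \<in> reals U \<Longrightarrow> real_mult U r t \<in> reals U"
    using R.a_closed[of r t] R.m_closed[of r t] by simp_all
qed

text \<open>One of the sets provided by \<open>real_graphs\<close>, fixed so that it can be used as
  a parameter.\<close>

definition gA :: 'v where "gA = (SOME A. \<forall>r \<in> reals U. \<forall>t \<in> reals U. \<forall>u \<in> reals U.
  opair U r (opair U t u) \<in> ext U A \<longleftrightarrow> real_add U r t = u)"
definition gM :: 'v where "gM = (SOME A. \<forall>r \<in> reals U. \<forall>t \<in> reals U. \<forall>u \<in> reals U.
  opair U r (opair U t u) \<in> ext U A \<longleftrightarrow> real_mult U r t = u)"
definition gL :: 'v where "gL = (SOME A. \<forall>r \<in> reals U. \<forall>t \<in> reals U. opair U r t \<in> ext U A \<longleftrightarrow> real_le U r t)"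

lemma gA: "r \<in> reals U \<Longrightarrow> t \<in> reals U \<Longrightarrow> u \<in> reals U \<Longrightarrow> opair U r (opair U t u) \<in> ext U gA \<longleftrightarrow> real_add U r t = u"
proof -
  have "\<exists>A. \<forall>r \<in> reals U. \<forall>t \<in> reals U. \<forall>u \<in> reals U. opair U r (opair U t u) \<in> ext U A \<longleftrightarrow> real_add U r t = u"
    using RF_graphs by (elim exE, rule_tac x = A in exI) simp
  note * = someI_ex[OF this, folded gA_def]
  assume "r \<in> reals U" "t \<in> reals U" "u \<in> reals U"
  then show ?thesis using * by blast
qed

lemma gM: "r \<in> reals U \<Longrightarrow> t \<in> reals U \<Longrightarrow> u \<in> reals U \<Longrightarrow> opair U r (opair U t u) \<in> ext U gM \<longleftrightarrow> real_mult U r t = u"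
proof -
  have "\<exists>A. \<forall>r \<in> reals U. \<forall>t \<in> reals U. \<forall>u \<in> reals U. opair U r (opair U t u) \<in> ext U A \<longleftrightarrow> real_mult U r t = u"
    using RF_graphs by (elim exE, rule_tac x = M in exI) simp
  note * = someI_ex[OF this, folded gM_def]
  assume "r \<in> reals U" "t \<in> reals U" "u \<in> reals U"
  then show ?thesis using * by blast
qed

lemma gL: "r \<in> reals U \<Longrightarrow> t \<in> reals U \<Longrightarrow> opair U r t \<in> ext U gL \<longleftrightarrow> real_le U r t"
proof -
  have "\<exists>A. \<forall>r \<in> reals U. \<forall>t \<in> reals U. opair U r t \<in> ext U A \<longleftrightarrow> real_le U r t"
    using RF_graphs by (elim exE, rule_tac x = L in exI) simp
  note * = someI_ex[OF this, folded gL_def]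
  assume "r \<in> reals U" "t \<in> reals U"
  then show ?thesis using * by blast
qed

text \<open>A copy of \<open>real_struct U\<close> whose operations are definable for all arguments.
  The two have the same truth values under assignments of reals, by \<open>lsat_rs\<close>, so
  pointwise statements in the ultrapower may use this copy.\<close>

definition rs :: "('v, 'v) lstruct" where
  "rs = \<lparr>carr = reals U, ladd = (\<lambda>r t. wl U (\<lambda>u. u \<in> reals U \<and> opair U r (opair U t u) \<in> ext U gA)),
     lmul = (\<lambda>r t. wl U (\<lambda>u. u \<in> reals U \<and> opair U r (opair U t u) \<in> ext U gM)), lle = (\<lambda>r t. opair U r t \<in> ext U gL),
     lzero = real_zero U, lone = real_one U, lrel = (\<lambda>R xs. tuple U xs \<in> ext U R)\<rparr>"

lemma rs_ops:
  assumes "r \<in> reals U" "t \<in> reals U"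
  shows "ladd rs r t = real_add U r t" "lmul rs r t = real_mult U r t" "lle rs r t = real_le U r t"
proof -
  have "wl U (\<lambda>u. u \<in> reals U \<and> opair U r (opair U t u) \<in> ext U gA) = real_add U r t"
    by (rule wl_eq) (use gA[OF assms] real_closed(3)[OF assms] in blast)+
  then show "ladd rs r t = real_add U r t" by (simp add: rs_def)
  have "wl U (\<lambda>u. u \<in> reals U \<and> opair U r (opair U t u) \<in> ext U gM) = real_mult U r t"
    by (rule wl_eq) (use gM[OF assms] real_closed(4)[OF assms] in blast)+
  then show "lmul rs r t = real_mult U r t" by (simp add: rs_def)
  show "lle rs r t = real_le U r t" using gL[OF assms] by (simp add: rs_def)
qed

lemma rs_other: "carr rs = reals U" "lzero rs = real_zero U" "lone rs = real_one U" "lrel rs R xs \<longleftrightarrow> tuple U xs \<in> ext U R"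
  by (simp_all add: rs_def)

lemma real_struct_simps: "carr (real_struct U) = reals U" "ladd (real_struct U) = real_add U" "lmul (real_struct U) = real_mult U"
  "lle (real_struct U) = real_le U" "lzero (real_struct U) = real_zero U" "lone (real_struct U) = real_one U"
  "lrel (real_struct U) R xs \<longleftrightarrow> tuple U xs \<in> ext U R"
  by (simp_all add: real_struct_def)

lemma leval_rs:
  assumes "\<And>i. e i \<in> reals U"
  shows "leval (real_struct U) e t \<in> reals U \<and> leval rs e t = leval (real_struct U) e t"
  by (induction t) (simp_all add: assms rs_ops rs_other real_closed real_struct_simps)

lemma lsat_rs:
  assumes "\<And>i. e i \<in> reals U"
  shows "lsat rs e \<phi> = lsat (real_struct U) e \<phi>"
  using assms
proof (induction \<phi> arbitrary: e)
  case (LAll \<phi>)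
  have "lsat rs (case_nat x e) \<phi> = lsat (real_struct U) (case_nat x e) \<phi>" if "x \<in> reals U" for x
    by (rule LAll.IH) (use that LAll.prems in \<open>auto split: nat.split\<close>)
  then show ?case by (simp add: rs_other real_struct_simps)
next
  case (LRel R ts)
  have "map (leval rs e) ts = map (leval (real_struct U) e) ts"
    by (intro map_cong refl) (use leval_rs[of e] LRel in blast)
  then show ?case unfolding lsat.simps rs_other real_struct_simps by (rule arg_cong)
qed (use leval_rs rs_ops in \<open>simp_all add: real_struct_simps\<close>)

lemma dt_leval: "dt U (\<lambda>e. leval rs e t)"
proof (induction t)
  case (LAdd s t)
  have "dt U (\<lambda>e. wl U (\<lambda>u. u \<in> reals U \<and> opair U (e 0) (opair U (e 1) u) \<in> ext U gA))" by (intro df)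
  from dt_subst2[where f = "\<lambda>x y. wl U (\<lambda>u. u \<in> reals U \<and> opair U x (opair U y u) \<in> ext U gA)", OF this LAdd]
  show ?case by (simp add: rs_def)
next
  case (LMul s t)
  have "dt U (\<lambda>e. wl U (\<lambda>u. u \<in> reals U \<and> opair U (e 0) (opair U (e 1) u) \<in> ext U gM))" by (intro df)
  from dt_subst2[where f = "\<lambda>x y. wl U (\<lambda>u. u \<in> reals U \<and> opair U x (opair U y u) \<in> ext U gM)", OF this LMul]
  show ?case by (simp add: rs_def)
qed (simp_all add: df)

lemma dt_tuple: "(\<And>t. t \<in> set ts \<Longrightarrow> dt U t) \<Longrightarrow> dt U (\<lambda>e. tuple U (map (\<lambda>t. t e) ts))"
proof (induction ts rule: induct_list012)
  case (3 t u ts)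
  then show ?case by (simp add: df)
qed (simp_all add: df)

text \<open>The induction is external: each formula separately yields a definable predicate of the
  assignment.\<close>

lemma dfn_lsat: "dfn U (\<lambda>e. lsat rs e \<phi>)"
proof (induction \<phi>)
  case (LEq s t)
  then show ?case by (simp add: dfn_eq dt_leval)
next
  case (LLe s t)
  then show ?case using dt_leval by (simp add: rs_def df)
next
  case (LRel R ts)
  have "dt U (\<lambda>e. tuple U (map (\<lambda>t. t e) (map (\<lambda>t e. leval rs e t) ts)))"
    by (rule dt_tuple) (auto intro: dt_leval)
  then show ?case by (simp add: rs_other df comp_def)
next
  case (LAll \<phi>)
  have "dfn U (\<lambda>e. \<forall>x \<in> reals U. lsat rs (case_nat x e) \<phi>)"
  proof (rule dfn_ball, rule dfn_imp)
    have "case_nat (e 0) (\<lambda>i. e (Suc i)) = e" for e :: "nat \<Rightarrow> 'v" by (auto split: nat.split)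
    then show "dfn U (\<lambda>e. lsat rs (case_nat (e 0) (\<lambda>i. e (Suc i))) \<phi>)" using LAll by simp
  qed (intro df)
  then show ?case by (simp add: rs_other)
qed (simp_all add: df)

end

locale ultra = nbg U for U :: "'v universe" +
  fixes \<F> :: "'v set set"
  assumes uf: "definable_ultrafilter U \<F>"
    and hat: "\<And>\<alpha>. \<alpha> \<in> ordinals U \<Longrightarrow> hat U \<alpha> \<in> \<F>"
begin

section \<open>Largeness\<close>

definition large :: "('v \<Rightarrow> bool) \<Rightarrow> bool" where
  "large Q \<longleftrightarrow> {s \<in> Sigma_class U. Q s} \<in> \<F>"

lemma Sigma_subclass: "dprd U Q \<Longrightarrow> {s \<in> Sigma_class U. Q s} \<in> definable_subclasses U"
  unfolding definable_subclasses_def definable_iff mem_Collect_eq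
  by (intro conjI) (intro df, assumption, blast)

lemma large_cong: "(\<And>s. s \<in> Sigma_class U \<Longrightarrow> Q s = Q' s) \<Longrightarrow> large Q = large Q'"
  unfolding large_def by (metis (mono_tags, lifting) Collect_cong)

lemma large_mono:
  assumes "large Q" "dprd U Q'" "\<And>s. s \<in> Sigma_class U \<Longrightarrow> Q s \<Longrightarrow> Q' s"
  shows "large Q'"
proof -
  have "\<forall>X \<in> \<F>. \<forall>Y \<in> definable_subclasses U. X \<subseteq> Y \<longrightarrow> Y \<in> \<F>" using uf unfolding definable_ultrafilter_def by blast
  moreover have "{s \<in> Sigma_class U. Q s} \<subseteq> {s \<in> Sigma_class U. Q' s}" using assms(3) by blast
  ultimately show ?thesis using assms(1) Sigma_subclass[OF assms(2)] unfolding large_def by blast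
qed

lemma large_conj: assumes "large Q" "large Q'" shows "large (\<lambda>s. Q s \<and> Q' s)"
proof -
  have "\<forall>X \<in> \<F>. \<forall>Y \<in> \<F>. X \<inter> Y \<in> \<F>" using uf unfolding definable_ultrafilter_def by blast
  then have "{s \<in> Sigma_class U. Q s} \<inter> {s \<in> Sigma_class U. Q' s} \<in> \<F>" using assms unfolding large_def by blast
  moreover have "{s \<in> Sigma_class U. Q s} \<inter> {s \<in> Sigma_class U. Q' s} = {s \<in> Sigma_class U. Q s \<and> Q' s}" by blast
  ultimately show ?thesis unfolding large_def by simp
qed

lemma large_ex: assumes "large Q" shows "\<exists>s \<in> Sigma_class U. Q s"
proof -
  have "{} \<notin> \<F>" using uf unfolding definable_ultrafilter_def by blast
  then have "{s \<in> Sigma_class U. Q s} \<noteq> {}" using assms unfolding large_def by metis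
  then show ?thesis by blast
qed

lemma large_all: assumes "\<And>s. s \<in> Sigma_class U \<Longrightarrow> Q s" shows "large Q"
proof -
  have "Sigma_class U \<in> \<F>" using uf unfolding definable_ultrafilter_def by blast
  moreover have "{s \<in> Sigma_class U. Q s} = Sigma_class U" using assms by blast
  ultimately show ?thesis unfolding large_def by simp
qed

lemma large_not:
  assumes "dprd U Q"
  shows "large (\<lambda>s. \<not> Q s) \<longleftrightarrow> \<not> large Q"
proof
  assume "large (\<lambda>s. \<not> Q s)"
  then show "\<not> large Q" using large_conj[of Q "\<lambda>s. \<not> Q s"] large_ex[of "\<lambda>s. Q s \<and> \<not> Q s"] by blast
next
  assume n: "\<not> large Q"
  have "\<forall>X \<in> definable_subclasses U. X \<in> \<F> \<or> Sigma_class U - X \<in> \<F>" using uf unfolding definable_ultrafilter_def by blast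
  then have "Sigma_class U - {s \<in> Sigma_class U. Q s} \<in> \<F>" using n Sigma_subclass[OF assms] unfolding large_def by blast
  moreover have "Sigma_class U - {s \<in> Sigma_class U. Q s} = {s \<in> Sigma_class U. \<not> Q s}" by blast
  ultimately show "large (\<lambda>s. \<not> Q s)" unfolding large_def by simp
qed

text \<open>The coding of the ultrafilter enters here. By \<open>dfn_code\<close> the classes of the
  family share a formula and differ in a parameter definable from the environment, and for a fixed
  formula membership of the coded class in \<open>\<F>\<close> is a definable condition on the
  parameter.\<close>

lemma df_large [df]:
  assumes "dfn U (\<lambda>e. Q (e 0) (\<lambda>i. e (Suc i)))"
  shows "dfn U (\<lambda>e. large (\<lambda>s. Q s e))"
proof -
  have "dfn U (\<lambda>e. e 0 \<in> Sigma_class U \<and> Q (e 0) (\<lambda>i. e (Suc i)))" by (intro df assms)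
  from dfn_code[of "\<lambda>s e. s \<in> Sigma_class U \<and> Q s e", OF this]
  obtain \<psi> t where t: "dt U t" "\<And>e. coded_class U \<psi> (t e) = {s. s \<in> Sigma_class U \<and> Q s e}" by blast
  have "coded U \<F>" using uf unfolding definable_ultrafilter_def by blast
  then have "definable_rel U 1 (\<lambda>as. map2 (coded_class U) [\<psi>] as ! 0 \<in> \<F>)"
    unfolding coded_def coded_rel_def by simp
  from definable_relD[OF this, of "[t]"] have "dfn U (\<lambda>e. coded_class U \<psi> (t e) \<in> \<F>)" using t(1) by simp
  then show ?thesis unfolding t(2) large_def .
qed

section \<open>The elements of the ultrapower\<close>

definition cls :: "'v set \<Rightarrow> 'v set set" where
  "cls G = {H \<in> A0 U. large (\<lambda>s. vl G s = vl H s)}"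

lemma A0_definable: "G \<in> A0 U \<Longrightarrow> definable U G" unfolding A0_iff by blast

lemma df_vlA [df]: "G \<in> A0 U \<Longrightarrow> dt U t \<Longrightarrow> dt U (\<lambda>e. vl G (t e))"
  by (rule df_vl1[OF A0_definable])

lemma dprd_vl_eq: "G \<in> A0 U \<Longrightarrow> H \<in> A0 U \<Longrightarrow> dprd U (\<lambda>s. vl G s = vl H s)"
  by (rule dfn_eq[OF df_vlA[OF _ dt_var] df_vlA[OF _ dt_var]])

lemma dprd_vl_const: "G \<in> A0 U \<Longrightarrow> dprd U (\<lambda>s. vl G s = c)"
  by (rule dfn_eq[OF df_vlA[OF _ dt_var] dt_const])

lemma vl_reals: "G \<in> A0 U \<Longrightarrow> s \<in> Sigma_class U \<Longrightarrow> vl G s \<in> reals U"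
  using val_reals val_vl by metis

lemma sim_image: assumes "G \<in> A0 U" shows "sim_sigma_tau U \<F> `` {G} = cls G"
proof -
  have "(G, H) \<in> sim_sigma_tau U \<F> \<longleftrightarrow> H \<in> cls G" for H
  proof (cases "H \<in> A0 U")
    case True
    have "large (\<lambda>s. sim_sigma U (\<lambda>p. app U G (opair U p s)) (\<lambda>p. app U H (opair U p s))) = large (\<lambda>s. vl G s = vl H s)"
      by (rule large_cong) (simp add: sim_sigma_val[OF assms True] val_vl assms True)
    then show ?thesis unfolding sim_sigma_tau_def cls_def large_def using assms True by simp
  qed (simp add: sim_sigma_tau_def cls_def)
  then show ?thesis by blast
qed

lemma IIR_carr: "carr (IIR0 U \<F>) = cls ` A0 U"
proof -
  have "carr (IIR0 U \<F>) = (\<Union>G \<in> A0 U. {sim_sigma_tau U \<F> `` {G}})" by (simp add: IIR0_def quotient_def)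
  also have "\<dots> = (\<Union>G \<in> A0 U. {cls G})" by (intro SUP_cong refl) (simp add: sim_image)
  finally show ?thesis by blast
qed

lemma cls_mem: "H \<in> cls G \<longleftrightarrow> H \<in> A0 U \<and> large (\<lambda>s. vl G s = vl H s)" unfolding cls_def by blast

lemma cls_self: "G \<in> A0 U \<Longrightarrow> G \<in> cls G"
  unfolding cls_mem using large_all[of "\<lambda>s. vl G s = vl G s"] by blast

lemma cls_eq:
  assumes "G \<in> A0 U" "H \<in> A0 U"
  shows "cls G = cls H \<longleftrightarrow> large (\<lambda>s. vl G s = vl H s)"
proof
  assume "cls G = cls H"
  then show "large (\<lambda>s. vl G s = vl H s)" using cls_self[OF assms(2)] cls_mem by blast
next
  have sub: "cls H \<subseteq> cls G" if "G \<in> A0 U" "H \<in> A0 U" "large (\<lambda>s. vl G s = vl H s)" for G H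
  proof
    fix K assume K: "K \<in> cls H"
    then have KA: "K \<in> A0 U" using cls_mem by blast
    have "large (\<lambda>s. vl G s = vl H s \<and> vl H s = vl K s)" using large_conj that(3) K cls_mem by blast
    then have "large (\<lambda>s. vl G s = vl K s)"
      by (rule large_mono) (rule dprd_vl_eq[OF that(1) KA], simp)
    then show "K \<in> cls G" using K cls_mem by blast
  qed
  assume l: "large (\<lambda>s. vl G s = vl H s)"
  then have "large (\<lambda>s. vl H s = vl G s)" by (simp add: eq_commute)
  then show "cls G = cls H" using sub assms l by blast
qed

lemma cls_mem_eq: "G \<in> A0 U \<Longrightarrow> H \<in> cls G \<Longrightarrow> cls H = cls G"
  using cls_eq cls_mem by metis

text \<open>Other representatives agree with the given ones on large classes, and these may be
  intersected, so the result is a single class. Here \<open>op\<close> is the operation of the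
  original structure and \<open>rop\<close> its definable form; they agree on reals.\<close>

lemma op_cls:
  assumes "\<And>t u. dt U t \<Longrightarrow> dt U u \<Longrightarrow> dt U (\<lambda>e. rop (t e) (u e))"
    "\<And>r t. r \<in> reals U \<Longrightarrow> t \<in> reals U \<Longrightarrow> rop r t = op r t"
    "F \<in> A0 U" "G \<in> A0 U" "K \<in> A0 U" "large (\<lambda>s. vl K s = rop (vl F s) (vl G s))"
  shows "{H \<in> A0 U. \<exists>F' \<in> cls F. \<exists>G' \<in> cls G. {s \<in> Sigma_class U. val U H s = op (val U F' s) (val U G' s)} \<in> \<F>} = cls K"
proof -
  have eq: "{s \<in> Sigma_class U. val U H s = op (val U F' s) (val U G' s)} \<in> \<F> \<longleftrightarrow> large (\<lambda>s. vl H s = rop (vl F' s) (vl G' s))"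
    if "H \<in> A0 U" "F' \<in> A0 U" "G' \<in> A0 U" for H F' G'
    unfolding large_def[symmetric] by (rule large_cong) (simp add: val_vl that assms(2) vl_reals)
  show ?thesis
  proof (intro equalityI subsetI)
    fix H assume "H \<in> {H \<in> A0 U. \<exists>F' \<in> cls F. \<exists>G' \<in> cls G. {s \<in> Sigma_class U. val U H s = op (val U F' s) (val U G' s)} \<in> \<F>}"
    then obtain F' G' where H: "H \<in> A0 U" "F' \<in> cls F" "G' \<in> cls G" "large (\<lambda>s. vl H s = rop (vl F' s) (vl G' s))"
      using eq cls_mem by blast
    have "large (\<lambda>s. (vl H s = rop (vl F' s) (vl G' s) \<and> vl K s = rop (vl F s) (vl G s)) \<and> (vl F s = vl F' s \<and> vl G s = vl G' s))"
      using H(2,3) cls_mem by (intro large_conj H(4) assms(6)) blast+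
    then have "large (\<lambda>s. vl K s = vl H s)" by (rule large_mono) (rule dprd_vl_eq[OF assms(5) H(1)], simp)
    then show "H \<in> cls K" using H(1) cls_mem by blast
  next
    fix H assume H: "H \<in> cls K"
    then have "H \<in> A0 U" "large (\<lambda>s. vl K s = vl H s)" using cls_mem by blast+
    from large_conj[OF this(2) assms(6)]
    have "large (\<lambda>s. vl H s = rop (vl F s) (vl G s))"
      by (rule large_mono) (rule dfn_eq[OF df_vlA[OF \<open>H \<in> A0 U\<close> dt_var] assms(1)[OF df_vlA[OF assms(3) dt_var] df_vlA[OF assms(4) dt_var]]], metis)
    then show "H \<in> {H \<in> A0 U. \<exists>F' \<in> cls F. \<exists>G' \<in> cls G. {s \<in> Sigma_class U. val U H s = op (val U F' s) (val U G' s)} \<in> \<F>}"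
      using eq[OF \<open>H \<in> A0 U\<close> assms(3,4)] cls_self[OF assms(3)] cls_self[OF assms(4)] \<open>H \<in> A0 U\<close> by blast
  qed
qed

lemma df_rs:
  "dt U t \<Longrightarrow> dt U u \<Longrightarrow> dt U (\<lambda>e. ladd rs (t e) (u e))"
  "dt U t \<Longrightarrow> dt U u \<Longrightarrow> dt U (\<lambda>e. lmul rs (t e) (u e))"
  "dt U t \<Longrightarrow> dt U u \<Longrightarrow> dfn U (\<lambda>e. lle rs (t e) (u e))"
proof -
  have 1: "dt U (\<lambda>e. wl U (\<lambda>u. u \<in> reals U \<and> opair U (e 0) (opair U (e 1) u) \<in> ext U g))" for g by (intro df)
  note 2 = dt_subst2[where f = "\<lambda>x y. wl U (\<lambda>u. u \<in> reals U \<and> opair U x (opair U y u) \<in> ext U g)" for g, OF 1]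
  show "dt U t \<Longrightarrow> dt U u \<Longrightarrow> dt U (\<lambda>e. ladd rs (t e) (u e))" using 2[of t u gA] by (simp add: rs_def)
  show "dt U t \<Longrightarrow> dt U u \<Longrightarrow> dt U (\<lambda>e. lmul rs (t e) (u e))" using 2[of t u gM] by (simp add: rs_def)
  show "dt U t \<Longrightarrow> dt U u \<Longrightarrow> dfn U (\<lambda>e. lle rs (t e) (u e))" by (simp add: rs_def df)
qed

lemma IIR_ops:
  "ladd (IIR0 U \<F>) x y = {H \<in> A0 U. \<exists>F \<in> x. \<exists>G \<in> y. {s \<in> Sigma_class U. val U H s = real_add U (val U F s) (val U G s)} \<in> \<F>}"
  "lmul (IIR0 U \<F>) x y = {H \<in> A0 U. \<exists>F \<in> x. \<exists>G \<in> y. {s \<in> Sigma_class U. val U H s = real_mult U (val U F s) (val U G s)} \<in> \<F>}"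
  "lle (IIR0 U \<F>) x y \<longleftrightarrow> (\<exists>F \<in> x. \<exists>G \<in> y. {s \<in> Sigma_class U. real_le U (val U F s) (val U G s)} \<in> \<F>)"
  by (simp_all add: IIR0_def)

lemma IIR_add: "F \<in> A0 U \<Longrightarrow> G \<in> A0 U \<Longrightarrow> K \<in> A0 U \<Longrightarrow> large (\<lambda>s. vl K s = ladd rs (vl F s) (vl G s)) \<Longrightarrow>
    ladd (IIR0 U \<F>) (cls F) (cls G) = cls K"
  unfolding IIR_ops by (rule op_cls[of "ladd rs" "real_add U", OF df_rs(1) rs_ops(1)])

lemma IIR_mul: "F \<in> A0 U \<Longrightarrow> G \<in> A0 U \<Longrightarrow> K \<in> A0 U \<Longrightarrow> large (\<lambda>s. vl K s = lmul rs (vl F s) (vl G s)) \<Longrightarrow>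
    lmul (IIR0 U \<F>) (cls F) (cls G) = cls K"
  unfolding IIR_ops by (rule op_cls[of "lmul rs" "real_mult U", OF df_rs(2) rs_ops(2)])

lemma IIR_le:
  assumes "F \<in> A0 U" "G \<in> A0 U"
  shows "lle (IIR0 U \<F>) (cls F) (cls G) \<longleftrightarrow> large (\<lambda>s. lle rs (vl F s) (vl G s))"
proof -
  have eq: "{s \<in> Sigma_class U. real_le U (val U F' s) (val U G' s)} \<in> \<F> \<longleftrightarrow> large (\<lambda>s. lle rs (vl F' s) (vl G' s))"
    if "F' \<in> A0 U" "G' \<in> A0 U" for F' G'
    unfolding large_def[symmetric] by (rule large_cong) (simp add: val_vl that rs_ops vl_reals)
  have "lle (IIR0 U \<F>) (cls F) (cls G) \<longleftrightarrow> (\<exists>F' \<in> cls F. \<exists>G' \<in> cls G. large (\<lambda>s. lle rs (vl F' s) (vl G' s)))"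
    unfolding IIR_ops using eq cls_mem by blast
  also have "\<dots> \<longleftrightarrow> large (\<lambda>s. lle rs (vl F s) (vl G s))"
  proof
    assume "\<exists>F' \<in> cls F. \<exists>G' \<in> cls G. large (\<lambda>s. lle rs (vl F' s) (vl G' s))"
    then obtain F' G' where H: "F' \<in> cls F" "G' \<in> cls G" "large (\<lambda>s. lle rs (vl F' s) (vl G' s))" by blast
    have "large (\<lambda>s. lle rs (vl F' s) (vl G' s) \<and> (vl F s = vl F' s \<and> vl G s = vl G' s))"
      using H(1,2) cls_mem by (intro large_conj H(3)) blast+
    then show "large (\<lambda>s. lle rs (vl F s) (vl G s))"
      by (rule large_mono) (rule df_rs(3)[OF df_vlA[OF assms(1) dt_var] df_vlA[OF assms(2) dt_var]], simp)
  qed (use cls_self assms in blast)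
  finally show ?thesis .
qed

lemma IIR_const:
  assumes "K \<in> A0 U" "large (\<lambda>s. vl K s = c)"
  shows "{H \<in> A0 U. {s \<in> Sigma_class U. val U H s = c} \<in> \<F>} = cls K"
proof -
  have "{s \<in> Sigma_class U. val U H s = c} \<in> \<F> \<longleftrightarrow> large (\<lambda>s. vl K s = vl H s)" if H: "H \<in> A0 U" for H
  proof -
    have "{s \<in> Sigma_class U. val U H s = c} \<in> \<F> \<longleftrightarrow> large (\<lambda>s. vl H s = c)"
      unfolding large_def[symmetric] by (rule large_cong) (simp add: val_vl H)
    also have "\<dots> \<longleftrightarrow> large (\<lambda>s. vl K s = vl H s)"
    proof
      assume "large (\<lambda>s. vl H s = c)"
      from large_conj[OF assms(2) this] show "large (\<lambda>s. vl K s = vl H s)"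
        by (rule large_mono) (rule dprd_vl_eq[OF assms(1) H], simp)
    next
      assume "large (\<lambda>s. vl K s = vl H s)"
      from large_conj[OF assms(2) this] show "large (\<lambda>s. vl H s = c)"
        by (rule large_mono) (rule dprd_vl_const[OF H], metis)
    qed
    finally show ?thesis .
  qed
  then show ?thesis unfolding cls_def by blast
qed

text \<open>The lists have standard length, so finitely many large classes are intersected one after
  the other.\<close>

lemma large_tuple_cong:
  assumes "list_all2 (\<lambda>F G. F \<in> A0 U \<and> G \<in> cls F) Fs Gs"
  shows "large (\<lambda>s. map (\<lambda>F. vl F s) Fs = map (\<lambda>F. vl F s) Gs)"
  using assms
proof (induction rule: list_all2_induct)
  case Nil
  then show ?case by (rule large_all) simp
next
  case (Cons F Fs G Gs)
  have "large (\<lambda>s. vl F s = vl G s)" using Cons(1) cls_mem by blast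
  from large_conj[OF this Cons.IH] show ?case by simp
qed

lemma IIR_rel:
  assumes "set Fs \<subseteq> A0 U"
  shows "lrel (IIR0 U \<F>) R (map cls Fs) \<longleftrightarrow> large (\<lambda>s. tuple U (map (\<lambda>F. vl F s) Fs) \<in> ext U R)"
proof -
  have dtup: "dfn U (\<lambda>e. tuple U (map (\<lambda>F. vl F (e 0)) Gs) \<in> ext U R)" if "set Gs \<subseteq> A0 U" for Gs
  proof -
    have "dt U (\<lambda>e. tuple U (map (\<lambda>t. t e) (map (\<lambda>F e. vl F (e 0)) Gs)))"
      by (rule dt_tuple) (use that in \<open>auto intro!: df\<close>)
    then show ?thesis by (intro df) (simp add: comp_def)
  qed
  have eq: "{s \<in> Sigma_class U. tuple U (map (\<lambda>F. val U F s) Gs) \<in> ext U R} \<in> \<F> \<longleftrightarrow>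
      large (\<lambda>s. tuple U (map (\<lambda>F. vl F s) Gs) \<in> ext U R)" if "set Gs \<subseteq> A0 U" for Gs
    unfolding large_def[symmetric]
  proof (rule large_cong)
    fix s assume "s \<in> Sigma_class U"
    then have "map (\<lambda>F. val U F s) Gs = map (\<lambda>F. vl F s) Gs" using that val_vl by (intro map_cong) auto
    then show "(tuple U (map (\<lambda>F. val U F s) Gs) \<in> ext U R) = (tuple U (map (\<lambda>F. vl F s) Gs) \<in> ext U R)"
      by (rule arg_cong[where f = "\<lambda>xs. tuple U xs \<in> ext U R"])
  qed
  show ?thesis
  proof
    assume "lrel (IIR0 U \<F>) R (map cls Fs)"
    then obtain Gs where G: "list_all2 (\<in>) Gs (map cls Fs)" "{s \<in> Sigma_class U. tuple U (map (\<lambda>F. val U F s) Gs) \<in> ext U R} \<in> \<F>"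
      by (auto simp: IIR0_def)
    have l2: "list_all2 (\<lambda>F G. F \<in> A0 U \<and> G \<in> cls F) Fs Gs"
      using G(1) assms unfolding list_all2_conv_all_nth by (auto simp: subset_iff)
    then have "set Gs \<subseteq> A0 U" unfolding list_all2_conv_all_nth using cls_mem by (auto simp: in_set_conv_nth)
    then have "large (\<lambda>s. tuple U (map (\<lambda>F. vl F s) Gs) \<in> ext U R)" using G(2) eq by blast
    from large_conj[OF this large_tuple_cong[OF l2]]
    show "large (\<lambda>s. tuple U (map (\<lambda>F. vl F s) Fs) \<in> ext U R)"
      by (rule large_mono) (rule dtup[OF assms], metis)
  next
    assume "large (\<lambda>s. tuple U (map (\<lambda>F. vl F s) Fs) \<in> ext U R)"
    moreover have "list_all2 (\<in>) Fs (map cls Fs)"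
      using assms cls_self unfolding list_all2_conv_all_nth by (auto simp: subset_iff)
    ultimately show "lrel (IIR0 U \<F>) R (map cls Fs)" using eq[OF assms] by (auto simp: IIR0_def)
  qed
qed

section \<open>The theorem of Los\<close>

lemma vl_mk:
  assumes "dfun U h" "\<And>s. s \<in> Sigma_class U \<Longrightarrow> h s \<in> reals U"
  shows "s \<in> Sigma_class U \<Longrightarrow> vl (mk h) s = h s"
  using mk[OF assms] val_vl by metis

text \<open>A term is evaluated pointwise and the resulting map is lifted by \<open>mk\<close>. The
  atomic cases of Los's theorem thereby reduce to the facts about two classes.\<close>

lemma leval_IIR:
  assumes e: "\<And>i. e i \<in> A0 U"
  defines "h \<equiv> \<lambda>t s. leval rs (\<lambda>i. vl (e i) s) t"
  shows "leval (IIR0 U \<F>) (\<lambda>i. cls (e i)) t = cls (mk (h t))" "mk (h t) \<in> A0 U" "s \<in> Sigma_class U \<Longrightarrow> vl (mk (h t)) s = h t s"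
proof -
  have dh: "dfun U (h t)" for t
    unfolding h_def using dt_subst[OF dt_leval, of "\<lambda>i e'. vl (e i) (e' 0)"] by (simp add: df e)
  have hr: "h t s \<in> reals U" if "s \<in> Sigma_class U" for t s
    unfolding h_def using leval_rs[of "\<lambda>i. vl (e i) s" t] vl_reals[OF e that] by simp
  have A: "mk (h t) \<in> A0 U" for t using mk(1)[OF dh hr] .
  have v: "vl (mk (h t)) s = h t s" if "s \<in> Sigma_class U" for t s using vl_mk[OF dh hr that] .
  show "mk (h t) \<in> A0 U" "s \<in> Sigma_class U \<Longrightarrow> vl (mk (h t)) s = h t s" using A v by blast+
  show "leval (IIR0 U \<F>) (\<lambda>i. cls (e i)) t = cls (mk (h t))"
  proof (induction t)
    case (LVar i)
    have "large (\<lambda>s. vl (e i) s = vl (mk (h (LVar i))) s)" by (rule large_all) (simp add: v, simp add: h_def)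
    then show ?case using cls_eq[OF e A] by simp
  next
    case (LAdd s t)
    have "large (\<lambda>x. vl (mk (h (LAdd s t))) x = ladd rs (vl (mk (h s)) x) (vl (mk (h t)) x))"
      by (rule large_all) (simp add: v, simp add: h_def)
    from IIR_add[OF A A A this] show ?case using LAdd by simp
  next
    case (LMul s t)
    have "large (\<lambda>x. vl (mk (h (LMul s t))) x = lmul rs (vl (mk (h s)) x) (vl (mk (h t)) x))"
      by (rule large_all) (simp add: v, simp add: h_def)
    from IIR_mul[OF A A A this] show ?case using LMul by simp
  next
    case LZero
    have "large (\<lambda>s. vl (mk (h LZero)) s = real_zero U)" by (rule large_all) (simp add: v, simp add: h_def rs_other)
    from IIR_const[OF A this] show ?case by (simp add: IIR0_def)
  next
    case LOne
    have "large (\<lambda>s. vl (mk (h LOne)) s = real_one U)" by (rule large_all) (simp add: v, simp add: h_def rs_other)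
    from IIR_const[OF A this] show ?case by (simp add: IIR0_def)
  qed
qed

lemma dprd_lsat: "(\<And>i. e i \<in> A0 U) \<Longrightarrow> dprd U (\<lambda>s. lsat rs (\<lambda>i. vl (e i) s) \<phi>)"
  using dfn_subst[OF dfn_lsat, of "\<lambda>i e'. vl (e i) (e' 0)"] by (simp add: df)

theorem Los:
  assumes "lformula U \<phi>" "\<And>i. e i \<in> A0 U"
  shows "lsat (IIR0 U \<F>) (\<lambda>i. cls (e i)) \<phi> \<longleftrightarrow> large (\<lambda>s. lsat rs (\<lambda>i. vl (e i) s) \<phi>)"
  using assms
proof (induction \<phi> arbitrary: e)
  case (LEq s t)
  note L = leval_IIR[of e, OF LEq.prems(2)]
  have "large (\<lambda>x. vl (mk (\<lambda>x. leval rs (\<lambda>i. vl (e i) x) s)) x = vl (mk (\<lambda>x. leval rs (\<lambda>i. vl (e i) x) t)) x) \<longleftrightarrow>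
      large (\<lambda>x. lsat rs (\<lambda>i. vl (e i) x) (LEq s t))"
    by (rule large_cong) (simp add: L(3))
  then show ?case using L(1) cls_eq[OF L(2) L(2)] by simp
next
  case (LLe s t)
  note L = leval_IIR[of e, OF LLe.prems(2)]
  have "large (\<lambda>x. lle rs (vl (mk (\<lambda>x. leval rs (\<lambda>i. vl (e i) x) s)) x) (vl (mk (\<lambda>x. leval rs (\<lambda>i. vl (e i) x) t)) x)) \<longleftrightarrow>
      large (\<lambda>x. lsat rs (\<lambda>i. vl (e i) x) (LLe s t))"
    by (rule large_cong) (simp add: L(3))
  then show ?case using L(1) IIR_le[OF L(2) L(2)] by simp
next
  case (LRel R ts)
  note L = leval_IIR[of e, OF LRel.prems(2)]
  let ?K = "\<lambda>t. mk (\<lambda>x. leval rs (\<lambda>i. vl (e i) x) t)"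
  have "map (leval (IIR0 U \<F>) (\<lambda>i. cls (e i))) ts = map cls (map ?K ts)" using L(1) by simp
  then have "lsat (IIR0 U \<F>) (\<lambda>i. cls (e i)) (LRel R ts) = lrel (IIR0 U \<F>) R (map cls (map ?K ts))"
    unfolding lsat.simps by (rule arg_cong)
  moreover have "set (map ?K ts) \<subseteq> A0 U" using L(2) by auto
  moreover have "large (\<lambda>s. tuple U (map (\<lambda>F. vl F s) (map ?K ts)) \<in> ext U R) \<longleftrightarrow>
      large (\<lambda>s. lsat rs (\<lambda>i. vl (e i) s) (LRel R ts))"
  proof (rule large_cong)
    fix s assume "s \<in> Sigma_class U"
    then have "map (\<lambda>F. vl F s) (map ?K ts) = map (leval rs (\<lambda>i. vl (e i) s)) ts" using L(3) by simp
    then show "(tuple U (map (\<lambda>F. vl F s) (map ?K ts)) \<in> ext U R) = lsat rs (\<lambda>i. vl (e i) s) (LRel R ts)"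
      unfolding lsat.simps rs_other by (rule arg_cong[where f = "\<lambda>xs. tuple U xs \<in> ext U R"])
  qed
  ultimately show ?case using IIR_rel[of "map ?K ts" R] by argo
next
  case (LNeg \<phi>)
  then show ?case using large_not[OF dprd_lsat[of e \<phi>, OF LNeg.prems(2)]] by simp
next
  case (LConj \<phi> \<psi>)
  have "large (\<lambda>s. lsat rs (\<lambda>i. vl (e i) s) \<phi> \<and> lsat rs (\<lambda>i. vl (e i) s) \<psi>) \<longleftrightarrow>
      large (\<lambda>s. lsat rs (\<lambda>i. vl (e i) s) \<phi>) \<and> large (\<lambda>s. lsat rs (\<lambda>i. vl (e i) s) \<psi>)" (is "large ?P \<longleftrightarrow> _")
  proof
    assume l: "large ?P"
    show "large (\<lambda>s. lsat rs (\<lambda>i. vl (e i) s) \<phi>) \<and> large (\<lambda>s. lsat rs (\<lambda>i. vl (e i) s) \<psi>)"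
      using large_mono[OF l dprd_lsat[of e \<phi>, OF LConj.prems(2)]] large_mono[OF l dprd_lsat[of e \<psi>, OF LConj.prems(2)]] by blast
  qed (use large_conj in blast)
  then show ?case using LConj by simp
next
  case (LAll \<phi>)
  have c: "case_nat (cls G) (\<lambda>i. cls (e i)) = (\<lambda>i. cls (case_nat G e i))" for G
    by (rule ext) (simp split: nat.split)
  have v: "case_nat (vl G s) (\<lambda>i. vl (e i) s) = (\<lambda>i. vl (case_nat G e i) s)" for G s
    by (rule ext) (simp split: nat.split)
  have A: "case_nat G e i \<in> A0 U" if "G \<in> A0 U" for G i using that LAll.prems(2) by (cases i) simp_all
  have IH: "lsat (IIR0 U \<F>) (case_nat (cls G) (\<lambda>i. cls (e i))) \<phi> \<longleftrightarrow> large (\<lambda>s. lsat rs (case_nat (vl G s) (\<lambda>i. vl (e i) s)) \<phi>)"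
    if "G \<in> A0 U" for G
    unfolding c v using LAll.IH[of "case_nat G e"] LAll.prems(1) A[OF that] by simp
  have "(\<forall>G \<in> A0 U. large (\<lambda>s. lsat rs (case_nat (vl G s) (\<lambda>i. vl (e i) s)) \<phi>)) \<longleftrightarrow>
      large (\<lambda>s. \<forall>x \<in> reals U. lsat rs (case_nat x (\<lambda>i. vl (e i) s)) \<phi>)" (is "?L \<longleftrightarrow> large ?R")
  proof
    assume l: ?L
    have d2: "dfn U (\<lambda>f. lsat rs (case_nat (f 0) (\<lambda>i. vl (e i) (f 1))) \<phi>)"
    proof -
      have "dt U (\<lambda>f. case_nat (f 0) (\<lambda>i. vl (e i) (f 1)) i)" for i by (intro df LAll.prems(2))
      then show ?thesis by (rule dfn_subst[OF dfn_lsat])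
    qed
    note d2' = dfn_subst2[where P = "\<lambda>x s. lsat rs (case_nat x (\<lambda>i. vl (e i) s)) \<phi>", OF d2]
    have dR: "dprd U ?R" by (intro df d2')
    show "large ?R"
    proof (rule ccontr)
      assume "\<not> large ?R"
      then have nl: "large (\<lambda>s. \<not> ?R s)" using large_not[OF dR] by blast
      \<comment> \<open>The least counterexample where there is one, and zero elsewhere, so that
        \<open>h\<close> is a total definable map into the reals and can be lifted by
        \<open>mk\<close>.\<close>
      define h where "h s = (if ?R s then real_zero U else wl U (\<lambda>x. x \<in> reals U \<and> \<not> lsat rs (case_nat x (\<lambda>i. vl (e i) s)) \<phi>))" for s
      have dh: "dfun U h" unfolding h_def by (intro df d2')
      have h: "h s \<in> reals U \<and> (\<not> ?R s \<longrightarrow> \<not> lsat rs (case_nat (h s) (\<lambda>i. vl (e i) s)) \<phi>)" for s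
      proof (cases "?R s")
        case True
        then show ?thesis using real_closed(1) by (simp add: h_def)
      next
        case False
        then obtain x where x: "x \<in> reals U \<and> \<not> lsat rs (case_nat x (\<lambda>i. vl (e i) s)) \<phi>" by blast
        have "dprd U (\<lambda>x. x \<in> reals U \<and> \<not> lsat rs (case_nat x (\<lambda>i. vl (e i) s)) \<phi>)" by (intro df d2')
        note w = wl_props(1)[OF this x]
        have "h s = wl U (\<lambda>x. x \<in> reals U \<and> \<not> lsat rs (case_nat x (\<lambda>i. vl (e i) s)) \<phi>)"
          unfolding h_def by (rule if_not_P[OF False])
        then have "h s \<in> reals U \<and> \<not> lsat rs (case_nat (h s) (\<lambda>i. vl (e i) s)) \<phi>" using w by (rule ssubst)
        then show ?thesis by blast
      qed
      have mA: "mk h \<in> A0 U" using mk(1)[OF dh] h by blast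
      have "large (\<lambda>s. lsat rs (case_nat (vl (mk h) s) (\<lambda>i. vl (e i) s)) \<phi>)" using l mA by blast
      from large_ex[OF large_conj[OF this nl]]
      obtain s where "s \<in> Sigma_class U" "lsat rs (case_nat (vl (mk h) s) (\<lambda>i. vl (e i) s)) \<phi>" "\<not> ?R s" by blast
      moreover have "vl (mk h) s = h s" using vl_mk[OF dh] h \<open>s \<in> Sigma_class U\<close> by blast
      ultimately show False using h by simp
    qed
  next
    assume l: "large ?R"
    show ?L
    proof
      fix G assume G: "G \<in> A0 U"
      show "large (\<lambda>s. lsat rs (case_nat (vl G s) (\<lambda>i. vl (e i) s)) \<phi>)"
      proof (rule large_mono[OF l])
        show "dprd U (\<lambda>s. lsat rs (case_nat (vl G s) (\<lambda>i. vl (e i) s)) \<phi>)"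
          unfolding v by (rule dprd_lsat[OF A[OF G]])
      qed (use vl_reals[OF G] in blast)
    qed
  qed
  then show ?case using IH by (simp add: IIR_carr rs_other)
qed

end

section \<open>Transfer of the field axioms and properness of the extension\<close>

lemma ordered_field_props:
  assumes "ordered_field A"
  shows "lzero A \<in> carr A" "lone A \<in> carr A" "lone A \<noteq> lzero A"
    "x \<in> carr A \<Longrightarrow> y \<in> carr A \<Longrightarrow> ladd A x y \<in> carr A"
    "x \<in> carr A \<Longrightarrow> y \<in> carr A \<Longrightarrow> lmul A x y \<in> carr A"
    "x \<in> carr A \<Longrightarrow> y \<in> carr A \<Longrightarrow> z \<in> carr A \<Longrightarrow> ladd A (ladd A x y) z = ladd A x (ladd A y z)"
    "x \<in> carr A \<Longrightarrow> y \<in> carr A \<Longrightarrow> z \<in> carr A \<Longrightarrow> lmul A (lmul A x y) z = lmul A x (lmul A y z)"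
    "x \<in> carr A \<Longrightarrow> y \<in> carr A \<Longrightarrow> ladd A x y = ladd A y x"
    "x \<in> carr A \<Longrightarrow> y \<in> carr A \<Longrightarrow> lmul A x y = lmul A y x"
    "x \<in> carr A \<Longrightarrow> ladd A (lzero A) x = x" "x \<in> carr A \<Longrightarrow> lmul A (lone A) x = x"
    "x \<in> carr A \<Longrightarrow> y \<in> carr A \<Longrightarrow> z \<in> carr A \<Longrightarrow> lmul A (ladd A x y) z = ladd A (lmul A x z) (lmul A y z)"
    "x \<in> carr A \<Longrightarrow> \<exists>y \<in> carr A. ladd A y x = lzero A"
    "x \<in> carr A \<Longrightarrow> x \<noteq> lzero A \<Longrightarrow> \<exists>y \<in> carr A. lmul A x y = lone A"
proof -
  let ?R = "\<lparr>carrier = carr A, monoid.mult = lmul A, one = lone A, zero = lzero A, add = ladd A\<rparr>"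
  have "field ?R" using assms unfolding ordered_field_def by blast
  then interpret R: field ?R .
  show "lzero A \<in> carr A" "lone A \<in> carr A" "lone A \<noteq> lzero A"
    using R.zero_closed R.one_closed R.one_not_zero by simp_all
  show "x \<in> carr A \<Longrightarrow> y \<in> carr A \<Longrightarrow> ladd A x y \<in> carr A" using R.a_closed[of x y] by simp
  show "x \<in> carr A \<Longrightarrow> y \<in> carr A \<Longrightarrow> lmul A x y \<in> carr A" using R.m_closed[of x y] by simp
  show "x \<in> carr A \<Longrightarrow> y \<in> carr A \<Longrightarrow> z \<in> carr A \<Longrightarrow> ladd A (ladd A x y) z = ladd A x (ladd A y z)"
    using R.a_assoc[of x y z] by simp
  show "x \<in> carr A \<Longrightarrow> y \<in> carr A \<Longrightarrow> z \<in> carr A \<Longrightarrow> lmul A (lmul A x y) z = lmul A x (lmul A y z)"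
    using R.m_assoc[of x y z] by simp
  show "x \<in> carr A \<Longrightarrow> y \<in> carr A \<Longrightarrow> ladd A x y = ladd A y x" using R.a_comm[of x y] by simp
  show "x \<in> carr A \<Longrightarrow> y \<in> carr A \<Longrightarrow> lmul A x y = lmul A y x" using R.m_comm[of x y] by simp
  show "x \<in> carr A \<Longrightarrow> ladd A (lzero A) x = x" using R.l_zero[of x] by simp
  show "x \<in> carr A \<Longrightarrow> lmul A (lone A) x = x" using R.l_one[of x] by simp
  show "x \<in> carr A \<Longrightarrow> y \<in> carr A \<Longrightarrow> z \<in> carr A \<Longrightarrow> lmul A (ladd A x y) z = ladd A (lmul A x z) (lmul A y z)"
    using R.l_distr[of x y z] by simp
  show "x \<in> carr A \<Longrightarrow> \<exists>y \<in> carr A. ladd A y x = lzero A"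
    using R.l_neg[of x] R.a_inv_closed[of x] by auto
  show "x \<in> carr A \<Longrightarrow> x \<noteq> lzero A \<Longrightarrow> \<exists>y \<in> carr A. lmul A x y = lone A"
    using R.field_Units R.Units_r_inv[of x] R.Units_inv_closed[of x] by auto
qed

text \<open>The field axioms broken into closure conditions and first-order clauses, the latter to
  be transferred one at a time by Los's theorem.\<close>

lemma ordered_fieldI:
  assumes "lzero A \<in> carr A" "lone A \<in> carr A" "lone A \<noteq> lzero A"
    "\<And>x y. x \<in> carr A \<Longrightarrow> y \<in> carr A \<Longrightarrow> ladd A x y \<in> carr A"
    "\<And>x y. x \<in> carr A \<Longrightarrow> y \<in> carr A \<Longrightarrow> lmul A x y \<in> carr A"
    "\<And>x y z. x \<in> carr A \<Longrightarrow> y \<in> carr A \<Longrightarrow> z \<in> carr A \<Longrightarrow> ladd A (ladd A x y) z = ladd A x (ladd A y z)"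
    "\<And>x y z. x \<in> carr A \<Longrightarrow> y \<in> carr A \<Longrightarrow> z \<in> carr A \<Longrightarrow> lmul A (lmul A x y) z = lmul A x (lmul A y z)"
    "\<And>x y. x \<in> carr A \<Longrightarrow> y \<in> carr A \<Longrightarrow> ladd A x y = ladd A y x"
    "\<And>x y. x \<in> carr A \<Longrightarrow> y \<in> carr A \<Longrightarrow> lmul A x y = lmul A y x"
    "\<And>x. x \<in> carr A \<Longrightarrow> ladd A (lzero A) x = x" "\<And>x. x \<in> carr A \<Longrightarrow> lmul A (lone A) x = x"
    "\<And>x y z. x \<in> carr A \<Longrightarrow> y \<in> carr A \<Longrightarrow> z \<in> carr A \<Longrightarrow> lmul A (ladd A x y) z = ladd A (lmul A x z) (lmul A y z)"
    "\<And>x. x \<in> carr A \<Longrightarrow> \<exists>y \<in> carr A. ladd A y x = lzero A"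
    "\<And>x. x \<in> carr A \<Longrightarrow> x \<noteq> lzero A \<Longrightarrow> \<exists>y \<in> carr A. lmul A x y = lone A"
    "\<forall>x \<in> carr A. lle A x x"
    "\<forall>x \<in> carr A. \<forall>y \<in> carr A. lle A x y \<longrightarrow> lle A y x \<longrightarrow> x = y"
    "\<forall>x \<in> carr A. \<forall>y \<in> carr A. \<forall>z \<in> carr A. lle A x y \<longrightarrow> lle A y z \<longrightarrow> lle A x z"
    "\<forall>x \<in> carr A. \<forall>y \<in> carr A. lle A x y \<or> lle A y x"
    "\<forall>x \<in> carr A. \<forall>y \<in> carr A. \<forall>z \<in> carr A. lle A x y \<longrightarrow> lle A (ladd A x z) (ladd A y z)"
    "\<forall>x \<in> carr A. \<forall>y \<in> carr A. lle A (lzero A) x \<longrightarrow> lle A (lzero A) y \<longrightarrow> lle A (lzero A) (lmul A x y)"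
  shows "ordered_field A"
proof -
  let ?R = "\<lparr>carrier = carr A, monoid.mult = lmul A, one = lone A, zero = lzero A, add = ladd A\<rparr>"
  have "abelian_group ?R" by (rule abelian_groupI) (auto simp: assms(1,4,6,10,13) intro: assms(8))
  moreover have "comm_monoid ?R" by (rule comm_monoidI) (auto simp: assms(2,5,7,11) intro: assms(9))
  ultimately have "cring ?R" by (rule cringI) (simp add: assms(12))
  then have "field ?R" by (rule cring.cring_fieldI2) (simp_all add: assms(3)[symmetric] assms(14))
  then show ?thesis unfolding ordered_field_def using assms(15-20) by blast
qed

context nbg
begin

definition tuples :: "nat \<Rightarrow> 'v set" where
  "tuples m = {tuple U xs | xs. length xs = m \<and> set xs \<subseteq> reals U}"

lemma tuples_1: "tuples (Suc 0) = reals U"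
proof (intro equalityI subsetI)
  fix x assume "x \<in> reals U"
  then show "x \<in> tuples (Suc 0)" unfolding tuples_def by (intro CollectI exI[of _ "[x]"]) simp
qed (auto simp: tuples_def length_Suc_conv)

lemma tuples_Suc: "tuples (Suc (Suc m)) = class_prod U (reals U) (tuples (Suc m))"
proof (intro equalityI subsetI)
  fix z assume "z \<in> class_prod U (reals U) (tuples (Suc m))"
  then obtain x xs where x: "z = opair U x (tuple U xs)" "x \<in> reals U" "length xs = Suc m" "set xs \<subseteq> reals U"
    unfolding class_prod_def tuples_def by blast
  then have "z = tuple U (x # xs)" by (cases xs) simp_all
  then show "z \<in> tuples (Suc (Suc m))" using x unfolding tuples_def by (intro CollectI exI[of _ "x # xs"]) simp
next
  fix z assume "z \<in> tuples (Suc (Suc m))"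
  then obtain xs where x: "z = tuple U xs" "length xs = Suc (Suc m)" "set xs \<subseteq> reals U" unfolding tuples_def by blast
  then obtain a b ys where xs: "xs = a # b # ys" by (metis length_Suc_conv)
  have "tuple U (b # ys) \<in> tuples (Suc m)" using x xs unfolding tuples_def by (intro CollectI exI[of _ "b # ys"]) simp
  then show "z \<in> class_prod U (reals U) (tuples (Suc m))" using x xs by simp
qed

lemma isset_tuples: "isset U (tuples (Suc m))"
  by (induction m rule: nat.induct) (simp_all add: tuples_1 isset_reals tuples_Suc isset_class_prod)

lemma df_real_rels:
  assumes "0 < m" "dt U t"
  shows "dfn U (\<lambda>e. t e \<in> real_rels U m)"
proof -
  obtain k where m: "m = Suc k" using assms(1) gr0_implies_Suc by blast
  have d: "dt U u \<Longrightarrow> dfn U (\<lambda>e. u e \<in> tuples (Suc k))" for u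
    by (rule dprdD[OF isset_dprd[OF isset_tuples]])
  have "dfn U (\<lambda>e. e 0 \<in> real_rels U m)"
    unfolding real_rels_def m tuples_def[symmetric] by (intro df d)
  then show ?thesis by (rule dprdD[OF _ assms(2)])
qed

lemma dfn_all_less: "(\<And>i. i < n \<Longrightarrow> dfn U (P i)) \<Longrightarrow> dfn U (\<lambda>e. \<forall>i<n. P i e)" for n :: nat
proof (induction n)
  case (Suc n)
  have "dfn U (\<lambda>e. P n e \<and> (\<forall>i<n. P i e))" by (intro dfn_conj Suc) simp_all
  then show ?case by (rule dfn_cong[rotated]) (auto simp: less_Suc_eq)
qed (simp add: dfn_const)

end

context ultra
begin

lemma large_const: "large (\<lambda>_. Q) \<longleftrightarrow> Q"
  using large_ex[of "\<lambda>_. Q"] large_all[of "\<lambda>_. Q"] by blast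

lemma dfun_const: "dfun U (\<lambda>_. c)" by (rule dt_const)

definition emb :: "'v \<Rightarrow> 'v set set" where "emb r = cls (mk (\<lambda>_. r))"

lemma mk_const: "r \<in> reals U \<Longrightarrow> mk (\<lambda>_. r) \<in> A0 U"
  "r \<in> reals U \<Longrightarrow> s \<in> Sigma_class U \<Longrightarrow> vl (mk (\<lambda>_. r)) s = r"
  using mk(1)[OF dfun_const, of r] vl_mk[OF dfun_const, of r] by simp_all

lemma emb_elementary: "elementary_embedding U (real_struct U) (IIR0 U \<F>) emb"
  unfolding elementary_embedding_def
proof (intro conjI allI impI)
  show "emb ` carr (real_struct U) \<subseteq> carr (IIR0 U \<F>)"
    unfolding IIR_carr real_struct_simps emb_def using mk_const(1) by blast
  fix \<phi> :: "'v lfm" and e :: "nat \<Rightarrow> 'v"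
  assume \<phi>: "lformula U \<phi>" and "range e \<subseteq> carr (real_struct U)"
  then have e: "e i \<in> reals U" for i unfolding real_struct_simps by blast
  have "lsat (IIR0 U \<F>) (emb \<circ> e) \<phi> \<longleftrightarrow> large (\<lambda>s. lsat rs (\<lambda>i. vl (mk (\<lambda>_. e i)) s) \<phi>)"
    using Los[OF \<phi>, of "\<lambda>i. mk (\<lambda>_. e i)"] mk_const(1)[OF e] by (simp add: emb_def comp_def)
  also have "\<dots> \<longleftrightarrow> large (\<lambda>_. lsat rs e \<phi>)"
    by (rule large_cong) (simp add: mk_const(2)[OF e])
  also have "\<dots> \<longleftrightarrow> lsat (real_struct U) e \<phi>" unfolding large_const by (rule lsat_rs[OF e])
  finally show "lsat (real_struct U) e \<phi> = lsat (IIR0 U \<F>) (emb \<circ> e) \<phi>" by simp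
qed

text \<open>A formula that holds in the reals under every assignment holds pointwise everywhere, for
  whatever representatives of the given elements are chosen.\<close>

lemma IIR_valid:
  assumes "lformula U \<phi>" "\<And>e. (\<And>i. e i \<in> reals U) \<Longrightarrow> lsat (real_struct U) e \<phi>" "\<And>i. x i \<in> carr (IIR0 U \<F>)"
  shows "lsat (IIR0 U \<F>) x \<phi>"
proof -
  have "\<forall>i. \<exists>G. G \<in> A0 U \<and> x i = cls G" using assms(3) unfolding IIR_carr by blast
  then obtain g where g: "\<And>i. g i \<in> A0 U" "\<And>i. x i = cls (g i)" by metis
  have "large (\<lambda>s. lsat rs (\<lambda>i. vl (g i) s) \<phi>)"
  proof (rule large_all)
    fix s assume "s \<in> Sigma_class U"
    then have v: "\<And>i. vl (g i) s \<in> reals U" using vl_reals[OF g(1)] by blast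
    show "lsat rs (\<lambda>i. vl (g i) s) \<phi>" using assms(2)[OF v] lsat_rs[OF v] by simp
  qed
  moreover have "x = (\<lambda>i. cls (g i))" using g(2) by (rule ext)
  ultimately show ?thesis using Los[OF assms(1) g(1)] by simp
qed

lemma IIR_closed:
  assumes "x \<in> carr (IIR0 U \<F>)" "y \<in> carr (IIR0 U \<F>)"
  shows "ladd (IIR0 U \<F>) x y \<in> carr (IIR0 U \<F>)" "lmul (IIR0 U \<F>) x y \<in> carr (IIR0 U \<F>)"
    "lzero (IIR0 U \<F>) \<in> carr (IIR0 U \<F>)" "lone (IIR0 U \<F>) \<in> carr (IIR0 U \<F>)"
proof -
  obtain F G where FG: "F \<in> A0 U" "x = cls F" "G \<in> A0 U" "y = cls G" using assms unfolding IIR_carr by blast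
  then have "case_nat x (\<lambda>_. y) = (\<lambda>i. cls (case_nat F (\<lambda>_. G) i))" by (intro ext) (simp split: nat.split)
  moreover have "case_nat F (\<lambda>_. G) i \<in> A0 U" for i using FG by (cases i) simp_all
  ultimately have "leval (IIR0 U \<F>) (case_nat x (\<lambda>_. y)) t \<in> carr (IIR0 U \<F>)" for t
    using leval_IIR(1,2)[of "case_nat F (\<lambda>_. G)" t] unfolding IIR_carr by simp
  from this[of "LAdd (LVar 0) (LVar 1)"] this[of "LMul (LVar 0) (LVar 1)"] this[of LZero] this[of LOne]
  show "ladd (IIR0 U \<F>) x y \<in> carr (IIR0 U \<F>)" "lmul (IIR0 U \<F>) x y \<in> carr (IIR0 U \<F>)"
    "lzero (IIR0 U \<F>) \<in> carr (IIR0 U \<F>)" "lone (IIR0 U \<F>) \<in> carr (IIR0 U \<F>)" by simp_all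
qed

lemma IIR_valid3:
  assumes "x \<in> carr (IIR0 U \<F>)" "y \<in> carr (IIR0 U \<F>)" "z \<in> carr (IIR0 U \<F>)" "lformula U \<phi>"
    "\<And>e. e 0 \<in> carr (real_struct U) \<Longrightarrow> e 1 \<in> carr (real_struct U) \<Longrightarrow> e 2 \<in> carr (real_struct U) \<Longrightarrow> lsat (real_struct U) e \<phi>"
  shows "lsat (IIR0 U \<F>) (case_nat x (case_nat y (\<lambda>_. z))) \<phi>"
  by (rule IIR_valid[OF assms(4)]) (use assms(5) real_struct_simps(1) assms(1-3) in \<open>auto split: nat.split\<close>)

lemma ordered_field_IIR: "ordered_field (IIR0 U \<F>)"
proof -
  let ?A = "IIR0 U \<F>"
  note R = ordered_field_props[OF ordered_field_reals]
  note O = ordered_field_reals[unfolded ordered_field_def, THEN conjunct2]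
  note V = IIR_valid3
  have ne: "mk (\<lambda>_. real_zero U) \<in> A0 U" by (rule mk_const(1)[OF real_closed(1)])
  then have c: "cls (mk (\<lambda>_. real_zero U)) \<in> carr ?A" unfolding IIR_carr by blast
  let ?x = "LVar 0" and ?y = "LVar 1" and ?z = "LVar 2"
  show ?thesis
  proof (rule ordered_fieldI)
    show "lzero ?A \<in> carr ?A" "lone ?A \<in> carr ?A" using IIR_closed[OF c c] by blast+
    show "lone ?A \<noteq> lzero ?A" using V[OF c c c, of "LNeg (LEq LOne LZero)"] R(3) by simp
    fix x y z assume x: "x \<in> carr ?A" and y: "y \<in> carr ?A"
    show "ladd ?A x y \<in> carr ?A" "lmul ?A x y \<in> carr ?A" using IIR_closed[OF x y] by blast+
    show "ladd ?A x y = ladd ?A y x" using V[OF x y x, of "LEq (LAdd ?x ?y) (LAdd ?y ?x)"] R(8) by simp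
    show "lmul ?A x y = lmul ?A y x" using V[OF x y x, of "LEq (LMul ?x ?y) (LMul ?y ?x)"] R(9) by simp
    assume z: "z \<in> carr ?A"
    show "ladd ?A (ladd ?A x y) z = ladd ?A x (ladd ?A y z)"
      using V[OF x y z, of "LEq (LAdd (LAdd ?x ?y) ?z) (LAdd ?x (LAdd ?y ?z))"] R(6) by (simp add: numeral_2_eq_2)
    show "lmul ?A (lmul ?A x y) z = lmul ?A x (lmul ?A y z)"
      using V[OF x y z, of "LEq (LMul (LMul ?x ?y) ?z) (LMul ?x (LMul ?y ?z))"] R(7) by (simp add: numeral_2_eq_2)
    show "lmul ?A (ladd ?A x y) z = ladd ?A (lmul ?A x z) (lmul ?A y z)"
      using V[OF x y z, of "LEq (LMul (LAdd ?x ?y) ?z) (LAdd (LMul ?x ?z) (LMul ?y ?z))"] R(12) by (simp add: numeral_2_eq_2)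
  next
    fix x assume x: "x \<in> carr ?A"
    show "ladd ?A (lzero ?A) x = x" using V[OF x x x, of "LEq (LAdd LZero ?x) ?x"] R(10) by simp
    show "lmul ?A (lone ?A) x = x" using V[OF x x x, of "LEq (LMul LOne ?x) ?x"] R(11) by simp
    \<comment> \<open>Existence is written as a negated universal. Below \<open>LAll\<close> the
      bound variable has index 0, and the former variable 0 is \<open>?y\<close>, of index
      1.\<close>
    show "\<exists>y \<in> carr ?A. ladd ?A y x = lzero ?A"
      using V[OF x x x, of "LNeg (LAll (LNeg (LEq (LAdd ?x ?y) LZero)))"] R(13) by simp
    have "lsat (real_struct U) e (LNeg (LConj (LNeg (LEq ?x LZero)) (LAll (LNeg (LEq (LMul ?y ?x) LOne)))))"
      if "e 0 \<in> carr (real_struct U)" for e using R(14)[OF that] by auto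
    from V[OF x x x _ this] show "\<exists>y \<in> carr ?A. lmul ?A x y = lone ?A" if "x \<noteq> lzero ?A" using that by simp
  next
    show "\<forall>x \<in> carr ?A. lle ?A x x"
    proof
      fix x assume x: "x \<in> carr ?A"
      show "lle ?A x x" using V[OF x x x, of "LLe ?x ?x"] O by simp
    qed
    show "\<forall>x \<in> carr ?A. \<forall>y \<in> carr ?A. lle ?A x y \<longrightarrow> lle ?A y x \<longrightarrow> x = y"
    proof (intro ballI)
      fix x y assume x: "x \<in> carr ?A" and y: "y \<in> carr ?A"
      have "lsat (real_struct U) e (LNeg (LConj (LConj (LLe ?x ?y) (LLe ?y ?x)) (LNeg (LEq ?x ?y))))"
        if "e 0 \<in> carr (real_struct U)" "e 1 \<in> carr (real_struct U)" for e
        using bspec[OF bspec[OF O[THEN conjunct2, THEN conjunct1] that(1)] that(2)] by simp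
      from V[OF x y x _ this] show "lle ?A x y \<longrightarrow> lle ?A y x \<longrightarrow> x = y" by simp
    qed
    show "\<forall>x \<in> carr ?A. \<forall>y \<in> carr ?A. \<forall>z \<in> carr ?A. lle ?A x y \<longrightarrow> lle ?A y z \<longrightarrow> lle ?A x z"
    proof (intro ballI)
      fix x y z assume x: "x \<in> carr ?A" and y: "y \<in> carr ?A" and z: "z \<in> carr ?A"
      have "lsat (real_struct U) e (LNeg (LConj (LConj (LLe ?x ?y) (LLe ?y ?z)) (LNeg (LLe ?x ?z))))"
        if "e 0 \<in> carr (real_struct U)" "e 1 \<in> carr (real_struct U)" "e 2 \<in> carr (real_struct U)" for e
        using bspec[OF bspec[OF bspec[OF O[THEN conjunct2, THEN conjunct2, THEN conjunct1] that(1)] that(2)] that(3)] by simp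
      from V[OF x y z _ this]
      show "lle ?A x y \<longrightarrow> lle ?A y z \<longrightarrow> lle ?A x z" by (simp add: numeral_2_eq_2)
    qed
    show "\<forall>x \<in> carr ?A. \<forall>y \<in> carr ?A. lle ?A x y \<or> lle ?A y x"
    proof (intro ballI)
      fix x y assume x: "x \<in> carr ?A" and y: "y \<in> carr ?A"
      have "lsat (real_struct U) e (LNeg (LConj (LNeg (LLe ?x ?y)) (LNeg (LLe ?y ?x))))"
        if "e 0 \<in> carr (real_struct U)" "e 1 \<in> carr (real_struct U)" for e
        using bspec[OF bspec[OF O[THEN conjunct2, THEN conjunct2, THEN conjunct2, THEN conjunct1] that(1)] that(2)] by simp
      from V[OF x y x _ this] show "lle ?A x y \<or> lle ?A y x" by simp
    qed
    show "\<forall>x \<in> carr ?A. \<forall>y \<in> carr ?A. \<forall>z \<in> carr ?A. lle ?A x y \<longrightarrow> lle ?A (ladd ?A x z) (ladd ?A y z)"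
    proof (intro ballI)
      fix x y z assume x: "x \<in> carr ?A" and y: "y \<in> carr ?A" and z: "z \<in> carr ?A"
      have "lsat (real_struct U) e (LNeg (LConj (LLe ?x ?y) (LNeg (LLe (LAdd ?x ?z) (LAdd ?y ?z)))))"
        if "e 0 \<in> carr (real_struct U)" "e 1 \<in> carr (real_struct U)" "e 2 \<in> carr (real_struct U)" for e
        using bspec[OF bspec[OF bspec[OF O[THEN conjunct2, THEN conjunct2, THEN conjunct2, THEN conjunct2, THEN conjunct1] that(1)] that(2)] that(3)]
        by simp
      from V[OF x y z _ this]
      show "lle ?A x y \<longrightarrow> lle ?A (ladd ?A x z) (ladd ?A y z)" by (simp add: numeral_2_eq_2)
    qed
    show "\<forall>x \<in> carr ?A. \<forall>y \<in> carr ?A. lle ?A (lzero ?A) x \<longrightarrow> lle ?A (lzero ?A) y \<longrightarrow> lle ?A (lzero ?A) (lmul ?A x y)"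
    proof (intro ballI)
      fix x y assume x: "x \<in> carr ?A" and y: "y \<in> carr ?A"
      have "lsat (real_struct U) e (LNeg (LConj (LConj (LLe LZero ?x) (LLe LZero ?y)) (LNeg (LLe LZero (LMul ?x ?y)))))"
        if "e 0 \<in> carr (real_struct U)" "e 1 \<in> carr (real_struct U)" for e
        using bspec[OF bspec[OF O[THEN conjunct2, THEN conjunct2, THEN conjunct2, THEN conjunct2, THEN conjunct2] that(1)] that(2)] by simp
      from V[OF x y x _ this] show "lle ?A (lzero ?A) x \<longrightarrow> lle ?A (lzero ?A) y \<longrightarrow> lle ?A (lzero ?A) (lmul ?A x y)" by simp
    qed
  qed
qed

lemma large_hat: "a \<in> ordinals U \<Longrightarrow> large (\<lambda>s. a \<in> ext U s)"
  unfolding large_def using hat unfolding hat_def .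

definition approximation :: "('v \<Rightarrow> 'v) \<Rightarrow> bool" where
  "approximation E \<longleftrightarrow> dfun U E \<and> (\<forall>x. \<exists>a \<in> ordinals U. \<exists>b \<in> ordinals U. \<forall>s. a \<in> ext U s \<longrightarrow> b \<in> ext U s \<longrightarrow> x \<in> ext U (E s)) \<and>
    (\<forall>P s. dprd U P \<longrightarrow> P (empty_set U) \<longrightarrow> (\<forall>x a. P x \<longrightarrow> P (adj x a)) \<longrightarrow> s \<in> Sigma_class U \<longrightarrow> P (E s))"

lemma approximation_exists: "\<exists>E. approximation E"
proof (rule finite_approximation[where thesis = "\<exists>E. approximation E"])
  fix E
  assume E: "dfun U E" "\<And>x. \<exists>a \<in> ordinals U. \<exists>b \<in> ordinals U. \<forall>s. a \<in> ext U s \<longrightarrow> b \<in> ext U s \<longrightarrow> x \<in> ext U (E s)"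
    "\<And>P s. dprd U P \<Longrightarrow> P (empty_set U) \<Longrightarrow> (\<And>x a. P x \<Longrightarrow> P (adj x a)) \<Longrightarrow> s \<in> Sigma_class U \<Longrightarrow> P (E s)"
  have c: "\<forall>P s. dprd U P \<longrightarrow> P (empty_set U) \<longrightarrow> (\<forall>x a. P x \<longrightarrow> P (adj x a)) \<longrightarrow> s \<in> Sigma_class U \<longrightarrow> P (E s)"
    by (intro allI impI, rule E(3)) simp_all
  have "approximation E" unfolding approximation_def by (rule conjI[OF E(1) conjI[OF allI[OF E(2)] c]])
  then show "\<exists>E. approximation E" by (rule exI[of approximation E])
qed

definition apx :: "'v \<Rightarrow> 'v" where "apx = (SOME E. approximation E)"

lemmas apx = someI_ex[OF approximation_exists, folded apx_def, unfolded approximation_def]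

lemma df_apx [df]: "dt U t \<Longrightarrow> dt U (\<lambda>e. apx (t e))"
  by (rule dfunD[OF apx[THEN conjunct1]])

lemma apx_induct:
  assumes "s \<in> Sigma_class U" "dprd U P" "P (empty_set U)" "\<And>x a. P x \<Longrightarrow> P (adj x a)"
  shows "P (apx s)"
  using apx[THEN conjunct2, THEN conjunct2, rule_format, of P s] assms by simp

text \<open>Fineness of the ultrafilter in the form used from here on: \<open>x\<close> is in
  \<open>apx s\<close> as soon as \<open>s\<close> contains the two ordinals that enumerate
  \<open>x\<close>, and each of the two conditions is large by the assumption on
  \<open>hat\<close>.\<close>

lemma large_apx: "large (\<lambda>s. x \<in> ext U (apx s))"
proof -
  obtain a b where "a \<in> ordinals U" "b \<in> ordinals U" "\<forall>s. a \<in> ext U s \<longrightarrow> b \<in> ext U s \<longrightarrow> x \<in> ext U (apx s)"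
    using apx by blast
  from large_conj[OF large_hat[OF this(1)] large_hat[OF this(2)]] this(3)
  show ?thesis by (elim large_mono) (intro df, blast)
qed

lemma emb_not_onto: "emb ` reals U \<noteq> carr (IIR0 U \<F>)"
proof -
  define h where "h s = wl U (\<lambda>r. r \<in> reals U \<and> r \<notin> ext U (apx s))" for s
  have dh: "dfun U h" unfolding h_def by (intro df)
  note O = ordered_field_reals[unfolded ordered_field_def real_struct_simps, THEN conjunct2]
  have h: "h s \<in> reals U \<and> h s \<notin> ext U (apx s)" if s: "s \<in> Sigma_class U" for s
  proof -
    \<comment> \<open>A set that is finite in the model contains only a bounded set of reals, by
      internal induction. As the reals have no maximum, some real lies outside.\<close>
    have "\<exists>r \<in> reals U. \<forall>y \<in> ext U (apx s). y \<in> reals U \<longrightarrow> lle rs y r"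
    proof (rule apx_induct[OF s, where P = "\<lambda>x. \<exists>r \<in> reals U. \<forall>y \<in> ext U x. y \<in> reals U \<longrightarrow> lle rs y r"])
      show "dprd U (\<lambda>x. \<exists>r \<in> reals U. \<forall>y \<in> ext U x. y \<in> reals U \<longrightarrow> lle rs y r)" by (intro df df_rs(3))
      show "\<exists>r \<in> reals U. \<forall>y \<in> ext U (empty_set U). y \<in> reals U \<longrightarrow> lle rs y r" using real_closed(1) by auto
      fix x a assume "\<exists>r \<in> reals U. \<forall>y \<in> ext U x. y \<in> reals U \<longrightarrow> lle rs y r"
      then obtain r where r: "r \<in> reals U" "\<And>y. y \<in> ext U x \<Longrightarrow> y \<in> reals U \<Longrightarrow> real_le U y r" using rs_ops(3) by blast
      show "\<exists>r \<in> reals U. \<forall>y \<in> ext U (adj x a). y \<in> reals U \<longrightarrow> lle rs y r"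
      proof (cases "a \<in> reals U \<and> \<not> real_le U a r")
        case True
        then have ra: "real_le U r a" "real_le U a a" using O r(1) by blast+
        have "real_le U y a" if "y \<in> ext U x" "y \<in> reals U" for y
          using O[THEN conjunct2, THEN conjunct2, THEN conjunct1] r(1) r(2)[OF that] that(2) True ra(1) by blast
        then show ?thesis using True ra(2) rs_ops(3) by (intro bexI[of _ a]) auto
      next
        case False
        then show ?thesis using r rs_ops(3) by (intro bexI[of _ r]) auto
      qed
    qed
    then obtain r where r: "r \<in> reals U" "\<And>y. y \<in> ext U (apx s) \<Longrightarrow> y \<in> reals U \<Longrightarrow> real_le U y r" using rs_ops(3) by blast
    obtain t where t: "t \<in> reals U" "\<not> real_le U t r" using real_no_max[OF r(1)] by blast
    have "t \<in> reals U \<and> t \<notin> ext U (apx s)" using t r(2) by blast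
    moreover have "dprd U (\<lambda>r. r \<in> reals U \<and> r \<notin> ext U (apx s))" by (intro df)
    ultimately show ?thesis unfolding h_def by (rule wl_props(1)[rotated])
  qed
  then have m: "mk h \<in> A0 U" "\<And>s. s \<in> Sigma_class U \<Longrightarrow> vl (mk h) s = h s"
    using mk(1)[OF dh] vl_mk[OF dh] by blast+
  have "emb r \<noteq> cls (mk h)" if r: "r \<in> reals U" for r
  proof
    assume "emb r = cls (mk h)"
    then have "large (\<lambda>s. vl (mk (\<lambda>_. r)) s = vl (mk h) s)" unfolding emb_def cls_eq[OF mk_const(1)[OF r] m(1)] .
    from large_ex[OF large_conj[OF this large_apx[of r]]]
    obtain s where s: "s \<in> Sigma_class U" "vl (mk (\<lambda>_. r)) s = vl (mk h) s" "r \<in> ext U (apx s)" by blast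
    then have "h s = r" using m(2) mk_const(2)[OF r] by simp
    then show False using h[OF s(1)] s(3) by blast
  qed
  then have "cls (mk h) \<notin> emb ` reals U" by (metis imageE)
  moreover have "cls (mk h) \<in> carr (IIR0 U \<F>)" unfolding IIR_carr using m(1) by (rule imageI)
  ultimately show ?thesis by metis
qed

lemma hyperreal_IIR: "hyperreal_field U (IIR0 U \<F>)"
  unfolding hyperreal_field_def using ordered_field_IIR emb_elementary emb_not_onto by blast

end

section \<open>The ultrapower as a coded class\<close>

context ultra
begin

text \<open>A class in \<open>A0 U\<close> lies in exactly one element of the ultrapower, so the
  existential over elements disappears and only conditions on representatives remain.\<close>

lemma el_iff:
  "(\<exists>xs. (set xs \<subseteq> carr (IIR0 U \<F>) \<and> list_all2 (\<in>) Xs xs) \<and> T xs) \<longleftrightarrow> set Xs \<subseteq> A0 U \<and> T (map cls Xs)"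
proof
  assume "\<exists>xs. (set xs \<subseteq> carr (IIR0 U \<F>) \<and> list_all2 (\<in>) Xs xs) \<and> T xs"
  then obtain xs where xs: "set xs \<subseteq> cls ` A0 U" "list_all2 (\<in>) Xs xs" "T xs" unfolding IIR_carr by blast
  have p: "Xs ! i \<in> A0 U \<and> xs ! i = cls (Xs ! i)" if i: "i < length xs" for i
  proof -
    obtain G where "G \<in> A0 U" "xs ! i = cls G" using xs(1) i by (metis imageE nth_mem subsetD)
    moreover have "Xs ! i \<in> xs ! i" using xs(2) i by (simp add: list_all2_conv_all_nth)
    ultimately show ?thesis using cls_mem_eq cls_mem by metis
  qed
  have l: "length Xs = length xs" using xs(2) by (rule list_all2_lengthD)
  have "xs = map cls Xs" by (rule nth_equalityI) (simp_all add: l p)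
  moreover have "set Xs \<subseteq> A0 U" using p l by (metis in_set_conv_nth subsetI)
  ultimately show "set Xs \<subseteq> A0 U \<and> T (map cls Xs)" using xs(3) by metis
next
  assume a: "set Xs \<subseteq> A0 U \<and> T (map cls Xs)"
  have "list_all2 (\<in>) Xs (map cls Xs)"
    using a cls_self unfolding list_all2_conv_all_nth by (simp add: subset_iff)
  moreover have "set (map cls Xs) \<subseteq> carr (IIR0 U \<F>)" unfolding IIR_carr using a by (simp add: image_mono)
  ultimately show "\<exists>xs. (set xs \<subseteq> carr (IIR0 U \<F>) \<and> list_all2 (\<in>) Xs xs) \<and> T xs"
    using a by (intro exI[of _ "map cls Xs"] conjI) simp_all
qed

text \<open>The pointwise result, lifted by \<open>mk\<close>, represents the value of the
  operation. Comparing it with \<open>K\<close> turns an equation between elements into a large set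
  of equations between reals, which is definable in the codes.\<close>

lemma IIR_binop_iff:
  assumes "\<And>t u. dt U t \<Longrightarrow> dt U u \<Longrightarrow> dt U (\<lambda>e. rop (t e) (u e))"
    "\<And>r t. r \<in> reals U \<Longrightarrow> t \<in> reals U \<Longrightarrow> rop r t \<in> reals U"
    "\<And>H. H \<in> A0 U \<Longrightarrow> large (\<lambda>s. vl H s = rop (vl F s) (vl G s)) \<Longrightarrow> f (cls F) (cls G) = cls H"
    "F \<in> A0 U" "G \<in> A0 U" "K \<in> A0 U"
  shows "f (cls F) (cls G) = cls K \<longleftrightarrow> large (\<lambda>s. vl K s = rop (vl F s) (vl G s))"
proof
  assume eq: "f (cls F) (cls G) = cls K"
  let ?h = "\<lambda>s. rop (vl F s) (vl G s)"
  have dh: "dfun U ?h" by (intro assms(1) df assms(4,5))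
  have hr: "?h s \<in> reals U" if "s \<in> Sigma_class U" for s using assms(2) vl_reals assms(4,5) that by blast
  have l: "large (\<lambda>s. vl (mk ?h) s = ?h s)" by (rule large_all) (rule vl_mk[OF dh hr])
  have A: "mk ?h \<in> A0 U" by (rule mk(1)[OF dh hr])
  have "cls (mk ?h) = cls K" using assms(3)[OF A l] eq by metis
  then have "large (\<lambda>s. vl (mk ?h) s = vl K s)" unfolding cls_eq[OF A assms(6)] .
  from large_conj[OF l this]
  show "large (\<lambda>s. vl K s = ?h s)"
    by (rule large_mono) (rule dfn_eq[OF df_vlA[OF assms(6) dt_var] dh], metis)
qed (rule assms(3)[OF assms(6)])

lemma rs_closed: "r \<in> reals U \<Longrightarrow> t \<in> reals U \<Longrightarrow> ladd rs r t \<in> reals U"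
  "r \<in> reals U \<Longrightarrow> t \<in> reals U \<Longrightarrow> lmul rs r t \<in> reals U"
  by (simp_all add: rs_ops real_closed)

lemma IIR_add_iff:
  assumes "F \<in> A0 U" "G \<in> A0 U" "K \<in> A0 U"
  shows "ladd (IIR0 U \<F>) (cls F) (cls G) = cls K \<longleftrightarrow> large (\<lambda>s. vl K s = ladd rs (vl F s) (vl G s))"
  by (rule IIR_binop_iff[where rop = "ladd rs" and f = "ladd (IIR0 U \<F>)", OF df_rs(1) rs_closed(1) IIR_add[OF assms(1,2)] assms])

lemma IIR_mul_iff:
  assumes "F \<in> A0 U" "G \<in> A0 U" "K \<in> A0 U"
  shows "lmul (IIR0 U \<F>) (cls F) (cls G) = cls K \<longleftrightarrow> large (\<lambda>s. vl K s = lmul rs (vl F s) (vl G s))"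
  by (rule IIR_binop_iff[where rop = "lmul rs" and f = "lmul (IIR0 U \<F>)", OF df_rs(2) rs_closed(2) IIR_mul[OF assms(1,2)] assms])

lemma IIR_consts: "lzero (IIR0 U \<F>) = emb (real_zero U)" "lone (IIR0 U \<F>) = emb (real_one U)"
proof -
  have "{H \<in> A0 U. {s \<in> Sigma_class U. val U H s = c} \<in> \<F>} = emb c" if c: "c \<in> reals U" for c
    unfolding emb_def by (rule IIR_const[OF mk_const(1)[OF c]]) (rule large_all, rule mk_const(2)[OF c])
  from this[OF real_closed(1)] this[OF real_closed(2)]
  show "lzero (IIR0 U \<F>) = emb (real_zero U)" "lone (IIR0 U \<F>) = emb (real_one U)" by (simp_all add: IIR0_def)
qed

lemma df_coded_A0: "dt U t \<Longrightarrow> dfn U (\<lambda>e. coded_class U \<phi> (t e) \<in> A0 U)"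
  by (rule df_A0[OF df_coded_class[OF dt_var dt_var]])

lemma df_coded_vl: "dt U t \<Longrightarrow> dt U u \<Longrightarrow> dt U (\<lambda>e. vl (coded_class U \<phi> (t e)) (u e))"
  by (rule df_vl[OF df_coded_class[OF dt_var dt_var]])

lemma coded_rel_cls:
  assumes "\<And>\<phi>s. length \<phi>s = k \<Longrightarrow> dfn U (\<lambda>e. set (map2 (coded_class U) \<phi>s (map e [0..<k])) \<subseteq> A0 U \<and>
      T (map cls (map2 (coded_class U) \<phi>s (map e [0..<k]))))"
  shows "coded_rel U k (\<lambda>Xs. \<exists>xs. (set xs \<subseteq> carr (IIR0 U \<F>) \<and> list_all2 (\<in>) Xs xs) \<and> T xs)"
  unfolding coded_rel_def el_iff by (intro allI impI definable_relI assms)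

lemma coded_rel1:
  assumes "\<And>\<phi>. dfn U (\<lambda>e. coded_class U \<phi> (e 0) \<in> A0 U \<and> T [cls (coded_class U \<phi> (e 0))])"
  shows "coded_rel U 1 (\<lambda>Xs. \<exists>xs. (set xs \<subseteq> carr (IIR0 U \<F>) \<and> list_all2 (\<in>) Xs xs) \<and> T xs)"
proof (rule coded_rel_cls)
  fix \<phi>s :: "fm list" assume "length \<phi>s = 1"
  then obtain \<phi> where "\<phi>s = [\<phi>]" by (auto simp: length_Suc_conv)
  then show "dfn U (\<lambda>e. set (map2 (coded_class U) \<phi>s (map e [0..<1])) \<subseteq> A0 U \<and>
      T (map cls (map2 (coded_class U) \<phi>s (map e [0..<1]))))" using assms[of \<phi>] by simp
qed

lemma coded_rel2:
  assumes "\<And>\<phi> \<psi>. dfn U (\<lambda>e. (coded_class U \<phi> (e 0) \<in> A0 U \<and> coded_class U \<psi> (e 1) \<in> A0 U) \<and>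
      T [cls (coded_class U \<phi> (e 0)), cls (coded_class U \<psi> (e 1))])"
  shows "coded_rel U 2 (\<lambda>Xs. \<exists>xs. (set xs \<subseteq> carr (IIR0 U \<F>) \<and> list_all2 (\<in>) Xs xs) \<and> T xs)"
proof (rule coded_rel_cls)
  fix \<phi>s :: "fm list" assume "length \<phi>s = 2"
  then obtain \<phi> \<psi> where "\<phi>s = [\<phi>, \<psi>]" by (auto simp: length_Suc_conv numeral_2_eq_2)
  moreover have "[0..<2] = [0, 1]" by (simp add: upt_rec)
  ultimately show "dfn U (\<lambda>e. set (map2 (coded_class U) \<phi>s (map e [0..<2])) \<subseteq> A0 U \<and>
      T (map cls (map2 (coded_class U) \<phi>s (map e [0..<2]))))" using assms[of \<phi> \<psi>] by simp
qed

lemma coded_rel3: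
  assumes "\<And>\<phi> \<psi> \<chi>. dfn U (\<lambda>e. (coded_class U \<phi> (e 0) \<in> A0 U \<and> coded_class U \<psi> (e 1) \<in> A0 U \<and> coded_class U \<chi> (e 2) \<in> A0 U) \<and>
      T [cls (coded_class U \<phi> (e 0)), cls (coded_class U \<psi> (e 1)), cls (coded_class U \<chi> (e 2))])"
  shows "coded_rel U 3 (\<lambda>Xs. \<exists>xs. (set xs \<subseteq> carr (IIR0 U \<F>) \<and> list_all2 (\<in>) Xs xs) \<and> T xs)"
proof (rule coded_rel_cls)
  fix \<phi>s :: "fm list" assume "length \<phi>s = 3"
  then obtain \<phi> \<psi> \<chi> where "\<phi>s = [\<phi>, \<psi>, \<chi>]" by (auto simp: length_Suc_conv numeral_3_eq_3)
  moreover have "[0..<3] = [0, 1, 2]" by (simp add: upt_rec)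
  ultimately show "dfn U (\<lambda>e. set (map2 (coded_class U) \<phi>s (map e [0..<3])) \<subseteq> A0 U \<and>
      T (map cls (map2 (coded_class U) \<phi>s (map e [0..<3]))))" using assms[of \<phi> \<psi> \<chi>] by simp
qed

text \<open>An operation of the ultrapower can be rewritten through \<open>large\<close> only for
  codes of members of \<open>A0 U\<close>; the first conjunct supplies this while the second is
  rewritten.\<close>

lemma dfn_conj_cong:
  assumes "\<And>e. P e \<Longrightarrow> Q e = Q' e" "dfn U P" "dfn U Q'"
  shows "dfn U (\<lambda>e. P e \<and> Q e)"
  by (rule dfn_cong[of _ "\<lambda>e. P e \<and> Q' e"]) (use assms(1) in blast, rule dfn_conj[OF assms(2,3)])

lemma coded_lrel:
  assumes "0 < m" "length \<phi>s = m"
  shows "definable_rel U (Suc m) (\<lambda>as. hd as \<in> real_rels U m \<and>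
    (\<exists>xs. (set xs \<subseteq> carr (IIR0 U \<F>) \<and> list_all2 (\<in>) (map2 (coded_class U) \<phi>s (tl as)) xs) \<and> lrel (IIR0 U \<F>) (hd as) xs))"
  unfolding el_iff
proof (rule definable_relI)
  let ?C = "\<lambda>e i. coded_class U (\<phi>s ! i) (e (Suc i))"
  have m: "map e [0..<Suc m] = e 0 # map (\<lambda>i. e (Suc i)) [0..<m]" for e :: "nat \<Rightarrow> 'v"
    by (simp add: upt_conv_Cons map_Suc_upt[symmetric] comp_def del: upt_Suc)
  have z: "map2 (coded_class U) \<phi>s (map (\<lambda>i. e (Suc i)) [0..<m]) = map (?C e) [0..<m]" for e
    by (rule nth_equalityI) (simp_all add: assms(2))
  have "dfn U (\<lambda>e. (\<forall>i<m. ?C e i \<in> A0 U) \<and> (e 0 \<in> real_rels U m \<and> lrel (IIR0 U \<F>) (e 0) (map cls (map (?C e) [0..<m]))))"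
  proof (rule dfn_conj_cong)
    fix e assume "\<forall>i<m. ?C e i \<in> A0 U"
    then have "set (map (?C e) [0..<m]) \<subseteq> A0 U" by auto
    then show "(e 0 \<in> real_rels U m \<and> lrel (IIR0 U \<F>) (e 0) (map cls (map (?C e) [0..<m]))) =
        (e 0 \<in> real_rels U m \<and> large (\<lambda>s. tuple U (map (\<lambda>F. vl F s) (map (?C e) [0..<m])) \<in> ext U (e 0)))"
      using IIR_rel by blast
  next
    show "dfn U (\<lambda>e. \<forall>i<m. ?C e i \<in> A0 U)" by (intro dfn_all_less df_coded_A0 dt_var)
    have "dt U (\<lambda>e. tuple U (map (\<lambda>t. t e) (map (\<lambda>i e. vl (coded_class U (\<phi>s ! i) (e (Suc (Suc i)))) (e 0)) [0..<m])))"
      by (rule dt_tuple) (auto intro!: df_coded_vl dt_var)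
    then have "dt U (\<lambda>e. tuple U (map (\<lambda>F. vl F (e 0)) (map (\<lambda>i. coded_class U (\<phi>s ! i) (e (Suc (Suc i)))) [0..<m])))"
      by (simp add: comp_def)
    from dfn_ext[OF this dt_var[of U "Suc 0"]]
    have "dfn U (\<lambda>e. large (\<lambda>s. tuple U (map (\<lambda>F. vl F s) (map (?C e) [0..<m])) \<in> ext U (e 0)))"
      by (rule df_large[where Q = "\<lambda>s e. tuple U (map (\<lambda>F. vl F s) (map (?C e) [0..<m])) \<in> ext U (e 0)"])
    then show "dfn U (\<lambda>e. e 0 \<in> real_rels U m \<and> large (\<lambda>s. tuple U (map (\<lambda>F. vl F s) (map (?C e) [0..<m])) \<in> ext U (e 0)))"
      by (intro dfn_conj df_real_rels[OF assms(1)] dt_var)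
  qed
  then show "dfn U (\<lambda>e. hd (map e [0..<Suc m]) \<in> real_rels U m \<and>
      set (map2 (coded_class U) \<phi>s (tl (map e [0..<Suc m]))) \<subseteq> A0 U \<and>
      lrel (IIR0 U \<F>) (hd (map e [0..<Suc m])) (map cls (map2 (coded_class U) \<phi>s (tl (map e [0..<Suc m])))))"
    unfolding m list.sel z by (rule dfn_cong[rotated]) auto
qed

lemma coded_IIR: "coded_struct U (IIR0 U \<F>)"
  unfolding coded_struct_def Let_def
proof (intro conjI allI impI)
  have ne: "cls G \<noteq> {}" if "G \<in> A0 U" for G using cls_self[OF that] by blast
  show "{} \<notin> carr (IIR0 U \<F>)" unfolding IIR_carr using ne by (metis imageE)
  show "pairwise disjnt (carr (IIR0 U \<F>))"
  proof (rule pairwiseI)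
    fix x y assume "x \<in> carr (IIR0 U \<F>)" "y \<in> carr (IIR0 U \<F>)" and xy: "x \<noteq> y"
    then obtain F G where FG: "F \<in> A0 U" "x = cls F" "G \<in> A0 U" "y = cls G" unfolding IIR_carr by blast
    show "disjnt x y"
      unfolding disjnt_iff
    proof (intro allI notI, elim conjE)
      fix H assume "H \<in> x" "H \<in> y"
      then have "cls H = x" "cls H = y" using cls_mem_eq FG by metis+
      then show False using xy by metis
    qed
  qed
  show "\<forall>X \<in> \<Union> (carr (IIR0 U \<F>)). definable U X" unfolding IIR_carr using cls_mem A0_definable by blast
  show "coded_rel U 1 (\<lambda>Xs. \<exists>xs. (set xs \<subseteq> carr (IIR0 U \<F>) \<and> list_all2 (\<in>) Xs xs) \<and> True)"
    by (rule coded_rel1) (intro dfn_conj dfn_const df_coded_A0 dt_var)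
  show "coded_rel U 2 (\<lambda>Xs. \<exists>xs. (set xs \<subseteq> carr (IIR0 U \<F>) \<and> list_all2 (\<in>) Xs xs) \<and> xs ! 0 = xs ! 1)"
  proof (rule coded_rel2, rule dfn_conj_cong)
    fix \<phi> \<psi> and e :: "nat \<Rightarrow> 'v"
    assume "coded_class U \<phi> (e 0) \<in> A0 U \<and> coded_class U \<psi> (e 1) \<in> A0 U"
    then show "([cls (coded_class U \<phi> (e 0)), cls (coded_class U \<psi> (e 1))] ! 0 = [cls (coded_class U \<phi> (e 0)), cls (coded_class U \<psi> (e 1))] ! 1) =
        large (\<lambda>s. vl (coded_class U \<phi> (e 0)) s = vl (coded_class U \<psi> (e 1)) s)" using cls_eq by simp
  qed (intro dfn_conj df_coded_A0 df_large dfn_eq df_coded_vl dt_var)+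
  show "coded_rel U 3 (\<lambda>Xs. \<exists>xs. (set xs \<subseteq> carr (IIR0 U \<F>) \<and> list_all2 (\<in>) Xs xs) \<and> ladd (IIR0 U \<F>) (xs ! 0) (xs ! 1) = xs ! 2)"
  proof (rule coded_rel3, rule dfn_conj_cong)
    fix \<phi> \<psi> \<chi> and e :: "nat \<Rightarrow> 'v"
    assume a: "coded_class U \<phi> (e 0) \<in> A0 U \<and> coded_class U \<psi> (e 1) \<in> A0 U \<and> coded_class U \<chi> (e 2) \<in> A0 U"
    let ?l = "[cls (coded_class U \<phi> (e 0)), cls (coded_class U \<psi> (e 1)), cls (coded_class U \<chi> (e 2))]"
    show "(ladd (IIR0 U \<F>) (?l ! 0) (?l ! 1) = ?l ! 2) =
        large (\<lambda>s. vl (coded_class U \<chi> (e 2)) s = ladd rs (vl (coded_class U \<phi> (e 0)) s) (vl (coded_class U \<psi> (e 1)) s))"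
      using a by (simp add: IIR_add_iff)
  qed (intro dfn_conj df_coded_A0 df_large dfn_eq df_rs df_coded_vl dt_var)+
  show "coded_rel U 3 (\<lambda>Xs. \<exists>xs. (set xs \<subseteq> carr (IIR0 U \<F>) \<and> list_all2 (\<in>) Xs xs) \<and> lmul (IIR0 U \<F>) (xs ! 0) (xs ! 1) = xs ! 2)"
  proof (rule coded_rel3, rule dfn_conj_cong)
    fix \<phi> \<psi> \<chi> and e :: "nat \<Rightarrow> 'v"
    assume a: "coded_class U \<phi> (e 0) \<in> A0 U \<and> coded_class U \<psi> (e 1) \<in> A0 U \<and> coded_class U \<chi> (e 2) \<in> A0 U"
    let ?l = "[cls (coded_class U \<phi> (e 0)), cls (coded_class U \<psi> (e 1)), cls (coded_class U \<chi> (e 2))]"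
    show "(lmul (IIR0 U \<F>) (?l ! 0) (?l ! 1) = ?l ! 2) =
        large (\<lambda>s. vl (coded_class U \<chi> (e 2)) s = lmul rs (vl (coded_class U \<phi> (e 0)) s) (vl (coded_class U \<psi> (e 1)) s))"
      using a by (simp add: IIR_mul_iff)
  qed (intro dfn_conj df_coded_A0 df_large dfn_eq df_rs df_coded_vl dt_var)+
  show "coded_rel U 2 (\<lambda>Xs. \<exists>xs. (set xs \<subseteq> carr (IIR0 U \<F>) \<and> list_all2 (\<in>) Xs xs) \<and> lle (IIR0 U \<F>) (xs ! 0) (xs ! 1))"
  proof (rule coded_rel2, rule dfn_conj_cong)
    fix \<phi> \<psi> and e :: "nat \<Rightarrow> 'v"
    assume a: "coded_class U \<phi> (e 0) \<in> A0 U \<and> coded_class U \<psi> (e 1) \<in> A0 U"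
    let ?l = "[cls (coded_class U \<phi> (e 0)), cls (coded_class U \<psi> (e 1))]"
    show "lle (IIR0 U \<F>) (?l ! 0) (?l ! 1) =
        large (\<lambda>s. lle rs (vl (coded_class U \<phi> (e 0)) s) (vl (coded_class U \<psi> (e 1)) s))" using IIR_le a by simp
  qed (intro dfn_conj df_coded_A0 df_large df_rs df_coded_vl dt_var)+
  have const: "coded_rel U 1 (\<lambda>Xs. \<exists>xs. (set xs \<subseteq> carr (IIR0 U \<F>) \<and> list_all2 (\<in>) Xs xs) \<and> xs ! 0 = emb c)"
    if c: "c \<in> reals U" for c
  proof (rule coded_rel1, rule dfn_conj_cong)
    fix \<phi> and e :: "nat \<Rightarrow> 'v"
    assume "coded_class U \<phi> (e 0) \<in> A0 U"
    then show "([cls (coded_class U \<phi> (e 0))] ! 0 = emb c) = large (\<lambda>s. vl (coded_class U \<phi> (e 0)) s = vl (mk (\<lambda>_. c)) s)"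
      unfolding emb_def using cls_eq mk_const(1)[OF c] by simp
  qed (intro df_coded_A0 df_large dfn_eq df_coded_vl df_vlA mk_const(1)[OF c] dt_var)+
  show "coded_rel U 1 (\<lambda>Xs. \<exists>xs. (set xs \<subseteq> carr (IIR0 U \<F>) \<and> list_all2 (\<in>) Xs xs) \<and> xs ! 0 = lzero (IIR0 U \<F>))"
    "coded_rel U 1 (\<lambda>Xs. \<exists>xs. (set xs \<subseteq> carr (IIR0 U \<F>) \<and> list_all2 (\<in>) Xs xs) \<and> xs ! 0 = lone (IIR0 U \<F>))"
    unfolding IIR_consts by (intro const real_closed)+
qed (rule coded_lrel)

theorem class_hyperreal_IIR: "class_hyperreal_field U (IIR0 U \<F>)"
  unfolding class_hyperreal_field_def using hyperreal_IIR coded_IIR by blast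

end

section \<open>Free variables, universal closure and codes of variables\<close>

primrec tfv :: "lterm \<Rightarrow> nat" where
  "tfv (LVar i) = Suc i"
| "tfv (LAdd s t) = max (tfv s) (tfv t)"
| "tfv (LMul s t) = max (tfv s) (tfv t)"
| "tfv LZero = 0"
| "tfv LOne = 0"

text \<open>An upper bound for the free variables; for a relation symbol, the sum over the arguments
  dominates each of them.\<close>

primrec lfv :: "'r lfm \<Rightarrow> nat" where
  "lfv (LEq s t) = max (tfv s) (tfv t)"
| "lfv (LLe s t) = max (tfv s) (tfv t)"
| "lfv (LRel R ts) = sum_list (map tfv ts)"
| "lfv (LNeg \<phi>) = lfv \<phi>"
| "lfv (LConj \<phi> \<psi>) = max (lfv \<phi>) (lfv \<psi>)"
| "lfv (LAll \<phi>) = lfv \<phi> - 1"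

lemma leval_cong: "(\<And>i. i < tfv t \<Longrightarrow> e i = e' i) \<Longrightarrow> leval A e t = leval A e' t"
  by (induction t) simp_all

lemma lsat_cong: "(\<And>i. i < lfv \<phi> \<Longrightarrow> e i = e' i) \<Longrightarrow> lsat A e \<phi> = lsat A e' \<phi>"
proof (induction \<phi> arbitrary: e e')
  case (LEq s t)
  have "leval A e s = leval A e' s" "leval A e t = leval A e' t" by (intro leval_cong; use LEq in simp)+
  then show ?case by simp
next
  case (LLe s t)
  have "leval A e s = leval A e' s" "leval A e t = leval A e' t" by (intro leval_cong; use LLe in simp)+
  then show ?case by simp
next
  case (LRel R ts)
  have "leval A e t = leval A e' t" if t: "t \<in> set ts" for t
  proof (rule leval_cong)
    fix i assume "i < tfv t"
    moreover have "tfv t \<le> sum_list (map tfv ts)" using t by (intro member_le_sum_list) auto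
    ultimately show "e i = e' i" using LRel by simp
  qed
  then have "map (leval A e) ts = map (leval A e') ts" by (intro map_cong refl)
  then show ?case unfolding lsat.simps by (rule arg_cong)
next
  case (LNeg \<phi>)
  have "lsat A e \<phi> = lsat A e' \<phi>" by (rule LNeg.IH) (use LNeg.prems in simp)
  then show ?case by simp
next
  case (LConj \<phi> \<psi>)
  have "lsat A e \<phi> = lsat A e' \<phi>" by (rule LConj.IH(1)) (use LConj.prems in simp)
  moreover have "lsat A e \<psi> = lsat A e' \<psi>" by (rule LConj.IH(2)) (use LConj.prems in simp)
  ultimately show ?case by simp
next
  case (LAll \<phi>)
  have "lsat A (case_nat x e) \<phi> = lsat A (case_nat x e') \<phi>" for x
    by (rule LAll.IH) (use LAll.prems in \<open>auto split: nat.split\<close>)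
  then show ?case by simp
qed

lemma lsat_funpow_LAll:
  assumes "lsat A e ((LAll ^^ n) \<phi>)" "\<And>i. x i \<in> carr A"
  shows "lsat A (\<lambda>i. if i < n then x i else e (i - n)) \<phi>"
  using assms(1)
proof (induction n arbitrary: e)
  case (Suc n)
  have "lsat A (case_nat (x n) e) ((LAll ^^ n) \<phi>)" using Suc.prems assms(2) by simp
  note IH = Suc.IH[OF this]
  have "(if i < n then x i else case_nat (x n) e (i - n)) = (if i < Suc n then x i else e (i - Suc n))" for i
  proof -
    consider "i < n" | "i = n" | k where "i = Suc (n + k)" by (metis less_iff_Suc_add linorder_neqE_nat)
    then show ?thesis by cases simp_all
  qed
  then show ?case using IH by presburger
qed simp

lemma lsat_funpow_LAll_I:
  "(\<And>e. (\<And>i. e i \<in> carr A) \<Longrightarrow> lsat A e \<phi>) \<Longrightarrow> (\<And>i. e i \<in> carr A) \<Longrightarrow> lsat A e ((LAll ^^ n) \<phi>)"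
proof (induction n arbitrary: e)
  case (Suc n)
  have "lsat A (case_nat x e) ((LAll ^^ n) \<phi>)" if "x \<in> carr A" for x
    by (rule Suc.IH[OF Suc.prems(1)]) (use that Suc.prems(2) in \<open>auto split: nat.split\<close>)
  then show ?case by simp
qed simp

lemma lformula_funpow_LAll: "lformula U ((LAll ^^ n) \<phi>) = lformula U \<phi>"
  by (induction n) simp_all

lemma lsat_foldr_LConj: "lsat A e (foldr LConj \<psi>s \<chi>) \<longleftrightarrow> (\<forall>\<psi> \<in> set \<psi>s. lsat A e \<psi>) \<and> lsat A e \<chi>"
  by (induction \<psi>s) auto

lemma lformula_foldr_LConj: "lformula U (foldr LConj \<psi>s \<chi>) \<longleftrightarrow> (\<forall>\<psi> \<in> set \<psi>s. lformula U \<psi>) \<and> lformula U \<chi>"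
  by (induction \<psi>s) auto

text \<open>Variable \<open>n\<close> serves as a code, from which the functions \<open>f i\<close>
  recover the variables below \<open>n\<close>.\<close>

lemma lsat_coding: "lsat A e (foldr LConj (map (\<lambda>i. LRel (f i) [LVar n, LVar i]) [0..<n]) \<chi>) \<longleftrightarrow>
    (\<forall>i<n. lrel A (f i) [e n, e i]) \<and> lsat A e \<chi>"
  unfolding lsat_foldr_LConj by auto

text \<open>The definition of an elementary embedding speaks only of parameters in its image,
  whereas \<open>x\<close> is arbitrary in \<open>B\<close>. The universal closure has no free
  variables, so it transfers under a constant assignment and can then be instantiated at
  \<open>x\<close>.\<close>

lemma elementary_valid:
  assumes "elementary_embedding U A B j" "lformula U \<phi>" "\<And>e. (\<And>i. e i \<in> carr A) \<Longrightarrow> lsat A e \<phi>"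
    "a \<in> carr A" "\<And>i. x i \<in> carr B"
  shows "lsat B x \<phi>"
proof -
  let ?n = "lfv \<phi>"
  have "lsat A (\<lambda>_. a) ((LAll ^^ ?n) \<phi>)" by (rule lsat_funpow_LAll_I) (rule assms(3), blast, rule assms(4))
  moreover have "lformula U ((LAll ^^ ?n) \<phi>)" "range (\<lambda>_. a) \<subseteq> carr A" using assms(2,4) by (auto simp: lformula_funpow_LAll)
  ultimately have "lsat B (j \<circ> (\<lambda>_. a)) ((LAll ^^ ?n) \<phi>)" using assms(1) unfolding elementary_embedding_def by metis
  from lsat_funpow_LAll[OF this, of x] assms(5)
  have "lsat B (\<lambda>i. if i < ?n then x i else (j \<circ> (\<lambda>_. a)) (i - ?n)) \<phi>" by blast
  moreover have "lsat B (\<lambda>i. if i < ?n then x i else (j \<circ> (\<lambda>_. a)) (i - ?n)) \<phi> = lsat B x \<phi>" by (rule lsat_cong) simp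
  ultimately show ?thesis by simp
qed

context nbg
begin

section \<open>Internal functions on the reals\<close>

definition ifun :: "'v \<Rightarrow> bool" where "ifun f \<longleftrightarrow> class_fun U (reals U) (reals U) (ext U f)"

definition cmp :: "'v \<Rightarrow> 'v \<Rightarrow> 'v" where
  "cmp f g = wl U (\<lambda>w. ext U w = {z. \<exists>x \<in> reals U. z = opair U x (ap f (ap g x))})"

lemma real_rels_1: "R \<in> real_rels U (Suc 0) \<longleftrightarrow> ext U R \<subseteq> reals U"
  unfolding real_rels_def tuples_def[symmetric] tuples_1 by simp

lemma real_rels_2: "R \<in> real_rels U 2 \<longleftrightarrow> ext U R \<subseteq> class_prod U (reals U) (reals U)"
  unfolding real_rels_def tuples_def[symmetric] numeral_2_eq_2 tuples_Suc tuples_1 by simp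

lemma ifun_rels: "ifun f \<Longrightarrow> f \<in> real_rels U 2"
  unfolding ifun_def class_fun_def real_rels_2 by (rule conjunct1)

lemma ifun_ap: "ifun f \<Longrightarrow> x \<in> reals U \<Longrightarrow> ap f x \<in> reals U"
  unfolding ifun_def by (rule class_fun_ap(1))

lemma ifun_mem: "ifun f \<Longrightarrow> x \<in> reals U \<Longrightarrow> opair U x y \<in> ext U f \<longleftrightarrow> y = ap f x"
  unfolding ifun_def by (rule class_fun_ap(2))

lemma df_ifun [df]: "dt U t \<Longrightarrow> dfn U (\<lambda>e. ifun (t e))"
  by (rule dfn_subst1[where P = ifun]) (unfold ifun_def, intro df)

lemma df_cmp [df]: "dt U t \<Longrightarrow> dt U u \<Longrightarrow> dt U (\<lambda>e. cmp (t e) (u e))"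
  by (rule dt_subst2[where f = cmp]) (unfold cmp_def, intro df)

lemma cmp_lam: "cmp f g = lam (reals U) (\<lambda>x. ap f (ap g x))"
proof -
  have d: "dfun U (\<lambda>x. ap f (ap g x))" by (intro df)
  have "{z. \<exists>x \<in> reals U. z = opair U x (ap f (ap g x))} = (\<lambda>x. opair U x (ap f (ap g x))) ` reals U" by blast
  moreover have "isset U ((\<lambda>x. opair U x (ap f (ap g x))) ` reals U)" by (rule isset_image[OF _ isset_reals]) (intro df)
  ultimately have "ext U (cmp f g) = (\<lambda>x. opair U x (ap f (ap g x))) ` reals U"
    unfolding cmp_def using wl_set by simp
  then have "ext U (cmp f g) = ext U (lam (reals U) (\<lambda>x. ap f (ap g x)))" using ext_lam[OF isset_reals d] by simp
  then show ?thesis unfolding ext_eq_iff .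
qed

lemma cmp:
  assumes "ifun f" "ifun g"
  shows "ifun (cmp f g)" "x \<in> reals U \<Longrightarrow> ap (cmp f g) x = ap f (ap g x)"
proof -
  have d: "dfun U (\<lambda>x. ap f (ap g x))" by (intro df)
  show "ifun (cmp f g)" unfolding cmp_lam ifun_def
    by (rule class_fun_lam[OF isset_reals d]) (use ifun_ap assms in blast)
  show "x \<in> reals U \<Longrightarrow> ap (cmp f g) x = ap f (ap g x)" unfolding cmp_lam by (rule ap_lam[OF isset_reals d])
qed

lemma projections: "\<exists>p q. ifun p \<and> ifun q \<and> (\<forall>x \<in> reals U. \<forall>y \<in> reals U. \<exists>z \<in> reals U. opair U z x \<in> ext U p \<and> opair U z y \<in> ext U q)"
  using real_pairing unfolding real_pairing_def ifun_def .

definition pr1 :: 'v where "pr1 = (SOME p. \<exists>q. ifun p \<and> ifun q \<and>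
  (\<forall>x \<in> reals U. \<forall>y \<in> reals U. \<exists>z \<in> reals U. opair U z x \<in> ext U p \<and> opair U z y \<in> ext U q))"
definition pr2 :: 'v where "pr2 = (SOME q. ifun pr1 \<and> ifun q \<and>
  (\<forall>x \<in> reals U. \<forall>y \<in> reals U. \<exists>z \<in> reals U. opair U z x \<in> ext U pr1 \<and> opair U z y \<in> ext U q))"

lemmas pr = someI_ex[OF someI_ex[OF projections, folded pr1_def], folded pr2_def]

end

section \<open>The embedding\<close>

locale target = ultra U \<F> for U :: "'v universe" and \<F> +
  fixes A :: "('v, 'v) lstruct"
  assumes A: "definable_hyperreal_field U A"
begin

text \<open>The unary and binary relations of \<open>A\<close>; the typing conditions make them definable.\<close>

definition B1 :: "'v \<Rightarrow> 'v \<Rightarrow> bool" where "B1 Y c \<longleftrightarrow> Y \<in> real_rels U (Suc 0) \<and> set [c] \<subseteq> carr A \<and> lrel A Y [c]"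
definition B2 :: "'v \<Rightarrow> 'v \<Rightarrow> 'v \<Rightarrow> bool" where "B2 R a b \<longleftrightarrow> R \<in> real_rels U 2 \<and> set [a, b] \<subseteq> carr A \<and> lrel A R [a, b]"

lemma definable_A: "definable U (carr A)"
  "0 < m \<Longrightarrow> definable_rel U (Suc m) (\<lambda>xs. hd xs \<in> real_rels U m \<and> set (tl xs) \<subseteq> carr A \<and> lrel A (hd xs) (tl xs))"
  using A unfolding definable_hyperreal_field_def definable_struct_def Let_def by blast+

lemma df_carr [df]: "dt U t \<Longrightarrow> dfn U (\<lambda>e. t e \<in> carr A)"
  by (rule definable_dfn[OF definable_A(1)])

lemma df_B1 [df]: "dt U t \<Longrightarrow> dt U u \<Longrightarrow> dfn U (\<lambda>e. B1 (t e) (u e))"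
  unfolding B1_def using definable_relD[OF definable_A(2)[of "Suc 0"], of "[t, u]"] by auto

lemma df_B2 [df]: "dt U t \<Longrightarrow> dt U u \<Longrightarrow> dt U v \<Longrightarrow> dfn U (\<lambda>e. B2 (t e) (u e) (v e))"
  unfolding B2_def using definable_relD[OF definable_A(2)[of 2], of "[t, u, v]"] by auto

lemma A_valid:
  assumes "lformula U \<phi>" "\<And>e. (\<And>i. e i \<in> reals U) \<Longrightarrow> lsat (real_struct U) e \<phi>" "\<And>i. x i \<in> carr A"
  shows "lsat A x \<phi>"
proof -
  obtain j where "elementary_embedding U (real_struct U) A j"
    using A unfolding definable_hyperreal_field_def hyperreal_field_def by blast
  then show ?thesis
  proof (rule elementary_valid[OF _ assms(1) _ _ assms(3)])
    show "real_zero U \<in> carr (real_struct U)" unfolding real_struct_simps by (rule real_closed(1))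
    fix e :: "nat \<Rightarrow> 'v" assume "\<And>i. e i \<in> carr (real_struct U)"
    then show "lsat (real_struct U) e \<phi>" unfolding real_struct_simps by (rule assms(2))
  qed
qed

lemma A_valid3:
  assumes "x \<in> carr A" "y \<in> carr A" "z \<in> carr A" "lformula U \<phi>" "\<And>e. (\<And>i. e i \<in> reals U) \<Longrightarrow> lsat (real_struct U) e \<phi>"
  shows "lsat A (case_nat x (case_nat y (\<lambda>_. z))) \<phi>"
  by (rule A_valid[OF assms(4,5)]) (use assms(1-3) in \<open>auto split: nat.split\<close>)

lemma A_nonempty: "\<exists>c. c \<in> carr A"
proof -
  obtain j where "elementary_embedding U (real_struct U) A j"
    using A unfolding definable_hyperreal_field_def hyperreal_field_def by blast
  then have "j (real_zero U) \<in> carr A" unfolding elementary_embedding_def real_struct_simps using real_closed(1) by blast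
  then show ?thesis by (rule exI)
qed

lemma B2_carr: "B2 R a b \<Longrightarrow> a \<in> carr A" "B2 R a b \<Longrightarrow> b \<in> carr A" "B2 R a b \<Longrightarrow> R \<in> real_rels U 2"
  unfolding B2_def by simp_all

text \<open>The pattern of the facts about \<open>A\<close>: a formula valid in the reals, with
  implications written by \<open>LNeg\<close> and \<open>LConj\<close>, is transferred by
  \<open>A_valid3\<close>. Here it says that a step along \<open>g\<close> followed by a step along
  \<open>f\<close> is a step along the composition.\<close>

lemma B2_cmp:
  assumes "ifun f" "ifun g" "B2 g c' c" "B2 f c a"
  shows "B2 (cmp f g) c' a"
proof -
  let ?\<phi> = "LNeg (LConj (LConj (LRel g [LVar 0, LVar 1]) (LRel f [LVar 1, LVar 2])) (LNeg (LRel (cmp f g) [LVar 0, LVar 2])))"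
  have "lsat A (case_nat c' (case_nat c (\<lambda>_. a))) ?\<phi>"
  proof (rule A_valid3)
    show "c' \<in> carr A" "c \<in> carr A" "a \<in> carr A" using assms(3,4) B2_carr by blast+
    show "lformula U ?\<phi>" using ifun_rels[OF assms(1)] ifun_rels[OF assms(2)] ifun_rels[OF cmp(1)[OF assms(1,2)]]
      by (simp add: numeral_2_eq_2)
    fix e :: "nat \<Rightarrow> 'v" assume e: "\<And>i. e i \<in> reals U"
    show "lsat (real_struct U) e ?\<phi>"
      by (simp add: real_struct_simps ifun_mem[OF assms(1) e] ifun_mem[OF assms(2) e] ifun_mem[OF cmp(1)[OF assms(1,2)] e]
          cmp(2)[OF assms(1,2) e])
  qed
  then show ?thesis using assms(3,4) ifun_rels[OF cmp(1)[OF assms(1,2)]] unfolding B2_def by (simp add: numeral_2_eq_2)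
qed

text \<open>The property of \<open>pr1\<close> and \<open>pr2\<close> that every pair has a code is
  one formula in two free variables, so it passes from the reals to \<open>A\<close>.\<close>

lemma A_pairing:
  assumes "c \<in> carr A" "a \<in> carr A"
  shows "\<exists>c'. B2 pr1 c' c \<and> B2 pr2 c' a"
proof -
  let ?\<phi> = "LNeg (LAll (LNeg (LConj (LRel pr1 [LVar 0, LVar 1]) (LRel pr2 [LVar 0, LVar 2]))))"
  have i: "pr1 \<in> real_rels U 2" "pr2 \<in> real_rels U 2" using pr ifun_rels by blast+
  have "lsat A (case_nat c (case_nat a (\<lambda>_. a))) ?\<phi>"
  proof (rule A_valid3[OF assms assms(2)])
    show "lformula U ?\<phi>" using i by (simp add: numeral_2_eq_2)
    fix e :: "nat \<Rightarrow> 'v" assume e: "\<And>i. e i \<in> reals U"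
    show "lsat (real_struct U) e ?\<phi>"
      using bspec[OF bspec[OF pr[THEN conjunct2, THEN conjunct2] e[of 0]] e[of 1]] by (simp add: real_struct_simps numeral_2_eq_2)
  qed
  then show ?thesis using i assms unfolding B2_def by (auto simp: numeral_2_eq_2)
qed

text \<open>One element \<open>c\<close> codes all elements of \<open>A\<close> in \<open>apx s\<close>, each being the value at \<open>c\<close> of an internal function.\<close>

lemma chart:
  assumes "s \<in> Sigma_class U"
  shows "\<exists>c \<in> carr A. \<exists>k. \<forall>a \<in> ext U (apx s). a \<in> carr A \<longrightarrow> ifun (ap k a) \<and> B2 (ap k a) c a"
proof (rule apx_induct[OF assms, where P = "\<lambda>X. \<exists>c \<in> carr A. \<exists>k. \<forall>a \<in> ext U X. a \<in> carr A \<longrightarrow> ifun (ap k a) \<and> B2 (ap k a) c a"])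
  show "dprd U (\<lambda>X. \<exists>c \<in> carr A. \<exists>k. \<forall>a \<in> ext U X. a \<in> carr A \<longrightarrow> ifun (ap k a) \<and> B2 (ap k a) c a)" by (intro df)
  show "\<exists>c \<in> carr A. \<exists>k. \<forall>a \<in> ext U (empty_set U). a \<in> carr A \<longrightarrow> ifun (ap k a) \<and> B2 (ap k a) c a"
    using A_nonempty by auto
  fix X a assume "\<exists>c \<in> carr A. \<exists>k. \<forall>a \<in> ext U X. a \<in> carr A \<longrightarrow> ifun (ap k a) \<and> B2 (ap k a) c a"
  then obtain c k where ck: "c \<in> carr A" "\<And>a. a \<in> ext U X \<Longrightarrow> a \<in> carr A \<Longrightarrow> ifun (ap k a) \<and> B2 (ap k a) c a" by blast
  show "\<exists>c \<in> carr A. \<exists>k. \<forall>b \<in> ext U (adj X a). b \<in> carr A \<longrightarrow> ifun (ap k b) \<and> B2 (ap k b) c b"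
  proof (cases "a \<in> carr A")
    case False
    then show ?thesis using ck by (intro bexI[of _ c] exI[of _ k]) auto
  next
    case True
    then obtain c' where c': "B2 pr1 c' c" "B2 pr2 c' a" using A_pairing ck(1) by blast
    \<comment> \<open>The new code \<open>c'\<close> yields the old code \<open>c\<close> through
      \<open>pr1\<close> and the new element \<open>a\<close> through \<open>pr2\<close>; the old
      functions are therefore preceded by \<open>pr1\<close>.\<close>
    define f where "f z = (if z = a then pr2 else cmp (ap k z) pr1)" for z
    have df': "dfun U f" unfolding f_def by (intro df)
    have "ifun (ap (lam (ext U (adj X a)) f) b) \<and> B2 (ap (lam (ext U (adj X a)) f) b) c' b"
      if b: "b \<in> ext U (adj X a)" "b \<in> carr A" for b
    proof -
      have "ap (lam (ext U (adj X a)) f) b = f b" by (rule ap_lam[OF isset_ext df' b(1)])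
      moreover have "ifun (f b) \<and> B2 (f b) c' b"
      proof (cases "b = a")
        case True
        then show ?thesis using c' pr unfolding f_def by simp
      next
        case False
        then have "ifun (ap k b)" "B2 (ap k b) c b" using ck(2) b by auto
        then show ?thesis using cmp(1) B2_cmp pr c'(1) False unfolding f_def by simp
      qed
      ultimately show ?thesis by simp
    qed
    then show ?thesis using B2_carr(1)[OF c'(1)] by blast
  qed
qed

text \<open>\<open>Z\<close> keeps those reals of \<open>Y\<close> at which \<open>f\<close> and
  \<open>g\<close> take values related by \<open>R\<close>. The element \<open>c\<close> survives
  the restriction because its own values \<open>a\<close> and \<open>b\<close> are related by
  \<open>R\<close>.\<close>

lemma B1_restrict:
  assumes "B1 Y c" "ifun f" "B2 f c a" "ifun g" "B2 g c b" "B2 R a b"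
    "ext U Z = {x \<in> ext U Y. opair U (ap f x) (ap g x) \<in> ext U R}"
  shows "B1 Z c"
proof -
  let ?\<phi> = "LNeg (LConj (LConj (LConj (LRel Y [LVar 0]) (LRel f [LVar 0, LVar 1])) (LConj (LRel g [LVar 0, LVar 2]) (LRel R [LVar 1, LVar 2])))
      (LNeg (LRel Z [LVar 0])))"
  have Z: "Z \<in> real_rels U (Suc 0)" using assms(1,7) unfolding B1_def real_rels_1 by blast
  have "lsat A (case_nat c (case_nat a (\<lambda>_. b))) ?\<phi>"
  proof (rule A_valid3)
    show "c \<in> carr A" "a \<in> carr A" "b \<in> carr A" using assms(3,6) B2_carr by blast+
    show "lformula U ?\<phi>" using ifun_rels[OF assms(2)] ifun_rels[OF assms(4)] assms(1) B2_carr(3)[OF assms(6)] Z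
      by (simp add: numeral_2_eq_2 B1_def)
    fix e :: "nat \<Rightarrow> 'v" assume e: "\<And>i. e i \<in> reals U"
    show "lsat (real_struct U) e ?\<phi>"
      by (auto simp: real_struct_simps ifun_mem[OF assms(2) e] ifun_mem[OF assms(4) e] assms(7))
  qed
  then show ?thesis using assms(1,3,5,6) Z unfolding B1_def B2_def by (simp add: numeral_2_eq_2)
qed

lemma B1_reals:
  assumes "ext U Y = reals U" "c \<in> carr A"
  shows "B1 Y c"
proof -
  have Y: "Y \<in> real_rels U (Suc 0)" using assms(1) unfolding real_rels_1 by simp
  have "lsat A (case_nat c (case_nat c (\<lambda>_. c))) (LRel Y [LVar 0])"
    by (rule A_valid3[OF assms(2) assms(2) assms(2)]) (use Y assms(1) in \<open>simp_all add: real_struct_simps\<close>)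
  then show ?thesis using Y assms(2) unfolding B1_def by simp
qed

lemma B1_nonempty:
  assumes "B1 Y c"
  shows "\<exists>x \<in> reals U. x \<in> ext U Y"
proof (rule ccontr)
  assume n: "\<not> (\<exists>x \<in> reals U. x \<in> ext U Y)"
  have c: "c \<in> carr A" using assms unfolding B1_def by simp
  have "lsat A (case_nat c (case_nat c (\<lambda>_. c))) (LNeg (LRel Y [LVar 0]))"
    by (rule A_valid3[OF c c c]) (use assms n in \<open>auto simp: real_struct_simps B1_def\<close>)
  then show False using assms unfolding B1_def by simp
qed

text \<open>The assignment \<open>g\<close> of reals realises all relations between elements of \<open>A\<close> that \<open>apx s\<close> knows of.\<close>

definition sol :: "'v \<Rightarrow> 'v \<Rightarrow> bool" where
  "sol s g \<longleftrightarrow> (\<forall>w \<in> ext U (apx s). \<forall>R a b. w = opair U R (opair U a b) \<longrightarrow> a \<in> ext U (apx s) \<longrightarrow> b \<in> ext U (apx s) \<longrightarrow>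
     B2 R a b \<longrightarrow> opair U (ap g a) (ap g b) \<in> ext U R)"

lemma df_sol [df]: "dt U t \<Longrightarrow> dt U u \<Longrightarrow> dfn U (\<lambda>e. sol (t e) (u e))"
  by (rule dfn_subst2[where P = sol]) (unfold sol_def, intro df)

text \<open>All elements in question are values of internal functions at \<open>c\<close>, so the
  constraints become internal conditions on one real. They are imposed one at a time on a set
  \<open>Y\<close> of reals to whose extension in \<open>A\<close> the element \<open>c\<close>
  belongs throughout. By transfer the final \<open>Y\<close> is nonempty, and evaluating the
  functions at one of its members gives the assignment.\<close>

lemma sol_exists:
  assumes "s \<in> Sigma_class U"
  shows "\<exists>g. sol s g"
proof -
  obtain c k where ck: "c \<in> carr A" "\<And>a. a \<in> ext U (apx s) \<Longrightarrow> a \<in> carr A \<Longrightarrow> ifun (ap k a) \<and> B2 (ap k a) c a"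
    using chart[OF assms] by blast
  let ?C = "\<lambda>w R a b. w = opair U R (opair U a b) \<and> a \<in> ext U (apx s) \<and> b \<in> ext U (apx s) \<and> B2 R a b"
  let ?P = "\<lambda>X. \<exists>Y. B1 Y c \<and> (\<forall>x \<in> ext U Y. \<forall>w \<in> ext U X. \<forall>R a b. ?C w R a b \<longrightarrow> opair U (ap (ap k a) x) (ap (ap k b) x) \<in> ext U R)"
  have "?P (apx s)"
  proof (rule apx_induct[OF assms, where P = ?P])
    show "dprd U ?P" by (intro df)
    obtain Y where "ext U Y = reals U" using isset_reals unfolding isset_def by metis
    then show "?P (empty_set U)" using B1_reals ck(1) by auto
    fix X w assume "?P X"
    then obtain Y where Y: "B1 Y c"
      "\<And>x w R a b. x \<in> ext U Y \<Longrightarrow> w \<in> ext U X \<Longrightarrow> ?C w R a b \<Longrightarrow> opair U (ap (ap k a) x) (ap (ap k b) x) \<in> ext U R" by blast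
    show "?P (adj X w)"
    proof (cases "\<exists>R a b. ?C w R a b")
      case False
      then show ?thesis using Y by (intro exI[of _ Y]) auto
    next
      case True
      then obtain R a b where w: "?C w R a b" by blast
      have k: "ifun (ap k a)" "B2 (ap k a) c a" "ifun (ap k b)" "B2 (ap k b) c b" using ck(2) w B2_carr by blast+
      have "isset U {x \<in> ext U Y. opair U (ap (ap k a) x) (ap (ap k b) x) \<in> ext U R}"
        by (rule isset_sep[OF _ isset_ext]) (intro df)
      then obtain Z where Z: "ext U Z = {x \<in> ext U Y. opair U (ap (ap k a) x) (ap (ap k b) x) \<in> ext U R}"
        unfolding isset_def by blast
      have "B1 Z c" using B1_restrict[OF Y(1) k _ Z] w by blast
      moreover have "opair U (ap (ap k a') x) (ap (ap k b') x) \<in> ext U R'"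
        if "x \<in> ext U Z" "v \<in> ext U (adj X w)" "?C v R' a' b'" for x v R' a' b'
      proof (cases "v = w")
        case True
        then have "R' = R" "a' = a" "b' = b" using that(3) w by simp_all
        then show ?thesis using that(1) Z by simp
      next
        case False
        then show ?thesis using Y(2)[of x v R' a' b'] that Z by simp
      qed
      ultimately show ?thesis by (intro exI[of _ Z]) blast
    qed
  qed
  then obtain Y where Y: "B1 Y c"
      "\<And>x w R a b. x \<in> ext U Y \<Longrightarrow> w \<in> ext U (apx s) \<Longrightarrow> ?C w R a b \<Longrightarrow> opair U (ap (ap k a) x) (ap (ap k b) x) \<in> ext U R" by blast
  obtain x where x: "x \<in> ext U Y" using B1_nonempty[OF Y(1)] by blast
  have d: "dfun U (\<lambda>a. ap (ap k a) x)" by (intro df)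
  have "sol s (lam (ext U (apx s)) (\<lambda>a. ap (ap k a) x))"
    unfolding sol_def
  proof (intro ballI allI impI)
    fix w R a b assume h: "w \<in> ext U (apx s)" "w = opair U R (opair U a b)" "a \<in> ext U (apx s)" "b \<in> ext U (apx s)" "B2 R a b"
    then show "opair U (ap (lam (ext U (apx s)) (\<lambda>a. ap (ap k a) x)) a) (ap (lam (ext U (apx s)) (\<lambda>a. ap (ap k a) x)) b) \<in> ext U R"
      using Y(2)[OF x h(1)] ap_lam[OF isset_ext d h(3)] ap_lam[OF isset_ext d h(4)] by simp
  qed
  then show ?thesis by (rule exI)
qed

text \<open>For elements that \<open>apx s\<close> does not contain, the least solution may give
  anything at all; the default makes every value a real, as lifting by \<open>mk\<close>
  requires.\<close>

definition em_val :: "'v \<Rightarrow> 'v \<Rightarrow> 'v" where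
  "em_val a s = (if ap (wl U (sol s)) a \<in> reals U then ap (wl U (sol s)) a else real_zero U)"

definition em :: "'v \<Rightarrow> 'v set set" where "em a = cls (mk (em_val a))"

lemma df_em_val [df]: "dt U t \<Longrightarrow> dt U u \<Longrightarrow> dt U (\<lambda>e. em_val (t e) (u e))"
  by (rule dt_subst2[where f = em_val]) (unfold em_val_def, intro df)

lemma em_mk: "mk (em_val a) \<in> A0 U" "s \<in> Sigma_class U \<Longrightarrow> vl (mk (em_val a)) s = em_val a s"
proof -
  have "dfun U (em_val a)" by (intro df)
  moreover have "em_val a s \<in> reals U" for s unfolding em_val_def using real_closed(1) by simp
  ultimately show "mk (em_val a) \<in> A0 U" "s \<in> Sigma_class U \<Longrightarrow> vl (mk (em_val a)) s = em_val a s"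
    using mk(1)[of "em_val a"] vl_mk[of "em_val a"] by blast+
qed

text \<open>The constraint is imposed at every \<open>s\<close> for which \<open>apx s\<close>
  contains \<open>a\<close>, \<open>b\<close> and the triple of \<open>R\<close>, \<open>a\<close>
  and \<open>b\<close>. These three conditions are large.\<close>

lemma em_rel:
  assumes "B2 R a b"
  shows "lrel (IIR0 U \<F>) R [em a, em b]"
proof -
  have m: "set [mk (em_val a), mk (em_val b)] \<subseteq> A0 U" using em_mk(1) by simp
  have "large (\<lambda>s. opair U R (opair U a b) \<in> ext U (apx s) \<and> a \<in> ext U (apx s) \<and> b \<in> ext U (apx s))"
    by (intro large_conj large_apx)
  then have "large (\<lambda>s. tuple U (map (\<lambda>F. vl F s) [mk (em_val a), mk (em_val b)]) \<in> ext U R)"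
  proof (rule large_mono)
    show "dprd U (\<lambda>s. tuple U (map (\<lambda>F. vl F s) [mk (em_val a), mk (em_val b)]) \<in> ext U R)"
      by (simp, intro df em_mk(1))
    fix s assume s: "s \<in> Sigma_class U" and h: "opair U R (opair U a b) \<in> ext U (apx s) \<and> a \<in> ext U (apx s) \<and> b \<in> ext U (apx s)"
    obtain g where g: "sol s g" using sol_exists[OF s] by blast
    have "dprd U (sol s)" by (intro df)
    from wl_props(1)[OF this g] have "opair U (ap (wl U (sol s)) a) (ap (wl U (sol s)) b) \<in> ext U R"
      unfolding sol_def[of s "wl U (sol s)"] using h assms by blast
    \<comment> \<open>As \<open>R\<close> relates only reals, both values are reals and
      \<open>em_val\<close> does not fall back on its default.\<close>
    moreover from this have "opair U (ap (wl U (sol s)) a) (ap (wl U (sol s)) b) \<in> class_prod U (reals U) (reals U)"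
      using B2_carr(3)[OF assms] unfolding real_rels_2 by blast
    ultimately have "opair U (em_val a s) (em_val b s) \<in> ext U R" unfolding em_val_def by simp
    then show "tuple U (map (\<lambda>F. vl F s) [mk (em_val a), mk (em_val b)]) \<in> ext U R" by (simp add: em_mk(2)[OF s])
  qed
  then show ?thesis using IIR_rel[OF m] by (simp add: em_def)
qed

lemma em_class_map: "class_map U (carr A) em"
  unfolding class_map_def
proof (intro exI conjI ballI)
  let ?G = "{z. \<exists>a w. z = opair U a w \<and> w \<in> mk (em_val a)}"
  show "definable U ?G" unfolding mk_def by (rule dprd_definable) (intro df)
  fix a
  have "{w. opair U a w \<in> ?G} = mk (em_val a)" by auto
  then show "{w. opair U a w \<in> ?G} \<in> em a" unfolding em_def using cls_self[OF em_mk(1)] by metis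
qed

lemma em_carr: "em a \<in> carr (IIR0 U \<F>)"
  unfolding em_def IIR_carr by (rule imageI) (rule em_mk(1))

text \<open>The external counterpart of \<open>chart\<close>, for the finitely many free variables
  of one formula.\<close>

lemma coding:
  fixes n :: nat
  assumes "\<And>i. x i \<in> carr A"
  shows "\<exists>c f. c \<in> carr A \<and> (\<forall>i<n. ifun (f i) \<and> B2 (f i) c (x i))"
proof (induction n)
  case 0
  show ?case using assms by auto
next
  case (Suc n)
  then obtain c f where cf: "c \<in> carr A" "\<And>i. i < n \<Longrightarrow> ifun (f i) \<and> B2 (f i) c (x i)" by blast
  obtain c' where c': "B2 pr1 c' c" "B2 pr2 c' (x n)" using A_pairing[OF cf(1) assms] by blast
  let ?f = "\<lambda>i. if i = n then pr2 else cmp (f i) pr1"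
  have "ifun (?f i) \<and> B2 (?f i) c' (x i)" if "i < Suc n" for i
    using that cf(2)[of i] c' pr cmp(1)[of "f i" pr1] B2_cmp[of "f i" pr1 c' c "x i"] by (auto simp: less_Suc_eq)
  then have "c' \<in> carr A \<and> (\<forall>i<Suc n. ifun (?f i) \<and> B2 (?f i) c' (x i))" using B2_carr(1)[OF c'(1)] by simp
  then show ?case by (rule_tac exI[of _ c'], rule_tac exI[of _ ?f])
qed

text \<open>In the reals, for coded assignments, the formula is equivalent to membership of the code
  in a set \<open>W\<close>. One implication, transferred to \<open>A\<close>, puts the code
  \<open>c\<close> into the extension of \<open>W\<close>. The binary relations \<open>f i\<close>
  and \<open>W\<close> are carried over by \<open>em_rel\<close>, and the converse implication,
  valid in the ultrapower, recovers the formula there.\<close>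

lemma em_preserves:
  assumes \<phi>: "lformula U \<phi>" and x: "\<And>i. x i \<in> carr A" and sat: "lsat A x \<phi>"
  shows "lsat (IIR0 U \<F>) (\<lambda>i. em (x i)) \<phi>"
proof -
  let ?n = "lfv \<phi>"
  obtain c f where "c \<in> carr A \<and> (\<forall>i<?n. ifun (f i) \<and> B2 (f i) c (x i))"
    using coding[where x = x and n = ?n, OF x] by (elim exE)
  then have cf: "c \<in> carr A" "\<And>i. i < ?n \<Longrightarrow> ifun (f i)" "\<And>i. i < ?n \<Longrightarrow> B2 (f i) c (x i)" by simp_all
  \<comment> \<open>Variable \<open>n\<close>, which does not occur in \<open>\<phi>\<close>, denotes a code of the variables below.\<close>
  define E where "E y i = (if i < ?n then ap (f i) y else y)" for y i
  have "dt U (\<lambda>e. E (e 0) i)" for i unfolding E_def by (cases "i < ?n") (simp_all add: df)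
  from dfn_subst[OF dfn_lsat[of \<phi>] this] have dE: "dprd U (\<lambda>y. lsat rs (E y) \<phi>)" .
  \<comment> \<open>A condition on one real is placed on the diagonal, because it is binary
    relations that \<open>em\<close> has been shown to preserve.\<close>
  have "dprd U (\<lambda>z. \<exists>y \<in> reals U. z = opair U y y \<and> lsat rs (E y) \<phi>)" by (intro df dprdD[OF dE])
  from isset_sep[OF this isset_class_prod[OF isset_reals isset_reals]]
  obtain W where W: "ext U W = {z \<in> class_prod U (reals U) (reals U). \<exists>y \<in> reals U. z = opair U y y \<and> lsat rs (E y) \<phi>}"
    unfolding isset_def by metis
  have Wmem: "opair U y y \<in> ext U W \<longleftrightarrow> lsat rs (E y) \<phi>" if "y \<in> reals U" for y
    unfolding W using that by auto
  have Wrel: "W \<in> real_rels U 2" unfolding real_rels_2 W by blast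
  let ?w = "LRel W [LVar ?n, LVar ?n]"
  let ?\<psi> = "\<lambda>\<chi>. foldr LConj (map (\<lambda>i. LRel (f i) [LVar ?n, LVar i]) [0..<?n]) \<chi>"
  have fw: "lformula U ?w" using Wrel by (simp add: numeral_2_eq_2)
  have f\<psi>: "lformula U (?\<psi> \<chi>) \<longleftrightarrow> lformula U \<chi>" for \<chi>
    unfolding lformula_foldr_LConj using ifun_rels[OF cf(2)] by (auto simp: numeral_2_eq_2)
  have real: "lsat (real_struct U) e \<phi> \<longleftrightarrow> opair U (e ?n) (e ?n) \<in> ext U W"
    if e: "\<And>i. e i \<in> reals U" and "\<forall>i<?n. lrel (real_struct U) (f i) [e ?n, e i]" for e
  proof -
    have "e i = E (e ?n) i" if "i < ?n" for i
      using that \<open>\<forall>i<?n. lrel (real_struct U) (f i) [e ?n, e i]\<close> ifun_mem[OF cf(2)[OF that] e, of ?n "e i"]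
      unfolding E_def by (simp add: real_struct_simps)
    then have "lsat rs e \<phi> = lsat rs (E (e ?n)) \<phi>" by (rule lsat_cong)
    then show ?thesis using lsat_rs[OF e] Wmem[OF e] by simp
  qed
  define x' where "x' i = (if i < ?n then x i else c)" for i
  have x': "x' i \<in> carr A" for i unfolding x'_def using x cf(1) by simp
  have "lsat A x' (LNeg (LConj (?\<psi> \<phi>) (LNeg ?w)))"
  proof (rule A_valid[OF _ _ x'])
    show "lformula U (LNeg (LConj (?\<psi> \<phi>) (LNeg ?w)))" using f\<psi> fw \<phi> by simp
    fix e :: "nat \<Rightarrow> 'v" assume e: "\<And>i. e i \<in> reals U"
    show "lsat (real_struct U) e (LNeg (LConj (?\<psi> \<phi>) (LNeg ?w)))"
      using real[where e = e, OF e] unfolding lsat.simps(4,5) lsat_coding by (auto simp: real_struct_simps)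
  qed
  moreover have "lsat A x' \<phi>" using sat lsat_cong[of \<phi> x x' A] by (simp add: x'_def)
  moreover have "\<forall>i<?n. lrel A (f i) [x' ?n, x' i]" using cf(3) unfolding B2_def x'_def by simp
  ultimately have "lrel A W [c, c]" unfolding lsat.simps(4,5) lsat_coding by (auto simp: x'_def)
  then have Wc: "B2 W c c" unfolding B2_def using Wrel cf(1) by simp
  have "lsat (IIR0 U \<F>) (\<lambda>i. em (x' i)) (LNeg (LConj (?\<psi> ?w) (LNeg \<phi>)))"
  proof (rule IIR_valid[OF _ _ em_carr])
    show "lformula U (LNeg (LConj (?\<psi> ?w) (LNeg \<phi>)))" using f\<psi> fw \<phi> by simp
    fix e :: "nat \<Rightarrow> 'v" assume e: "\<And>i. e i \<in> reals U"
    show "lsat (real_struct U) e (LNeg (LConj (?\<psi> ?w) (LNeg \<phi>)))"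
      using real[where e = e, OF e] unfolding lsat.simps(4,5) lsat_coding by (auto simp: real_struct_simps)
  qed
  moreover have "\<forall>i<?n. lrel (IIR0 U \<F>) (f i) [em (x' ?n), em (x' i)]"
    using em_rel[OF cf(3)] unfolding x'_def by simp
  moreover have "lsat (IIR0 U \<F>) (\<lambda>i. em (x' i)) ?w" using em_rel[OF Wc] by (simp add: x'_def)
  ultimately have "lsat (IIR0 U \<F>) (\<lambda>i. em (x' i)) \<phi>" unfolding lsat.simps(4,5) lsat_coding by blast
  then show ?thesis using lsat_cong[of \<phi> "\<lambda>i. em (x i)" "\<lambda>i. em (x' i)" "IIR0 U \<F>"] by (simp add: x'_def)
qed

text \<open>Preservation applied to \<open>LNeg \<phi>\<close> gives the converse direction.\<close>

lemma em_elementary: "elementary_embedding U A (IIR0 U \<F>) em"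
  unfolding elementary_embedding_def
proof (intro conjI allI impI)
  show "em ` carr A \<subseteq> carr (IIR0 U \<F>)" using em_carr by blast
  fix \<phi> and e :: "nat \<Rightarrow> 'v"
  assume \<phi>: "lformula U \<phi>" and "range e \<subseteq> carr A"
  then have e: "e i \<in> carr A" for i by blast
  show "lsat A e \<phi> = lsat (IIR0 U \<F>) (em \<circ> e) \<phi>"
    using em_preserves[OF \<phi> e] em_preserves[of "LNeg \<phi>" e] \<phi> e by (auto simp: comp_def)
qed

end

theorem theorem7p1:
  fixes U :: "'v universe" and \<F> :: "'v set set"
  assumes "NBG U"
    and "definable_ultrafilter U \<F>" and "nonprincipal U \<F>"
    and "\<And>\<alpha>. \<alpha> \<in> ordinals U \<Longrightarrow> hat U \<alpha> \<in> \<F>"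
  shows "class_hyperreal_field U (IIR0 U \<F>) \<and>
    (\<forall>A :: ('v, 'v) lstruct. definable_hyperreal_field U A \<longrightarrow>
      (\<exists>f. elementary_embedding U A (IIR0 U \<F>) f \<and> class_map U (carr A) f))"
proof -
  interpret ultra U \<F> by unfold_locales (use assms in blast)+
  have "\<exists>f. elementary_embedding U A (IIR0 U \<F>) f \<and> class_map U (carr A) f"
    if "definable_hyperreal_field U A" for A :: "('v, 'v) lstruct"
  proof -
    interpret target U \<F> A by unfold_locales (rule that)
    show ?thesis using em_elementary em_class_map by blast
  qed
  then show ?thesis using class_hyperreal_IIR by blast
qed

end
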